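(* For a prime $p$ and an integer $n\ge 2$, let $X_n=(x_{ij})_{1\le i,j\le n}$ be an $n\times n$ matrix of indeterminates and let $$R_{n,p}=\mathbb{F}_p[x_{ij}\mid 1\le i,j\le n]/(\det X_n).$$ Then for every prime $p$ and every integer $n\ge 2$, $$s(R_{n+1,p})\le s(R_{n,p})\qquad\text{and}\qquad \frac{(n!)^2}{(2n-1)!}\le s(R_{n,p})\le \frac23,$$ where $s(\cdot)$ denotes the $F$-signature at the homogeneous maximal ideal.
   Context: Let $(R,\mathfrak m,k)$ be a $d$-dimensional $F$-finite Noetherian local domain of characteristic $p>0$ with perfect residue field $k$. For $e\ge 1$ let $F^e_*R$ denote $R$ viewed as an $R$-module via the $e$-th iterate of Frobenius ($r\cdot F^e_*x=F^e_*(r^{p^e}x)$); $F$-finite means $F_*R$ is a finitely generated $R$-module. Write $F^e_*R\cong R^{\oplus a_e(R)}\oplus M_e$ with $M_e$ having no nonzero free direct summand. The $F$-signature of $R$ is $s(R)=\lim_{e\to\infty} a_e(R)/p^{ed}$ (the limit exists by a theorem of Tucker). For a standard graded ring $R$ with $R_0=k$, $s(R)$ denotes the $F$-signature of the localization of $R$ at its homogeneous maximal ideal (generated by the images of the variables). *)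

theory Defs
  imports
    "HOL-Library.Poly_Mapping"
    "HOL-Library.Extended_Nat"
    "HOL-Algebra.QuotRing"
    "HOL-Algebra.Module"
    "Jordan_Normal_Form.Determinant"
    "Berlekamp_Zassenhaus.Finite_Field"
begin

hide_const (open) Multiset.mult Polynomial.smult Modules.module

text \<open>The fraction \<open>r/s\<close> is the class of all pairs \<open>(r', s')\<close> equivalent to \<open>(r, s)\<close>. The set
  \<open>S\<close> is meant to be a multiplicatively closed subset of the ring containing \<open>1\<close>.\<close>

definition ring_fraction :: "('a, 'b) ring_scheme \<Rightarrow> 'a set \<Rightarrow> 'a \<Rightarrow> 'a \<Rightarrow> ('a \<times> 'a) set" where
  "ring_fraction R S r s = {(r', s'). r' \<in> carrier R \<and> s' \<in> S \<and>
     (\<exists>u\<in>S. u \<otimes>\<^bsub>R\<^esub> (r \<otimes>\<^bsub>R\<^esub> s') = u \<otimes>\<^bsub>R\<^esub> (r' \<otimes>\<^bsub>R\<^esub> s))}"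

text \<open>As for cosets in \<^const>\<open>FactRing\<close>, the operations take the union over all representatives; all
  the sets in such a union coincide.\<close>

definition localization :: "('a, 'b) ring_scheme \<Rightarrow> 'a set \<Rightarrow> ('a \<times> 'a) set ring" where
  "localization R S =
    \<lparr>carrier = {ring_fraction R S r s | r s. r \<in> carrier R \<and> s \<in> S},
     mult = (\<lambda>A B. \<Union>(r, s)\<in>A. \<Union>(r', s')\<in>B. ring_fraction R S (r \<otimes>\<^bsub>R\<^esub> r') (s \<otimes>\<^bsub>R\<^esub> s')),
     one = ring_fraction R S \<one>\<^bsub>R\<^esub> \<one>\<^bsub>R\<^esub>,
     zero = ring_fraction R S \<zero>\<^bsub>R\<^esub> \<one>\<^bsub>R\<^esub>,
     add = (\<lambda>A B. \<Union>(r, s)\<in>A. \<Union>(r', s')\<in>B.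
       ring_fraction R S ((r \<otimes>\<^bsub>R\<^esub> s') \<oplus>\<^bsub>R\<^esub> (r' \<otimes>\<^bsub>R\<^esub> s)) (s \<otimes>\<^bsub>R\<^esub> s'))\<rparr>"

definition localization_at :: "('a, 'b) ring_scheme \<Rightarrow> 'a set \<Rightarrow> ('a \<times> 'a) set ring" where
  "localization_at R P = localization R (carrier R - P)"

definition krull_dim :: "('a, 'b) ring_scheme \<Rightarrow> enat" where
  "krull_dim R = Sup {enat k | k. \<exists>P :: nat \<Rightarrow> 'a set.
     (\<forall>i\<le>k. primeideal (P i) R) \<and> (\<forall>i<k. P i \<subset> P (Suc i))}"

text \<open>The fields \<^const>\<open>mult\<close> and \<^const>\<open>one\<close> of a module record play no role in the locale
  \<^locale>\<open>module\<close>; they are left unspecified where there is no natural choice.\<close>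

definition free_module :: "('a, 'b) ring_scheme \<Rightarrow> nat \<Rightarrow> ('a, nat \<Rightarrow> 'a) module" where
  "free_module R a =
    \<lparr>carrier = {..<a} \<rightarrow>\<^sub>E carrier R, mult = undefined, one = undefined,
     zero = (\<lambda>i\<in>{..<a}. \<zero>\<^bsub>R\<^esub>),
     add = (\<lambda>x y. \<lambda>i\<in>{..<a}. x i \<oplus>\<^bsub>R\<^esub> y i),
     smult = (\<lambda>r x. \<lambda>i\<in>{..<a}. r \<otimes>\<^bsub>R\<^esub> x i)\<rparr>"

definition module_sum :: "('a, 'b) module \<Rightarrow> ('a, 'c) module \<Rightarrow> ('a, 'b \<times> 'c) module" where
  "module_sum M N =
    \<lparr>carrier = carrier M \<times> carrier N, mult = undefined, one = undefined,
     zero = (\<zero>\<^bsub>M\<^esub>, \<zero>\<^bsub>N\<^esub>),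
     add = (\<lambda>(x, y) (x', y'). (x \<oplus>\<^bsub>M\<^esub> x', y \<oplus>\<^bsub>N\<^esub> y')),
     smult = (\<lambda>r (x, y). (r \<odot>\<^bsub>M\<^esub> x, r \<odot>\<^bsub>N\<^esub> y))\<rparr>"

definition module_isomorphic ::
    "('a, 'r) ring_scheme \<Rightarrow> ('a, 'b) module \<Rightarrow> ('a, 'c) module \<Rightarrow> bool" where
  "module_isomorphic R M N \<longleftrightarrow> (\<exists>h. bij_betw h (carrier M) (carrier N) \<and>
     (\<forall>x\<in>carrier M. \<forall>y\<in>carrier M. h (x \<oplus>\<^bsub>M\<^esub> y) = h x \<oplus>\<^bsub>N\<^esub> h y) \<and>
     (\<forall>r\<in>carrier R. \<forall>x\<in>carrier M. h (r \<odot>\<^bsub>M\<^esub> x) = r \<odot>\<^bsub>N\<^esub> h x))"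

text \<open>\<open>M\<close> is isomorphic to the direct sum of \<open>R\<^sup>a\<close> and \<open>N\<close>. Taking \<open>N\<close> over the same element type
  as \<open>M\<close> is no restriction, since \<open>N\<close> embeds into \<open>M\<close>.\<close>

definition splits_free ::
    "('a, 'r) ring_scheme \<Rightarrow> ('a, 'b) module \<Rightarrow> nat \<Rightarrow> ('a, 'b) module \<Rightarrow> bool" where
  "splits_free R M a N \<longleftrightarrow>
     module R N \<and> module_isomorphic R M (module_sum (free_module R a) N)"

text \<open>A nonzero free direct summand of arbitrary rank contains one of finite positive rank.\<close>

definition has_free_summand :: "('a, 'r) ring_scheme \<Rightarrow> ('a, 'b) module \<Rightarrow> bool" where
  "has_free_summand R M \<longleftrightarrow> (\<exists>a>0. \<exists>N. splits_free R M a N)"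

definition frobenius_pushforward :: "nat \<Rightarrow> nat \<Rightarrow> ('a, 'r) ring_scheme \<Rightarrow> ('a, 'a) module" where
  "frobenius_pushforward p e R =
    \<lparr>carrier = carrier R, mult = mult R, one = \<one>\<^bsub>R\<^esub>, zero = \<zero>\<^bsub>R\<^esub>, add = add R,
     smult = (\<lambda>r x. (r [^]\<^bsub>R\<^esub> (p ^ e)) \<otimes>\<^bsub>R\<^esub> x)\<rparr>"

text \<open>For F-finite Noetherian local \<open>R\<close> the number \<open>a\<close> below exists and is unique, because finitely
  generated modules over a local Noetherian ring can be cancelled from direct sums.\<close>

definition frobenius_free_rank :: "nat \<Rightarrow> ('a, 'r) ring_scheme \<Rightarrow> nat \<Rightarrow> nat" where
  "frobenius_free_rank p R e =
     (THE a. \<exists>M. splits_free R (frobenius_pushforward p e R) a M \<and> \<not> has_free_summand R M)"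

text \<open>Meant for an F-finite Noetherian local domain \<open>R\<close> of characteristic \<open>p\<close> with perfect residue
  field; the limit then exists by a theorem of Tucker.\<close>

definition F_signature :: "nat \<Rightarrow> ('a, 'r) ring_scheme \<Rightarrow> real" where
  "F_signature p R =
     lim (\<lambda>e. real (frobenius_free_rank p R e) / real p ^ (e * the_enat (krull_dim R)))"

text \<open>Polynomials are finitely supported functions from exponent vectors to coefficients; their ring
  operations are those of \<^theory>\<open>HOL-Library.Poly_Mapping\<close>.\<close>

type_synonym ('v, 'a) mpoly = "('v \<Rightarrow>\<^sub>0 nat) \<Rightarrow>\<^sub>0 'a"

definition mpoly_var :: "'v \<Rightarrow> ('v, 'a::comm_ring_1) mpoly" where
  "mpoly_var v = Poly_Mapping.single (Poly_Mapping.single v 1) 1"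

definition mpoly_ring :: "'v set \<Rightarrow> ('v, 'a::comm_ring_1) mpoly ring" where
  "mpoly_ring V =
    \<lparr>carrier = {f. \<forall>m\<in>Poly_Mapping.keys f. Poly_Mapping.keys m \<subseteq> V},
     mult = (*), one = 1, zero = 0, add = (+)\<rparr>"

definition matrix_vars :: "nat \<Rightarrow> (nat \<times> nat) set" where
  "matrix_vars n = {..<n} \<times> {..<n}"

definition generic_matrix :: "nat \<Rightarrow> (nat \<times> nat, 'a::comm_ring_1) mpoly mat" where
  "generic_matrix n = mat n n mpoly_var"

definition det_ideal :: "nat \<Rightarrow> (nat \<times> nat, 'a::comm_ring_1) mpoly set" where
  "det_ideal n = PIdl\<^bsub>mpoly_ring (matrix_vars n)\<^esub> (det (generic_matrix n))"

definition det_ring :: "nat \<Rightarrow> (nat \<times> nat, 'a::comm_ring_1) mpoly set ring" where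
  "det_ring n = mpoly_ring (matrix_vars n) Quot det_ideal n"

definition det_ring_maximal_ideal :: "nat \<Rightarrow> (nat \<times> nat, 'a::comm_ring_1) mpoly set set" where
  "det_ring_maximal_ideal n = Idl\<^bsub>det_ring n\<^esub>
     ((\<lambda>v. det_ideal n +>\<^bsub>mpoly_ring (matrix_vars n)\<^esub> mpoly_var v) ` matrix_vars n)"

text \<open>Here \<^typ>\<open>'p mod_ring\<close> is the prime field with \<open>p = CARD('p)\<close> elements.\<close>

definition det_F_signature :: "'p::prime_card itself \<Rightarrow> nat \<Rightarrow> real" where
  "det_F_signature _ n = F_signature CARD('p)
     (localization_at (det_ring n :: (nat \<times> nat, 'p mod_ring) mpoly set ring)
       (det_ring_maximal_ideal n))"

end

theory Submission
  imports Defs "HOL-Library.Product_Lexorder"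
begin

text \<open>Let \<open>S = \<bbbF>\<^sub>p[V]\<close>, let \<open>f\<close> be the determinant and \<open>q = p\<^sup>e\<close>. By Fedder's description of the
  Frobenius-semilinear maps on \<open>S/(f)\<close>, the free rank of \<open>F\<^sup>e\<^sub>*R\<close> at the origin is the dimension of
  the image of the multiplication by \<open>f\<^sup>q\<^sup>-\<^sup>1\<close> on \<open>S\<close> modulo the \<open>q\<close>-th powers of the variables.

  Three comparisons of such images give the theorem. Translating one variable by \<open>1\<close> makes it a
  unit, and clearing its row and column turns the determinant of size \<open>n + 1\<close> into that of size \<open>n\<close>,
  up to a unit. Passing to the top form of \<open>f\<close> for a weight concentrated on the diagonal and on a
  cyclic off-diagonal does not increase the dimension; the top form is a binomial, for which the
  dimension can be counted, and it is all of \<open>f\<close> if \<open>n = 2\<close>. Finally, the dimension for \<open>pq\<close> is at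
  most \<open>p\<^sup>d\<close> times the one for \<open>q\<close>, up to an error of smaller order, where \<open>d\<close> is the dimension
  of \<open>R\<close>; hence the limit exists.\<close>

text \<open>Over the field with \<open>p\<close> elements a space of dimension \<open>a\<close> has
  \<open>p ^ a\<close> elements, so images and kernels are compared as finite sets, without bases of
  quotients. The same counting shows that the free rank exists and is unique. The normalization
  involves the Krull dimension of the local ring, so the value n^2 - 1 is established separately:
  from above by counting standard monomials, from below by an explicit chain of primes.

  Degrees drive the comparison of sizes: the determinant of size \<open>n + 1\<close> is the form of
  highest degree in its sum with the determinant of size \<open>n\<close>, and this sum is what the
  translation produces. The constants come from the binomial: the sum of
  \<open>((M + 1) ^ n - M ^ n) * ((q - M) ^ n - (q - 1 - M) ^ n)\<close> over \<open>M < q\<close>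
  grows like \<open>q ^ (2 * n - 1)\<close> times n^2 times the Beta integral of x^(n-1)
  (1-x)^(n-1), that is (n!)^2 / (2n-1)!. At n = 2 this is 2/3, and monotonicity turns this value
  into the upper bound for all n.\<close>

declare lookup_eq_zero_in_keys_contradict [rule del]

abbreviation coef :: "('m \<Rightarrow>\<^sub>0 'a::zero) \<Rightarrow> 'm \<Rightarrow> 'a" where "coef \<equiv> Poly_Mapping.lookup"
abbreviation supp :: "('m \<Rightarrow>\<^sub>0 'a::zero) \<Rightarrow> 'm set" where "supp \<equiv> Poly_Mapping.keys"
abbreviation mterm :: "'m \<Rightarrow> 'a::zero \<Rightarrow> 'm \<Rightarrow>\<^sub>0 'a" where "mterm \<equiv> Poly_Mapping.single"

section \<open>Polynomials in a given set of variables\<close>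

definition polys :: "'v set \<Rightarrow> ('v, 'a::zero) mpoly set" where
  "polys V = {f. \<forall>m\<in>supp f. supp m \<subseteq> V}"

lemma carrier_mpoly_ring: "carrier (mpoly_ring V) = polys V"
  by (simp add: mpoly_ring_def polys_def)

lemma polys_0 [simp]: "0 \<in> polys V" by (simp add: polys_def)

lemma polys_mono: "supp m \<subseteq> V \<Longrightarrow> mterm m c \<in> polys V" by (simp add: polys_def)

lemma polys_const [simp]: "mterm 0 c \<in> polys V" by (simp add: polys_def)

lemma polys_1 [simp]: "1 \<in> polys V" by (simp add: polys_def)

lemma polys_add [simp]: "f \<in> polys V \<Longrightarrow> g \<in> polys V \<Longrightarrow> f + g \<in> polys V"
  using keys_add[of f g] by (auto simp: polys_def)

lemma polys_uminus [simp]: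
  fixes f :: "('v, 'a::comm_ring_1) mpoly"
  shows "f \<in> polys V \<Longrightarrow> - f \<in> polys V"
  by (simp add: polys_def in_keys_iff)

lemma polys_diff [simp]:
  fixes f :: "('v, 'a::comm_ring_1) mpoly"
  shows "f \<in> polys V \<Longrightarrow> g \<in> polys V \<Longrightarrow> f - g \<in> polys V"
  using polys_add[of f V "-g"] by simp

lemma polys_mult [simp]:
  fixes f :: "('v, 'a::comm_ring_1) mpoly"
  assumes "f \<in> polys V" "g \<in> polys V" shows "f * g \<in> polys V"
proof -
  have "supp m \<subseteq> V" if "m \<in> supp (f * g)" for m
  proof -
    obtain a b where "m = a + b" "a \<in> supp f" "b \<in> supp g"
      using \<open>m \<in> supp (f * g)\<close> keys_mult[of f g] by auto
    moreover have "supp a \<subseteq> V" "supp b \<subseteq> V"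
      using assms \<open>a \<in> supp f\<close> \<open>b \<in> supp g\<close> by (auto simp: polys_def)
    ultimately show ?thesis using keys_add[of a b] by blast
  qed
  then show ?thesis by (simp add: polys_def)
qed

lemma polys_power [simp]:
  fixes f :: "('v, 'a::comm_ring_1) mpoly"
  shows "f \<in> polys V \<Longrightarrow> f ^ k \<in> polys V"
  by (induction k) auto

lemma polys_sum: "(\<And>i. i \<in> I \<Longrightarrow> f i \<in> polys V) \<Longrightarrow> sum f I \<in> polys V"
  by (induction I rule: infinite_finite_induct) auto

lemma polys_prod:
  fixes f :: "'i \<Rightarrow> ('v, 'a::comm_ring_1) mpoly"
  shows "(\<And>i. i \<in> I \<Longrightarrow> f i \<in> polys V) \<Longrightarrow> prod f I \<in> polys V"
  by (induction I rule: infinite_finite_induct) auto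

lemma polys_var [simp]: "v \<in> V \<Longrightarrow> mpoly_var v \<in> polys V"
  by (simp add: mpoly_var_def polys_mono)

lemma polys_subset: "V \<subseteq> W \<Longrightarrow> polys V \<subseteq> polys W"
  by (auto simp: polys_def)

lemma poly_as_sum:
  fixes f :: "'m \<Rightarrow>\<^sub>0 'a::comm_monoid_add"
  shows "f = (\<Sum>m\<in>supp f. mterm m (coef f m))"
  by (rule poly_mapping_eqI) (auto simp: lookup_sum lookup_single when_def in_keys_iff)

lemma poly_as_sum':
  fixes f :: "'m \<Rightarrow>\<^sub>0 'a::comm_monoid_add"
  assumes "finite T" "supp f \<subseteq> T"
  shows "f = (\<Sum>m\<in>T. mterm m (coef f m))"
  using assms by (intro poly_mapping_eqI) (auto simp: lookup_sum lookup_single when_def in_keys_iff)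

lemma polys_induct [consumes 1, case_names zero mterm add]:
  fixes f :: "('v, 'a::comm_monoid_add) mpoly"
  assumes "f \<in> polys V" "P 0" "\<And>m c. supp m \<subseteq> V \<Longrightarrow> P (mterm m c)"
    "\<And>f g. f \<in> polys V \<Longrightarrow> g \<in> polys V \<Longrightarrow> P f \<Longrightarrow> P g \<Longrightarrow> P (f + g)"
  shows "P f"
proof -
  have "T \<subseteq> supp f \<Longrightarrow> P (\<Sum>m\<in>T. mterm m (coef f m)) \<and> (\<Sum>m\<in>T. mterm m (coef f m)) \<in> polys V"
    if "finite T" for T
    using that
  proof (induction T)
    case empty
    then show ?case using assms by simp
  next
    case (insert m T)
    then have m: "supp m \<subseteq> V" using assms(1) by (simp add: polys_def)
    have "P (mterm m (coef f m))" "mterm m (coef f m) \<in> polys V"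
      using m assms(3) by (simp_all add: polys_mono)
    then show ?case using insert assms(4) polys_add by simp
  qed
  then show ?thesis using poly_as_sum[of f] by (metis finite_keys order_refl)
qed

lemma supp_add_mon: fixes a b :: "'v \<Rightarrow>\<^sub>0 nat" shows "supp (a + b) = supp a \<union> supp b"
  by (auto simp: in_keys_iff lookup_add)

subsection \<open>Frobenius\<close>

lift_definition mscale :: "nat \<Rightarrow> ('v \<Rightarrow>\<^sub>0 nat) \<Rightarrow> ('v \<Rightarrow>\<^sub>0 nat)" is "\<lambda>k m v. k * m v"
  by (erule rev_finite_subset) auto

lemma lookup_mscale [simp]: "coef (mscale k m) v = k * coef m v"
  by transfer simp

lemma mscale_add: "mscale k (a + b) = mscale k a + mscale k b"
  by (rule poly_mapping_eqI) (simp add: lookup_add algebra_simps)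

lemma mscale_0 [simp]: "mscale k 0 = 0" "mscale 0 m = 0"
  by (auto intro!: poly_mapping_eqI)

lemma supp_mscale: "k > 0 \<Longrightarrow> supp (mscale k m) = supp m"
  by (auto simp: in_keys_iff)

lemma mono_power:
  fixes c :: "'a::comm_ring_1"
  shows "mterm m c ^ k = mterm (mscale k m) (c ^ k)"
proof (induction k)
  case (Suc k)
  have "m + mscale k m = mscale (Suc k) m"
    by (rule poly_mapping_eqI) (simp add: lookup_add)
  then show ?case using Suc by (simp add: mult_single)
qed simp

lemma CHAR_mpoly: "CHAR(('v, 'p::prime_card mod_ring) mpoly) = CARD('p)"
proof (rule CHAR_eq_posI)
  show "CARD('p) > 0" by simp
  show "of_nat CARD('p) = (0 :: ('v, 'p mod_ring) mpoly)"
    using of_nat_CHAR[where 'a = "'p mod_ring"]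
      by (metis semiring_char_mod_ring single_of_nat single_zero)
next
  fix x assume "0 < x" "x < CARD('p)"
  then have "of_nat x \<noteq> (0::'p mod_ring)"
    using of_nat_0_mod_ring_dvd[of x, where 'a = 'p] nat_dvd_not_less by blast
  then show "of_nat x \<noteq> (0::('v, 'p mod_ring) mpoly)"
    by (metis single_of_nat single_zero lookup_single_eq lookup_zero)
qed

lemma frob_add:
  fixes x y :: "('v, 'p::prime_card mod_ring) mpoly"
  shows "(x + y) ^ (CARD('p) ^ e) = x ^ (CARD('p) ^ e) + y ^ (CARD('p) ^ e)"
  by (rule freshmans_dream') (simp_all add: CHAR_mpoly prime_card)

lemma frob_sum:
  fixes x :: "'i \<Rightarrow> ('v, 'p::prime_card mod_ring) mpoly"
  shows "(\<Sum>i\<in>I. x i) ^ (CARD('p) ^ e) = (\<Sum>i\<in>I. x i ^ (CARD('p) ^ e))"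
  by (rule freshmans_dream_sum') (simp_all add: CHAR_mpoly prime_card)

lemma card_mod_ring: "CARD('p::nontriv mod_ring) = CARD('p)"
  by (rule CARD_mod_ring)

lemma frob_const:
  fixes c :: "'p::prime_card mod_ring"
  shows "c ^ (CARD('p) ^ e) = c"
proof (induction e)
  case (Suc e)
  have "c ^ CARD('p) = c" using finite_field_power_card_eq_same[of c] by (simp add: card_mod_ring)
  then show ?case using Suc by (simp add: power_mult)
qed simp

lemma frob_diff:
  fixes x y :: "('v, 'p::prime_card mod_ring) mpoly"
  shows "(x - y) ^ (CARD('p) ^ e) = x ^ (CARD('p) ^ e) - y ^ (CARD('p) ^ e)"
  using frob_add[of "x - y" y e] by simp

text \<open>Frobenius is additive and fixes the coefficients, which lie in the prime field, so only
  the exponents are scaled.\<close>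

lemma frob_poly:
  fixes f :: "('v, 'p::prime_card mod_ring) mpoly"
  shows "f ^ (CARD('p) ^ e) = (\<Sum>m\<in>supp f. mterm (mscale (CARD('p) ^ e) m) (coef f m))"
  by (subst poly_as_sum[of f], subst frob_sum) (simp add: mono_power frob_const)

subsection \<open>Reduction modulo the Frobenius power of the maximal ideal\<close>

text \<open>The ideal generated by the \<open>q\<close>-th powers of the variables. It is a monomial
  ideal, so membership is decided term by term.\<close>

definition frob_ideal :: "nat \<Rightarrow> ('v, 'a::zero) mpoly set" where
  "frob_ideal q = {f. \<forall>m\<in>supp f. \<exists>v. q \<le> coef m v}"

text \<open>Normal form modulo \<open>frob_ideal q\<close>. Residue classes become honest
  polynomials supported in a finite box, which can be counted.\<close>

lift_definition red :: "nat \<Rightarrow> ('v, 'a::zero) mpoly \<Rightarrow> ('v, 'a) mpoly" is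
  "\<lambda>q f m. if \<forall>v. coef m v < q then f m else 0"
  by (erule rev_finite_subset) auto

lemma lookup_red: "coef (red q f) m = (if \<forall>v. coef m v < q then coef f m else 0)"
  by transfer simp

lemma red_add: "red q (f + g) = red q f + red q (g :: ('v, 'a::comm_ring_1) mpoly)"
  by (rule poly_mapping_eqI) (simp add: lookup_red lookup_add)

lemma red_diff: "red q (f - g) = red q f - red q (g :: ('v, 'a::comm_ring_1) mpoly)"
  by (rule poly_mapping_eqI) (simp add: lookup_red lookup_minus)

lemma red_0 [simp]: "red q 0 = 0"
  by (rule poly_mapping_eqI) (simp add: lookup_red)

lemma red_eq_0_iff: "red q f = 0 \<longleftrightarrow> f \<in> frob_ideal q"
proof
  assume a: "red q f = 0"
  have "\<exists>v. q \<le> coef m v" if "m \<in> supp f" for m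
  proof (rule ccontr)
    assume "\<not> (\<exists>v. q \<le> coef m v)"
    then have "coef (red q f) m = coef f m" by (simp add: lookup_red not_le)
    with a that show False by (simp add: in_keys_iff)
  qed
  then show "f \<in> frob_ideal q" by (simp add: frob_ideal_def)
next
  assume f: "f \<in> frob_ideal q"
  show "red q f = 0"
  proof (rule poly_mapping_eqI)
    fix m
    show "coef (red q f) m = coef 0 m"
      using f by (cases "m \<in> supp f") (auto simp: lookup_red frob_ideal_def in_keys_iff not_less)
  qed
qed

lemma frob_ideal_0 [simp]: "0 \<in> frob_ideal q" by (simp add: frob_ideal_def)

lemma frob_ideal_add: "f \<in> frob_ideal q \<Longrightarrow> g \<in> frob_ideal q \<Longrightarrow> f + g \<in> frob_ideal q"
  for f g :: "('v, 'a::comm_ring_1) mpoly"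
  by (simp add: red_add flip: red_eq_0_iff)

lemma frob_ideal_mult:
  fixes f g :: "('v, 'a::comm_ring_1) mpoly"
  assumes "f \<in> frob_ideal q" shows "g * f \<in> frob_ideal q" "f * g \<in> frob_ideal q"
proof -
  have "\<exists>v. q \<le> coef m v" if "m \<in> supp (f * g)" for m
  proof -
    obtain a b where "m = a + b" "a \<in> supp f" "b \<in> supp g"
      using \<open>m \<in> supp (f * g)\<close> keys_mult[of f g] by blast
    then obtain v where "q \<le> coef a v" using assms by (auto simp: frob_ideal_def)
    then show ?thesis using \<open>m = a + b\<close> by (auto simp: lookup_add intro: trans_le_add1)
  qed
  then show "f * g \<in> frob_ideal q" by (simp add: frob_ideal_def)
  then show "g * f \<in> frob_ideal q" by (simp add: mult.commute)
qed

lemma frob_ideal_sum: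
  fixes f :: "'i \<Rightarrow> ('v, 'a::comm_ring_1) mpoly"
  shows "(\<And>i. i \<in> I \<Longrightarrow> f i \<in> frob_ideal q) \<Longrightarrow> sum f I \<in> frob_ideal q"
  by (induction I rule: infinite_finite_induct) (auto intro: frob_ideal_add)

lemma red_red_mult: "red q (red q f * g) = red q (f * (g :: ('v, 'a::comm_ring_1) mpoly))"
proof -
  have "f - red q f \<in> frob_ideal q"
    unfolding red_eq_0_iff[symmetric] by (intro poly_mapping_eqI) (simp add: lookup_minus
      lookup_red)
  then have "(f - red q f) * g \<in> frob_ideal q" by (rule frob_ideal_mult)
  then show ?thesis by (simp add: left_diff_distrib red_diff flip: red_eq_0_iff)
qed

lemma red_eq_iff: "red q f = red q g \<longleftrightarrow> f - g \<in> frob_ideal q"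
  for f g :: "('v, 'a::comm_ring_1) mpoly"
  by (simp add: red_diff flip: red_eq_0_iff)

lemma frob_ideal_mscale: "q > 0 \<Longrightarrow> m \<noteq> 0 \<Longrightarrow> mterm (mscale q m) c \<in> frob_ideal q"
proof -
  assume "q > 0" "m \<noteq> 0"
  then obtain v where "coef m v > 0" by (auto simp: poly_mapping_eq_iff fun_eq_iff)
  then have "q \<le> coef (mscale q m) v" by simp
  then show ?thesis by (auto simp: frob_ideal_def)
qed

text \<open>By \<open>frob_poly\<close> the power is a sum of scaled nonconstant monomials, and each
  of them is divisible by the \<open>q\<close>-th power of a variable.\<close>

lemma frob_power_in_frob_ideal:
  fixes f :: "('v, 'p::prime_card mod_ring) mpoly"
  assumes "coef f 0 = 0" shows "f ^ (CARD('p) ^ e) \<in> frob_ideal (CARD('p) ^ e)"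
  unfolding frob_poly
  by (intro frob_ideal_sum frob_ideal_mscale) (use assms in \<open>auto simp: in_keys_iff\<close>)

lemma frob_ideal_frob:
  fixes f :: "('v, 'p::prime_card mod_ring) mpoly"
  assumes "f \<in> frob_ideal q" shows "f ^ (CARD('p) ^ e) \<in> frob_ideal (CARD('p) ^ e * q)"
  unfolding frob_poly
proof (intro frob_ideal_sum)
  fix m assume "m \<in> supp f"
  then show "mterm (mscale (CARD('p) ^ e) m) (coef f m) \<in> frob_ideal (CARD('p) ^ e * q)"
    using assms by (auto simp: frob_ideal_def)
qed

subsection \<open>Finite sets of polynomials\<close>

lemma card_supported:
  assumes "finite T"
  shows "finite {f :: 'm \<Rightarrow>\<^sub>0 'a::{zero,finite}. supp f \<subseteq> T}"
    and "card {f :: 'm \<Rightarrow>\<^sub>0 'a::{zero,finite}. supp f \<subseteq> T} = CARD('a) ^ card T"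
proof -
  have bij: "bij_betw (\<lambda>f. restrict (coef f) T) {f :: 'm \<Rightarrow>\<^sub>0 'a. supp f \<subseteq> T} (T \<rightarrow>\<^sub>E UNIV)"
  proof (rule bij_betwI[where g = "\<lambda>h. Abs_poly_mapping (\<lambda>m. if m \<in> T then h m else 0)"])
    have l: "coef (Abs_poly_mapping (\<lambda>m. if m \<in> T then h m else 0))
      = (\<lambda>m. if m \<in> T then h m else 0)"
      for h :: "'m \<Rightarrow> 'a"
      by (rule lookup_Abs_poly_mapping) (use assms in \<open>auto intro: rev_finite_subset\<close>)
    show "(\<lambda>f. restrict (coef f) T) \<in> {f. supp f \<subseteq> T} \<rightarrow> T \<rightarrow>\<^sub>E UNIV" by auto
    show "(\<lambda>h. Abs_poly_mapping (\<lambda>m. if m \<in> T then h m else 0)) \<in> (T \<rightarrow>\<^sub>E UNIV) \<rightarrow> {f :: 'm \<Rightarrow>\<^sub>0 'a.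
      supp f \<subseteq> T}"
      unfolding Pi_iff subset_iff mem_Collect_eq in_keys_iff l by simp
    show "Abs_poly_mapping (\<lambda>m. if m \<in> T then restrict (coef f) T m else 0) = f"
      if "f \<in> {f. supp f \<subseteq> T}" for f :: "'m \<Rightarrow>\<^sub>0 'a"
    proof (rule poly_mapping_eqI)
      fix m
      have "m \<notin> T \<Longrightarrow> coef f m = 0" using that by (metis in_keys_iff mem_Collect_eq subsetD)
      then show "coef (Abs_poly_mapping (\<lambda>m. if m \<in> T then restrict (coef f) T m else 0)) m
        = coef f m"
        unfolding l by simp
    qed
    show "restrict (coef (Abs_poly_mapping (\<lambda>m. if m \<in> T then h m else 0))) T = h"
      if "h \<in> T \<rightarrow>\<^sub>E UNIV" for h :: "'m \<Rightarrow> 'a"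
      unfolding l using that by (simp add: fun_eq_iff restrict_def PiE_iff extensional_def)
  qed
  have "finite (T \<rightarrow>\<^sub>E (UNIV :: 'a set))" using assms by (simp add: finite_PiE)
  then show "finite {f :: 'm \<Rightarrow>\<^sub>0 'a. supp f \<subseteq> T}" using bij bij_betw_finite by blast
  show "card {f :: 'm \<Rightarrow>\<^sub>0 'a. supp f \<subseteq> T} = CARD('a) ^ card T"
    using bij_betw_same_card[OF bij] assms by (simp add: card_funcsetE)
qed

text \<open>Boxes with a separate range for each variable: later counts force one exponent to be
  zero or short and leave the others free.\<close>

definition mons :: "'v set \<Rightarrow> ('v \<Rightarrow> nat set) \<Rightarrow> ('v \<Rightarrow>\<^sub>0 nat) set" where
  "mons V B = {m. supp m \<subseteq> V \<and> (\<forall>v\<in>V. coef m v \<in> B v)}"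

definition monf :: "'v set \<Rightarrow> ('v \<Rightarrow> nat) \<Rightarrow> 'v \<Rightarrow>\<^sub>0 nat" where
  "monf V g = Abs_poly_mapping (\<lambda>v. if v \<in> V then g v else 0)"

lemma lookup_monf: "finite V \<Longrightarrow> coef (monf V g) = (\<lambda>v. if v \<in> V then g v else 0)"
  unfolding monf_def by (rule lookup_Abs_poly_mapping) (auto intro: rev_finite_subset)

lemma supp_monf: "finite V \<Longrightarrow> supp (monf V g) \<subseteq> V"
  by (auto simp: in_keys_iff lookup_monf split: if_splits)

lemma bij_mons:
  assumes "finite V"
  shows "bij_betw (\<lambda>m. restrict (coef m) V) (mons V B) (PiE V B)"
proof (rule bij_betwI[where g = "monf V"])
  show "(\<lambda>m. restrict (coef m) V) \<in> mons V B \<rightarrow> PiE V B" by (auto simp: mons_def)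
  show "monf V \<in> PiE V B \<rightarrow> mons V B"
    using assms by (auto simp: mons_def lookup_monf in_keys_iff split: if_splits)
  show "monf V (restrict (coef m) V) = m" if "m \<in> mons V B" for m
  proof (rule poly_mapping_eqI)
    fix v
    have "v \<notin> V \<Longrightarrow> coef m v = 0" using that unfolding mons_def
      by (metis (lifting) in_keys_iff mem_Collect_eq subsetD)
    then show "coef (monf V (restrict (coef m) V)) v = coef m v"
      using assms by (simp add: lookup_monf)
  qed
  show "restrict (coef (monf V h)) V = h" if "h \<in> PiE V B" for h
    using that assms by (simp add: lookup_monf fun_eq_iff restrict_def PiE_iff extensional_def)
qed

lemma card_mons:
  assumes "finite V"
  shows "card (mons V B) = (\<Prod>v\<in>V. card (B v))"
  using bij_betw_same_card[OF bij_mons[OF assms]] assms by (simp add: card_PiE)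

lemma finite_mons:
  assumes "finite V" "\<And>v. v \<in> V \<Longrightarrow> finite (B v)"
  shows "finite (mons V B)"
  using bij_betw_finite[OF bij_mons[OF assms(1)]] assms by (simp add: finite_PiE)

abbreviation box :: "nat \<Rightarrow> 'v set \<Rightarrow> ('v \<Rightarrow>\<^sub>0 nat) set" where
  "box q V \<equiv> mons V (\<lambda>_. {..<q})"

lemma box_iff: "q > 0 \<Longrightarrow> m \<in> box q V \<longleftrightarrow> supp m \<subseteq> V \<and> (\<forall>v. coef m v < q)"
proof -
  assume q: "q > 0"
  have "coef m v < q" if "supp m \<subseteq> V" "\<forall>v\<in>V. coef m v < q" for v
    using that q by (cases "v \<in> V") (force simp: in_keys_iff subset_iff)+
  then show ?thesis by (auto simp: mons_def)
qed

lemma card_box: "finite V \<Longrightarrow> card (box q V) = q ^ card V"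
  by (simp add: card_mons)

lemma finite_box [simp]: "finite V \<Longrightarrow> finite (box q V)"
  by (simp add: finite_mons)

lemma supp_red: "f \<in> polys V \<Longrightarrow> q > 0 \<Longrightarrow> supp (red q f) \<subseteq> box q V"
  by (auto simp: box_iff in_keys_iff lookup_red polys_def split: if_splits)

lemma finite_red: "finite V \<Longrightarrow> q > 0 \<Longrightarrow> finite (red q ` (polys V :: ('v, 'a::{zero,finite}) mpoly
  set))"
  by (rule finite_subset[OF _ card_supported(1)[of "box q V"]]) (use supp_red in auto)

text \<open>Over a finite field, the cardinality of a vector space stands in for its dimension.\<close>

definition mult_image :: "nat \<Rightarrow> 'v set \<Rightarrow> ('v, 'a::comm_ring_1) mpoly \<Rightarrow> ('v, 'a) mpoly set" where
  "mult_image q V F = (\<lambda>s. red q (F * s)) ` polys V"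

lemma finite_mult_image:
  fixes F :: "('v, 'a::{comm_ring_1,finite}) mpoly"
  shows "finite V \<Longrightarrow> q > 0 \<Longrightarrow> F \<in> polys V \<Longrightarrow> finite (mult_image q V F)"
  unfolding mult_image_def by (rule finite_subset[OF _ finite_red[of V q]]) auto

subsection \<open>The trace map\<close>

definition topm :: "nat \<Rightarrow> 'v set \<Rightarrow> ('v \<Rightarrow>\<^sub>0 nat)" where
  "topm q V = monf V (\<lambda>_. q - 1)"

lemma lookup_topm: "finite V \<Longrightarrow> coef (topm q V) v = (if v \<in> V then q - 1 else 0)"
  by (simp add: topm_def lookup_monf)

lemma supp_topm: "finite V \<Longrightarrow> supp (topm q V) \<subseteq> V"
  by (simp add: topm_def supp_monf)

text \<open>The standard generator of the Frobenius-semilinear maps of the polynomial ring: the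
  monomial with exponents \<open>q * d + (q - 1)\<close> goes to the one with exponents
  \<open>d\<close>, all others go to 0. Coefficients pass unchanged because each element of the
  prime field is its own \<open>q\<close>-th root.\<close>

definition frob_trace :: "nat \<Rightarrow> 'v set \<Rightarrow> ('v, 'a::zero) mpoly \<Rightarrow> ('v, 'a) mpoly" where
  "frob_trace q V g = Poly_Mapping.map_key (\<lambda>d. mscale q d + topm q V) g"

lemma inj_frob_key: "q > 0 \<Longrightarrow> inj (\<lambda>d. mscale q d + m)"
  by (rule injI) (auto simp: poly_mapping_eq_iff fun_eq_iff lookup_add)

lemma lookup_frob_trace:
  "q > 0 \<Longrightarrow> coef (frob_trace q V g) d = coef g (mscale q d + topm q V)"
  by (simp add: frob_trace_def map_key.rep_eq[OF inj_frob_key])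

lemma frob_trace_add:
  "q > 0 \<Longrightarrow> frob_trace q V (f + g) = frob_trace q V f
    + frob_trace q V (g :: ('v, 'a::comm_ring_1) mpoly)"
  by (rule poly_mapping_eqI) (simp add: lookup_frob_trace lookup_add)

lemma frob_trace_0: "q > 0 \<Longrightarrow> frob_trace q V 0 = 0"
  by (rule poly_mapping_eqI) (simp add: lookup_frob_trace)

lemma frob_trace_sum:
  fixes f :: "'i \<Rightarrow> ('v, 'a::comm_ring_1) mpoly"
  shows "q > 0 \<Longrightarrow> frob_trace q V (\<Sum>i\<in>I. f i) = (\<Sum>i\<in>I. frob_trace q V (f i))"
  by (induction I rule: infinite_finite_induct) (simp_all add: frob_trace_add frob_trace_0)

lemma frob_trace_polys: "q > 0 \<Longrightarrow> f \<in> polys V \<Longrightarrow> frob_trace q V f \<in> polys V"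
proof -
  assume q: "q > 0" and f: "f \<in> polys V"
  have "supp m \<subseteq> V" if "m \<in> supp (frob_trace q V f)" for m
  proof -
    have "supp (mscale q m + topm q V) \<subseteq> V"
      using that f q by (simp add: polys_def in_keys_iff lookup_frob_trace)
    then show ?thesis using q by (simp add: supp_add_mon supp_mscale)
  qed
  then show ?thesis by (simp add: polys_def)
qed

lemma lookup_mono_mult:
  fixes g :: "('v, 'a::comm_ring_1) mpoly"
  shows "coef (mterm a c * g) (a + k) = c * coef g k"
proof -
  have "mterm a c * g = (\<Sum>m\<in>supp g. mterm (a + m) (c * coef g m))"
    by (subst (1) poly_as_sum[of g]) (simp add: sum_distrib_left mult_single)
  then show ?thesis by (auto simp: lookup_sum lookup_single when_def in_keys_iff)
qed

lemma lookup_mono_mult_not: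
  fixes g :: "('v, 'a::comm_ring_1) mpoly"
  assumes "\<And>k. m \<noteq> a + k"
  shows "coef (mterm a c * g) m = 0"
proof -
  have "mterm a c * g = (\<Sum>m\<in>supp g. mterm (a + m) (c * coef g m))"
    by (subst (1) poly_as_sum[of g]) (simp add: sum_distrib_left mult_single)
  moreover have "(\<Sum>x\<in>supp g. if a + x = m then c * coef g x else 0) = 0"
    using assms by (intro sum.neutral) auto
  ultimately show ?thesis by (simp add: lookup_sum lookup_single when_def)
qed

lemma coef_frob_trace_mono:
  fixes g :: "('v, 'a::comm_ring_1) mpoly"
  assumes "finite V" "q > 0"
  shows "frob_trace q V (mterm (mscale q d) c * g) = mterm d c * frob_trace q V g"
proof (rule poly_mapping_eqI)
  fix k
  show "coef (frob_trace q V (mterm (mscale q d) c * g)) k = coef (mterm d c * frob_trace q V g) k"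
  proof (cases "\<exists>k'. k = d + k'")
    case True
    then obtain k' where k: "k = d + k'" by blast
    have "mscale q k + topm q V = mscale q d + (mscale q k' + topm q V)"
      by (simp add: k mscale_add add.assoc)
    then show ?thesis using assms k by (simp add: lookup_frob_trace lookup_mono_mult)
  next
    case False
    \<comment> \<open>All exponents of \<open>topm q V\<close> are below \<open>q\<close>, so
      rounding both sides down to multiples of \<open>q\<close> would make \<open>d\<close> divide
      \<open>k\<close> in every variable.\<close>
    have "mscale q k + topm q V \<noteq> mscale q d + l" for l
    proof
      assume eq: "mscale q k + topm q V = mscale q d + l"
      have "coef d v \<le> coef k v" for v
      proof -
        have "q * coef k v + coef (topm q V) v = q * coef d v + coef l v"
          using arg_cong[OF eq, of "\<lambda>x. coef x v"] by (simp add: lookup_add)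
        moreover have "coef (topm q V) v < q" using assms by (simp add: lookup_topm)
        ultimately have "q * coef d v < q * (coef k v + 1)" by (simp add: algebra_simps)
        then show ?thesis using nat_mult_less_cancel1 assms(2)
          by (metis less_Suc_eq_le Suc_eq_plus1)
      qed
      then have "k = d + (k - d)" by (intro poly_mapping_eqI) (simp add: lookup_add lookup_minus)
      with False show False by blast
    qed
    then have "coef (mterm (mscale q d) c * g) (mscale q k + topm q V) = 0"
      by (intro lookup_mono_mult_not) auto
    then show ?thesis using assms False by (simp add: lookup_frob_trace lookup_mono_mult_not)
  qed
qed

text \<open>The projection formula, one term of \<open>f\<close> at a time: by
  \<open>frob_poly\<close>, \<open>f ^ q\<close> has the scaled terms of \<open>f\<close> with the
  same coefficients.\<close>

lemma frob_trace_mult: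
  fixes f g :: "('v, 'p::prime_card mod_ring) mpoly"
  assumes "finite V" and q: "q = CARD('p) ^ e"
  shows "frob_trace q V (f ^ q * g) = f * frob_trace q V g"
proof -
  have q0: "q > 0" using q by simp
  have "frob_trace q V (f ^ q * g) = (\<Sum>m\<in>supp f. mterm m (coef f m) * frob_trace q V g)"
    unfolding q frob_poly
    by (simp add: sum_distrib_right frob_trace_sum coef_frob_trace_mono[OF assms(1)])
  also have "\<dots> = f * frob_trace q V g"
    by (subst (3) poly_as_sum[of f]) (simp add: sum_distrib_right)
  finally show ?thesis .
qed

lemma frob_trace_coef_0: "q > 0 \<Longrightarrow> coef (frob_trace q V g) 0 = coef g (topm q V)"
  by (simp add: lookup_frob_trace)

text \<open>The box monomials and their complements in \<open>topm q V\<close> are dual bases for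
  the pairing of \<open>s\<close> and \<open>t\<close> by the trace of \<open>s * t\<close>.\<close>

lemma frob_trace_box:
  fixes c :: "'a::comm_ring_1"
  assumes "finite V" "q > 0" "a \<in> box q V" "b \<in> box q V"
  shows "frob_trace q V (mterm (topm q V - a + b) c) = (if a = b then mterm 0 c else 0)"
proof (rule poly_mapping_eqI)
  fix k
  have lt: "coef (topm q V - a + b) v = (if v \<in> V then q - 1 - coef a v + coef b v else 0)" for v
    using assms by (auto simp: lookup_add lookup_minus lookup_topm box_iff in_keys_iff)
  have *: "topm q V - a + b = mscale q k + topm q V \<longleftrightarrow> a = b \<and> k = 0"
  proof
    assume eq: "topm q V - a + b = mscale q k + topm q V"
    have "coef a v = coef b v \<and> coef k v = 0" for v
    proof (cases "v \<in> V")
      case True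
      have ab: "coef a v < q" "coef b v < q" using assms by (auto simp: box_iff)
      have e: "q - 1 - coef a v + coef b v = q * coef k v + (q - 1)"
        using arg_cong[OF eq, of "\<lambda>x. coef x v"] True assms lt by (simp add: lookup_add lookup_topm)
      \<comment> \<open>Both \<open>coef a v\<close> and \<open>coef b v\<close> are below
        \<open>q\<close>, so this is uniqueness of division with remainder.\<close>
      then have "q * coef k v + coef a v = coef b v" using ab by linarith
      then have "coef k v = 0" using ab by (cases "coef k v") auto
      then show ?thesis using e ab by simp
    next
      case False
      have "coef a v = 0" "coef b v = 0" using False assms by (auto simp: box_iff in_keys_iff)
      moreover have "0 = q * coef k v"
        using arg_cong[OF eq, of "\<lambda>x. coef x v"] False assms lt
          by (simp add: lookup_add lookup_topm)
      ultimately show ?thesis using assms by simp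
    qed
    then show "a = b \<and> k = 0" by (auto intro!: poly_mapping_eqI)
  next
    assume "a = b \<and> k = 0"
    then show "topm q V - a + b = mscale q k + topm q V"
    proof (intro poly_mapping_eqI)
      fix v
      have "coef b v < q" using assms by (simp add: box_iff)
      then show "coef (topm q V - a + b) v = coef (mscale q k + topm q V) v"
        unfolding lt using \<open>a = b \<and> k = 0\<close> assms(1) by (simp add: lookup_add lookup_topm)
    qed
  qed
  show "coef (frob_trace q V (mterm (topm q V - a + b) c)) k
    = coef (if a = b then mterm 0 c else 0) k"
    using assms by (auto simp: lookup_frob_trace lookup_single * when_def)
qed

lemma mon_div_mod:
  fixes m :: "'v \<Rightarrow>\<^sub>0 nat"
  assumes "q > 0" "supp m \<subseteq> V" "finite V"
  obtains d b where "m = mscale q d + b" "b \<in> box q V" "supp d \<subseteq> V"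
proof
  show "m = mscale q (monf V (\<lambda>v. coef m v div q)) + monf V (\<lambda>v. coef m v mod q)"
    using assms by (intro poly_mapping_eqI) (auto simp: lookup_add lookup_monf in_keys_iff)
  show "monf V (\<lambda>v. coef m v mod q) \<in> box q V"
    using assms supp_monf[OF assms(3)] by (auto simp: box_iff lookup_monf)
  show "supp (monf V (\<lambda>v. coef m v div q)) \<subseteq> V" using assms by (simp add: supp_monf)
qed

text \<open>The box monomials form a basis over the \<open>q\<close>-th powers, and by
  \<open>frob_trace_box\<close> the coordinates are found by pairing with the complementary
  monomials. Additivity leaves the case of a single monomial, whose exponents are divided by
  \<open>q\<close> with remainder.\<close>

lemma frob_basis:
  fixes g :: "('v, 'p::prime_card mod_ring) mpoly"
  assumes V: "finite V" and q: "q = CARD('p) ^ e" and g: "g \<in> polys V"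
  shows "g = (\<Sum>b\<in>box q V. frob_trace q V (g * mterm (topm q V - b) 1) ^ q * mterm b 1)"
  using g
proof (induction rule: polys_induct)
  case zero
  then show ?case using q by (simp add: frob_trace_0 power_0_left)
next
  case (mterm m c)
  have q0: "q > 0" using q by simp
  obtain d b where m: "m = mscale q d + b" "b \<in> box q V" "supp d \<subseteq> V"
    using mon_div_mod[OF q0 mterm V] by blast
  have *: "frob_trace q V (mterm m c * mterm (topm q V - b') 1) = (if b' = b then mterm d c else 0)"
    if "b' \<in> box q V" for b'
  proof -
    have "mterm m c * mterm (topm q V - b') (1::'p mod_ring)
        = mterm (mscale q d) 1 * mterm (topm q V - b' + b) c"
      by (simp add: mult_single m algebra_simps)
    then have "frob_trace q V (mterm m c * mterm (topm q V - b') 1)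
        = mterm d 1 * frob_trace q V (mterm (topm q V - b' + b) c)"
      using coef_frob_trace_mono[OF V q0] by metis
    then show ?thesis unfolding frob_trace_box[OF V q0 that m(2)] by (simp add: mult_single)
  qed
  have "(\<Sum>b'\<in>box q V. frob_trace q V (mterm m c * mterm (topm q V - b') 1) ^ q * mterm b' 1)
     = (\<Sum>b'\<in>box q V. if b' = b then mterm d c ^ q * mterm b 1 else 0)"
    by (intro sum.cong refl) (use q0 in \<open>simp add: * power_0_left\<close>)
  also have "\<dots> = mterm d c ^ q * mterm b 1" using m V by simp
  also have "\<dots> = mterm m c" using q m by (simp add: mono_power frob_const mult_single)
  finally show ?case by simp
next
  case (add f g)
  have q0: "q > 0" using q by simp
  have "(\<Sum>b\<in>box q V. frob_trace q V ((f + g) * mterm (topm q V - b) 1) ^ q * mterm b 1)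
     = (\<Sum>b\<in>box q V. frob_trace q V (f * mterm (topm q V - b) 1) ^ q * mterm b 1)
     + (\<Sum>b\<in>box q V. frob_trace q V (g * mterm (topm q V - b) 1) ^ q * mterm b 1)"
    unfolding sum.distrib[symmetric] distrib_right frob_trace_add[OF q0]
    unfolding q frob_add distrib_right ..
  then show ?case using add by simp
qed

text \<open>Evaluation at the origin is multiplicative because natural exponents cannot
  cancel.\<close>

lemma coef_0_mult: "coef (f * g) 0 = coef f 0 * coef g 0"
  for f g :: "('v, 'a::comm_ring_1) mpoly"
proof -
  have *: "coef (mterm m (coef f m) * g) 0 = (if m = 0 then coef f 0 * coef g 0 else 0)" for m
  proof (cases "m = 0")
    case True
    then show ?thesis using lookup_mono_mult[of 0 "coef f 0" g 0] by simp
  next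
    case False
    have "0 \<noteq> m + k" for k using False
      by (metis add_eq_0_iff_both_eq_0 lookup_add lookup_zero poly_mapping_eqI)
    then show ?thesis using False lookup_mono_mult_not[of 0 m] by simp
  qed
  have "f * g = (\<Sum>m\<in>supp f. mterm m (coef f m) * g)"
    by (subst poly_as_sum[of f]) (simp add: sum_distrib_right)
  then show ?thesis by (simp add: lookup_sum *) (simp add: in_keys_iff)
qed

lemma coef_0_power: "coef (f ^ k) 0 = coef f 0 ^ k"
  for f :: "('v, 'a::comm_ring_1) mpoly"
  by (induction k) (auto simp: coef_0_mult)

lemma coef_0_prod: "coef (prod f I) 0 = (\<Prod>i\<in>I. coef (f i) 0)"
  for f :: "'i \<Rightarrow> ('v, 'a::comm_ring_1) mpoly"
  by (induction I rule: infinite_finite_induct) (auto simp: coef_0_mult)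

lemma frob_ideal_coef: "g \<in> frob_ideal q \<Longrightarrow> (\<And>v. coef m v < q) \<Longrightarrow> coef g m = 0"
  using lookup_red[of q g m] red_eq_0_iff[of q g] by simp

lemma power_pred: "0 < q \<Longrightarrow> x ^ q = x * x ^ (q - 1)" for x :: "'a::comm_monoid_mult"
  by (metis power_minus_mult mult.commute)

subsection \<open>Hypersurfaces and Fedder's criterion\<close>

text \<open>\<open>L\<close> plays the role of the localization of \<open>k[V]/(f)\<close> at the origin.\<close>

locale local_hypersurface = cring L for L :: "'l ring" (structure) +
  fixes V :: "'v::linorder set" and f :: "('v, 'p::prime_card mod_ring) mpoly"
    and \<phi> :: "('v, 'p mod_ring) mpoly \<Rightarrow> 'l"
  assumes finV: "finite V" and fV: "f \<in> polys V" and f_nz: "f \<noteq> 0" and f0: "coef f 0 = 0"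
    and phi_closed [simp]: "s \<in> polys V \<Longrightarrow> \<phi> s \<in> carrier L"
    and phi_add: "s \<in> polys V \<Longrightarrow> t \<in> polys V \<Longrightarrow> \<phi> (s + t) = \<phi> s \<oplus> \<phi> t"
    and phi_mult: "s \<in> polys V \<Longrightarrow> t \<in> polys V \<Longrightarrow> \<phi> (s * t) = \<phi> s \<otimes> \<phi> t"
    and phi_1: "\<phi> 1 = \<one>"
    and phi_unit: "u \<in> polys V \<Longrightarrow> coef u 0 \<noteq> 0 \<Longrightarrow> \<phi> u \<in> Units L"
    and phi_surj: "y \<in> carrier L \<Longrightarrow>
      \<exists>s\<in>polys V. \<exists>u\<in>polys V. coef u 0 \<noteq> 0 \<and> y \<otimes> \<phi> u = \<phi> s"
    and phi_ker: "s \<in> polys V \<Longrightarrow> \<phi> s = \<zero> \<longleftrightarrow>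
      (\<exists>u\<in>polys V. coef u 0 \<noteq> 0 \<and> (\<exists>t\<in>polys V. u * s = f * t))"
begin

section \<open>Fractions and the residue field of the local ring\<close>

definition units :: "('v, 'p mod_ring) mpoly set" where
  "units = {u \<in> polys V. coef u 0 \<noteq> 0}"

lemma units_mult [simp]: "u \<in> units \<Longrightarrow> w \<in> units \<Longrightarrow> u * w \<in> units"
  by (simp add: units_def coef_0_mult)
lemma units_1 [simp]: "1 \<in> units" by (simp add: units_def)
lemma units_power [simp]: "u \<in> units \<Longrightarrow> u ^ k \<in> units" by (induction k) auto
lemma phi_units [simp]: "u \<in> units \<Longrightarrow> \<phi> u \<in> Units L" by (simp add: units_def phi_unit)
lemma unitsI: "u \<in> polys V \<Longrightarrow> coef u 0 \<noteq> 0 \<Longrightarrow> u \<in> units" by (simp add: units_def)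
lemma units_coef_0: "u \<in> units \<Longrightarrow> coef u 0 \<noteq> 0" by (simp add: units_def)
lemma phi_surj_units: "y \<in> carrier L \<Longrightarrow> \<exists>s\<in>polys V. \<exists>u\<in>units. y \<otimes> \<phi> u = \<phi> s"
  using phi_surj unfolding units_def by blast
lemma phi_ker_units: "s \<in> polys V \<Longrightarrow> \<phi> s = \<zero> \<longleftrightarrow> (\<exists>u\<in>units. \<exists>t\<in>polys V. u * s = f * t)"
  using phi_ker unfolding units_def by blast
lemma units_polys [simp]: "u \<in> units \<Longrightarrow> u \<in> polys V" by (simp add: units_def)
declare units_coef_0 [simp]

lemma phi_0 [simp]: "\<phi> 0 = \<zero>"
proof -
  have "1 * (0 :: ('v, 'p mod_ring) mpoly) = f * 0" by simp
  then show ?thesis using phi_ker_units[of 0] units_1 polys_0 by blast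
qed

lemma phi_f [simp]: "t \<in> polys V \<Longrightarrow> \<phi> (f * t) = \<zero>"
proof -
  assume "t \<in> polys V"
  moreover have "1 * (f * t) = f * t" by simp
  ultimately show ?thesis using phi_ker_units[of "f * t"] fV units_1 polys_mult by blast
qed

lemma phi_power: "s \<in> polys V \<Longrightarrow> \<phi> (s ^ k) = \<phi> s [^] k"
  by (induction k) (simp_all add: phi_1 phi_mult m_comm)

lemma phi_diff: "s \<in> polys V \<Longrightarrow> t \<in> polys V \<Longrightarrow> \<phi> s = \<phi> t \<Longrightarrow> \<phi> (s - t) = \<zero>"
proof -
  assume a: "s \<in> polys V" "t \<in> polys V" "\<phi> s = \<phi> t"
  have "\<phi> (s - t) \<oplus> \<phi> t = \<phi> t" using a phi_add[of "s - t" t] by simp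
  then show ?thesis using a by (metis add.l_cancel_one' phi_closed polys_diff a_comm)
qed

text \<open>\<open>y\<close> is the fraction of \<open>s\<close> by \<open>u\<close>. Keeping
  numerator and denominator as polynomials turns statements about \<open>L\<close> into polynomial
  identities.\<close>

definition rep :: "'l \<Rightarrow> ('v, 'p mod_ring) mpoly \<Rightarrow> ('v, 'p mod_ring) mpoly \<Rightarrow> bool" where
  "rep y s u \<longleftrightarrow> s \<in> polys V \<and> u \<in> units \<and> y \<in> carrier L \<and> y \<otimes> \<phi> u = \<phi> s"

lemma ex_rep: "y \<in> carrier L \<Longrightarrow> \<exists>s u. rep y s u"
  using phi_surj_units unfolding rep_def by blast

lemma rep_phi: "s \<in> polys V \<Longrightarrow> rep (\<phi> s) s 1"
  by (simp add: rep_def phi_1)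

lemma rep_scale: "rep y s u \<Longrightarrow> w \<in> units \<Longrightarrow> rep y (s * w) (u * w)"
  by (auto simp: rep_def phi_mult) (metis m_assoc phi_closed units_polys)

lemma unit_cancel: "u \<in> units \<Longrightarrow> x \<in> carrier L \<Longrightarrow> y \<in> carrier L \<Longrightarrow> x \<otimes> \<phi> u = y \<otimes> \<phi> u \<Longrightarrow> x = y"
  by (metis Units_l_cancel m_comm phi_closed phi_units units_polys)

lemma ex_common_rep:
  assumes "y \<in> carrier L" "z \<in> carrier L"
  obtains s t u where "rep y s u" "rep z t u"
proof -
  obtain s u where 1: "rep y s u" using ex_rep assms by blast
  obtain t w where 2: "rep z t w" using ex_rep assms by blast
  have "rep y (s * w) (u * w)" "rep z (t * u) (w * u)"
    using 1 2 rep_scale by (auto simp: rep_def)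
  then show ?thesis using that by (metis mult.commute)
qed

lemma rep_unique:
  assumes "rep y s u" "rep y t w"
  shows "\<phi> (s * w - t * u) = \<zero>"
proof (rule phi_diff)
  show "s * w \<in> polys V" "t * u \<in> polys V" using assms by (auto simp: rep_def)
  have c: "y \<in> carrier L" "\<phi> u \<in> carrier L" "\<phi> w \<in> carrier L" using assms by (auto simp: rep_def)
  have "\<phi> (s * w) = (y \<otimes> \<phi> u) \<otimes> \<phi> w" using assms by (simp add: rep_def phi_mult)
  also have "\<dots> = (y \<otimes> \<phi> w) \<otimes> \<phi> u" using c by (simp add: m_ac)
  also have "\<dots> = \<phi> (t * u)" using assms by (simp add: rep_def phi_mult)
  finally show "\<phi> (s * w) = \<phi> (t * u)" .
qed

text \<open>Evaluation of a fraction at the origin; it does not depend on the representation because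
  \<open>f\<close> vanishes there.\<close>

definition residue :: "'l \<Rightarrow> 'p mod_ring" where
  "residue y = (THE c. \<exists>s u. rep y s u \<and> c = coef s 0 / coef u 0)"

lemma coef_0_of_phi_0: "s \<in> polys V \<Longrightarrow> \<phi> s = \<zero> \<Longrightarrow> coef s 0 = 0"
proof -
  assume "s \<in> polys V" "\<phi> s = \<zero>"
  then obtain u t where "u \<in> units" "u * s = f * t" using phi_ker_units by blast
  then have "coef u 0 * coef s 0 = 0" by (metis coef_0_mult f0 mult_zero_left)
  then show ?thesis using \<open>u \<in> units\<close> by simp
qed

lemma residue_rep:
  assumes "rep y s u"
  shows "residue y = coef s 0 / coef u 0"
  unfolding residue_def
proof (rule the_equality)
  show "\<exists>t w. rep y t w \<and> coef s 0 / coef u 0 = coef t 0 / coef w 0" using assms by blast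
  fix c assume "\<exists>t w. rep y t w \<and> c = coef t 0 / coef w 0"
  then obtain t w where 1: "rep y t w" "c = coef t 0 / coef w 0" by blast
  have "coef (s * w - t * u) 0 = 0"
    using rep_unique[OF assms 1(1)] assms 1(1) by (intro coef_0_of_phi_0) (auto simp: rep_def)
  then show "c = coef s 0 / coef u 0"
    using 1 assms by (simp add: lookup_minus coef_0_mult rep_def frac_eq_eq)
qed

lemma residue_phi [simp]: "s \<in> polys V \<Longrightarrow> residue (\<phi> s) = coef s 0"
  using residue_rep[OF rep_phi, of s] by simp

lemma residue_add:
  assumes "y \<in> carrier L" "z \<in> carrier L"
  shows "residue (y \<oplus> z) = residue y + residue z"
proof -
  obtain s t u where 1: "rep y s u" "rep z t u" by (rule ex_common_rep[OF assms])
  then have "rep (y \<oplus> z) (s + t) u" by (simp add: rep_def phi_add l_distr)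
  then show ?thesis using 1[THEN residue_rep]
    by (simp add: residue_rep lookup_add add_divide_distrib)
qed

lemma residue_mult:
  assumes "y \<in> carrier L" "z \<in> carrier L"
  shows "residue (y \<otimes> z) = residue y * residue z"
proof -
  obtain s u where 1: "rep y s u" using ex_rep assms by blast
  obtain t w where 2: "rep z t w" using ex_rep assms by blast
  have "y \<otimes> z \<otimes> (\<phi> u \<otimes> \<phi> w) = (y \<otimes> \<phi> u) \<otimes> (z \<otimes> \<phi> w)"
    using 1[unfolded rep_def, THEN conjunct2, THEN conjunct1] 2[unfolded rep_def, THEN conjunct2,
      THEN conjunct1] assms
    by (simp add: m_ac)
  then have "rep (y \<otimes> z) (s * t) (u * w)" using 1 2 by (simp add: rep_def phi_mult)
  then show ?thesis using 1 2 by (simp add: residue_rep coef_0_mult)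
qed

text \<open>Locality of \<open>L\<close>: a nonzero residue means that the numerator, too, has a
  nonzero constant term and is therefore invertible in \<open>L\<close>.\<close>

lemma residue_unit: "y \<in> carrier L \<Longrightarrow> residue y \<noteq> 0 \<Longrightarrow> y \<in> Units L"
proof -
  assume y: "y \<in> carrier L" "residue y \<noteq> 0"
  obtain s u where 1: "rep y s u" using ex_rep y by blast
  then have "s \<in> units" using y residue_rep[OF 1] by (intro unitsI) (auto simp: rep_def)
  then have "y \<otimes> \<phi> u \<in> Units L" using 1 by (simp add: rep_def)
  moreover have u: "\<phi> u \<in> Units L" "\<phi> u \<in> carrier L" using 1 by (auto simp: rep_def)
  ultimately have "y \<otimes> \<phi> u \<otimes> inv (\<phi> u) \<in> Units L" by simp
  then show ?thesis using y u by (simp add: m_assoc)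
qed

text \<open>The product of the individual denominators serves all, as the property survives
  multiplication by units. It is applied to the finitely many monomials of a box.\<close>

lemma common_denominator:
  assumes "finite B" "\<And>b. b \<in> B \<Longrightarrow> \<exists>u\<in>units. Q b u"
    "\<And>b u w. b \<in> B \<Longrightarrow> u \<in> units \<Longrightarrow> w \<in> units \<Longrightarrow> Q b u \<Longrightarrow> Q b (u * w)"
  shows "\<exists>u\<in>units. \<forall>b\<in>B. Q b u"
  using assms
proof (induction B)
  case (insert b B)
  then obtain u where u: "u \<in> units" "\<forall>b\<in>B. Q b u" by auto
  obtain w where w: "w \<in> units" "Q b w" using insert by blast
  have "Q b (w * u)" using insert.prems(2)[of b w u] u w by simp
  moreover have "\<forall>b'\<in>B. Q b' (w * u)" using insert.prems(2)[of _ u w] u w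
    by (simp add: mult.commute)
  ultimately show ?case using u w by (intro bexI[of _ "w * u"]) auto
qed (use units_1 in blast)

text \<open>Fedder's criterion. Every Frobenius-semilinear map on the hypersurface is induced by
  \<open>s \<mapsto> tr (c * s)\<close> with \<open>c\<close> a multiple of \<open>f\<^sup>q\<^sup>-\<^sup>1\<close>, because \<open>tr\<close> generates the semilinear
  maps of the polynomial ring.\<close>

definition semilinear :: "nat \<Rightarrow> (('v, 'p mod_ring) mpoly \<Rightarrow> 'l) \<Rightarrow> bool" where
  "semilinear q \<theta> \<longleftrightarrow> (\<forall>s\<in>polys V. \<theta> s \<in> carrier L) \<and>
     (\<forall>s\<in>polys V. \<forall>t\<in>polys V. \<theta> (s + t) = \<theta> s \<oplus> \<theta> t) \<and>
     (\<forall>r\<in>polys V. \<forall>s\<in>polys V. \<theta> (r ^ q * s) = \<phi> r \<otimes> \<theta> s) \<and>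
     (\<forall>s\<in>polys V. \<phi> s = \<zero> \<longrightarrow> \<theta> s = \<zero>)"

lemma semilinear_0: "semilinear q \<theta> \<Longrightarrow> \<theta> 0 = \<zero>"
  by (simp add: semilinear_def)

text \<open>Up to a unit, \<open>\<theta>\<close> is the trace of \<open>c * s\<close>. Since it
  kills the multiples of \<open>f\<close>, a unit multiple of \<open>c\<close> is divisible by
  \<open>f ^ (q - 1)\<close>, and the residue of \<open>\<theta> s\<close> is, up to nonzero
  factors, a coefficient of a multiple of \<open>f ^ (q - 1) * s\<close> at a monomial with
  exponents below \<open>q\<close>.\<close>

lemma fedder_vanishing:
  assumes \<theta>: "semilinear q \<theta>" and q: "q = CARD('p) ^ e"
    and s: "s \<in> polys V" "f ^ (q - 1) * s \<in> frob_ideal q"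
  shows "residue (\<theta> s) = 0"
proof -
  have q0: "q > 0" using q by simp
  note cl = \<theta>[unfolded semilinear_def, THEN conjunct1, rule_format]
  note ad = \<theta>[unfolded semilinear_def, THEN conjunct2, THEN conjunct1, rule_format]
  note sm = \<theta>[unfolded semilinear_def, THEN conjunct2, THEN conjunct2, THEN conjunct1, rule_format]
  note ke = \<theta>[unfolded semilinear_def, THEN conjunct2, THEN conjunct2, THEN conjunct2, rule_format]
  let ?B = "box q V"
  have bV: "mterm b c \<in> polys V" if "b \<in> ?B" for b and c :: "'p mod_ring"
    using that q0 by (simp add: polys_mono box_iff)
  have top_B: "topm q V - b \<in> ?B" if "b \<in> ?B" for b
    using that q0 finV
    by (auto simp: box_iff lookup_minus lookup_topm in_keys_iff split: if_splits)
  \<comment> \<open>\<open>\<theta>\<close> is determined by its values on the box monomials; these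
    are finitely many and so share a denominator.\<close>
  have "\<exists>u\<in>units. \<forall>b\<in>?B. \<exists>t\<in>polys V. \<theta> (mterm b 1) \<otimes> \<phi> u = \<phi> t"
  proof (rule common_denominator)
    show "finite ?B" using finV by simp
    show "\<exists>u\<in>units. \<exists>t\<in>polys V. \<theta> (mterm b 1) \<otimes> \<phi> u = \<phi> t" if "b \<in> ?B" for b
      using ex_rep[OF cl[OF bV[OF that]], of 1] by (auto simp: rep_def)
    show "\<exists>t\<in>polys V. \<theta> (mterm b 1) \<otimes> \<phi> (u * w) = \<phi> t"
      if "b \<in> ?B" "u \<in> units" "w \<in> units" and ex: "\<exists>t\<in>polys V. \<theta> (mterm b 1) \<otimes> \<phi> u = \<phi> t" for b u w
    proof -
      obtain t where t: "t \<in> polys V" "\<theta> (mterm b 1) \<otimes> \<phi> u = \<phi> t" using ex by blast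
      then have "\<theta> (mterm b 1) \<otimes> \<phi> (u * w) = \<phi> (t * w)"
        using that cl[OF bV[OF that(1)], of 1] by (simp add: phi_mult m_assoc[symmetric])
      then show ?thesis using t that by (auto intro!: bexI[of _ "t * w"])
    qed
  qed
  then obtain u B where u: "u \<in> units"
    and B: "\<And>b. b \<in> ?B \<Longrightarrow> B b \<in> polys V \<and> \<theta> (mterm b 1) \<otimes> \<phi> u = \<phi> (B b)"
    by metis
  \<comment> \<open>The dual basis converts the prescribed values \<open>B b\<close> into the
    coefficient \<open>c\<close> of a trace form.\<close>
  define c where "c = (\<Sum>b\<in>?B. B b ^ q * mterm (topm q V - b) 1)"
  have cV: "c \<in> polys V" unfolding c_def
    using B bV top_B by (intro polys_sum) auto
  have trV: "frob_trace q V x \<in> polys V" if "x \<in> polys V" for x :: "('v, 'p mod_ring) mpoly"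
    using that q0 frob_trace_polys by blast
  have trc: "frob_trace q V (c * mterm b 1) = B b" if b: "b \<in> ?B" for b
  proof -
    have "c * mterm b 1 = (\<Sum>b'\<in>?B. B b' ^ q * mterm (topm q V - b' + b) 1)"
      by (simp add: c_def sum_distrib_right mult.assoc mult_single)
    then have "frob_trace q V (c * mterm b 1)
        = (\<Sum>b'\<in>?B. B b' * frob_trace q V (mterm (topm q V - b' + b) 1))"
      by (simp add: frob_trace_sum[OF q0] frob_trace_mult[OF finV q])
    also have "\<dots> = (\<Sum>b'\<in>?B. if b' = b then B b else 0)"
      by (rule sum.cong) (simp_all add: frob_trace_box[OF finV q0 _ b])
    also have "\<dots> = B b" using b finV by simp
    finally show ?thesis .
  qed
  have rep\<theta>: "\<phi> u \<otimes> \<theta> x = \<phi> (frob_trace q V (c * x))" if "x \<in> polys V" for x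
    using that
  proof (induction rule: polys_induct)
    case zero
    then show ?case using u semilinear_0[OF \<theta>] by (simp add: frob_trace_0[OF q0])
  next
    case (mterm m a)
    obtain d b where m: "m = mscale q d + b" "b \<in> ?B" "supp d \<subseteq> V"
      using mon_div_mod[OF q0 mterm finV] by blast
    have eq: "mterm m a = mterm d a ^ q * mterm b 1"
      using q m by (simp add: mono_power frob_const mult_single)
    have dV: "mterm d a \<in> polys V" using m by (simp add: polys_mono)
    have "\<phi> u \<otimes> \<theta> (mterm m a) = \<phi> (mterm d a) \<otimes> \<phi> (B b)"
    proof -
      have "\<phi> (mterm d a) \<in> carrier L" "\<phi> u \<in> carrier L" "\<theta> (mterm b 1) \<in> carrier L"
        using u cl[OF bV[OF m(2)], of 1] dV by simp_all
      then have "\<phi> u \<otimes> (\<phi> (mterm d a) \<otimes> \<theta> (mterm b 1)) = \<phi> (mterm d a) \<otimes> (\<theta> (mterm b 1) \<otimes> \<phi> u)"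
        by (simp add: m_ac)
      then show ?thesis unfolding eq sm[OF dV bV[OF m(2)], of 1] using B[OF m(2)] by simp
    qed
    moreover have "c * mterm m a = mterm d a ^ q * (c * mterm b 1)"
      by (simp add: eq mult.left_commute)
    ultimately show ?case
      using dV B[OF m(2)] trc[OF m(2)] by (simp only: frob_trace_mult[OF finV q] phi_mult)
  next
    case (add x y)
    then show ?case
      using u cV trV cl by (simp add: ad r_distr distrib_left frob_trace_add[OF q0] phi_add)
  qed
  let ?t = "\<lambda>b. frob_trace q V (c * (f * mterm b 1))"
  \<comment> \<open>\<open>\<theta>\<close> vanishes on multiples of \<open>f\<close>, so these
    traces vanish in \<open>L\<close>, and a unit \<open>v\<close> turns them into multiples of
    \<open>f\<close>.\<close>
  have "\<exists>v\<in>units. \<forall>b\<in>?B. \<exists>t\<in>polys V. v * ?t b = f * t"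
  proof (rule common_denominator)
    show "finite ?B" using finV by simp
    fix b assume b: "b \<in> ?B"
    have "\<theta> (f * mterm b 1) = \<zero>" using b fV bV by (intro ke) auto
    then have "\<phi> (?t b) = \<zero>" using rep\<theta>[of "f * mterm b 1"] u fV bV b by simp
    moreover have "?t b \<in> polys V" using trV cV fV bV b by simp
    ultimately show "\<exists>v\<in>units. \<exists>t\<in>polys V. v * ?t b = f * t"
      using phi_ker_units by blast
  next
    fix b u w assume w: "w \<in> units" "\<exists>t\<in>polys V. u * ?t b = f * t"
    then obtain t where t: "t \<in> polys V" "u * ?t b = f * t" by blast
    have "u * w * ?t b = w * (u * ?t b)" by (simp only: mult_ac)
    also have "\<dots> = f * (w * t)" unfolding t(2) by (simp only: mult_ac)
    finally show "\<exists>t\<in>polys V. u * w * ?t b = f * t" using w t by (metis polys_mult units_polys)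
  qed
  then obtain v T where v: "v \<in> units" and T: "\<And>b. b \<in> ?B \<Longrightarrow> T b \<in> polys V \<and> v * ?t b = f * T b"
    by metis
  define T' where "T' = (\<Sum>b\<in>?B. T (topm q V - b) ^ q * mterm b 1)"
  have T'V: "T' \<in> polys V" unfolding T'_def using T bV top_B by (intro polys_sum) auto
  \<comment> \<open>All coordinates of \<open>v ^ q * (c * f)\<close> in the Frobenius basis are
    divisible by \<open>f\<close>, hence the element itself is divisible by \<open>f ^ q\<close>;
    cancelling one \<open>f\<close> leaves \<open>f ^ (q - 1)\<close>.\<close>
  have "v ^ q * (c * f) = (\<Sum>b\<in>?B. frob_trace q V (v ^ q * (c * f) * mterm (topm q V - b) 1) ^ q *
    mterm b 1)"
    using v cV fV by (intro frob_basis[OF finV q]) auto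
  also have "\<dots> = (\<Sum>b\<in>?B. f ^ q * (T (topm q V - b) ^ q * mterm b 1))"
  proof (rule sum.cong)
    fix b assume b: "b \<in> ?B"
    have "frob_trace q V (v ^ q * (c * f) * mterm (topm q V - b) 1) = v * ?t (topm q V - b)"
      using frob_trace_mult[OF finV q, of v "c * (f * mterm (topm q V - b) 1)"]
      by (simp add: mult.assoc)
    also have "\<dots> = f * T (topm q V - b)" using T top_B[OF b] by blast
    finally show "frob_trace q V (v ^ q * (c * f) * mterm (topm q V - b) 1) ^ q * mterm b 1
        = f ^ q * (T (topm q V - b) ^ q * mterm b 1)"
      by (simp add: power_mult_distrib mult.assoc)
  qed simp
  also have "\<dots> = f ^ q * T'" by (simp add: T'_def sum_distrib_left)
  finally have "f * (v ^ q * c) = f * (f ^ (q - 1) * T')"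
    by (simp only: power_pred[OF q0, of f] mult_ac)
  then have vc: "v ^ q * c = f ^ (q - 1) * T'" using f_nz by simp
  have "\<phi> v \<otimes> (\<phi> u \<otimes> \<theta> s) = \<phi> (frob_trace q V (T' * (f ^ (q - 1) * s)))"
  proof -
    have "\<phi> v \<otimes> (\<phi> u \<otimes> \<theta> s) = \<phi> (v * frob_trace q V (c * s))"
      using rep\<theta>[OF s(1)] v trV cV s by (simp add: phi_mult)
    also have "v * frob_trace q V (c * s) = frob_trace q V (v ^ q * c * s)"
      using frob_trace_mult[OF finV q, of v "c * s"] by (simp add: mult.assoc)
    finally show ?thesis unfolding vc by (simp only: mult_ac)
  qed
  \<comment> \<open>The constant term of a trace is the coefficient at \<open>topm q V\<close>,
    whose exponents are all below \<open>q\<close>.\<close>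
  then have "residue (\<phi> v \<otimes> (\<phi> u \<otimes> \<theta> s)) = coef (T' * (f ^ (q - 1) * s)) (topm q V)"
    using T'V fV s trV frob_trace_coef_0[OF q0] by simp
  also have "\<dots> = 0"
  proof -
    have "T' * (f ^ (q - 1) * s) \<in> frob_ideal q" using s frob_ideal_mult by blast
    moreover have "coef (topm q V) w < q" for w using q0 finV by (simp add: lookup_topm)
    ultimately show ?thesis by (rule frob_ideal_coef)
  qed
  finally have "residue (\<phi> v) * (residue (\<phi> u) * residue (\<theta> s)) = 0"
    using u v cl[OF s(1)] by (simp add: residue_mult del: residue_phi)
  then show ?thesis using u v by simp
qed

text \<open>Expanding the fraction of \<open>s\<close> by \<open>u\<close> with
  \<open>u ^ (q - 1)\<close> makes its denominator \<open>u ^ q\<close>, which semilinearity pulls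
  out as \<open>u\<close>. This forces the value: \<open>\<theta> (s * u ^ (q - 1))\<close> divided
  by \<open>u\<close>.\<close>

lemma semilinear_extends:
  assumes \<theta>: "semilinear q \<theta>" and q: "q > 0"
  obtains \<psi> where "\<And>y. y \<in> carrier L \<Longrightarrow> \<psi> y \<in> carrier L"
    "\<And>y z. y \<in> carrier L \<Longrightarrow> z \<in> carrier L \<Longrightarrow> \<psi> (y \<oplus> z) = \<psi> y \<oplus> \<psi> z"
    "\<And>r y. r \<in> carrier L \<Longrightarrow> y \<in> carrier L \<Longrightarrow> \<psi> (r [^] q \<otimes> y) = r \<otimes> \<psi> y"
    "\<And>s. s \<in> polys V \<Longrightarrow> \<psi> (\<phi> s) = \<theta> s"
proof -
  note cl = \<theta>[unfolded semilinear_def, THEN conjunct1, rule_format]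
  note ad = \<theta>[unfolded semilinear_def, THEN conjunct2, THEN conjunct1, rule_format]
  note sm = \<theta>[unfolded semilinear_def, THEN conjunct2, THEN conjunct2, THEN conjunct1, rule_format]
  note ke = \<theta>[unfolded semilinear_def, THEN conjunct2, THEN conjunct2, THEN conjunct2, rule_format]
  have \<theta>_eq: "\<theta> s = \<theta> t" if "s \<in> polys V" "t \<in> polys V" "\<phi> (s - t) = \<zero>" for s t
    using ad[of "s - t" t] ke[of "s - t"] that cl[of t] by simp
  define \<psi> where "\<psi> y = (SOME z. z \<in> carrier L \<and> (\<exists>s u. rep y s u \<and> z \<otimes> \<phi> u = \<theta> (s * u ^ (q - 1))))"
    for y
  have psi: "\<psi> y \<in> carrier L \<and> \<psi> y \<otimes> \<phi> u = \<theta> (s * u ^ (q - 1))" if r: "rep y s u" for y s u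
  proof -
    have "inv (\<phi> u) \<otimes> \<theta> (s * u ^ (q - 1)) \<otimes> \<phi> u = \<theta> (s * u ^ (q - 1))"
    proof -
      have "\<phi> u \<in> Units L" "\<phi> u \<in> carrier L" "\<theta> (s * u ^ (q - 1)) \<in> carrier L"
        using r cl[of "s * u ^ (q - 1)"] by (auto simp: rep_def)
      then show ?thesis
        by (metis Units_inv_closed Units_r_inv l_one m_assoc m_comm)
    qed
    moreover have "inv (\<phi> u) \<otimes> \<theta> (s * u ^ (q - 1)) \<in> carrier L"
      using r cl[of "s * u ^ (q - 1)"] by (simp add: rep_def)
    ultimately have "\<exists>z. z \<in> carrier L \<and> (\<exists>s u. rep y s u \<and> z \<otimes> \<phi> u = \<theta> (s * u ^ (q - 1)))"
      using r by blast
    from someI_ex[OF this] obtain s' u' where 1: "\<psi> y \<in> carrier L" "rep y s' u'"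
      "\<psi> y \<otimes> \<phi> u' = \<theta> (s' * u' ^ (q - 1))" unfolding \<psi>_def by blast
    have uu: "u \<in> units" "u' \<in> units" "s \<in> polys V" "s' \<in> polys V" using r 1 by (auto simp: rep_def)
    have uq: "w ^ q = w * w ^ (q - 1)" for w :: "('v, 'p mod_ring) mpoly"
      by (rule power_pred[OF q])
    \<comment> \<open>Independence of the representation: over the common denominator
      \<open>u * u'\<close> the two arguments differ by a multiple of
      \<open>s * u' - s' * u\<close>, which vanishes in \<open>L\<close>.\<close>
    have e1: "\<phi> u' \<otimes> \<theta> (s * u ^ (q - 1)) = \<theta> (s * u' * (u * u') ^ (q - 1))"
      using sm[of u' "s * u ^ (q - 1)"] uu by (simp add: uq[of u'] power_mult_distrib mult_ac)
    have e2: "\<phi> u \<otimes> \<theta> (s' * u' ^ (q - 1)) = \<theta> (s' * u * (u * u') ^ (q - 1))"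
      using sm[of u "s' * u' ^ (q - 1)"] uu by (simp add: uq[of u] power_mult_distrib mult_ac)
    have "\<phi> ((s * u' - s' * u) * (u * u') ^ (q - 1)) = \<zero>"
      using rep_unique[OF r 1(2)] uu by (subst phi_mult) auto
    then have "\<theta> (s * u' * (u * u') ^ (q - 1)) = \<theta> (s' * u * (u * u') ^ (q - 1))"
      using uu by (intro \<theta>_eq) (auto simp: left_diff_distrib)
    then have "\<phi> u' \<otimes> \<theta> (s * u ^ (q - 1)) = \<phi> u \<otimes> (\<psi> y \<otimes> \<phi> u')" using e1 e2 1 by simp
    moreover have "\<theta> (s * u ^ (q - 1)) \<otimes> \<phi> u' = \<phi> u' \<otimes> \<theta> (s * u ^ (q - 1))"
      using uu cl[of "s * u ^ (q - 1)"] by (intro m_comm) simp_all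
    moreover have "\<phi> u \<otimes> (\<psi> y \<otimes> \<phi> u') = (\<psi> y \<otimes> \<phi> u) \<otimes> \<phi> u'"
      using uu 1(1) by (simp add: m_ac)
    ultimately have "\<theta> (s * u ^ (q - 1)) \<otimes> \<phi> u' = (\<psi> y \<otimes> \<phi> u) \<otimes> \<phi> u'" by simp
    then have "\<theta> (s * u ^ (q - 1)) = \<psi> y \<otimes> \<phi> u"
      by (rule unit_cancel[OF uu(2), rotated 2]) (use uu 1(1) cl[of "s * u ^ (q - 1)"] in simp_all)
    then show ?thesis using 1(1) by simp
  qed
  show ?thesis
  proof (rule that[of \<psi>])
    show c: "\<psi> y \<in> carrier L" if "y \<in> carrier L" for y using psi ex_rep that by blast
    show "\<psi> (y \<oplus> z) = \<psi> y \<oplus> \<psi> z" if yz: "y \<in> carrier L" "z \<in> carrier L" for y z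
    proof -
      obtain s t u where 1: "rep y s u" "rep z t u" by (rule ex_common_rep[OF yz])
      then have 2: "rep (y \<oplus> z) (s + t) u" by (simp add: rep_def phi_add l_distr)
      have "\<psi> (y \<oplus> z) \<otimes> \<phi> u = (\<psi> y \<oplus> \<psi> z) \<otimes> \<phi> u"
        using psi[OF 1(1)] psi[OF 1(2)] psi[OF 2] 1
        by (simp add: rep_def l_distr distrib_right ad)
      then show ?thesis by (rule unit_cancel[rotated 3]) (use 1 yz c in \<open>simp_all add: rep_def\<close>)
    qed
    show "\<psi> (r [^] q \<otimes> y) = r \<otimes> \<psi> y" if ry: "r \<in> carrier L" "y \<in> carrier L" for r y
    proof -
      obtain s u where 1: "rep y s u" using ex_rep ry by blast
      obtain a w where 2: "rep r a w" using ex_rep ry by blast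
      have aw: "a \<in> polys V" "w \<in> units" "r \<otimes> \<phi> w = \<phi> a" "s \<in> polys V" "u \<in> units"
        using 1 2 by (auto simp: rep_def)
      have "r [^] q \<otimes> y \<otimes> (\<phi> w [^] q \<otimes> \<phi> u) = (r \<otimes> \<phi> w) [^] q \<otimes> (y \<otimes> \<phi> u)"
        using ry aw(2,5) by (simp add: nat_pow_distrib m_ac)
      then have 3: "rep (r [^] q \<otimes> y) (a ^ q * s) (w ^ q * u)"
        using 1 2 ry by (simp add: rep_def phi_mult phi_power)
      have e: "a ^ q * s * (w ^ q * u) ^ (q - 1) = a ^ q * ((w ^ (q - 1)) ^ q * (s * u ^ (q - 1)))"
      proof -
        have "(w ^ q) ^ (q - 1) = (w ^ (q - 1)) ^ q" by (metis power_mult mult.commute)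
        then show ?thesis by (simp only: power_mult_distrib mult_ac)
      qed
      have e': "\<theta> (a ^ q * s * (w ^ q * u) ^ (q - 1))
        = \<phi> a \<otimes> (\<phi> (w ^ (q - 1)) \<otimes> \<theta> (s * u ^ (q - 1)))"
        unfolding e using aw by (simp add: sm)
      have wq: "\<phi> (w ^ q) = \<phi> w \<otimes> \<phi> (w ^ (q - 1))"
        using aw phi_mult[of w "w ^ (q - 1)"] by (simp add: power_pred[OF q, of w])
      have "\<psi> (r [^] q \<otimes> y) \<otimes> \<phi> (w ^ q * u) = \<phi> a \<otimes> (\<phi> (w ^ (q - 1)) \<otimes> (\<psi> y \<otimes> \<phi> u))"
        using psi[OF 3] psi[OF 1] e' by simp
      also have "\<dots> = (r \<otimes> \<psi> y) \<otimes> \<phi> (w ^ q * u)"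
        using aw(1,2,4,5) ry c by (simp add: aw(3)[symmetric] phi_mult wq m_ac)
      finally show ?thesis by (rule unit_cancel[rotated 3]) (use aw(2,5) ry c in simp_all)
    qed
    show "\<psi> (\<phi> s) = \<theta> s" if "s \<in> polys V" for s
    proof -
      have a: "\<psi> (\<phi> s) \<in> carrier L" "\<psi> (\<phi> s) \<otimes> \<phi> 1 = \<theta> (s * 1 ^ (q - 1))"
        using psi[OF rep_phi[OF that]] by blast+
      then show ?thesis using r_one[OF a(1)] unfolding phi_1 by simp
    qed
  qed
qed

text \<open>Some term of \<open>f ^ (q - 1) * s\<close> has all exponents below \<open>q\<close>.
  Multiplication by the complementary monomial moves it to \<open>topm q V\<close>, where the trace
  sees it as a constant term; the factor \<open>f ^ (q - 1)\<close> makes the map descend to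
  \<open>L\<close>.\<close>

lemma fedder_nonvanishing:
  assumes q: "q = CARD('p) ^ e" and s: "s \<in> polys V" "f ^ (q - 1) * s \<notin> frob_ideal q"
  obtains \<psi> where "\<And>y. y \<in> carrier L \<Longrightarrow> \<psi> y \<in> carrier L"
    "\<And>y z. y \<in> carrier L \<Longrightarrow> z \<in> carrier L \<Longrightarrow> \<psi> (y \<oplus> z) = \<psi> y \<oplus> \<psi> z"
    "\<And>r y. r \<in> carrier L \<Longrightarrow> y \<in> carrier L \<Longrightarrow> \<psi> (r [^] q \<otimes> y) = r \<otimes> \<psi> y"
    "residue (\<psi> (\<phi> s)) \<noteq> 0"
proof -
  have q0: "q > 0" using q by simp
  obtain b where b: "b \<in> supp (f ^ (q - 1) * s)" "\<And>v. coef b v < q"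
    using s unfolding frob_ideal_def by (auto simp: not_le)
  have "f ^ (q - 1) * s \<in> polys V" using fV s by simp
  then have "supp b \<subseteq> V" using b unfolding polys_def by blast
  then have bB: "b \<in> box q V" using b q0 by (simp add: box_iff)
  define g where "g = mterm (topm q V - b) 1 * f ^ (q - 1)"
  have gV: "g \<in> polys V" unfolding g_def
    using fV supp_topm[OF finV, of q]
    by (intro polys_mult polys_mono polys_power) (auto simp: in_keys_iff lookup_minus)
  define \<theta> where "\<theta> t = \<phi> (frob_trace q V (g * t))" for t
  have tr: "frob_trace q V x \<in> polys V" if "x \<in> polys V" for x :: "('v, 'p mod_ring) mpoly"
    using that q0 frob_trace_polys by blast
  have sl: "semilinear q \<theta>"
    unfolding semilinear_def
  proof (intro conjI ballI impI)
    show "\<theta> t \<in> carrier L" if "t \<in> polys V" for t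
      unfolding \<theta>_def using that gV tr by simp
    show "\<theta> (t + t') = \<theta> t \<oplus> \<theta> t'" if "t \<in> polys V" "t' \<in> polys V" for t t'
      unfolding \<theta>_def using that gV tr by (simp add: distrib_left frob_trace_add[OF q0] phi_add)
    show "\<theta> (r ^ q * t) = \<phi> r \<otimes> \<theta> t" if "r \<in> polys V" "t \<in> polys V" for r t
      unfolding \<theta>_def mult.left_commute[of g] frob_trace_mult[OF finV q]
      using that gV tr by (simp add: phi_mult)
    show "\<theta> t = \<zero>" if t: "t \<in> polys V" "\<phi> t = \<zero>" for t
    proof -
      obtain v t' where v: "v \<in> units" "t' \<in> polys V" "v * t = f * t'"
        using t phi_ker_units by blast
      \<comment> \<open>One factor \<open>f\<close> comes from \<open>v * t = f * t'\<close>, the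
        remaining \<open>q - 1\<close> from \<open>g\<close>; the trace turns \<open>f ^ q\<close>
        into \<open>f\<close>.\<close>
      have "v ^ q * (g * t) = f ^ q * (mterm (topm q V - b) 1 * (v ^ (q - 1) * t'))"
      proof -
        have "v ^ q * (g * t) = v ^ (q - 1) * (f ^ (q - 1) * (mterm (topm q V - b) 1 * (v * t)))"
          unfolding power_pred[OF q0, of v] g_def by (simp only: mult_ac)
        then show ?thesis unfolding v(3) by (simp only: power_pred[OF q0, of f] mult_ac)
      qed
      then have "v * frob_trace q V (g * t)
        = f * frob_trace q V (mterm (topm q V - b) 1 * (v ^ (q - 1) * t'))"
        using frob_trace_mult[OF finV q] by metis
      moreover have "frob_trace q V (mterm (topm q V - b) 1 * (v ^ (q - 1) * t')) \<in> polys V"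
        using v supp_topm[OF finV, of q]
        by (intro tr polys_mult polys_mono polys_power) (auto simp: in_keys_iff lookup_minus)
      ultimately show ?thesis unfolding \<theta>_def
        using v gV t tr phi_ker_units[of "frob_trace q V (g * t)"] by auto
    qed
  qed
  moreover have "residue (\<theta> s) \<noteq> 0"
  proof -
    have "topm q V = (topm q V - b) + b"
    proof (rule poly_mapping_eqI)
      fix v
      have "coef b v < q" "v \<notin> V \<Longrightarrow> coef b v = 0"
        using bB q0 by (auto simp: box_iff in_keys_iff)
      then show "coef (topm q V) v = coef (topm q V - b + b) v"
        using finV by (auto simp: lookup_add lookup_minus lookup_topm)
    qed
    then have "coef (g * s) (topm q V) = coef (f ^ (q - 1) * s) b"
      using lookup_mono_mult[of "topm q V - b" 1 "f ^ (q - 1) * s" b]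
        by (simp add: g_def mult.assoc)
    then show ?thesis unfolding \<theta>_def
      using gV s tr b by (simp add: frob_trace_coef_0[OF q0] in_keys_iff)
  qed
  ultimately have res: "residue (\<theta> s) \<noteq> 0" by simp
  show ?thesis
  proof (rule semilinear_extends[OF sl q0])
    fix \<psi>
    assume *: "\<And>y. y \<in> carrier L \<Longrightarrow> \<psi> y \<in> carrier L"
      "\<And>y z. y \<in> carrier L \<Longrightarrow> z \<in> carrier L \<Longrightarrow> \<psi> (y \<oplus> z) = \<psi> y \<oplus> \<psi> z"
      "\<And>r y. r \<in> carrier L \<Longrightarrow> y \<in> carrier L \<Longrightarrow> \<psi> (r [^] q \<otimes> y) = r \<otimes> \<psi> y"
      "\<And>s. s \<in> polys V \<Longrightarrow> \<psi> (\<phi> s) = \<theta> s"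
    show ?thesis by (rule that[of \<psi>]) (simp_all add: * res s)
  qed
qed

end

subsection \<open>The free rank of the Frobenius push-forward\<close>

text \<open>If \<open>\<mu>\<close> determines \<open>\<tau>\<close>, the image of
  \<open>\<tau>\<close> is an image of that of \<open>\<mu>\<close>. This is how dimensions are
  compared throughout.\<close>

lemma card_image_le_if_factor:
  assumes "finite (\<mu> ` A)" "\<And>s t. s \<in> A \<Longrightarrow> t \<in> A \<Longrightarrow> \<mu> s = \<mu> t \<Longrightarrow> \<tau> s = \<tau> t"
  shows "card (\<tau> ` A) \<le> card (\<mu> ` A)"
proof -
  have "\<tau> ` A \<subseteq> (\<lambda>m. \<tau> (SOME s. s \<in> A \<and> \<mu> s = m)) ` (\<mu> ` A)"
  proof
    fix x assume "x \<in> \<tau> ` A"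
    then obtain s where s: "s \<in> A" "x = \<tau> s" by blast
    then have "(SOME t. t \<in> A \<and> \<mu> t = \<mu> s) \<in> A \<and> \<mu> (SOME t. t \<in> A \<and> \<mu> t = \<mu> s) = \<mu> s"
      by (intro someI_ex[of "\<lambda>t. t \<in> A \<and> \<mu> t = \<mu> s"]) blast
    then have "\<tau> (SOME t. t \<in> A \<and> \<mu> t = \<mu> s) = x" using assms(2) s by blast
    then show "x \<in> (\<lambda>m. \<tau> (SOME s. s \<in> A \<and> \<mu> s = m)) ` (\<mu> ` A)" using s by blast
  qed
  then show ?thesis using assms(1) by (meson card_image_le card_mono finite_imageI le_trans)
qed

lemma module_sum_simps:
  "carrier (module_sum M N) = carrier M \<times> carrier N"
  "(x, y) \<oplus>\<^bsub>module_sum M N\<^esub> (x', y') = (x \<oplus>\<^bsub>M\<^esub> x', y \<oplus>\<^bsub>N\<^esub> y')"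
  "r \<odot>\<^bsub>module_sum M N\<^esub> (x, y) = (r \<odot>\<^bsub>M\<^esub> x, r \<odot>\<^bsub>N\<^esub> y)"
  by (simp_all add: module_sum_def)

lemma free_module_simps:
  "carrier (free_module R a) = {..<a} \<rightarrow>\<^sub>E carrier R"
  "x \<oplus>\<^bsub>free_module R a\<^esub> y = (\<lambda>i\<in>{..<a}. x i \<oplus>\<^bsub>R\<^esub> y i)"
  "r \<odot>\<^bsub>free_module R a\<^esub> x = (\<lambda>i\<in>{..<a}. r \<otimes>\<^bsub>R\<^esub> x i)"
  by (simp_all add: free_module_def)

lemma frobenius_pushforward_simps:
  "carrier (frobenius_pushforward p e R) = carrier R"
  "x \<oplus>\<^bsub>frobenius_pushforward p e R\<^esub> y = x \<oplus>\<^bsub>R\<^esub> y"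
  "\<zero>\<^bsub>frobenius_pushforward p e R\<^esub> = \<zero>\<^bsub>R\<^esub>"
  "r \<odot>\<^bsub>frobenius_pushforward p e R\<^esub> x = (r [^]\<^bsub>R\<^esub> (p ^ e)) \<otimes>\<^bsub>R\<^esub> x"
  by (simp_all add: frobenius_pushforward_def)

text \<open>The isomorphism inside \<open>splits_free\<close> with the sum of modules unfolded, so
  that the free part is accessible coordinate by coordinate.\<close>

definition split_map ::
    "('a, 'r) ring_scheme \<Rightarrow> ('a, 'b) module \<Rightarrow> nat \<Rightarrow> ('a, 'c) module \<Rightarrow> ('b \<Rightarrow> (nat \<Rightarrow> 'a) \<times> 'c) \<Rightarrow> bool"
      where
  "split_map R M a N h \<longleftrightarrow> bij_betw h (carrier M) (({..<a} \<rightarrow>\<^sub>E carrier R) \<times> carrier N) \<and>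
    (\<forall>x\<in>carrier M. \<forall>y\<in>carrier M.
       h (x \<oplus>\<^bsub>M\<^esub> y) = ((\<lambda>i\<in>{..<a}. fst (h x) i \<oplus>\<^bsub>R\<^esub> fst (h y) i), snd (h x) \<oplus>\<^bsub>N\<^esub> snd (h y))) \<and>
    (\<forall>r\<in>carrier R. \<forall>x\<in>carrier M.
       h (r \<odot>\<^bsub>M\<^esub> x) = ((\<lambda>i\<in>{..<a}. r \<otimes>\<^bsub>R\<^esub> fst (h x) i), r \<odot>\<^bsub>N\<^esub> snd (h x)))"

lemma split_map_bij: "split_map R M a N h \<Longrightarrow>
  bij_betw h (carrier M) (({..<a} \<rightarrow>\<^sub>E carrier R) \<times> carrier N)"
  by (simp add: split_map_def)

lemma split_map_add: "split_map R M a N h \<Longrightarrow> x \<in> carrier M \<Longrightarrow> y \<in> carrier M \<Longrightarrow>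
    h (x \<oplus>\<^bsub>M\<^esub> y) = ((\<lambda>i\<in>{..<a}. fst (h x) i \<oplus>\<^bsub>R\<^esub> fst (h y) i), snd (h x) \<oplus>\<^bsub>N\<^esub> snd (h y))"
  by (simp add: split_map_def)

lemma split_map_smult: "split_map R M a N h \<Longrightarrow> r \<in> carrier R \<Longrightarrow> x \<in> carrier M \<Longrightarrow>
    h (r \<odot>\<^bsub>M\<^esub> x) = ((\<lambda>i\<in>{..<a}. r \<otimes>\<^bsub>R\<^esub> fst (h x) i), r \<odot>\<^bsub>N\<^esub> snd (h x))"
  by (simp add: split_map_def)

lemma splits_free_iff: "splits_free R M a N \<longleftrightarrow> module R N \<and> (\<exists>h. split_map R M a N h)"
proof -
  have ad: "u \<oplus>\<^bsub>module_sum (free_module R a) N\<^esub> v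
      = ((\<lambda>i\<in>{..<a}. fst u i \<oplus>\<^bsub>R\<^esub> fst v i), snd u \<oplus>\<^bsub>N\<^esub> snd v)" for u v
    by (cases u; cases v) (simp add: module_sum_simps free_module_simps)
  have sm: "r \<odot>\<^bsub>module_sum (free_module R a) N\<^esub> u
      = ((\<lambda>i\<in>{..<a}. r \<otimes>\<^bsub>R\<^esub> fst u i), r \<odot>\<^bsub>N\<^esub> snd u)" for r u
    by (cases u) (simp add: module_sum_simps free_module_simps)
  show ?thesis
    unfolding splits_free_def module_isomorphic_def split_map_def ad sm
    by (simp add: module_sum_simps free_module_simps)
qed

lemma splits_freeI:
  assumes "module R N" "bij_betw h (carrier M) (({..<a} \<rightarrow>\<^sub>E carrier R) \<times> carrier N)"
    "\<And>x y. x \<in> carrier M \<Longrightarrow> y \<in> carrier M \<Longrightarrow>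
       h (x \<oplus>\<^bsub>M\<^esub> y) = ((\<lambda>i\<in>{..<a}. fst (h x) i \<oplus>\<^bsub>R\<^esub> fst (h y) i), snd (h x) \<oplus>\<^bsub>N\<^esub> snd (h y))"
    "\<And>r x. r \<in> carrier R \<Longrightarrow> x \<in> carrier M \<Longrightarrow>
       h (r \<odot>\<^bsub>M\<^esub> x) = ((\<lambda>i\<in>{..<a}. r \<otimes>\<^bsub>R\<^esub> fst (h x) i), r \<odot>\<^bsub>N\<^esub> snd (h x))"
  shows "splits_free R M a N"
  unfolding splits_free_iff split_map_def using assms by blast

lemma splits_free_0: "module R M \<Longrightarrow> splits_free R M 0 M"
  by (rule splits_freeI[where h = "\<lambda>x. (\<lambda>_. undefined, x)"])
    (auto simp: bij_betw_def inj_on_def restrict_def)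

lemma splits_free_add:
  fixes R :: "('a, 'r) ring_scheme"
  assumes "splits_free R M a N" "splits_free R N b N'"
  shows "splits_free R M (a + b) N'"
proof -
  obtain h where N: "module R N" and h: "split_map R M a N h"
    using assms(1) unfolding splits_free_iff by blast
  obtain g where N': "module R N'" and g: "split_map R N b N' g"
    using assms(2) unfolding splits_free_iff by blast
  note bh = split_map_bij[OF h] and ah = split_map_add[OF h] and sh = split_map_smult[OF h]
  note bg = split_map_bij[OF g] and ag = split_map_add[OF g] and sg = split_map_smult[OF g]
  define glue :: "(nat \<Rightarrow> 'a) \<Rightarrow> (nat \<Rightarrow> 'a) \<Rightarrow> nat \<Rightarrow> 'a"
    where "glue v w = (\<lambda>i\<in>{..<a + b}. if i < a then v i else w (i - a))" for v w
  define k where "k x = (glue (fst (h x)) (fst (g (snd (h x)))), snd (g (snd (h x))))" for x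
  have sh_c: "snd (h x) \<in> carrier N" if "x \<in> carrier M" for x
    using bij_betwE[OF bh] that by (metis mem_Times_iff)
  let ?F = "\<lambda>(v, n). (glue v (fst (g n)), snd (g n))"
  have "bij_betw ?F (({..<a} \<rightarrow>\<^sub>E carrier R) \<times> carrier N) (({..<a + b} \<rightarrow>\<^sub>E carrier R) \<times> carrier N')"
  proof (rule bij_betwI[where g = "\<lambda>(v, n). ((\<lambda>i\<in>{..<a}. v i), the_inv_into (carrier N) g
    ((\<lambda>i\<in>{..<b}. v (a + i)), n))"])
    have g_c: "fst (g n) \<in> {..<b} \<rightarrow>\<^sub>E carrier R" "snd (g n) \<in> carrier N'" if "n \<in> carrier N" for n
      using bij_betwE[OF bg] that by (metis mem_Times_iff)+
    show "?F \<in> ({..<a} \<rightarrow>\<^sub>E carrier R) \<times> carrier N \<rightarrow> ({..<a + b} \<rightarrow>\<^sub>E carrier R) \<times> carrier N'"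
    proof
      fix x assume "x \<in> ({..<a} \<rightarrow>\<^sub>E carrier R) \<times> carrier N"
      then obtain v n where x: "x = (v, n)" "v \<in> {..<a} \<rightarrow>\<^sub>E carrier R" "n \<in> carrier N" by blast
      have "glue v (fst (g n)) \<in> {..<a + b} \<rightarrow>\<^sub>E carrier R"
      proof (rule PiE_I)
        fix i assume i: "i \<in> {..<a + b}"
        show "glue v (fst (g n)) i \<in> carrier R"
        proof (cases "i < a")
          case True
          then show ?thesis using x(2) i by (auto simp: glue_def PiE_iff)
        next
          case False
          then have "i - a \<in> {..<b}" using i by auto
          then show ?thesis using g_c(1)[OF x(3)] i False by (auto simp: glue_def PiE_iff)
        qed
      qed (simp add: glue_def)
      then show "?F x \<in> ({..<a + b} \<rightarrow>\<^sub>E carrier R) \<times> carrier N'" using x g_c by simp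
    qed
    have vb: "(\<lambda>i\<in>{..<b}. v (a + i)) \<in> {..<b} \<rightarrow>\<^sub>E carrier R"
      "(\<lambda>i\<in>{..<a}. v i) \<in> {..<a} \<rightarrow>\<^sub>E carrier R"
      if "v \<in> {..<a + b} \<rightarrow>\<^sub>E carrier R" for v
      using that by (auto simp: PiE_iff)
    have gi: "the_inv_into (carrier N) g z \<in> carrier N" "g (the_inv_into (carrier N) g z) = z"
      if "z \<in> ({..<b} \<rightarrow>\<^sub>E carrier R) \<times> carrier N'" for z
      using that bg bij_betw_imp_surj_on[OF bg] the_inv_into_into[of g "carrier N" z "carrier N"]
        f_the_inv_into_f_bij_betw[OF bg, of z] bij_betw_imp_inj_on[OF bg] by auto
    show "(\<lambda>(v, n). ((\<lambda>i\<in>{..<a}. v i), the_inv_into (carrier N) g ((\<lambda>i\<in>{..<b}. v (a + i)), n)))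
      \<in> ({..<a + b} \<rightarrow>\<^sub>E carrier R) \<times> carrier N' \<rightarrow> ({..<a} \<rightarrow>\<^sub>E carrier R) \<times> carrier N"
      using vb gi(1) by auto
    show "(case ?F x of (v, n) \<Rightarrow> ((\<lambda>i\<in>{..<a}. v i), the_inv_into (carrier N) g ((\<lambda>i\<in>{..<b}. v (a
      + i)), n))) = x"
      if xin: "x \<in> ({..<a} \<rightarrow>\<^sub>E carrier R) \<times> carrier N" for x
    proof -
      obtain v n where x: "x = (v, n)" "v \<in> {..<a} \<rightarrow>\<^sub>E carrier R" "n \<in> carrier N" using xin by blast
      have 1: "(\<lambda>i\<in>{..<a}. glue v (fst (g n)) i) = v"
        using x(2) by (auto simp: glue_def fun_eq_iff restrict_def PiE_iff extensional_def)
      have 2: "(\<lambda>i\<in>{..<b}. glue v (fst (g n)) (a + i)) = fst (g n)"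
        using g_c(1)[OF x(3)] by (auto simp: glue_def fun_eq_iff restrict_def PiE_iff
          extensional_def)
      have "the_inv_into (carrier N) g (g n) = n"
        using bg x(3) by (simp add: the_inv_into_f_f bij_betw_imp_inj_on)
      then show ?thesis unfolding x prod.case 1 2 by simp
    qed
    show "?F (case y of (v, n) \<Rightarrow> ((\<lambda>i\<in>{..<a}. v i), the_inv_into (carrier N) g ((\<lambda>i\<in>{..<b}. v (a
      + i)), n))) = y"
      if yin: "y \<in> ({..<a + b} \<rightarrow>\<^sub>E carrier R) \<times> carrier N'" for y
    proof -
      obtain v n where y: "y = (v, n)" "v \<in> {..<a + b} \<rightarrow>\<^sub>E carrier R" "n \<in> carrier N'"
        using yin by blast
      have "g (the_inv_into (carrier N) g ((\<lambda>i\<in>{..<b}. v (a + i)), n))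
        = ((\<lambda>i\<in>{..<b}. v (a + i)), n)"
        using gi(2) vb(1)[OF y(2)] y(3) by simp
      moreover have "glue (\<lambda>i\<in>{..<a}. v i) (\<lambda>i\<in>{..<b}. v (a + i)) = v"
        using y(2) by (auto simp: glue_def fun_eq_iff restrict_def PiE_iff extensional_def)
      ultimately show ?thesis unfolding y prod.case by simp
    qed
  qed
  then have "bij_betw (?F \<circ> h) (carrier M) (({..<a + b} \<rightarrow>\<^sub>E carrier R) \<times> carrier N')"
    by (rule bij_betw_trans[OF bh])
  moreover have "?F \<circ> h = k" by (auto simp: k_def fun_eq_iff split: prod.split)
  ultimately have bk: "bij_betw k (carrier M) (({..<a + b} \<rightarrow>\<^sub>E carrier R) \<times> carrier N')" by simp
  show ?thesis
  proof (rule splits_freeI[OF N' bk])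
    fix x y assume xy: "x \<in> carrier M" "y \<in> carrier M"
    show "k (x \<oplus>\<^bsub>M\<^esub> y) = ((\<lambda>i\<in>{..<a + b}. fst (k x) i \<oplus>\<^bsub>R\<^esub> fst (k y) i), snd (k x) \<oplus>\<^bsub>N'\<^esub> snd (k y))"
      using sh_c[OF xy(1)] sh_c[OF xy(2)]
        by (auto simp: k_def ah[OF xy] ag glue_def fun_eq_iff restrict_def)
  next
    fix r x assume rx: "r \<in> carrier R" "x \<in> carrier M"
    show "k (r \<odot>\<^bsub>M\<^esub> x) = ((\<lambda>i\<in>{..<a + b}. r \<otimes>\<^bsub>R\<^esub> fst (k x) i), r \<odot>\<^bsub>N'\<^esub> snd (k x))"
      using sh_c[OF rx(2)] rx(1) by (auto simp: k_def sh[OF rx] sg glue_def fun_eq_iff restrict_def)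
  qed
qed

text \<open>Rescaling \<open>n0\<close> gives \<open>w\<close> with
  \<open>\<chi> w = \<one>\<close>, and each \<open>n\<close> is \<open>\<chi> n\<close> times
  \<open>w\<close> plus an element of the kernel of \<open>\<chi>\<close>. Functionals on a module
  without free summand thus take only nonunit values.\<close>

lemma has_free_summand_of_unit_functional:
  assumes N: "module R N"
    and \<chi>: "\<And>n. n \<in> carrier N \<Longrightarrow> \<chi> n \<in> carrier R"
      "\<And>n m. n \<in> carrier N \<Longrightarrow> m \<in> carrier N \<Longrightarrow> \<chi> (n \<oplus>\<^bsub>N\<^esub> m) = \<chi> n \<oplus>\<^bsub>R\<^esub> \<chi> m"
      "\<And>r n. r \<in> carrier R \<Longrightarrow> n \<in> carrier N \<Longrightarrow> \<chi> (r \<odot>\<^bsub>N\<^esub> n) = r \<otimes>\<^bsub>R\<^esub> \<chi> n"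
    and n0: "n0 \<in> carrier N" "\<chi> n0 \<in> Units R"
  shows "has_free_summand R N"
proof -
  interpret module R N by fact
  define w where "w = inv\<^bsub>R\<^esub> (\<chi> n0) \<odot>\<^bsub>N\<^esub> n0"
  have w: "w \<in> carrier N" "\<chi> w = \<one>\<^bsub>R\<^esub>" using n0 by (simp_all add: w_def \<chi>)
  define K where "K = {n \<in> carrier N. \<chi> n = \<zero>\<^bsub>R\<^esub>}"
  have chi0: "\<chi> \<zero>\<^bsub>N\<^esub> = \<zero>\<^bsub>R\<^esub>"
    using \<chi>(3)[of "\<zero>\<^bsub>R\<^esub>" n0] n0 \<chi>(1)[of n0] by simp
  have chim: "\<chi> (\<ominus>\<^bsub>N\<^esub> n) = \<ominus>\<^bsub>R\<^esub> \<chi> n" if "n \<in> carrier N" for n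
  proof -
    have "\<chi> (\<ominus>\<^bsub>N\<^esub> n) \<oplus>\<^bsub>R\<^esub> \<chi> n = \<zero>\<^bsub>R\<^esub>" using that chi0 by (simp add: M.l_neg flip: \<chi>(2))
    then show ?thesis using that \<chi>(1) by (metis R.minus_equality M.a_inv_closed)
  qed
  have "submodule K R N"
    by (rule submoduleI) (auto simp: K_def chi0 chim \<chi>)
  then have mK: "module R (N\<lparr>carrier := K\<rparr>)"
    using submodule.submodule_is_module N by blast
  define h where "h n = ((\<lambda>i\<in>{..<1::nat}. \<chi> n), n \<ominus>\<^bsub>N\<^esub> (\<chi> n \<odot>\<^bsub>N\<^esub> w))" for n
  have K1: "n \<ominus>\<^bsub>N\<^esub> (\<chi> n \<odot>\<^bsub>N\<^esub> w) \<in> K" if "n \<in> carrier N" for n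
    using that w \<chi>(1)[OF that] by (simp add: K_def M.minus_eq \<chi> chim R.r_neg)
  have "splits_free R N 1 (N\<lparr>carrier := K\<rparr>)"
  proof (rule splits_freeI[where h = h])
    show "module R (N\<lparr>carrier := K\<rparr>)" by fact
    show "bij_betw h (carrier N) (({..<1::nat} \<rightarrow>\<^sub>E carrier R) \<times> carrier (N\<lparr>carrier := K\<rparr>))"
    proof (rule bij_betwI[where g = "\<lambda>(v, n). n \<oplus>\<^bsub>N\<^esub> (v 0 \<odot>\<^bsub>N\<^esub> w)"])
      show "h \<in> carrier N \<rightarrow> ({..<1::nat} \<rightarrow>\<^sub>E carrier R) \<times> carrier (N\<lparr>carrier := K\<rparr>)"
        using \<chi>(1) K1 by (auto simp: h_def)
      show "(\<lambda>(v, n). n \<oplus>\<^bsub>N\<^esub> (v 0 \<odot>\<^bsub>N\<^esub> w)) \<in> ({..<1::nat} \<rightarrow>\<^sub>E carrier R) \<times> carrier (N\<lparr>carrier := K\<rparr>)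
        \<rightarrow> carrier N"
      proof
        fix y assume "y \<in> ({..<1::nat} \<rightarrow>\<^sub>E carrier R) \<times> carrier (N\<lparr>carrier := K\<rparr>)"
        then obtain v n where y: "y = (v, n)" "v \<in> {..<1::nat} \<rightarrow>\<^sub>E carrier R" "n \<in> carrier N"
          by (auto simp: K_def)
        then have "v 0 \<in> carrier R" by (auto simp: PiE_iff)
        then show "(\<lambda>(v, n). n \<oplus>\<^bsub>N\<^esub> (v 0 \<odot>\<^bsub>N\<^esub> w)) y \<in> carrier N" using y w by simp
      qed
      show "(case h x of (v, n) \<Rightarrow> n \<oplus>\<^bsub>N\<^esub> (v 0 \<odot>\<^bsub>N\<^esub> w)) = x" if "x \<in> carrier N" for x
        using that w \<chi>(1)[OF that] by (simp add: h_def M.minus_eq M.a_assoc M.l_neg)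
      show "h (case y of (v, n) \<Rightarrow> n \<oplus>\<^bsub>N\<^esub> (v 0 \<odot>\<^bsub>N\<^esub> w)) = y"
        if yin: "y \<in> ({..<1::nat} \<rightarrow>\<^sub>E carrier R) \<times> carrier (N\<lparr>carrier := K\<rparr>)" for y
      proof -
        obtain v n where y: "y = (v, n)" "v \<in> {..<1::nat} \<rightarrow>\<^sub>E carrier R" "n \<in> carrier N"
          "\<chi> n = \<zero>\<^bsub>R\<^esub>"
          using yin by (auto simp: K_def)
        have v0: "v 0 \<in> carrier R" using y(2) by (auto simp: PiE_iff)
        have c: "\<chi> (n \<oplus>\<^bsub>N\<^esub> (v 0 \<odot>\<^bsub>N\<^esub> w)) = v 0" using y v0 w by (simp add: \<chi>)
        have "(\<lambda>i\<in>{..<1::nat}. v 0) = v"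
          using y(2) by (auto simp: fun_eq_iff restrict_def PiE_iff extensional_def)
        moreover have "n \<oplus>\<^bsub>N\<^esub> (v 0 \<odot>\<^bsub>N\<^esub> w) \<ominus>\<^bsub>N\<^esub> (v 0 \<odot>\<^bsub>N\<^esub> w) = n"
          using y v0 w by (simp add: M.minus_eq M.a_assoc M.r_neg)
        ultimately show ?thesis unfolding y prod.case h_def c by simp
      qed
    qed
    show "h (x \<oplus>\<^bsub>N\<^esub> y) = ((\<lambda>i\<in>{..<1::nat}. fst (h x) i \<oplus>\<^bsub>R\<^esub> fst (h y) i), snd (h x) \<oplus>\<^bsub>N\<lparr>carrier :=
      K\<rparr>\<^esub> snd (h y))"
      if "x \<in> carrier N" "y \<in> carrier N" for x y
      using that w \<chi>(1)[OF that(1)] \<chi>(1)[OF that(2)]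
      by (simp add: h_def \<chi> M.minus_eq smult_l_distr M.minus_add M.a_ac restrict_def fun_eq_iff)
    show "h (r \<odot>\<^bsub>N\<^esub> x) = ((\<lambda>i\<in>{..<1::nat}. r \<otimes>\<^bsub>R\<^esub> fst (h x) i), r \<odot>\<^bsub>N\<lparr>carrier := K\<rparr>\<^esub> snd (h x))"
      if "r \<in> carrier R" "x \<in> carrier N" for r x
      using that w \<chi>(1)[OF that(2)]
      by (simp add: h_def \<chi> M.minus_eq smult_r_distr smult_assoc1 smult_r_minus restrict_def
        fun_eq_iff)
  qed
  then show ?thesis unfolding has_free_summand_def by (intro exI[of _ 1]) auto
qed

context local_hypersurface
begin

text \<open>A common denominator reduces this to the polynomial ring, which has characteristic
  \<open>p\<close>.\<close>

lemma frob_L: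
  assumes "a \<in> carrier L" "b \<in> carrier L"
  shows "(a \<oplus> b) [^] (CARD('p) ^ e) = a [^] (CARD('p) ^ e) \<oplus> b [^] (CARD('p) ^ e)"
proof -
  let ?q = "CARD('p) ^ e"
  obtain s t u where 1: "rep a s u" "rep b t u" by (rule ex_common_rep[OF assms])
  have r: "s \<in> polys V" "t \<in> polys V" "u \<in> units" "a \<otimes> \<phi> u = \<phi> s" "b \<otimes> \<phi> u = \<phi> t"
    using 1 by (auto simp: rep_def)
  have c: "\<phi> u \<in> carrier L" using r by simp
  have "(a \<oplus> b) [^] ?q \<otimes> \<phi> (u ^ ?q) = ((a \<oplus> b) \<otimes> \<phi> u) [^] ?q"
    using assms c r(3) by (simp add: nat_pow_distrib phi_power)
  also have "(a \<oplus> b) \<otimes> \<phi> u = \<phi> (s + t)" using assms c r by (simp add: l_distr phi_add)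
  also have "\<phi> (s + t) [^] ?q = \<phi> (s ^ ?q) \<oplus> \<phi> (t ^ ?q)"
  proof -
    have "\<phi> (s + t) [^] (CARD('p) ^ e) = \<phi> ((s + t) ^ (CARD('p) ^ e))"
      using r by (simp add: phi_power)
    also have "\<dots> = \<phi> (s ^ (CARD('p) ^ e)) \<oplus> \<phi> (t ^ (CARD('p) ^ e))"
      unfolding frob_add using r by (simp add: phi_add)
    finally show ?thesis .
  qed
  also have "\<dots> = (a \<otimes> \<phi> u) [^] ?q \<oplus> (b \<otimes> \<phi> u) [^] ?q" using r by (simp add: phi_power)
  also have "\<dots> = (a [^] ?q \<oplus> b [^] ?q) \<otimes> \<phi> (u ^ ?q)"
    using assms c r(3) by (simp add: nat_pow_distrib l_distr phi_power)
  finally show ?thesis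
    by (rule unit_cancel[rotated 3]) (use assms r(3) in simp_all)
qed

lemma module_push: "module L (frobenius_pushforward CARD('p) e L)"
proof (rule moduleI)
  show "cring L" by (rule is_cring)
  show "abelian_group (frobenius_pushforward CARD('p) e L)"
    by (rule abelian_groupI)
      (auto simp: frobenius_pushforward_simps a_ac intro: l_neg bexI[of _ "\<ominus> x" for x])
qed (auto simp: frobenius_pushforward_simps r_distr l_distr nat_pow_distrib m_assoc frob_L)

context
  fixes e a :: nat and N :: "('l, 'n) module" and h :: "'l \<Rightarrow> (nat \<Rightarrow> 'l) \<times> 'n"
  assumes N: "module L N" and h: "split_map L (frobenius_pushforward CARD('p) e L) a N h"
begin

lemma h_bij: "bij_betw h (carrier L) (({..<a} \<rightarrow>\<^sub>E carrier L) \<times> carrier N)"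
  using split_map_bij[OF h] by (simp add: frobenius_pushforward_simps)

lemma h_add: "x \<in> carrier L \<Longrightarrow> y \<in> carrier L \<Longrightarrow>
    h (x \<oplus> y) = ((\<lambda>i\<in>{..<a}. fst (h x) i \<oplus> fst (h y) i), snd (h x) \<oplus>\<^bsub>N\<^esub> snd (h y))"
  using split_map_add[OF h, of x y] by (simp add: frobenius_pushforward_simps)

lemma h_smult: "r \<in> carrier L \<Longrightarrow> x \<in> carrier L \<Longrightarrow>
    h (r [^] (CARD('p) ^ e) \<otimes> x) = ((\<lambda>i\<in>{..<a}. r \<otimes> fst (h x) i), r \<odot>\<^bsub>N\<^esub> snd (h x))"
  using split_map_smult[OF h, of r x] by (simp add: frobenius_pushforward_simps)

lemma h_closed: "x \<in> carrier L \<Longrightarrow> i < a \<Longrightarrow> fst (h x) i \<in> carrier L"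
  "x \<in> carrier L \<Longrightarrow> snd (h x) \<in> carrier N"
    "x \<in> carrier L \<Longrightarrow> fst (h x) \<in> {..<a} \<rightarrow>\<^sub>E carrier L"
  using bij_betwE[OF h_bij] by (auto simp: mem_Times_iff PiE_iff)

definition hinv :: "(nat \<Rightarrow> 'l) \<times> 'n \<Rightarrow> 'l" where "hinv = the_inv_into (carrier L) h"

lemma hinv_closed: "v \<in> {..<a} \<rightarrow>\<^sub>E carrier L \<Longrightarrow> n \<in> carrier N \<Longrightarrow> hinv (v, n) \<in> carrier L"
  unfolding hinv_def by (rule the_inv_into_into[of h "carrier L" _ "carrier L"])
    (use h_bij in \<open>auto simp: bij_betw_def\<close>)

lemma h_hinv: "v \<in> {..<a} \<rightarrow>\<^sub>E carrier L \<Longrightarrow> n \<in> carrier N \<Longrightarrow> h (hinv (v, n)) = (v, n)"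
  unfolding hinv_def by (rule f_the_inv_into_f_bij_betw[OF h_bij]) auto

lemma h_inj: "x \<in> carrier L \<Longrightarrow> y \<in> carrier L \<Longrightarrow> h x = h y \<Longrightarrow> x = y"
  using h_bij by (auto simp: bij_betw_def inj_on_def)

text \<open>On \<open>N\<close> the functional \<open>\<psi>\<close> has values of residue 0, since
  otherwise \<open>N\<close> would split off a free summand; on the free part it is linear in the
  coordinates, whose residues vanish by assumption.\<close>

lemma residue_functional:
  assumes nf: "\<not> has_free_summand L N"
    and \<psi>: "\<And>y. y \<in> carrier L \<Longrightarrow> \<psi> y \<in> carrier L"
      "\<And>y z. y \<in> carrier L \<Longrightarrow> z \<in> carrier L \<Longrightarrow> \<psi> (y \<oplus> z) = \<psi> y \<oplus> \<psi> z"
      "\<And>r y. r \<in> carrier L \<Longrightarrow> y \<in> carrier L \<Longrightarrow> \<psi> (r [^] (CARD('p) ^ e) \<otimes> y) = r \<otimes> \<psi> y"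
    and y: "y \<in> carrier L" "\<And>i. i < a \<Longrightarrow> residue (fst (h y) i) = 0"
  shows "residue (\<psi> y) = 0"
proof -
  interpret N: module L N by (rule N)
  let ?zv = "\<lambda>i\<in>{..<a}. \<zero>"
  have zv: "?zv \<in> {..<a} \<rightarrow>\<^sub>E carrier L" by simp
  note hz = hinv_closed[OF zv] h_hinv[OF zv]
  have N_part: "residue (\<psi> (hinv (?zv, n))) = 0" if n: "n \<in> carrier N" for n
  proof (rule ccontr)
    assume res: "residue (\<psi> (hinv (?zv, n))) \<noteq> 0"
    have "has_free_summand L N"
    proof (rule has_free_summand_of_unit_functional[OF N, where \<chi> = "\<lambda>n. \<psi> (hinv (?zv, n))"
      and ?n0.0 = n])
      show "\<psi> (hinv (?zv, m)) \<in> carrier L" if "m \<in> carrier N" for m using that hz \<psi>(1) by simp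
      show "\<psi> (hinv (?zv, m \<oplus>\<^bsub>N\<^esub> m')) = \<psi> (hinv (?zv, m)) \<oplus> \<psi> (hinv (?zv, m'))"
        if m: "m \<in> carrier N" "m' \<in> carrier N" for m m'
      proof -
        have "hinv (?zv, m \<oplus>\<^bsub>N\<^esub> m') = hinv (?zv, m) \<oplus> hinv (?zv, m')"
        proof (rule h_inj)
          have "(\<lambda>i\<in>{..<a}. ?zv i \<oplus> ?zv i) = ?zv" by (auto simp: restrict_def)
          then show "h (hinv (?zv, m \<oplus>\<^bsub>N\<^esub> m')) = h (hinv (?zv, m) \<oplus> hinv (?zv, m'))"
            using m by (simp only: hz h_add N.M.a_closed fst_conv snd_conv)
        qed (use m hz in simp_all)
        then show ?thesis using m hz \<psi>(2) by simp
      qed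
      show "\<psi> (hinv (?zv, r \<odot>\<^bsub>N\<^esub> m)) = r \<otimes> \<psi> (hinv (?zv, m))"
        if m: "r \<in> carrier L" "m \<in> carrier N" for r m
      proof -
        have "hinv (?zv, r \<odot>\<^bsub>N\<^esub> m) = r [^] (CARD('p) ^ e) \<otimes> hinv (?zv, m)"
        proof (rule h_inj)
          have "(\<lambda>i\<in>{..<a}. r \<otimes> ?zv i) = ?zv" using m by (auto simp: restrict_def)
          then show "h (hinv (?zv, r \<odot>\<^bsub>N\<^esub> m)) = h (r [^] (CARD('p) ^ e) \<otimes> hinv (?zv, m))"
            using m by (simp only: hz h_smult N.smult_closed fst_conv snd_conv)
        qed (use m hz in simp_all)
        then show ?thesis using m hz \<psi>(3) by simp
      qed
      show "n \<in> carrier N" by (rule n)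
      show "\<psi> (hinv (?zv, n)) \<in> Units L" using res n hz \<psi>(1) by (intro residue_unit) simp_all
    qed
    then show False using nf by simp
  qed
  define v where "v = fst (h y)"
  have v: "v i \<in> carrier L" "residue (v i) = 0" if "i < a" for i
    using that y h_closed(1) by (simp_all add: v_def)
  \<comment> \<open>The coordinates are switched on one at a time, so additivity of
    \<open>\<psi>\<close> is applied to two summands only.\<close>
  define w where "w j = (\<lambda>i\<in>{..<a}. if i < j then v i else \<zero>)" for j
  have w: "w j \<in> {..<a} \<rightarrow>\<^sub>E carrier L" for j using v by (auto simp: w_def)
  have "residue (\<psi> (hinv (w j, \<zero>\<^bsub>N\<^esub>))) = 0" if "j \<le> a" for j
    using that
  proof (induction j)
    case 0
    have "w 0 = ?zv" by (simp add: w_def)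
    then show ?case using N_part[OF N.M.zero_closed] by (simp only:)
  next
    case (Suc j)
    let ?e = "\<lambda>i\<in>{..<a}. if i = j then \<one> else \<zero>"
    have e: "?e \<in> {..<a} \<rightarrow>\<^sub>E carrier L" by auto
    have cl: "hinv (w j, \<zero>\<^bsub>N\<^esub>) \<in> carrier L" "hinv (?e, \<zero>\<^bsub>N\<^esub>) \<in> carrier L" "v j \<in> carrier L"
      using hinv_closed[OF w] hinv_closed[OF e] v Suc by simp_all
    have "hinv (w (Suc j), \<zero>\<^bsub>N\<^esub>) = hinv (w j, \<zero>\<^bsub>N\<^esub>) \<oplus> v j [^] (CARD('p) ^ e) \<otimes> hinv (?e, \<zero>\<^bsub>N\<^esub>)"
    proof (rule h_inj)
      show "hinv (w (Suc j), \<zero>\<^bsub>N\<^esub>) \<in> carrier L" by (simp add: hinv_closed[OF w])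
      show "hinv (w j, \<zero>\<^bsub>N\<^esub>) \<oplus> v j [^] (CARD('p) ^ e) \<otimes> hinv (?e, \<zero>\<^bsub>N\<^esub>) \<in> carrier L"
        using cl by simp
      have "(\<lambda>i\<in>{..<a}. w j i \<oplus> (\<lambda>i\<in>{..<a}. v j \<otimes> ?e i) i) = w (Suc j)"
        using Suc.prems v by (auto simp: w_def fun_eq_iff restrict_def less_Suc_eq)
      then show "h (hinv (w (Suc j), \<zero>\<^bsub>N\<^esub>))
        = h (hinv (w j, \<zero>\<^bsub>N\<^esub>) \<oplus> v j [^] (CARD('p) ^ e) \<otimes> hinv (?e, \<zero>\<^bsub>N\<^esub>))"
        using cl by (simp only: h_add h_smult h_hinv[OF w] h_hinv[OF e] N.M.zero_closed m_closed
          nat_pow_closed fst_conv snd_conv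
          N.smult_r_null N.M.l_zero)
    qed
    then have "residue (\<psi> (hinv (w (Suc j), \<zero>\<^bsub>N\<^esub>)))
        = residue (\<psi> (hinv (w j, \<zero>\<^bsub>N\<^esub>))) + residue (v j) * residue (\<psi> (hinv (?e, \<zero>\<^bsub>N\<^esub>)))"
      using cl by (simp add: \<psi> residue_add residue_mult)
    then show ?case using Suc v by simp
  qed
  from this[of a] have 1: "residue (\<psi> (hinv (w a, \<zero>\<^bsub>N\<^esub>))) = 0" by simp
  have "w a = v" using h_closed(3)[OF y(1)]
    by (auto simp: w_def v_def fun_eq_iff restrict_def PiE_iff extensional_def)
  have "y = hinv (v, \<zero>\<^bsub>N\<^esub>) \<oplus> hinv (?zv, snd (h y))"
  proof (rule h_inj)
    have hv: "h (hinv (v, \<zero>\<^bsub>N\<^esub>)) = (v, \<zero>\<^bsub>N\<^esub>)" "hinv (v, \<zero>\<^bsub>N\<^esub>) \<in> carrier L"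
      using h_closed(3)[OF y(1)] by (auto simp: v_def intro: h_hinv hinv_closed)
    have hs: "h (hinv (?zv, snd (h y))) = (?zv, snd (h y))" "hinv (?zv, snd (h y)) \<in> carrier L"
      using hz h_closed(2)[OF y(1)] by auto
    show "hinv (v, \<zero>\<^bsub>N\<^esub>) \<oplus> hinv (?zv, snd (h y)) \<in> carrier L" using hv hs by simp
    have "(\<lambda>i\<in>{..<a}. v i \<oplus> ?zv i) = v"
      using h_closed(3)[OF y(1)] by (auto simp: v_def fun_eq_iff restrict_def PiE_iff
        extensional_def)
    then have "h (hinv (v, \<zero>\<^bsub>N\<^esub>) \<oplus> hinv (?zv, snd (h y))) = (v, snd (h y))"
      using hv hs h_closed(2)[OF y(1)] by (simp add: h_add)
    then show "h y = h (hinv (v, \<zero>\<^bsub>N\<^esub>) \<oplus> hinv (?zv, snd (h y)))" by (simp add: v_def)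
  qed (rule y)
  moreover have "hinv (v, \<zero>\<^bsub>N\<^esub>) \<in> carrier L" "hinv (?zv, snd (h y)) \<in> carrier L"
    using h_closed(2,3)[OF y(1)] hz by (auto simp: v_def intro: hinv_closed)
  ultimately have "residue (\<psi> y) = residue (\<psi> (hinv (v, \<zero>\<^bsub>N\<^esub>)))
    + residue (\<psi> (hinv (?zv, snd (h y))))"
    using residue_add \<psi> by metis
  then show ?thesis using 1 \<open>w a = v\<close> N_part h_closed(2)[OF y(1)] by simp
qed

text \<open>The free part modulo the maximal ideal. It has \<open>p ^ a\<close> elements and is to
  be matched with the image of multiplication by \<open>f ^ (q - 1)\<close>.\<close>

definition res_coords :: "('v, 'p mod_ring) mpoly \<Rightarrow> nat \<Rightarrow> 'p mod_ring" where
  "res_coords s = (\<lambda>i\<in>{..<a}. residue (fst (h (\<phi> s)) i))"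

lemma res_coords_image: "res_coords ` polys V = ({..<a} \<rightarrow>\<^sub>E UNIV)"
proof
  show "res_coords ` polys V \<subseteq> {..<a} \<rightarrow>\<^sub>E UNIV"
    unfolding res_coords_def by (intro image_subsetI restrict_PiE_iff[THEN iffD2]) simp
  show "{..<a} \<rightarrow>\<^sub>E UNIV \<subseteq> res_coords ` polys V"
  proof
    fix g :: "nat \<Rightarrow> 'p mod_ring" assume g: "g \<in> {..<a} \<rightarrow>\<^sub>E UNIV"
    interpret N: module L N by (rule N)
    define v where "v = (\<lambda>i\<in>{..<a}. \<phi> (mterm 0 (g i)))"
    have v: "v \<in> {..<a} \<rightarrow>\<^sub>E carrier L" by (simp add: v_def)
    define y where "y = hinv (v, \<zero>\<^bsub>N\<^esub>)"
    have y: "y \<in> carrier L" "h y = (v, \<zero>\<^bsub>N\<^esub>)" using v by (simp_all add: y_def hinv_closed h_hinv)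
    obtain s u where r: "rep y s u" using ex_rep y by blast
    have su: "s \<in> polys V" "u \<in> units" "y \<otimes> \<phi> u = \<phi> s" using r by (auto simp: rep_def)
    \<comment> \<open>The preimage \<open>y\<close> is only a fraction. Its product with the
      \<open>q\<close>-th power of \<open>?w\<close>, which has constant term 1, is the class of a
      polynomial, and the coordinates merely get multiplied by an element of residue 1.\<close>
    let ?k = "mterm 0 (inverse (coef u 0)) :: ('v, 'p mod_ring) mpoly"
    let ?w = "?k * u"
    let ?s = "?k ^ (CARD('p) ^ e) * (s * u ^ ((CARD('p) ^ e) - 1))"
    have kw: "?w \<in> polys V" "coef ?w 0 = 1"
      using su(2) by (simp_all add: coef_0_mult)
    have "\<phi> ?s = \<phi> ?w [^] (CARD('p) ^ e) \<otimes> y"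
    proof -
      have "?w ^ (CARD('p) ^ e) = ?k ^ (CARD('p) ^ e) * u ^ ((CARD('p) ^ e) - 1) * u"
        using power_pred[of "CARD('p) ^ e" u] by (simp add: power_mult_distrib mult_ac)
      then have "\<phi> ?w [^] (CARD('p) ^ e) \<otimes> y
        = \<phi> (?k ^ (CARD('p) ^ e) * u ^ ((CARD('p) ^ e) - 1)) \<otimes> (y \<otimes> \<phi> u)"
      proof -
        have "\<phi> ?w [^] (CARD('p) ^ e) = \<phi> (?k ^ (CARD('p) ^ e) * u ^ ((CARD('p) ^ e) - 1)) \<otimes> \<phi> u"
          unfolding phi_power[OF kw(1), symmetric] \<open>?w ^ (CARD('p) ^ e) = _\<close>
          using su(2) by (intro phi_mult) auto
        moreover have "\<phi> (?k ^ (CARD('p) ^ e) * u ^ ((CARD('p) ^ e) - 1)) \<in> carrier L"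
          "\<phi> u \<in> carrier L"
          using su(2) by simp_all
        ultimately show ?thesis using y(1) by (simp only: m_ac)
      qed
      also have "\<dots> = \<phi> ?s" unfolding su(3) using su(1,2) by (simp add: mult_ac flip: phi_mult)
      finally show ?thesis by simp
    qed
    then have "h (\<phi> ?s) = ((\<lambda>i\<in>{..<a}. \<phi> ?w \<otimes> v i), \<phi> ?w \<odot>\<^bsub>N\<^esub> \<zero>\<^bsub>N\<^esub>)"
      using h_smult[of "\<phi> ?w" y] kw y by simp
    then have "res_coords ?s = g"
      using g kw by (auto simp: res_coords_def v_def residue_mult fun_eq_iff PiE_iff extensional_def
        restrict_def)
    then show "g \<in> res_coords ` polys V" using su(1,2) by (intro image_eqI[of _ _ ?s]) auto
  qed
qed

lemma res_coords_diff:
  assumes "s \<in> polys V" "t \<in> polys V"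
  shows "res_coords s = res_coords t \<longleftrightarrow> (\<forall>i<a. residue (fst (h (\<phi> (s - t))) i) = 0)"
proof -
  have "h (\<phi> s) = h (\<phi> (s - t) \<oplus> \<phi> t)" using phi_add[of "s - t" t] assms by simp
  then have "residue (fst (h (\<phi> s)) i) = residue (fst (h (\<phi> (s - t))) i)
    + residue (fst (h (\<phi> t)) i)"
    if "i < a" for i
    using that assms by (simp add: h_add residue_add h_closed)
  then show ?thesis by (auto simp: res_coords_def fun_eq_iff restrict_def)
qed

lemma card_res_coords: "card (res_coords ` polys V) = CARD('p) ^ a"
  by (simp add: res_coords_image card_funcsetE card_mod_ring)

lemma coords_semilinear:
  assumes "i < a" shows "semilinear (CARD('p) ^ e) (\<lambda>s. fst (h (\<phi> s)) i)"
proof -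
  interpret N: module L N by (rule N)
  have h0: "fst (h \<zero>) i = \<zero>"
  proof -
    have "h (\<zero> [^] (CARD('p) ^ e) \<otimes> \<zero>) = ((\<lambda>i\<in>{..<a}. \<zero> \<otimes> fst (h \<zero>) i), \<zero> \<odot>\<^bsub>N\<^esub> snd (h \<zero>))"
      by (rule h_smult) auto
    then have "fst (h (\<zero> [^] (CARD('p) ^ e) \<otimes> \<zero>)) i = \<zero> \<otimes> fst (h \<zero>) i"
      using assms by (simp only: fst_conv restrict_apply) simp
    then show ?thesis using h_closed(1)[of \<zero> i] assms by simp
  qed
  show ?thesis
    unfolding semilinear_def using assms
    by (auto simp: h_closed phi_add phi_mult phi_power h_add h_smult h0)
qed

text \<open>Each coordinate of the free part is a semilinear map, so by
  \<open>fedder_vanishing\<close> the reduced product \<open>f ^ (q - 1) * s\<close> determines the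
  residue coordinates of \<open>s\<close>.\<close>

lemma pow_rank_le: "CARD('p) ^ a \<le> card (mult_image (CARD('p) ^ e) V (f ^ ((CARD('p) ^ e) - 1)))"
  unfolding card_res_coords[symmetric] mult_image_def
proof (rule card_image_le_if_factor)
  show "finite ((\<lambda>s. red (CARD('p) ^ e) (f ^ ((CARD('p) ^ e) - 1) * s)) ` polys V)"
    using finite_mult_image[OF finV, of "CARD('p) ^ e" "f ^ (CARD('p) ^ e - 1)"] fV
      by (simp add: mult_image_def)
  fix s t assume st: "s \<in> polys V" "t \<in> polys V"
    "red (CARD('p) ^ e) (f ^ ((CARD('p) ^ e) - 1) * s)
    = red (CARD('p) ^ e) (f ^ ((CARD('p) ^ e) - 1) * t)"
  then have "f ^ ((CARD('p) ^ e) - 1) * (s - t) \<in> frob_ideal (CARD('p) ^ e)"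
    by (simp add: red_eq_iff right_diff_distrib)
  then have "\<forall>i<a. residue (fst (h (\<phi> (s - t))) i) = 0"
    using fedder_vanishing[OF coords_semilinear refl, of _ "s - t"] st by simp
  then show "res_coords s = res_coords t" using res_coords_diff st by simp
qed

text \<open>If two polynomials had equal residue coordinates but different products,
  \<open>fedder_nonvanishing\<close> would give a functional whose value on their difference has
  nonzero residue, against \<open>residue_functional\<close>.\<close>

lemma pow_rank_eq:
  assumes nf: "\<not> has_free_summand L N"
  shows "CARD('p) ^ a = card (mult_image (CARD('p) ^ e) V (f ^ ((CARD('p) ^ e) - 1)))"
proof (rule antisym[OF pow_rank_le])
  show "card (mult_image (CARD('p) ^ e) V (f ^ ((CARD('p) ^ e) - 1))) \<le> CARD('p) ^ a"
    unfolding card_res_coords[symmetric] mult_image_def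
  proof (rule card_image_le_if_factor)
    show "finite (res_coords ` polys V)" by (simp add: res_coords_image finite_PiE)
    fix s t assume st: "s \<in> polys V" "t \<in> polys V" "res_coords s = res_coords t"
    then have 0: "\<forall>i<a. residue (fst (h (\<phi> (s - t))) i) = 0" using res_coords_diff by simp
    have "f ^ ((CARD('p) ^ e) - 1) * (s - t) \<in> frob_ideal (CARD('p) ^ e)"
    proof (rule ccontr)
      assume "f ^ ((CARD('p) ^ e) - 1) * (s - t) \<notin> frob_ideal (CARD('p) ^ e)"
      from fedder_nonvanishing[OF refl _ this] st
      obtain \<psi> where \<psi>: "\<And>y. y \<in> carrier L \<Longrightarrow> \<psi> y \<in> carrier L"
        "\<And>y z. y \<in> carrier L \<Longrightarrow> z \<in> carrier L \<Longrightarrow> \<psi> (y \<oplus> z) = \<psi> y \<oplus> \<psi> z"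
        "\<And>r y. r \<in> carrier L \<Longrightarrow> y \<in> carrier L \<Longrightarrow> \<psi> (r [^] (CARD('p) ^ e) \<otimes> y) = r \<otimes> \<psi> y"
        "residue (\<psi> (\<phi> (s - t))) \<noteq> 0" by auto
      have "residue (\<psi> (\<phi> (s - t))) = 0"
        by (rule residue_functional[OF nf \<psi>(1,2,3)]) (use st 0 in auto)
      then show False using \<psi>(4) by simp
    qed
    then show "red (CARD('p) ^ e) (f ^ ((CARD('p) ^ e) - 1) * s)
      = red (CARD('p) ^ e) (f ^ ((CARD('p) ^ e) - 1) * t)"
      by (simp add: red_eq_iff right_diff_distrib)
  qed
qed

end

theorem pow_frobenius_free_rank:
  "CARD('p) ^ frobenius_free_rank CARD('p) L e
     = card (mult_image (CARD('p) ^ e) V (f ^ (CARD('p) ^ e - 1)))"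
proof -
  let ?c = "card (mult_image (CARD('p) ^ e) V (f ^ (CARD('p) ^ e - 1)))"
  \<comment> \<open>The ranks of free summands are bounded by \<open>pow_rank_le\<close>; the
    complement of a largest one has no free summand. All ranks with such a complement give the same
    power of \<open>p\<close>, which is the uniqueness behind the definite description.\<close>
  let ?S = "{a. \<exists>N :: ('l, 'l) module. splits_free L (frobenius_pushforward CARD('p) e L) a N}"
  have p1: "CARD('p) > 1" using prime_card[where 'a = 'p] prime_gt_1_nat by blast
  have le: "CARD('p) ^ a \<le> ?c" if "a \<in> ?S" for a
    using that pow_rank_le unfolding splits_free_iff by blast
  have "a \<le> ?c" if "a \<in> ?S" for a
    using le[OF that] power_gt_expt[of "CARD('p)" a] p1 by simp
  then have fin: "finite ?S" by (meson finite_nat_set_iff_bounded_le)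
  have "0 \<in> ?S" using splits_free_0[OF module_push] by blast
  then have "Max ?S \<in> ?S" using fin Max_in by blast
  then obtain N :: "('l, 'l) module" where N:
    "splits_free L (frobenius_pushforward CARD('p) e L) (Max ?S) N" by blast
  have nf: "\<not> has_free_summand L N"
  proof
    assume "has_free_summand L N"
    then obtain b N' where b: "b > 0" and s: "splits_free L N b (N' :: ('l, 'l) module)"
      unfolding has_free_summand_def by blast
    have "Max ?S + b \<in> ?S" using splits_free_add[OF N s] by blast
    then show False using fin b Max_ge[of ?S "Max ?S + b"] by simp
  qed
  have eq: "CARD('p) ^ a = ?c" if "splits_free L (frobenius_pushforward CARD('p) e L) a N"
    "\<not> has_free_summand L N"
    for a and N :: "('l, 'l) module"
    using that pow_rank_eq unfolding splits_free_iff by blast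
  have "frobenius_free_rank CARD('p) L e = Max ?S"
    unfolding frobenius_free_rank_def
  proof (rule the_equality)
    show "\<exists>M. splits_free L (frobenius_pushforward CARD('p) e L) (Max ?S) M \<and>
      \<not> has_free_summand L M" using N nf by blast
    fix a assume "\<exists>M. splits_free L (frobenius_pushforward CARD('p) e L) a M \<and>
      \<not> has_free_summand L M"
    then have "CARD('p) ^ a = CARD('p) ^ Max ?S" using eq N nf by metis
    then show "a = Max ?S" using p1 by simp
  qed
  then show ?thesis using eq[OF N nf] by simp
qed

end

subsection \<open>Localization\<close>

locale fractions = cring R for R :: "('a, 'b) ring_scheme" (structure) +
  fixes S :: "'a set"
  assumes S_sub: "S \<subseteq> carrier R" and S_one: "\<one> \<in> S"
    and S_mult: "s \<in> S \<Longrightarrow> t \<in> S \<Longrightarrow> s \<otimes> t \<in> S"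
begin

abbreviation "fr \<equiv> ring_fraction R S"

lemma S_carrier [simp]: "s \<in> S \<Longrightarrow> s \<in> carrier R" using S_sub by blast

definition eqv :: "'a \<Rightarrow> 'a \<Rightarrow> 'a \<Rightarrow> 'a \<Rightarrow> bool" where
  "eqv r s r' s' \<longleftrightarrow> (\<exists>u\<in>S. u \<otimes> (r \<otimes> s') = u \<otimes> (r' \<otimes> s))"

lemma eqv_refl: "eqv r s r s" using S_one by (auto simp: eqv_def)

lemma eqv_sym: "eqv r s r' s' \<Longrightarrow> eqv r' s' r s" unfolding eqv_def by metis

lemma eqv_trans:
  assumes c: "r \<in> carrier R" "r' \<in> carrier R" "r'' \<in> carrier R" "s \<in> S" "s' \<in> S" "s'' \<in> S"
    and 1: "eqv r s r' s'" and 2: "eqv r' s' r'' s''"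
  shows "eqv r s r'' s''"
proof -
  obtain u v where u: "u \<in> S" "u \<otimes> (r \<otimes> s') = u \<otimes> (r' \<otimes> s)"
    and v: "v \<in> S" "v \<otimes> (r' \<otimes> s'') = v \<otimes> (r'' \<otimes> s')"
    using 1 2 by (auto simp: eqv_def)
  \<comment> \<open>The middle denominator \<open>s'\<close> has to enter the multiplier: it links
    the two given equations.\<close>
  have "u \<otimes> v \<otimes> s' \<otimes> (r \<otimes> s'') = v \<otimes> s'' \<otimes> (u \<otimes> (r \<otimes> s'))" using c u(1) v(1) by (simp add: m_ac)
  also have "\<dots> = u \<otimes> s \<otimes> (v \<otimes> (r' \<otimes> s''))" unfolding u(2) using c u(1) v(1) by (simp add: m_ac)
  also have "\<dots> = u \<otimes> v \<otimes> s' \<otimes> (r'' \<otimes> s)" unfolding v(2) using c u(1) v(1) by (simp add: m_ac)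
  finally show ?thesis using c u(1) v(1)
    by (auto simp: eqv_def intro!: bexI[of _ "u \<otimes> v \<otimes> s'"] S_mult)
qed

lemma mem_frac: "(r', s') \<in> fr r s \<longleftrightarrow> r' \<in> carrier R \<and> s' \<in> S \<and> eqv r s r' s'"
  by (simp add: ring_fraction_def eqv_def)

lemma frac_eq_iff:
  assumes "r \<in> carrier R" "r' \<in> carrier R" "s \<in> S" "s' \<in> S"
  shows "fr r s = fr r' s' \<longleftrightarrow> eqv r s r' s'"
proof
  assume "fr r s = fr r' s'"
  then have "(r', s') \<in> fr r s" using assms eqv_refl by (simp add: mem_frac)
  then show "eqv r s r' s'" by (simp add: mem_frac)
next
  assume e: "eqv r s r' s'"
  show "fr r s = fr r' s'"
  proof (rule Set.set_eqI)
    fix z show "z \<in> fr r s \<longleftrightarrow> z \<in> fr r' s'"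
    proof (cases z)
      case (Pair a b)
      show ?thesis unfolding Pair mem_frac
        using eqv_trans[of r r' a s s' b] eqv_trans[of r' r a s' s b]
        assms e eqv_sym[OF e] by blast
    qed
  qed
qed

text \<open>Products of equivalent fractions are equivalent, so the union in the definition runs
  over equal sets; it is nonempty and collapses to one class.\<close>

lemma loc_mult:
  assumes "r \<in> carrier R" "r' \<in> carrier R" "s \<in> S" "s' \<in> S"
  shows "fr r s \<otimes>\<^bsub>localization R S\<^esub> fr r' s' = fr (r \<otimes> r') (s \<otimes> s')"
proof -
  have eq: "fr (a \<otimes> a') (b \<otimes> b') = fr (r \<otimes> r') (s \<otimes> s')"
    if h: "(a, b) \<in> fr r s" "(a', b') \<in> fr r' s'" for a b a' b'
  proof -
    have c: "a \<in> carrier R" "a' \<in> carrier R" "b \<in> S" "b' \<in> S" "eqv r s a b" "eqv r' s' a' b'"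
      using h by (auto simp: mem_frac)
    obtain u v where u: "u \<in> S" "u \<otimes> (r \<otimes> b) = u \<otimes> (a \<otimes> s)"
      and v: "v \<in> S" "v \<otimes> (r' \<otimes> b') = v \<otimes> (a' \<otimes> s')"
      using c by (auto simp: eqv_def)
    have "u \<otimes> v \<otimes> ((r \<otimes> r') \<otimes> (b \<otimes> b')) = (u \<otimes> (r \<otimes> b)) \<otimes> (v \<otimes> (r' \<otimes> b'))"
      using c assms u(1) v(1) by (simp add: m_ac)
    also have "\<dots> = u \<otimes> v \<otimes> ((a \<otimes> a') \<otimes> (s \<otimes> s'))"
      unfolding u(2) v(2) using c assms u(1) v(1) by (simp add: m_ac)
    finally have "eqv (r \<otimes> r') (s \<otimes> s') (a \<otimes> a') (b \<otimes> b')"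
      using u v by (auto simp: eqv_def intro!: bexI[of _ "u \<otimes> v"] S_mult)
    then show ?thesis using c assms by (subst frac_eq_iff) (auto intro: S_mult eqv_sym)
  qed
  have ne: "(r, s) \<in> fr r s" "(r', s') \<in> fr r' s'" using assms eqv_refl by (auto simp: mem_frac)
  have "fr r s \<otimes>\<^bsub>localization R S\<^esub> fr r' s'
      = (\<Union>(a, b)\<in>fr r s. \<Union>(a', b')\<in>fr r' s'. fr (a \<otimes> a') (b \<otimes> b'))"
    by (simp add: localization_def)
  also have "\<dots> = (\<Union>(a, b)\<in>fr r s. \<Union>(a', b')\<in>fr r' s'. fr (r \<otimes> r') (s \<otimes> s'))"
    using eq by (intro SUP_cong refl) (auto intro!: SUP_cong)
  also have "\<dots> = fr (r \<otimes> r') (s \<otimes> s')" using ne by auto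
  finally show ?thesis .
qed

lemma loc_add:
  assumes "r \<in> carrier R" "r' \<in> carrier R" "s \<in> S" "s' \<in> S"
  shows "fr r s \<oplus>\<^bsub>localization R S\<^esub> fr r' s' = fr ((r \<otimes> s') \<oplus> (r' \<otimes> s)) (s \<otimes> s')"
proof -
  have eq: "fr ((a \<otimes> b') \<oplus> (a' \<otimes> b)) (b \<otimes> b') = fr ((r \<otimes> s') \<oplus> (r' \<otimes> s)) (s \<otimes> s')"
    if h: "(a, b) \<in> fr r s" "(a', b') \<in> fr r' s'" for a b a' b'
  proof -
    have c: "a \<in> carrier R" "a' \<in> carrier R" "b \<in> S" "b' \<in> S" "eqv r s a b" "eqv r' s' a' b'"
      using h by (auto simp: mem_frac)
    obtain u v where u: "u \<in> S" "u \<otimes> (r \<otimes> b) = u \<otimes> (a \<otimes> s)"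
      and v: "v \<in> S" "v \<otimes> (r' \<otimes> b') = v \<otimes> (a' \<otimes> s')"
      using c by (auto simp: eqv_def)
    have "u \<otimes> v \<otimes> (((r \<otimes> s') \<oplus> (r' \<otimes> s)) \<otimes> (b \<otimes> b'))
        = (u \<otimes> (r \<otimes> b)) \<otimes> (v \<otimes> s' \<otimes> b') \<oplus> (v \<otimes> (r' \<otimes> b')) \<otimes> (u \<otimes> s \<otimes> b)"
      using c assms u(1) v(1) by (simp add: m_ac r_distr l_distr)
    also have "\<dots> = u \<otimes> v \<otimes> (((a \<otimes> b') \<oplus> (a' \<otimes> b)) \<otimes> (s \<otimes> s'))"
      unfolding u(2) v(2) using c assms u(1) v(1) by (simp add: m_ac r_distr l_distr)
    finally have "eqv ((r \<otimes> s') \<oplus> (r' \<otimes> s)) (s \<otimes> s') ((a \<otimes> b') \<oplus> (a' \<otimes> b)) (b \<otimes> b')"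
      using u v by (auto simp: eqv_def intro!: bexI[of _ "u \<otimes> v"] S_mult)
    then show ?thesis using c assms by (subst frac_eq_iff) (auto intro: S_mult eqv_sym)
  qed
  have ne: "(r, s) \<in> fr r s" "(r', s') \<in> fr r' s'" using assms eqv_refl by (auto simp: mem_frac)
  have "fr r s \<oplus>\<^bsub>localization R S\<^esub> fr r' s'
      = (\<Union>(a, b)\<in>fr r s. \<Union>(a', b')\<in>fr r' s'. fr ((a \<otimes> b') \<oplus> (a' \<otimes> b)) (b \<otimes> b'))"
    by (simp add: localization_def)
  also have "\<dots> = (\<Union>(a, b)\<in>fr r s. \<Union>(a', b')\<in>fr r' s'. fr ((r \<otimes> s') \<oplus> (r' \<otimes> s)) (s \<otimes> s'))"
    using eq by (intro SUP_cong refl) (auto intro!: SUP_cong)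
  also have "\<dots> = fr ((r \<otimes> s') \<oplus> (r' \<otimes> s)) (s \<otimes> s')" using ne by auto
  finally show ?thesis .
qed

lemma frac_eqI: "r \<in> carrier R \<Longrightarrow> r' \<in> carrier R \<Longrightarrow> s \<in> S \<Longrightarrow> s' \<in> S \<Longrightarrow> r \<otimes> s' = r' \<otimes> s \<Longrightarrow>
  fr r s = fr r' s'"
  using S_one by (subst frac_eq_iff) (auto simp: eqv_def)

lemma loc_carrier: "carrier (localization R S) = {fr r s | r s. r \<in> carrier R \<and> s \<in> S}"
  "\<one>\<^bsub>localization R S\<^esub> = fr \<one> \<one>" "\<zero>\<^bsub>localization R S\<^esub> = fr \<zero> \<one>"
  by (simp_all add: localization_def)

lemma frac_closed: "r \<in> carrier R \<Longrightarrow> s \<in> S \<Longrightarrow> fr r s \<in> carrier (localization R S)"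
  by (auto simp: loc_carrier)

lemma loc_cring: "cring (localization R S)"
proof (rule cringI)
  note [simp] = loc_mult loc_add S_mult S_one loc_carrier(2,3)
  have E: "\<exists>r s. x = fr r s \<and> r \<in> carrier R \<and> s \<in> S" if "x \<in> carrier (localization R S)" for x
    using that by (auto simp: loc_carrier)
  show "abelian_group (localization R S)"
  proof (rule abelian_groupI)
    fix x y assume "x \<in> carrier (localization R S)" "y \<in> carrier (localization R S)"
    then obtain r s r' s' where x: "x = fr r s" "r \<in> carrier R" "s \<in> S" "y = fr r' s'"
      "r' \<in> carrier R" "s' \<in> S"
      using E by blast
    show "x \<oplus>\<^bsub>localization R S\<^esub> y \<in> carrier (localization R S)" using x by (simp add: frac_closed)
    show "x \<oplus>\<^bsub>localization R S\<^esub> y = y \<oplus>\<^bsub>localization R S\<^esub> x"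
      using x by simp (rule frac_eqI; simp add: m_ac a_ac)
    fix z assume "z \<in> carrier (localization R S)"
    then obtain t w where z: "z = fr t w" "t \<in> carrier R" "w \<in> S" using E by blast
    show "x \<oplus>\<^bsub>localization R S\<^esub> y \<oplus>\<^bsub>localization R S\<^esub> z
      = x \<oplus>\<^bsub>localization R S\<^esub> (y \<oplus>\<^bsub>localization R S\<^esub> z)"
      using x z by simp (rule frac_eqI; simp add: m_ac a_ac r_distr l_distr)
  next
    show "\<zero>\<^bsub>localization R S\<^esub> \<in> carrier (localization R S)" by (simp add: frac_closed)
    fix x assume "x \<in> carrier (localization R S)"
    then obtain r s where x: "x = fr r s" "r \<in> carrier R" "s \<in> S" using E by blast
    show "\<zero>\<^bsub>localization R S\<^esub> \<oplus>\<^bsub>localization R S\<^esub> x = x" using x by simp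
    show "\<exists>y\<in>carrier (localization R S). y \<oplus>\<^bsub>localization R S\<^esub> x = \<zero>\<^bsub>localization R S\<^esub>"
    proof (rule bexI[of _ "fr (\<ominus> r) s"])
      show "fr (\<ominus> r) s \<in> carrier (localization R S)" using x by (simp add: frac_closed)
      have "fr ((\<ominus> r \<otimes> s) \<oplus> (r \<otimes> s)) (s \<otimes> s) = fr \<zero> \<one>"
        using x by (intro frac_eqI) (auto simp: l_minus l_neg)
      then show "fr (\<ominus> r) s \<oplus>\<^bsub>localization R S\<^esub> x = \<zero>\<^bsub>localization R S\<^esub>" using x by simp
    qed
  qed
  show "comm_monoid (localization R S)"
  proof (rule comm_monoidI)
    fix x y assume "x \<in> carrier (localization R S)" "y \<in> carrier (localization R S)"
    then obtain r s r' s' where x: "x = fr r s" "r \<in> carrier R" "s \<in> S" "y = fr r' s'"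
      "r' \<in> carrier R" "s' \<in> S"
      using E by blast
    show "x \<otimes>\<^bsub>localization R S\<^esub> y \<in> carrier (localization R S)" using x by (simp add: frac_closed)
    show "x \<otimes>\<^bsub>localization R S\<^esub> y = y \<otimes>\<^bsub>localization R S\<^esub> x" using x by (simp add: m_comm)
    fix z assume "z \<in> carrier (localization R S)"
    then obtain t w where z: "z = fr t w" "t \<in> carrier R" "w \<in> S" using E by blast
    show "x \<otimes>\<^bsub>localization R S\<^esub> y \<otimes>\<^bsub>localization R S\<^esub> z
      = x \<otimes>\<^bsub>localization R S\<^esub> (y \<otimes>\<^bsub>localization R S\<^esub> z)"
      using x z by (simp add: m_assoc)
  next
    show "\<one>\<^bsub>localization R S\<^esub> \<in> carrier (localization R S)" by (simp add: frac_closed)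
    fix x assume "x \<in> carrier (localization R S)"
    then obtain r s where x: "x = fr r s" "r \<in> carrier R" "s \<in> S" using E by blast
    show "\<one>\<^bsub>localization R S\<^esub> \<otimes>\<^bsub>localization R S\<^esub> x = x" using x by simp
  qed
  fix x y z assume "x \<in> carrier (localization R S)" "y \<in> carrier (localization R S)"
    "z \<in> carrier (localization R S)"
  then obtain r s r' s' t w where x: "x = fr r s" "r \<in> carrier R" "s \<in> S" "y = fr r' s'"
    "r' \<in> carrier R" "s' \<in> S"
    "z = fr t w" "t \<in> carrier R" "w \<in> S"
    using E by meson
  show "(x \<oplus>\<^bsub>localization R S\<^esub> y) \<otimes>\<^bsub>localization R S\<^esub> z
      = x \<otimes>\<^bsub>localization R S\<^esub> z \<oplus>\<^bsub>localization R S\<^esub> y \<otimes>\<^bsub>localization R S\<^esub> z"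
    using x by simp (rule frac_eqI; simp add: m_ac a_ac r_distr l_distr)
qed

end

section \<open>The hypersurface ring and its localization at the origin\<close>

lemma mpoly_ring_simps:
  "\<one>\<^bsub>mpoly_ring V\<^esub> = 1" "\<zero>\<^bsub>mpoly_ring V\<^esub> = 0"
  "x \<otimes>\<^bsub>mpoly_ring V\<^esub> y = x * y" "x \<oplus>\<^bsub>mpoly_ring V\<^esub> y = x + y"
  by (simp_all add: mpoly_ring_def)

lemma cring_mpoly_ring: "cring (mpoly_ring V :: ('v, 'a::comm_ring_1) mpoly ring)"
proof (rule cringI)
  show "abelian_group (mpoly_ring V :: ('v, 'a) mpoly ring)"
  proof (rule abelian_groupI)
    fix x :: "('v, 'a) mpoly" assume "x \<in> carrier (mpoly_ring V)"
    then show "\<exists>y\<in>carrier (mpoly_ring V). y \<oplus>\<^bsub>mpoly_ring V\<^esub> x = \<zero>\<^bsub>mpoly_ring V\<^esub>"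
      by (intro bexI[of _ "- x"]) (auto simp: mpoly_ring_simps carrier_mpoly_ring)
  qed (auto simp: mpoly_ring_simps carrier_mpoly_ring add_ac)
  show "comm_monoid (mpoly_ring V :: ('v, 'a) mpoly ring)"
    by (rule comm_monoidI) (auto simp: mpoly_ring_simps carrier_mpoly_ring mult_ac)
qed (auto simp: mpoly_ring_simps carrier_mpoly_ring distrib_right)

context
  fixes V :: "'v::linorder set" and f :: "('v, 'p::prime_card mod_ring) mpoly"
  assumes V: "finite V" and f: "f \<in> polys V" "f \<noteq> 0" "coef f 0 = 0"
begin

interpretation S: cring "mpoly_ring V :: ('v, 'p mod_ring) mpoly ring" by (rule cring_mpoly_ring)

definition "hyp_ideal = PIdl\<^bsub>mpoly_ring V\<^esub> f"

interpretation I: ideal hyp_ideal "mpoly_ring V"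
  unfolding hyp_ideal_def using f by (intro S.cgenideal_ideal) (simp add: carrier_mpoly_ring)

definition "hyp_ring = mpoly_ring V Quot hyp_ideal"

interpretation R: cring hyp_ring
  unfolding hyp_ring_def by (rule I.quotient_is_cring) (rule cring_mpoly_ring)

definition cls :: "('v, 'p mod_ring) mpoly \<Rightarrow> ('v, 'p mod_ring) mpoly set" where
  "cls s = hyp_ideal +>\<^bsub>mpoly_ring V\<^esub> s"

lemma mem_hyp_ideal: "s \<in> hyp_ideal \<longleftrightarrow> (\<exists>t\<in>polys V. s = f * t)"
  by (auto simp: hyp_ideal_def cgenideal_def carrier_mpoly_ring mpoly_ring_simps mult.commute)

lemma cls_closed [simp]: "s \<in> polys V \<Longrightarrow> cls s \<in> carrier hyp_ring"
  by (auto simp: cls_def hyp_ring_def FactRing_def A_RCOSETS_def' carrier_mpoly_ring)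

lemma cls_add: "s \<in> polys V \<Longrightarrow> t \<in> polys V \<Longrightarrow> cls (s + t) = cls s \<oplus>\<^bsub>hyp_ring\<^esub> cls t"
  and cls_mult: "s \<in> polys V \<Longrightarrow> t \<in> polys V \<Longrightarrow> cls (s * t) = cls s \<otimes>\<^bsub>hyp_ring\<^esub> cls t"
  and cls_1: "cls 1 = \<one>\<^bsub>hyp_ring\<^esub>"
  using ring_hom_add[OF I.rcos_ring_hom, of s t] ring_hom_mult[OF I.rcos_ring_hom, of s t]
    ring_hom_one[OF I.rcos_ring_hom]
  unfolding cls_def hyp_ring_def carrier_mpoly_ring mpoly_ring_simps by blast+

lemma cls_surj: "y \<in> carrier hyp_ring \<Longrightarrow> \<exists>s\<in>polys V. y = cls s"
  by (auto simp: cls_def hyp_ring_def FactRing_def A_RCOSETS_def' carrier_mpoly_ring)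

lemma cls_0: "cls 0 = \<zero>\<^bsub>hyp_ring\<^esub>"
  using cls_add[of 0 0] R.l_zero[of "cls 0"] R.add.r_cancel_one'[of "cls 0" "cls 0"] by simp

lemma cls_eq_0: "s \<in> polys V \<Longrightarrow> cls s = \<zero>\<^bsub>hyp_ring\<^esub> \<longleftrightarrow> (\<exists>t\<in>polys V. s = f * t)"
proof -
  assume s: "s \<in> polys V"
  have "cls s = \<zero>\<^bsub>hyp_ring\<^esub> \<longleftrightarrow> s \<in> hyp_ideal"
    using s I.a_rcos_const[of s] I.a_rcos_self[of s]
    by (auto simp: cls_def hyp_ring_def FactRing_def carrier_mpoly_ring)
  then show ?thesis by (simp add: mem_hyp_ideal)
qed

lemma cls_diff: "s \<in> polys V \<Longrightarrow> t \<in> polys V \<Longrightarrow> cls s = cls t \<Longrightarrow> \<exists>r\<in>polys V. s - t = f * r"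
proof -
  assume a: "s \<in> polys V" "t \<in> polys V" "cls s = cls t"
  have "cls (s - t) \<oplus>\<^bsub>hyp_ring\<^esub> cls t = cls t" using a cls_add[of "s - t" t] by simp
  then have "cls (s - t) = \<zero>\<^bsub>hyp_ring\<^esub>"
    using a R.add.l_cancel_one'[of "cls t" "cls (s - t)"] R.a_comm by simp
  then show ?thesis using cls_eq_0[of "s - t"] a by simp
qed

lemma cls_coef_0: "s \<in> polys V \<Longrightarrow> t \<in> polys V \<Longrightarrow> cls s = cls t \<Longrightarrow> coef s 0 = coef t 0"
proof -
  assume a: "s \<in> polys V" "t \<in> polys V" "cls s = cls t"
  then obtain r where "s - t = f * r" using cls_diff by blast
  then have "coef (s - t) 0 = 0" using f by (simp add: coef_0_mult)
  then show ?thesis by (simp add: lookup_minus)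
qed

definition "hyp_max = Idl\<^bsub>hyp_ring\<^esub> (cls ` mpoly_var ` V)"

text \<open>The classes of polynomials without constant term form an ideal containing the variables;
  conversely, every nonconstant monomial is divisible by a variable.\<close>

lemma hyp_max_eq: "hyp_max = {cls s | s. s \<in> polys V \<and> coef s 0 = 0}"
proof
  let ?K = "{cls s | s. s \<in> polys V \<and> coef s 0 = 0}"
  have "ideal ?K hyp_ring"
  proof (rule idealI)
    show "ring hyp_ring" by (rule R.ring_axioms)
    show "subgroup ?K (add_monoid hyp_ring)"
    proof (rule R.add.subgroupI)
      show "?K \<subseteq> carrier hyp_ring" by auto
      show "?K \<noteq> {}" by (auto intro: exI[of _ 0])
      fix a assume "a \<in> ?K"
      then obtain s where s: "a = cls s" "s \<in> polys V" "coef s 0 = 0" by blast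
      have "cls (- s) \<oplus>\<^bsub>hyp_ring\<^esub> cls s = \<zero>\<^bsub>hyp_ring\<^esub>" using s cls_add[of "- s" s] cls_0 by simp
      then have "\<ominus>\<^bsub>hyp_ring\<^esub> a = cls (- s)" using s by (intro R.minus_equality) auto
      then show "\<ominus>\<^bsub>hyp_ring\<^esub> a \<in> ?K" using s by auto
      fix b assume "b \<in> ?K"
      then obtain t where t: "b = cls t" "t \<in> polys V" "coef t 0 = 0" by blast
      show "a \<oplus>\<^bsub>hyp_ring\<^esub> b \<in> ?K" using s t by (auto simp: lookup_add
        intro!: exI[of _ "s + t"] cls_add[symmetric])
    qed
    fix a x assume a: "a \<in> ?K" "x \<in> carrier hyp_ring"
    then obtain s t where s: "a = cls s" "s \<in> polys V" "coef s 0 = 0" "x = cls t" "t \<in> polys V"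
      using cls_surj by blast
    show "x \<otimes>\<^bsub>hyp_ring\<^esub> a \<in> ?K" using s by (auto simp: coef_0_mult
      intro!: exI[of _ "t * s"] cls_mult[symmetric])
    show "a \<otimes>\<^bsub>hyp_ring\<^esub> x \<in> ?K" using s by (auto simp: coef_0_mult
      intro!: exI[of _ "s * t"] cls_mult[symmetric])
  qed
  moreover have "cls ` mpoly_var ` V \<subseteq> ?K"
  proof -
    have "coef (mpoly_var v :: ('v, 'p mod_ring) mpoly) 0 = 0" for v
    proof -
      have "Poly_Mapping.single v (1::nat) \<noteq> 0"
      proof
        assume 0: "Poly_Mapping.single v (1::nat) = 0"
        show False using lookup_single_eq[of v "1::nat"] unfolding 0 by simp
      qed
      then show ?thesis by (simp add: mpoly_var_def lookup_single)
    qed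
    note var0 = this
    show ?thesis
    proof
      fix x assume "x \<in> cls ` mpoly_var ` V"
      then obtain v where "v \<in> V" "x = cls (mpoly_var v)" by blast
      then show "x \<in> ?K" using var0[of v] polys_var[of v V]
        by (intro CollectI exI[of _ "mpoly_var v"]) simp
    qed
  qed
  ultimately show "hyp_max \<subseteq> ?K" unfolding hyp_max_def by (rule R.genideal_minimal)
next
  have gens: "cls ` mpoly_var ` V \<subseteq> carrier hyp_ring" by auto
  interpret M: ideal hyp_max hyp_ring unfolding hyp_max_def by (rule R.genideal_ideal[OF gens])
  \<comment> \<open>Subtracting the constant term makes the claim additive in \<open>s\<close>,
    which allows induction over the terms.\<close>
  have "cls (s - mterm 0 (coef s 0)) \<in> hyp_max" if "s \<in> polys V" for s :: "('v, 'p mod_ring) mpoly"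
    using that
  proof (induction rule: polys_induct)
    case zero
    then show ?case using M.zero_closed cls_0 by simp
  next
    case (mterm m c)
    show ?case
    proof (cases "m = 0")
      case True
      then show ?thesis using M.zero_closed cls_0 by simp
    next
      case False
      then obtain v where v: "v \<in> supp m" using keys_eq_empty[of m] by blast
      then have vV: "v \<in> V" using mterm by blast
      let ?m = "m - Poly_Mapping.single v 1"
      have mV: "supp ?m \<subseteq> V" using mterm by (auto simp: in_keys_iff lookup_minus)
      have "Poly_Mapping.single v 1 + ?m = m"
        using v by (intro poly_mapping_eqI) (auto simp: lookup_add lookup_minus lookup_single
          when_def in_keys_iff)
      then have "mterm m c = mpoly_var v * mterm ?m c" by (simp add: mpoly_var_def mult_single)
      moreover have "cls (mpoly_var v) \<in> hyp_max"
        using R.genideal_self[OF gens] vV by (auto simp: hyp_max_def)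
      ultimately have "cls (mterm m c) \<in> hyp_max"
        using vV mV M.I_r_closed by (simp add: cls_mult polys_mono)
      moreover have "coef (mterm m c) 0 = 0" using False by (simp add: lookup_single)
      ultimately show ?thesis by simp
    qed
  next
    case (add s t)
    have eq: "s + t - mterm 0 (coef (s + t) 0)
      = (s - mterm 0 (coef s 0)) + (t - mterm 0 (coef t 0))"
      by (simp add: lookup_add single_add)
    show ?case unfolding eq using add(1,2) M.a_closed[OF add(3,4)]
      by (subst cls_add) simp_all
  qed
  then show "{cls s | s. s \<in> polys V \<and> coef s 0 = 0} \<subseteq> hyp_max" by force
qed

lemma cls_mem_hyp_max: "s \<in> polys V \<Longrightarrow> cls s \<in> hyp_max \<longleftrightarrow> coef s 0 = 0"
proof -
  assume s: "s \<in> polys V"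
  show ?thesis
  proof
    assume "cls s \<in> hyp_max"
    then obtain t where t: "t \<in> polys V" "coef t 0 = 0" "cls s = cls t"
      unfolding hyp_max_eq by blast
    then show "coef s 0 = 0" using cls_coef_0[OF s t(1,3)] by simp
  next
    assume "coef s 0 = 0"
    then show "cls s \<in> hyp_max" unfolding hyp_max_eq using s by blast
  qed
qed

definition "hyp_S = carrier hyp_ring - hyp_max"

lemma mem_hyp_S: "y \<in> hyp_S \<longleftrightarrow> (\<exists>u\<in>polys V. coef u 0 \<noteq> 0 \<and> y = cls u)"
proof
  assume y: "y \<in> hyp_S"
  then obtain u where "u \<in> polys V" "y = cls u" unfolding hyp_S_def using cls_surj by blast
  then show "\<exists>u\<in>polys V. coef u 0 \<noteq> 0 \<and> y = cls u"
    using y cls_mem_hyp_max[of u] unfolding hyp_S_def by blast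
next
  assume "\<exists>u\<in>polys V. coef u 0 \<noteq> 0 \<and> y = cls u"
  then obtain u where "u \<in> polys V" "coef u 0 \<noteq> 0" "y = cls u" by blast
  then show "y \<in> hyp_S" using cls_mem_hyp_max[of u] unfolding hyp_S_def by simp
qed

interpretation F: fractions hyp_ring hyp_S
proof
  show "hyp_S \<subseteq> carrier hyp_ring" by (auto simp: hyp_S_def)
  show "\<one>\<^bsub>hyp_ring\<^esub> \<in> hyp_S" unfolding mem_hyp_S by (auto simp: cls_1 intro!: bexI[of _ 1])
  show "s \<otimes>\<^bsub>hyp_ring\<^esub> t \<in> hyp_S" if "s \<in> hyp_S" "t \<in> hyp_S" for s t
  proof -
    obtain u w where "u \<in> polys V" "coef u 0 \<noteq> 0" "s = cls u" "w \<in> polys V" "coef w 0 \<noteq> 0"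
      "t = cls w"
      using \<open>s \<in> hyp_S\<close> \<open>t \<in> hyp_S\<close> unfolding mem_hyp_S by blast
    then show ?thesis unfolding mem_hyp_S
      by (intro bexI[of _ "u * w"]) (auto simp: coef_0_mult cls_mult)
  qed
qed

definition "hyp_phi s = ring_fraction hyp_ring hyp_S (cls s) \<one>\<^bsub>hyp_ring\<^esub>"

text \<open>For the kernel: a fraction with denominator 1 vanishes iff an element outside the
  maximal ideal kills its numerator, and these elements are the classes of polynomials with nonzero
  constant term.\<close>

lemma local_hypersurface_localization:
  "local_hypersurface (localization_at hyp_ring hyp_max) V f hyp_phi"
proof -
  let ?L = "localization hyp_ring hyp_S"
  have L: "localization_at hyp_ring hyp_max = ?L" by (simp add: localization_at_def hyp_S_def)
  interpret L: cring ?L by (rule F.loc_cring)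
  note [simp] = F.S_one
  have cl: "hyp_phi s \<in> carrier ?L" if "s \<in> polys V" for s
    using that by (simp add: hyp_phi_def F.frac_closed)
  have mult: "hyp_phi (s * t) = hyp_phi s \<otimes>\<^bsub>?L\<^esub> hyp_phi t" if "s \<in> polys V" "t \<in> polys V" for s t
    using that by (simp add: hyp_phi_def F.loc_mult cls_mult)
  show ?thesis unfolding L
  proof (intro local_hypersurface.intro local_hypersurface_axioms.intro)
    show "cring ?L" by (rule F.loc_cring)
    show "finite V" "f \<in> polys V" "f \<noteq> 0" "coef f 0 = 0" using V f by auto
    show "hyp_phi s \<in> carrier ?L" if "s \<in> polys V" for s by (rule cl[OF that])
    show "hyp_phi (s + t) = hyp_phi s \<oplus>\<^bsub>?L\<^esub> hyp_phi t" if "s \<in> polys V" "t \<in> polys V" for s t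
      using that by (simp add: hyp_phi_def F.loc_add cls_add)
    show "hyp_phi (s * t) = hyp_phi s \<otimes>\<^bsub>?L\<^esub> hyp_phi t" if "s \<in> polys V" "t \<in> polys V" for s t
      by (rule mult[OF that])
    show "hyp_phi 1 = \<one>\<^bsub>?L\<^esub>" by (simp add: hyp_phi_def cls_1 F.loc_carrier)
    show "hyp_phi u \<in> Units ?L" if u: "u \<in> polys V" "coef u 0 \<noteq> 0" for u
    proof -
      have uS: "cls u \<in> hyp_S" using u mem_hyp_S by blast
      have "ring_fraction hyp_ring hyp_S \<one>\<^bsub>hyp_ring\<^esub> (cls u) \<otimes>\<^bsub>?L\<^esub> hyp_phi u = \<one>\<^bsub>?L\<^esub>"
        using u uS F.S_mult by (simp add: hyp_phi_def F.loc_mult F.loc_carrier)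
          (rule F.frac_eqI; simp)
      moreover have "ring_fraction hyp_ring hyp_S \<one>\<^bsub>hyp_ring\<^esub> (cls u) \<in> carrier ?L"
        using uS by (simp add: F.frac_closed)
      moreover have "hyp_phi u \<otimes>\<^bsub>?L\<^esub> ring_fraction hyp_ring hyp_S \<one>\<^bsub>hyp_ring\<^esub> (cls u) = \<one>\<^bsub>?L\<^esub>"
        using calculation L.m_comm[OF cl[OF u(1)]] by simp
      ultimately show ?thesis using cl[OF u(1)] unfolding Units_def by blast
    qed
    show "\<exists>s\<in>polys V. \<exists>u\<in>polys V. coef u 0 \<noteq> 0 \<and> y \<otimes>\<^bsub>?L\<^esub> hyp_phi u = hyp_phi s"
      if "y \<in> carrier ?L" for y
    proof -
      obtain r s where "y = ring_fraction hyp_ring hyp_S r s" "r \<in> carrier hyp_ring" "s \<in> hyp_S"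
        using \<open>y \<in> carrier ?L\<close> by (auto simp: F.loc_carrier)
      moreover obtain t where "t \<in> polys V" "r = cls t" using cls_surj calculation by blast
      moreover obtain u where "u \<in> polys V" "coef u 0 \<noteq> 0" "s = cls u"
        using mem_hyp_S calculation by blast
      ultimately have y: "y = ring_fraction hyp_ring hyp_S (cls t) (cls u)" "cls u \<in> hyp_S"
        "t \<in> polys V" "u \<in> polys V" "coef u 0 \<noteq> 0" by auto
      have "y \<otimes>\<^bsub>?L\<^esub> hyp_phi u = hyp_phi t"
        using y by (simp add: hyp_phi_def F.loc_mult) (rule F.frac_eqI; simp)
      then show ?thesis using y by blast
    qed
    show "hyp_phi s = \<zero>\<^bsub>?L\<^esub> \<longleftrightarrow> (\<exists>u\<in>polys V. coef u 0 \<noteq> 0 \<and> (\<exists>t\<in>polys V. u * s = f * t))"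
      if s: "s \<in> polys V" for s
    proof -
      have "hyp_phi s = \<zero>\<^bsub>?L\<^esub> \<longleftrightarrow> (\<exists>w\<in>hyp_S. w \<otimes>\<^bsub>hyp_ring\<^esub> cls s = \<zero>\<^bsub>hyp_ring\<^esub>)"
        using s by (simp add: hyp_phi_def F.loc_carrier F.frac_eq_iff F.eqv_def)
      also have "\<dots> \<longleftrightarrow> (\<exists>u\<in>polys V. coef u 0 \<noteq> 0 \<and> cls (u * s) = \<zero>\<^bsub>hyp_ring\<^esub>)"
      proof
        assume "\<exists>w\<in>hyp_S. w \<otimes>\<^bsub>hyp_ring\<^esub> cls s = \<zero>\<^bsub>hyp_ring\<^esub>"
        then obtain w where w: "w \<in> hyp_S" "w \<otimes>\<^bsub>hyp_ring\<^esub> cls s = \<zero>\<^bsub>hyp_ring\<^esub>" by blast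
        obtain u where "u \<in> polys V" "coef u 0 \<noteq> 0" "w = cls u"
          using w(1) unfolding mem_hyp_S by blast
        with w(2) show "\<exists>u\<in>polys V. coef u 0 \<noteq> 0 \<and> cls (u * s) = \<zero>\<^bsub>hyp_ring\<^esub>"
          using s cls_mult[of u s] by (intro bexI[of _ u]) simp_all
      next
        assume "\<exists>u\<in>polys V. coef u 0 \<noteq> 0 \<and> cls (u * s) = \<zero>\<^bsub>hyp_ring\<^esub>"
        then obtain u where "u \<in> polys V" "coef u 0 \<noteq> 0" "cls (u * s) = \<zero>\<^bsub>hyp_ring\<^esub>" by blast
        then show "\<exists>w\<in>hyp_S. w \<otimes>\<^bsub>hyp_ring\<^esub> cls s = \<zero>\<^bsub>hyp_ring\<^esub>"
          using s cls_mult[of u s] mem_hyp_S by (intro bexI[of _ "cls u"]) auto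
      qed
      also have "\<dots> \<longleftrightarrow> (\<exists>u\<in>polys V. coef u 0 \<noteq> 0 \<and> (\<exists>t\<in>polys V. u * s = f * t))"
      proof -
        have "cls (u * s) = \<zero>\<^bsub>hyp_ring\<^esub> \<longleftrightarrow> (\<exists>t\<in>polys V. u * s = f * t)" if "u \<in> polys V" for u
          using cls_eq_0[of "u * s"] s that by simp
        then show ?thesis by blast
      qed
      finally show ?thesis .
    qed
  qed
qed

end

subsection \<open>Substitution\<close>

definition mon_subst :: "('v \<Rightarrow> 'c::comm_ring_1) \<Rightarrow> ('v \<Rightarrow>\<^sub>0 nat) \<Rightarrow> 'c" where
  "mon_subst y m = (\<Prod>v\<in>supp m. y v ^ coef m v)"

lemma mon_subst_superset: "finite A \<Longrightarrow> supp m \<subseteq> A \<Longrightarrow> mon_subst y m = (\<Prod>v\<in>A. y v ^ coef m v)"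
  unfolding mon_subst_def by (rule prod.mono_neutral_left) (auto simp: in_keys_iff)

lemma mon_subst_add: "mon_subst y (a + b) = mon_subst y a * mon_subst y b"
proof -
  have "finite (supp a \<union> supp b)" by simp
  then show ?thesis
    by (simp add: mon_subst_superset[of "supp a \<union> supp b"] supp_add_mon lookup_add power_add
      prod.distrib)
qed

lemma mon_subst_0 [simp]: "mon_subst y 0 = 1" by (simp add: mon_subst_def)

lemma mon_subst_single: "mon_subst y (Poly_Mapping.single v k) = y v ^ k"
  by (simp add: mon_subst_superset[of "{v}"])

definition psubst :: "('v \<Rightarrow> ('w, 'a::comm_ring_1) mpoly) \<Rightarrow> ('v, 'a) mpoly \<Rightarrow> ('w, 'a) mpoly" where
  "psubst y g = (\<Sum>m\<in>supp g. mterm 0 (coef g m) * mon_subst y m)"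

lemma psubst_superset: "finite T \<Longrightarrow> supp g \<subseteq> T \<Longrightarrow>
  psubst y g = (\<Sum>m\<in>T. mterm 0 (coef g m) * mon_subst y m)"
  unfolding psubst_def by (rule sum.mono_neutral_left) (auto simp: in_keys_iff)

lemma psubst_add: "psubst y (f + g) = psubst y f + psubst y g"
proof -
  have T: "finite (supp f \<union> supp g)" by simp
  show ?thesis
    using keys_add[of f g]
    by (simp add: psubst_superset[OF T] lookup_add single_add distrib_right sum.distrib)
qed

lemma psubst_0 [simp]: "psubst y 0 = 0" by (simp add: psubst_def)

lemma psubst_mterm: "psubst y (mterm m c) = mterm 0 c * mon_subst y m"
  by (simp add: psubst_superset[of "{m}"])

lemma psubst_const [simp]: "psubst y (mterm 0 c) = mterm 0 c"
  by (simp add: psubst_mterm)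

lemma psubst_1 [simp]: "psubst y 1 = 1"
  using psubst_const[of y 1] by simp

lemma psubst_var: "psubst y (mpoly_var v) = y v"
  by (simp add: mpoly_var_def psubst_mterm mon_subst_single)

lemma mpoly_induct [case_names zero mterm add]:
  fixes f :: "('v, 'a::comm_monoid_add) mpoly"
  assumes "P 0" "\<And>m c. P (mterm m c)" "\<And>f g. P f \<Longrightarrow> P g \<Longrightarrow> P (f + g)"
  shows "P f"
  by (rule polys_induct[of f UNIV]) (use assms in \<open>auto simp: polys_def\<close>)

lemma psubst_mult:
  fixes y :: "'v \<Rightarrow> ('w, 'a::comm_ring_1) mpoly"
  shows "psubst y (f * g) = psubst y f * psubst y g"
proof (induction f rule: mpoly_induct)
  case (mterm m c)
  show ?case
  proof (induction g rule: mpoly_induct)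
    case (mterm m' c')
    have "mterm 0 (c * c') = (mterm 0 c * mterm 0 c' :: ('w, 'a) mpoly)" by (simp add: mult_single)
    then have "psubst y (mterm m c * mterm m' c')
      = (mterm 0 c * mterm 0 c') * (mon_subst y m * mon_subst y m')"
      by (simp only: mult_single psubst_mterm mon_subst_add)
    then show ?case by (simp only: psubst_mterm mult_ac)
  qed (simp_all add: distrib_left psubst_add)
qed (simp_all add: distrib_right psubst_add)

lemma psubst_uminus: "psubst y (- f) = - psubst y f"
  using psubst_add[of y f "- f"] by (simp add: eq_neg_iff_add_eq_0 add.commute)

lemma psubst_diff: "psubst y (f - g) = psubst y f - psubst y g"
  using psubst_add[of y f "- g"] by (simp add: psubst_uminus)

lemma psubst_power: "psubst y (f ^ k) = psubst y f ^ k"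
  by (induction k) (simp_all add: psubst_mult)

lemma psubst_sum: "psubst y (\<Sum>i\<in>I. f i) = (\<Sum>i\<in>I. psubst y (f i))"
  by (induction I rule: infinite_finite_induct) (simp_all add: psubst_add)

lemma psubst_polys:
  assumes "f \<in> polys V" "\<And>v. v \<in> V \<Longrightarrow> y v \<in> polys W"
  shows "psubst y f \<in> polys W"
  unfolding psubst_def mon_subst_def
proof (intro polys_sum polys_mult polys_prod polys_power polys_const)
  fix m v assume "m \<in> supp f" "v \<in> supp m"
  then have "v \<in> V" using assms(1) unfolding polys_def by blast
  then show "y v \<in> polys W" by (rule assms(2))
qed

lemma mterm_as_vars:
  fixes c :: "'a::comm_ring_1"
  shows "mterm m c = mterm 0 c * (\<Prod>v\<in>supp m. mpoly_var v ^ coef m v)"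
proof -
  have "(\<Prod>v\<in>A. mpoly_var v ^ coef m v) = (mterm (\<Sum>v\<in>A. Poly_Mapping.single v (coef m v)) 1 ::
    ('b, 'a) mpoly)"
    if "finite A" for A and m :: "'b \<Rightarrow>\<^sub>0 nat"
    using that
  proof (induction A)
    case (insert v A)
    have "mscale k (Poly_Mapping.single v 1) = Poly_Mapping.single v k" for k
      by (rule poly_mapping_eqI) (simp add: lookup_single when_def)
    then show ?case using insert by (simp add: mpoly_var_def mono_power mult_single)
  qed simp
  then show ?thesis using poly_as_sum[of m] by (simp add: mult_single)
qed

lemma psubst_hom_unique:
  fixes y :: "'v \<Rightarrow> ('w, 'a::comm_ring_1) mpoly"
  assumes "f \<in> polys V" "\<And>f g. F (f + g) = F f + F g" "\<And>f g. F (f * g) = F f * F g"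
    "\<And>c. F (mterm 0 c) = mterm 0 c" "\<And>v. v \<in> V \<Longrightarrow> F (mpoly_var v) = y v"
  shows "F f = psubst y f"
  using assms(1)
proof (induction rule: polys_induct)
  case zero
  then show ?case using assms(4)[of 0] by simp
next
  case (mterm m c)
  have F1: "F 1 = 1" using assms(4)[of 1] by simp
  have Fp: "F (g ^ k) = F g ^ k" for g k by (induction k) (simp_all add: F1 assms(3))
  have "F (\<Prod>v\<in>A. mpoly_var v ^ coef m v) = (\<Prod>v\<in>A. y v ^ coef m v)" if "finite A" "A \<subseteq> V" for A
    using that by (induction A) (simp_all add: F1 assms(3,5) Fp)
  then show ?case using mterm by (subst mterm_as_vars) (simp add: assms(3,4) psubst_mterm
    mon_subst_def)
next
  case (add f g)
  then show ?case by (simp add: assms(2) psubst_add)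
qed

subsection \<open>Weights and standard monomials\<close>

definition wt :: "('v \<Rightarrow> nat) \<Rightarrow> ('v \<Rightarrow>\<^sub>0 nat) \<Rightarrow> nat" where
  "wt w m = (\<Sum>v\<in>supp m. w v * coef m v)"

lemma wt_superset: "finite A \<Longrightarrow> supp m \<subseteq> A \<Longrightarrow> wt w m = (\<Sum>v\<in>A. w v * coef m v)"
  unfolding wt_def by (rule sum.mono_neutral_left) (auto simp: in_keys_iff)

lemma wt_add: "wt w (a + b) = wt w a + wt w b"
proof -
  have "finite (supp a \<union> supp b)" by simp
  then show ?thesis
    by (simp add: wt_superset[of "supp a \<union> supp b"] supp_add_mon lookup_add distrib_left
      sum.distrib)
qed

lemma wt_0 [simp]: "wt w 0 = 0" by (simp add: wt_def)

lemma wt_single: "wt w (Poly_Mapping.single v k) = w v * k"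
  by (simp add: wt_superset[of "{v}"])

lemma wt_sum: "wt w (\<Sum>i\<in>I. m i) = (\<Sum>i\<in>I. wt w (m i))"
  by (induction I rule: infinite_finite_induct) (simp_all add: wt_add)

lemma wt_ge: "w v \<ge> 1 \<Longrightarrow> coef m v \<le> wt w m"
proof (cases "v \<in> supp m")
  case True
  assume "w v \<ge> 1"
  then have "coef m v \<le> w v * coef m v" by simp
  also have "\<dots> \<le> wt w m" unfolding wt_def using True by (intro member_le_sum) auto
  finally show ?thesis .
qed (simp add: in_keys_iff)

text \<open>A unique term of highest weight replaces the leading term of a monomial order; the
  weight need not separate the remaining monomials.\<close>

definition leads :: "('v \<Rightarrow> nat) \<Rightarrow> ('v, 'a::zero) mpoly \<Rightarrow> ('v \<Rightarrow>\<^sub>0 nat) \<Rightarrow> bool" where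
  "leads w F m \<longleftrightarrow> coef F m \<noteq> 0 \<and> (\<forall>m'\<in>supp F. m' \<noteq> m \<longrightarrow> wt w m' < wt w m)"

lemma supp_mult_E:
  fixes f g :: "('v, 'a::comm_ring_1) mpoly"
  assumes "m \<in> supp (f * g)"
  obtains a b where "m = a + b" "a \<in> supp f" "b \<in> supp g"
  using assms keys_mult[of f g] by blast

lemma coef_mult_lead:
  fixes f g :: "('v, 'a::comm_ring_1) mpoly"
  assumes "\<And>a b. a \<in> supp f \<Longrightarrow> b \<in> supp g \<Longrightarrow> a + b = m + m' \<Longrightarrow> a = m \<and> b = m'"
  shows "coef (f * g) (m + m') = coef f m * coef g m'"
proof -
  have "f * g = (\<Sum>a\<in>supp f. \<Sum>b\<in>supp g. mterm (a + b) (coef f a * coef g b))"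
    by (subst poly_as_sum[of f], subst poly_as_sum[of g]) (simp only: sum_product mult_single)
  then have "coef (f * g) (m + m') = (\<Sum>a\<in>supp f. \<Sum>b\<in>supp g. if a = m \<and>
    b = m' then coef f m * coef g m' else 0)"
    using assms by (auto simp: lookup_sum lookup_single when_def intro!: sum.cong)
  also have "\<dots> = (\<Sum>a\<in>supp f. if a = m then (\<Sum>b\<in>supp g. if b
    = m' then coef f m * coef g m' else 0) else 0)"
    by (intro sum.cong) auto
  also have "\<dots> = coef f m * coef g m'" by (auto simp: in_keys_iff)
  finally show ?thesis .
qed

text \<open>Only the pair of extreme terms reaches the maximal weight, and the product of their
  coefficients is nonzero in a domain.\<close>

lemma leads_mult:
  fixes F G :: "('v, 'a::idom) mpoly"
  assumes "leads w F m" "leads w G m'"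
  shows "leads w (F * G) (m + m')"
proof -
  have lt: "a = m \<and> b = m'" if ab: "a \<in> supp F" "b \<in> supp G" and w: "wt w (a + b) \<ge> wt w (m + m')"
    for a b
  proof (rule ccontr)
    assume n: "\<not> (a = m \<and> b = m')"
    have "a = m \<or> wt w a < wt w m" "b = m' \<or> wt w b < wt w m'"
      using ab assms by (auto simp: leads_def)
    then show False using n w by (auto simp: wt_add)
  qed
  have "coef (F * G) (m + m') = coef F m * coef G m'"
    by (rule coef_mult_lead) (use lt in auto)
  moreover have "wt w k < wt w (m + m')" if k: "k \<in> supp (F * G)" "k \<noteq> m + m'" for k
  proof -
    obtain a b where ab: "k = a + b" "a \<in> supp F" "b \<in> supp G" using k(1) by (rule supp_mult_E)
    have "\<not> wt w (m + m') \<le> wt w (a + b)" using lt[OF ab(2,3)] k(2) ab(1) by blast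
    then show ?thesis using ab(1) by simp
  qed
  ultimately show ?thesis using assms by (simp add: leads_def)
qed

lemma leads_power:
  fixes F :: "('v, 'a::idom) mpoly"
  assumes "leads w F m" shows "leads w (F ^ k) (mscale k m)"
proof (induction k)
  case 0
  then show ?case by (simp add: leads_def)
next
  case (Suc k)
  have "mscale (Suc k) m = m + mscale k m" by (rule poly_mapping_eqI) (simp add: lookup_add)
  then show ?case using leads_mult[OF assms Suc] by simp
qed

text \<open>Division with remainder, by induction on the weight: a monomial divisible by a leading
  monomial is congruent to terms of smaller weight. Only spanning is claimed; the remainder need not
  be unique.\<close>

lemma standard_monomials:
  fixes I :: "('v, 'a::field) mpoly set"
  assumes I: "0 \<in> I" "\<And>s t. s \<in> I \<Longrightarrow> t \<in> I \<Longrightarrow> s + t \<in> I"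
      "\<And>s t. s \<in> polys V \<Longrightarrow> t \<in> I \<Longrightarrow> s * t \<in> I"
    and G: "\<And>m0. m0 \<in> G \<Longrightarrow> \<exists>F\<in>I \<inter> polys V. leads w F m0"
    and s: "s \<in> polys V" "\<And>m. m \<in> supp s \<Longrightarrow> wt w m < W"
  shows "\<exists>s'\<in>polys V. s - s' \<in> I \<and> (\<forall>m\<in>supp s'. wt w m < W \<and> (\<forall>m0\<in>G. \<nexists>d. m = m0 + d))"
  using s
proof (induction W arbitrary: s)
  case 0
  then have "s = 0" using keys_eq_empty[of s] by blast
  then show ?case using I(1) by (intro bexI[of _ 0]) auto
next
  case (Suc W)
  let ?st = "\<lambda>m. \<forall>m0\<in>G. \<nexists>d. m = m0 + d"
  have mon: "\<exists>s'\<in>polys V. mterm m c - s' \<in> I \<and> (\<forall>k\<in>supp s'. wt w k < Suc W \<and> ?st k)"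
    if m: "supp m \<subseteq> V" "wt w m < Suc W" for m c
  proof (cases "?st m")
    case True
    then show ?thesis using I(1) m by (intro bexI[of _ "mterm m c"]) (auto simp: polys_mono)
  next
    case False
    then obtain m0 d where md: "m0 \<in> G" "m = m0 + d" by blast
    then obtain F where F: "F \<in> I" "F \<in> polys V" "leads w F m0" using G by blast
    have dV: "supp d \<subseteq> V" using m md by (simp add: supp_add_mon)
    have c0: "coef F m0 \<noteq> 0" using F by (simp add: leads_def)
    \<comment> \<open>The scaling makes the coefficient of \<open>h\<close> at \<open>m\<close>
      equal to \<open>c\<close>, so that only terms of smaller weight survive in
      \<open>mterm m c - h\<close>.\<close>
    define h where "h = mterm d (c / coef F m0) * F"
    have hI: "h \<in> I" "h \<in> polys V" unfolding h_def using F dV I(3) by (auto simp: polys_mono)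
    have "wt w k < W" if k: "k \<in> supp (mterm m c - h)" for k
    proof -
      have hk: "coef h (d + l) = (c / coef F m0) * coef F l"
        for l unfolding h_def by (rule lookup_mono_mult)
      have "k \<noteq> m" using k hk[of m0] c0 md by (auto simp: in_keys_iff lookup_minus add.commute)
      then have "coef h k \<noteq> 0" using k by (auto simp: in_keys_iff lookup_minus lookup_single
        when_def)
      then obtain l where l: "k = d + l" using lookup_mono_mult_not[of k d "c / coef F m0" F]
        unfolding h_def by blast
      then have "l \<in> supp F" "l \<noteq> m0" using \<open>coef h k \<noteq> 0\<close> hk \<open>k \<noteq> m\<close> md
        by (auto simp: in_keys_iff add.commute)
      then have "wt w l < wt w m0" using F by (simp add: leads_def)
      then show ?thesis using l md m by (simp add: wt_add)
    qed
    moreover have "mterm m c - h \<in> polys V" using hI m by (simp add: polys_mono)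
    ultimately obtain s' where s': "s' \<in> polys V" "mterm m c - h - s' \<in> I"
      "\<forall>k\<in>supp s'. wt w k < W \<and> ?st k"
      using Suc.IH by blast
    have "mterm m c - s' = (mterm m c - h - s') + h" by simp
    then have "mterm m c - s' \<in> I" using I(2)[OF s'(2) hI(1)] by (simp only:)
    then show ?thesis using s' by (auto intro!: bexI[of _ s'] less_SucI)
  qed
  have "\<exists>s'\<in>polys V. (\<Sum>m\<in>T. mterm m (coef s m)) - s' \<in> I \<and> (\<forall>k\<in>supp s'. wt w k < Suc W \<and> ?st k)"
    if "finite T" "T \<subseteq> supp s" for T
    using that
  proof (induction T)
    case empty
    then show ?case using I(1) by (intro bexI[of _ 0]) auto
  next
    case (insert m T)
    have "supp m \<subseteq> V" "wt w m < Suc W" using insert.prems Suc.prems by (auto simp: polys_def)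
    then obtain s1 where s1: "s1 \<in> polys V" "mterm m (coef s m) - s1 \<in> I"
      "\<forall>k\<in>supp s1. wt w k < Suc W \<and> ?st k"
      using mon by blast
    obtain s2 where s2: "s2 \<in> polys V" "(\<Sum>m\<in>T. mterm m (coef s m)) - s2 \<in> I"
      "\<forall>k\<in>supp s2. wt w k < Suc W \<and> ?st k"
      using insert by auto
    have eq: "(\<Sum>m\<in>insert m T. mterm m (coef s m)) - (s1 + s2)
        = (mterm m (coef s m) - s1) + ((\<Sum>m\<in>T. mterm m (coef s m)) - s2)"
      using insert by simp
    have "(\<Sum>m\<in>insert m T. mterm m (coef s m)) - (s1 + s2) \<in> I"
      unfolding eq by (rule I(2)[OF s1(2) s2(2)])
    moreover have "\<forall>k\<in>supp (s1 + s2). wt w k < Suc W \<and> ?st k" using s1(3) s2(3) keys_add[of s1 s2]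
      by blast
    ultimately show ?case using s1(1) s2(1) by (intro bexI[of _ "s1 + s2"]) auto
  qed
  from this[of "supp s"] show ?case using poly_as_sum[of s] by simp
qed

subsection \<open>Algebraic independence modulo primes\<close>

definition prime_set :: "'v set \<Rightarrow> ('v, 'a::comm_ring_1) mpoly set \<Rightarrow> bool" where
  "prime_set V Q \<longleftrightarrow> Q \<subseteq> polys V \<and> 0 \<in> Q \<and> (\<forall>s\<in>Q. \<forall>t\<in>Q. s + t \<in> Q) \<and>
     (\<forall>s\<in>polys V. \<forall>t\<in>Q. s * t \<in> Q) \<and> (\<forall>s\<in>polys V. \<forall>t\<in>polys V. s * t \<in> Q \<longrightarrow> s \<in> Q \<or> t \<in> Q) \<and> 1 \<notin> Q"

lemma prime_set_diff: "prime_set V Q \<Longrightarrow> s \<in> Q \<Longrightarrow> t \<in> Q \<Longrightarrow> s - t \<in> Q"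
proof -
  assume Q: "prime_set V Q" "s \<in> Q" "t \<in> Q"
  have "- 1 * t \<in> Q" using Q polys_uminus[OF polys_1, of V] unfolding prime_set_def by blast
  then have "s + (- 1) * t \<in> Q" using Q unfolding prime_set_def by blast
  then show ?thesis by simp
qed

lemma split_off_var:
  fixes g :: "('v, 'a::comm_ring_1) mpoly"
  assumes g: "g \<in> polys W" and j: "j \<in> W" "\<And>m. m \<in> supp g \<Longrightarrow> coef m j \<le> d"
  obtains g0 g1 where "g = g0 + mpoly_var j * g1" "g0 \<in> polys (W - {j})" "g1 \<in> polys W"
    "\<And>m. m \<in> supp g1 \<Longrightarrow> coef m j \<le> d - 1" "d = 0 \<Longrightarrow> g1 = 0"
proof
  let ?A = "{m \<in> supp g. coef m j = 0}" and ?B = "{m \<in> supp g. coef m j \<noteq> 0}"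
  let ?m = "\<lambda>m. m - Poly_Mapping.single j 1"
  have m: "Poly_Mapping.single j 1 + ?m m = m" if "m \<in> ?B" for m
    using that by (intro poly_mapping_eqI) (auto simp: lookup_add lookup_minus lookup_single
      when_def)
  have "mpoly_var j * (\<Sum>m\<in>?B. mterm (?m m) (coef g m)) = (\<Sum>m\<in>?B. mterm m (coef g m))"
    unfolding mpoly_var_def sum_distrib_left mult_single using m by (intro sum.cong) simp_all
  moreover have "supp g = ?A \<union> ?B" "?A \<inter> ?B = {}" by auto
  then have "(\<Sum>m\<in>supp g. mterm m (coef g m))
    = (\<Sum>m\<in>?A. mterm m (coef g m)) + (\<Sum>m\<in>?B. mterm m (coef g m))"
    using sum.union_disjoint[of ?A ?B "\<lambda>m. mterm m (coef g m)"] by simp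
  ultimately show "g = (\<Sum>m\<in>?A. mterm m (coef g m)) + mpoly_var j * (\<Sum>m\<in>?B. mterm (?m m) (coef g m))"
    using poly_as_sum[of g] by simp
  have gW: "supp m \<subseteq> W" if "m \<in> supp g" for m using g that by (simp add: polys_def)
  show "(\<Sum>m\<in>?A. mterm m (coef g m)) \<in> polys (W - {j})"
    using gW by (intro polys_sum polys_mono) (auto simp: in_keys_iff)
  have "supp (?m m) \<subseteq> supp m" for m :: "'v \<Rightarrow>\<^sub>0 nat" by (auto simp: in_keys_iff lookup_minus)
  then show "(\<Sum>m\<in>?B. mterm (?m m) (coef g m)) \<in> polys W"
    using gW by (intro polys_sum polys_mono) blast
  show "coef k j \<le> d - 1" if k: "k \<in> supp (\<Sum>m\<in>?B. mterm (?m m) (coef g m))" for k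
  proof -
    have "\<exists>m\<in>?B. k \<in> supp (mterm (?m m) (coef g m))"
      using keys_sum[of "\<lambda>m. mterm (?m m) (coef g m)" ?B] k by blast
    then obtain m where "m \<in> ?B" "k = ?m m" by (auto split: if_splits)
    then have "coef k j = coef m j - 1" "coef m j \<le> d" using j by (auto simp: lookup_minus)
    then show ?thesis by simp
  qed
  show "(\<Sum>m\<in>?B. mterm (?m m) (coef g m)) = 0" if "d = 0" using that j by (intro sum.neutral) auto
qed

text \<open>Write \<open>g\<close> as \<open>g0\<close> plus the variable \<open>j\<close> times
  \<open>g1\<close>. As \<open>t j\<close> lies in \<open>P (Suc j)\<close>, so does the value of
  \<open>g0\<close>, and \<open>g0 = 0\<close> by induction on \<open>k - j\<close>. As
  \<open>t j\<close> is not in the prime \<open>P j\<close>, the value of \<open>g1\<close> lies in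
  \<open>P j\<close>, and the degree in the variable \<open>j\<close> has dropped. In the last step
  \<open>g\<close> is constant, and \<open>P k\<close> contains no nonzero constant.\<close>

lemma alg_indep_of_prime_chain:
  fixes P :: "nat \<Rightarrow> ('v, 'a::field) mpoly set"
  assumes P: "\<And>i. i \<le> k \<Longrightarrow> prime_set V (P i)" "\<And>i. i < k \<Longrightarrow> P i \<subseteq> P (Suc i)"
    and t: "\<And>i. i < k \<Longrightarrow> t i \<in> P (Suc i) \<and> t i \<notin> P i"
    and j: "j \<le> k" and g: "g \<in> polys {j..<k}" "psubst t g \<in> P j"
  shows "g = 0"
  using j g
proof (induction "k - j" arbitrary: j g)
  case 0
  then have jk: "j = k" by simp
  then have "m = 0" if "m \<in> supp g" for m using that 0 keys_eq_empty[of m] by (auto simp: polys_def)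
  then have "supp g \<subseteq> {0}" by blast
  then have gc: "g = mterm 0 (coef g 0)" using poly_as_sum'[of "{0}" g] by simp
  show ?case
  proof (rule ccontr)
    assume "g \<noteq> 0"
    have c: "coef g 0 \<noteq> 0"
    proof
      assume z: "coef g 0 = 0"
      have "g = mterm 0 0" using gc unfolding z .
      then show False using \<open>g \<noteq> 0\<close> by simp
    qed
    have "psubst t g = mterm 0 (coef g 0)" using arg_cong[OF gc, of "psubst t"]
      unfolding psubst_const .
    then have "mterm 0 (coef g 0) \<in> P k" using 0(4) jk by simp
    then have "mterm 0 (inverse (coef g 0)) * mterm 0 (coef g 0) \<in> P k"
      using P(1)[of k] polys_const unfolding prime_set_def by blast
    then show False using P(1)[of k] c by (simp add: mult_single prime_set_def)
  qed
next
  case (Suc x)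
  then have jk: "j < k" by simp
  have tV: "t i \<in> polys V" if "i < k" for i using t[OF that] P(1)[of "Suc i"] that
    unfolding prime_set_def by auto
  have main: "g = 0" if "g \<in> polys {j..<k}" "psubst t g \<in> P j" "\<And>m. m \<in> supp g \<Longrightarrow> coef m j \<le> d"
    for d g
    using that
  proof (induction d arbitrary: g)
    case (0 g)
    obtain g0 g1 where g01: "g = g0 + mpoly_var j * g1" "g0 \<in> polys ({j..<k} - {j})" "g1 = 0"
      using split_off_var[OF 0(1), of j 0] 0(3) jk by auto
    have "{j..<k} - {j} = {Suc j..<k}" by auto
    then show ?case using Suc.hyps(1)[of "Suc j" g0] Suc.hyps(2) jk g01 0(2) P(2)[OF jk] by auto
  next
    case (Suc d g)
    obtain g0 g1 where g01: "g = g0 + mpoly_var j * g1" "g0 \<in> polys ({j..<k} - {j})"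
      "g1 \<in> polys {j..<k}"
      "\<And>m. m \<in> supp g1 \<Longrightarrow> coef m j \<le> d"
      using split_off_var[OF Suc.prems(1), of j "Suc d"] Suc.prems(3) jk by auto
    have s1: "psubst t g1 \<in> polys V" using g01(3) tV by (intro psubst_polys) auto
    have e: "psubst t g = psubst t g0 + t j * psubst t g1"
      by (simp add: g01 psubst_add psubst_mult psubst_var)
    have "t j * psubst t g1 \<in> P (Suc j)"
    proof -
      have "psubst t g1 * t j \<in> P (Suc j)"
        using P(1)[of "Suc j"] t[OF jk] s1 jk unfolding prime_set_def by auto
      then show ?thesis by (simp add: mult.commute)
    qed
    moreover have "psubst t g \<in> P (Suc j)" using Suc.prems(2) P(2)[OF jk] by blast
    ultimately have "psubst t g0 \<in> P (Suc j)"
      using prime_set_diff[of V "P (Suc j)" "psubst t g" "t j * psubst t g1"] P(1)[of "Suc j"] jk e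
        by simp
    moreover have "{j..<k} - {j} = {Suc j..<k}" by auto
    ultimately have g0: "g0 = 0" using \<open>\<And>j g. x = k - j \<Longrightarrow> j \<le> k \<Longrightarrow> g \<in> polys {j..<k} \<Longrightarrow> psubst t g \<in> P
      j \<Longrightarrow> g = 0\<close>[of "Suc j" g0]
      \<open>Suc x = k - j\<close> jk g01(2) by simp
    then have "t j * psubst t g1 \<in> P j" using Suc.prems(2) e by simp
    then have "psubst t g1 \<in> P j" using P(1)[of j] t[OF jk] tV[OF jk] s1 jk unfolding prime_set_def
      by auto
    then have "g1 = 0" using Suc.IH g01 by blast
    then show ?case using g0 g01 by simp
  qed
  obtain d where "\<And>m. m \<in> supp g \<Longrightarrow> coef m j \<le> d"
  proof
    show "coef m j \<le> Max ((\<lambda>m. coef m j) ` supp g)" if "m \<in> supp g"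
      for m using that by (intro Max_ge) auto
  qed
  then show ?case using main Suc.prems by blast
qed

subsection \<open>Top forms\<close>

lemma card_additive:
  fixes g :: "'a::ab_group_add \<Rightarrow> 'b::ab_group_add"
  assumes fin: "finite H" and H: "0 \<in> H" "\<And>x y. x \<in> H \<Longrightarrow> y \<in> H \<Longrightarrow> x + y \<in> H"
    "\<And>x y. x \<in> H \<Longrightarrow> y \<in> H \<Longrightarrow> x - y \<in> H"
    and g: "\<And>x y. x \<in> H \<Longrightarrow> y \<in> H \<Longrightarrow> g (x + y) = g x + g y"
  shows "card H = card {x \<in> H. g x = 0} * card (g ` H)"
proof -
  let ?K = "{x \<in> H. g x = 0}"
  have gm: "g (x - y) = g x - g y" if "x \<in> H" "y \<in> H" for x y
    using g[of "x - y" y] H(3)[OF that] that by (simp add: algebra_simps)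
  have fib: "card {x \<in> H. g x = z} = card ?K" if z: "z \<in> g ` H" for z
  proof -
    obtain h where h: "h \<in> H" "z = g h" using z by blast
    have "bij_betw (\<lambda>x. x + h) ?K {x \<in> H. g x = z}"
      by (rule bij_betwI[where g = "\<lambda>x. x - h"]) (use h H g gm in auto)
    then show ?thesis by (simp add: bij_betw_same_card)
  qed
  have "H = (\<Union>z\<in>g ` H. {x \<in> H. g x = z})" by blast
  then have "card H = card (\<Union>z\<in>g ` H. {x \<in> H. g x = z})" by simp
  also have "\<dots> = (\<Sum>z\<in>g ` H. card {x \<in> H. g x = z})"
    using fin by (intro card_UN_disjoint) auto
  also have "\<dots> = card ?K * card (g ` H)" using fib by simp
  finally show ?thesis .
qed

lift_definition hcomp :: "('v \<Rightarrow> nat) \<Rightarrow> nat \<Rightarrow> ('v, 'a::zero) mpoly \<Rightarrow> ('v, 'a) mpoly" is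
  "\<lambda>w d f m. if wt w m = d then f m else 0"
  by (erule rev_finite_subset) auto

lemma lookup_hcomp: "coef (hcomp w d f) m = (if wt w m = d then coef f m else 0)"
  by transfer simp

lemma hcomp_add: "hcomp w d (f + g) = hcomp w d f + hcomp w d (g :: ('v, 'a::comm_ring_1) mpoly)"
  by (rule poly_mapping_eqI) (simp add: lookup_hcomp lookup_add)

lemma hcomp_0 [simp]: "hcomp w d 0 = 0"
  by (rule poly_mapping_eqI) (simp add: lookup_hcomp)

text \<open>Reduction discards whole monomials and hence respects the grading by any weight.\<close>

lemma hcomp_red: "hcomp w d (red q f) = red q (hcomp w d f)"
  by (rule poly_mapping_eqI) (simp add: lookup_hcomp lookup_red)

lemma supp_hcomp: "supp (hcomp w d f) = {m \<in> supp f. wt w m = d}"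
  by (auto simp: in_keys_iff lookup_hcomp split: if_splits)

lemma hcomp_id: "(\<And>m. m \<in> supp f \<Longrightarrow> wt w m = d) \<Longrightarrow> hcomp w d f = f"
  by (rule poly_mapping_eqI) (auto simp: lookup_hcomp in_keys_iff)

lemma hcomp_zeroI: "(\<And>m. m \<in> supp f \<Longrightarrow> wt w m \<noteq> d) \<Longrightarrow> hcomp w d f = 0"
  by (rule poly_mapping_eqI) (auto simp: lookup_hcomp in_keys_iff)

lemma hcomp_top_mult:
  fixes T R a :: "('v, 'a::comm_ring_1) mpoly"
  assumes T: "\<And>m. m \<in> supp T \<Longrightarrow> wt w m = D" and R: "\<And>m. m \<in> supp R \<Longrightarrow> wt w m < D"
    and a: "\<And>m. m \<in> supp a \<Longrightarrow> wt w m \<le> i"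
  shows "hcomp w (D + i) ((T + R) * a) = T * hcomp w i a"
proof -
  define b where "b = a - hcomp w i a"
  have ab: "a = hcomp w i a + b" by (simp add: b_def)
  have b: "wt w m < i" if m: "m \<in> supp b" for m
  proof -
    have "coef a m \<noteq> 0 \<and> wt w m \<noteq> i"
      using m by (auto simp: b_def in_keys_iff lookup_minus lookup_hcomp split: if_splits)
    then have "m \<in> supp a" "wt w m \<noteq> i" by (auto simp: in_keys_iff)
    then show ?thesis using a by fastforce
  qed
  have "(T + R) * a = T * hcomp w i a + (T * b + R * a)"
    by (subst (1 2) ab) (simp add: algebra_simps)
  moreover have "hcomp w (D + i) (T * hcomp w i a) = T * hcomp w i a"
  proof (rule hcomp_id)
    fix m assume "m \<in> supp (T * hcomp w i a)"
    then obtain k l where "m = k + l" "k \<in> supp T" "l \<in> supp (hcomp w i a)" by (rule supp_mult_E)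
    then show "wt w m = D + i" using T by (simp add: wt_add supp_hcomp)
  qed
  moreover have "hcomp w (D + i) (T * b) = 0"
  proof (rule hcomp_zeroI)
    fix m assume "m \<in> supp (T * b)"
    then obtain k l where kl: "m = k + l" "k \<in> supp T" "l \<in> supp b" by (rule supp_mult_E)
    then show "wt w m \<noteq> D + i" using T[OF kl(2)] b[OF kl(3)] by (simp add: wt_add)
  qed
  moreover have "hcomp w (D + i) (R * a) = 0"
  proof (rule hcomp_zeroI)
    fix m assume "m \<in> supp (R * a)"
    then obtain k l where kl: "m = k + l" "k \<in> supp R" "l \<in> supp a" by (rule supp_mult_E)
    then show "wt w m \<noteq> D + i" using R[OF kl(2)] a[OF kl(3)] by (simp add: wt_add)
  qed
  ultimately show ?thesis by (simp add: hcomp_add)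
qed

lemma mult_image_box:
  fixes F :: "('v, 'a::comm_ring_1) mpoly"
  assumes "q > 0"
  shows "mult_image q V F = (\<lambda>a. red q (F * a)) ` {a. supp a \<subseteq> box q V}"
proof
  show "mult_image q V F \<subseteq> (\<lambda>a. red q (F * a)) ` {a. supp a \<subseteq> box q V}"
  proof
    fix x assume "x \<in> mult_image q V F"
    then obtain s where s: "s \<in> polys V" "x = red q (F * s)" by (auto simp: mult_image_def)
    have "x = red q (F * red q s)" unfolding s(2) using red_red_mult[of q s F]
      by (simp add: mult.commute)
    then show "x \<in> (\<lambda>a. red q (F * a)) ` {a. supp a \<subseteq> box q V}"
      using supp_red[OF s(1) assms] by blast
  qed
  have "a \<in> polys V" if "supp a \<subseteq> box q V" for a :: "('v, 'a) mpoly"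
    using that box_iff[OF assms, of _ V] unfolding polys_def by blast
  then show "(\<lambda>a. red q (F * a)) ` {a. supp a \<subseteq> box q V} \<subseteq> mult_image q V F"
    by (auto simp: mult_image_def)
qed

text \<open>If \<open>(T + R) * a\<close> reduces to 0, then so does \<open>T\<close> times the top
  component of \<open>a\<close>. Filtering the kernels by weight, the kernel for
  \<open>T + R\<close> is therefore at most as large as that for \<open>T\<close>, and the images
  compare the other way round.\<close>

lemma card_mult_image_top_form:
  fixes T R :: "('v, 'a::{comm_ring_1,finite}) mpoly"
  assumes V: "finite V" and q: "q > 0"
    and T: "\<And>m. m \<in> supp T \<Longrightarrow> wt w m = D" and R: "\<And>m. m \<in> supp R \<Longrightarrow> wt w m < D"
  shows "card (mult_image q V T) \<le> card (mult_image q V (T + R))"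
proof -
  define A :: "('v, 'a) mpoly set" where "A = {a. supp a \<subseteq> box q V}"
  have finA: "finite A" unfolding A_def by (rule card_supported) (use V in simp)
  have A: "0 \<in> A" "a + b \<in> A" "a - b \<in> A" if "a \<in> A" "b \<in> A" for a b
    using that keys_add[of a b] keys_diff[of a b] by (auto simp: A_def)
  define K where "K F i = {a \<in> A. red q (F * a) = 0 \<and> (\<forall>m\<in>supp a. wt w m < i)}"
    for F :: "('v, 'a) mpoly" and i
  define H where "H F i = {a \<in> A. red q (F * a) = 0 \<and> (\<forall>m\<in>supp a. wt w m = i)}"
    for F :: "('v, 'a) mpoly" and i
  have finK: "finite (K F i)" "finite (H F i)" for F i using finA by (simp_all add: K_def H_def)
  have zA: "0 \<in> A" by (simp add: A_def)
  have K_le: "card (K (T + R) i) \<le> card (K T i)" for i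
  proof (induction i)
    case 0
    have "a = 0" if "\<forall>m\<in>supp a. False" for a :: "('v, 'a) mpoly"
      using that keys_eq_empty[of a] by blast
    then have "K F 0 = {0}" for F by (auto simp: K_def zA)
    then show ?case by simp
  next
    case (Suc i)
    let ?K = "K (T + R) (Suc i)"
    have c1: "card ?K = card {a \<in> ?K. hcomp w i a = 0} * card (hcomp w i ` ?K)"
    proof (rule card_additive)
      show "finite ?K" by (rule finK)
      show "0 \<in> ?K" by (simp add: K_def zA)
      show "x + y \<in> ?K" if "x \<in> ?K" "y \<in> ?K" for x y
        using that A(2)[of x y] keys_add[of x y] by (auto simp: K_def distrib_left red_add)
      show "x - y \<in> ?K" if "x \<in> ?K" "y \<in> ?K" for x y
        using that A(3)[of x y] keys_diff[of x y] by (auto simp: K_def right_diff_distrib red_diff)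
    qed (rule hcomp_add)
    have "{a \<in> ?K. hcomp w i a = 0} \<subseteq> K (T + R) i"
    proof
      fix a assume a: "a \<in> {a \<in> ?K. hcomp w i a = 0}"
      have "wt w m < i" if m: "m \<in> supp a" for m
      proof -
        have "m \<notin> supp (hcomp w i a)" using a by simp
        then have "wt w m \<noteq> i" using m by (simp add: supp_hcomp)
        moreover have "wt w m < Suc i" using a m by (simp add: K_def)
        ultimately show ?thesis by simp
      qed
      then show "a \<in> K (T + R) i" using a by (simp add: K_def)
    qed
    then have c2: "card {a \<in> ?K. hcomp w i a = 0} \<le> card (K (T + R) i)"
      using finK by (intro card_mono) auto
    have "hcomp w i ` ?K \<subseteq> H T i"
    proof
      fix b assume "b \<in> hcomp w i ` ?K"
      then obtain a where a: "a \<in> ?K" "b = hcomp w i a" by blast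
      have "red q (T * b) = red q (hcomp w (D + i) ((T + R) * a))"
        unfolding a(2) using T R a(1) by (subst hcomp_top_mult) (auto simp: K_def less_Suc_eq_le)
      also have "\<dots> = hcomp w (D + i) (red q ((T + R) * a))" by (simp add: hcomp_red)
      also have "\<dots> = 0" using a(1) by (simp add: K_def)
      finally have "red q (T * b) = 0" .
      moreover have "b \<in> A" using a(1) by (auto simp: a(2) K_def A_def supp_hcomp)
      ultimately show "b \<in> H T i" by (auto simp: H_def a(2) supp_hcomp)
    qed
    then have c3: "card (hcomp w i ` ?K) \<le> card (H T i)" using finK by (intro card_mono) auto
    have "card ?K \<le> card (K T i) * card (H T i)"
      unfolding c1 by (rule mult_le_mono[OF order.trans[OF c2 Suc.IH] c3])
    also have "\<dots> = card (K T i \<times> H T i)" by (simp add: card_cartesian_product)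
    \<comment> \<open>The sum is direct because its two parts live in different weights; being
      annihilated by \<open>T\<close>, both stay inside the kernel for \<open>T\<close>.\<close>
    also have "\<dots> = card ((\<lambda>(u, v). u + v) ` (K T i \<times> H T i))"
    proof (rule card_image[symmetric], rule inj_onI)
      fix x y assume xy: "x \<in> K T i \<times> H T i" "y \<in> K T i \<times> H T i"
        "(case x of (u, v) \<Rightarrow> u + v) = (case y of (u, v) \<Rightarrow> u + v)"
      obtain u v u' v' where x: "x = (u, v)" "y = (u', v')" by (cases x; cases y)
      have c: "hcomp w i u = 0" "hcomp w i u' = 0" "hcomp w i v = v" "hcomp w i v' = v'"
        using xy x by (auto simp: K_def H_def intro!: hcomp_zeroI hcomp_id)
      have "hcomp w i (u + v) = hcomp w i (u' + v')" using xy x by simp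
      then have "v = v'" by (simp add: hcomp_add c)
      then show "x = y" using xy x by simp
    qed
    also have "\<dots> \<le> card (K T (Suc i))"
    proof (rule card_mono[OF finK(1)], rule)
      fix z assume "z \<in> (\<lambda>(u, v). u + v) ` (K T i \<times> H T i)"
      then obtain u v where z: "z = u + v" "u \<in> K T i" "v \<in> H T i" by auto
      then show "z \<in> K T (Suc i)"
        using A(2)[of u v] keys_add[of u v]
          by (auto simp: K_def H_def distrib_left red_add less_SucI)
    qed
    finally show ?case .
  qed
  \<comment> \<open>Larger than every weight in the finite box, so the filtration is exhausted at
    \<open>B\<close>.\<close>
  define B where "B = Suc (Max (insert 0 (wt w ` box q V)))"
  have KB: "K F B = {a \<in> A. red q (F * a) = 0}" for F
  proof -
    have "wt w m < B" if "a \<in> A" "m \<in> supp a" for a m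
    proof -
      have "m \<in> box q V" using that by (auto simp: A_def)
      then have "wt w m \<le> Max (insert 0 (wt w ` box q V))" using V by (intro Max_ge) auto
      then show ?thesis by (simp add: B_def)
    qed
    then show ?thesis by (auto simp: K_def)
  qed
  have split: "card A = card (K F B) * card (mult_image q V F)" for F
  proof -
    have "card A = card {a \<in> A. red q (F * a) = 0} * card ((\<lambda>a. red q (F * a)) ` A)"
      by (rule card_additive) (use finA A zA in \<open>auto simp: distrib_left red_add\<close>)
    then show ?thesis by (simp add: KB mult_image_box[OF q] A_def)
  qed
  have pos: "card A > 0" using finA zA by (auto simp: card_gt_0_iff)
  \<comment> \<open>Kernel times image is the size of the whole box space for both
    multipliers.\<close>
  have eq: "card (K T B) * card (mult_image q V T)
    = card (K (T + R) B) * card (mult_image q V (T + R))"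
    using split by metis
  also have "\<dots> \<le> card (K T B) * card (mult_image q V (T + R))" using K_le by simp
  finally show ?thesis using pos split[of T] by auto
qed

subsection \<open>Krull dimension\<close>

lemma prime_set_kernel:
  fixes y :: "'v \<Rightarrow> ('w::linorder, 'a::idom) mpoly"
  shows "prime_set V {s \<in> polys V. psubst y s = 0}"
  by (auto simp: prime_set_def psubst_add psubst_mult)

text \<open>A substitution without constant terms sends the origin to the origin.\<close>

lemma coef_0_psubst:
  assumes "s \<in> polys V" "\<And>v. v \<in> V \<Longrightarrow> coef (y v) 0 = 0"
  shows "coef (psubst y s) 0 = coef s (0 :: 'v \<Rightarrow>\<^sub>0 nat)"
  using assms(1)
proof (induction rule: polys_induct)
  case (mterm m c)
  show ?case
  proof (cases "m = 0")
    case False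
    then obtain v where v: "v \<in> supp m" using keys_eq_empty[of m] by blast
    then have "v \<in> V" using mterm by blast
    have "coef (mon_subst y m) 0 = 0"
      unfolding mon_subst_def coef_0_prod
      using v assms(2)[OF \<open>v \<in> V\<close>] by (intro prod_zero) (auto simp: coef_0_power in_keys_iff
        power_0_left intro!: bexI[of _ v])
    then show ?thesis using False by (simp add: psubst_mterm coef_0_mult lookup_single)
  qed simp
qed (simp_all add: psubst_add lookup_add)

lemma psubst_box_weight:
  fixes t :: "nat \<Rightarrow> ('v, 'a::comm_ring_1) mpoly"
  assumes t: "\<And>i m. i < k \<Longrightarrow> m \<in> supp (t i) \<Longrightarrow> wt w m \<le> b"
    and g: "supp g \<subseteq> box D {..<k}" and m: "m \<in> supp (psubst t g)"
  shows "wt w m \<le> k * (D * b)"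
proof -
  have pw: "wt w m \<le> c * b" if "i < k" "m \<in> supp (t i ^ c)" for i c m
    using that
  proof (induction c arbitrary: m)
    case 0
    then show ?case by simp
  next
    case (Suc c)
    from Suc.prems(2) have "m \<in> supp (t i * t i ^ c)" by simp
    then obtain u v where uv: "m = u + v" "u \<in> supp (t i)" "v \<in> supp (t i ^ c)"
      by (rule supp_mult_E)
    then show ?case using Suc.IH[OF Suc.prems(1) uv(3)] t[OF Suc.prems(1) uv(2)]
      by (simp add: wt_add)
  qed
  have pr: "wt w m \<le> (\<Sum>i\<in>A. c i * b)" if "finite A" "A \<subseteq> {..<k}" "m \<in> supp (\<Prod>i\<in>A. t i ^ c i)"
    for A c m
    using that
  proof (induction A arbitrary: m)
    case empty
    then show ?case by simp
  next
    case (insert i A)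
    from insert.prems(2) insert.hyps have "m \<in> supp (t i ^ c i * (\<Prod>i\<in>A. t i ^ c i))" by simp
    then obtain u v where uv: "m = u + v" "u \<in> supp (t i ^ c i)" "v \<in> supp (\<Prod>i\<in>A. t i ^ c i)"
      by (rule supp_mult_E)
    have "wt w v \<le> (\<Sum>i\<in>A. c i * b)" using insert.IH[OF _ uv(3)] insert.prems(1) by blast
    moreover have "wt w u \<le> c i * b" using pw[OF _ uv(2)] insert.prems(1) by blast
    ultimately show ?case using insert.hyps by (simp add: wt_add uv(1))
  qed
  have "m \<in> (\<Union>n\<in>supp g. supp (mterm 0 (coef g n) * mon_subst t n))"
    using m keys_sum[of "\<lambda>n. mterm 0 (coef g n) * mon_subst t n" "supp g"] unfolding psubst_def
      by blast
  then obtain n where n: "n \<in> supp g" "m \<in> supp (mterm 0 (coef g n) * mon_subst t n)" by blast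
  have nb: "n \<in> box D {..<k}" using n g by blast
  then have ns: "supp n \<subseteq> {..<k}" by (simp add: mons_def)
  from n(2) obtain u v where uv: "m = u + v" "u \<in> supp (mterm 0 (coef g n))"
    "v \<in> supp (mon_subst t n)"
    by (rule supp_mult_E)
  have "wt w m = wt w v" using uv by (auto simp: wt_add split: if_splits)
  also have "\<dots> \<le> (\<Sum>i\<in>{..<k}. coef n i * b)"
    using uv(3) ns by (intro pr) (auto simp: mon_subst_superset[of "{..<k}"])
  also have "\<dots> \<le> (\<Sum>i\<in>{..<k}. D * b)"
    using nb by (intro sum_mono mult_right_mono) (auto simp: mons_def less_imp_le)
  also have "\<dots> = k * (D * b)" by simp
  finally show ?thesis .
qed

lemma pow_le_imp_exponent_le:
  fixes C a b :: nat
  assumes "\<And>D. D > 0 \<Longrightarrow> D ^ a \<le> C * D ^ b"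
  shows "a \<le> b"
proof (rule ccontr)
  assume "\<not> a \<le> b"
  then obtain c where c: "a = b + Suc c" using less_iff_Suc_add[of b a] by auto
  \<comment> \<open>With a larger exponent on the left, any \<open>D\<close> above the constant
    \<open>C\<close> violates the inequality.\<close>
  define D where "D = Suc C"
  have "D ^ b * D ^ Suc c \<le> D ^ b * C" 
  proof -
    have "D > 0" by (simp add: D_def)
    from assms[OF this] show ?thesis unfolding c power_add mult.commute[of C] .
  qed
  moreover have "D ^ b > 0" by (simp add: D_def)
  ultimately have "D ^ Suc c \<le> C" by (simp only: nat_mult_le_cancel1)
  moreover have "D \<le> D ^ Suc c" by (rule self_le_power) (simp_all add: D_def)
  ultimately show False by (simp add: D_def)
qed

text \<open>Picking \<open>t i\<close> in \<open>P (Suc i)\<close> outside \<open>P i\<close> gives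
  \<open>k\<close> elements that are algebraically independent modulo \<open>P 0\<close>, so their
  monomials with exponents below \<open>D\<close> contribute \<open>D ^ k\<close> dimensions. Modulo
  \<open>f\<close> they are expressed by standard monomials of weight linear in \<open>D\<close>, of
  which there are only about \<open>D ^ (card V - 1)\<close>.\<close>

lemma prime_chain_length:
  fixes P :: "nat \<Rightarrow> ('v, 'a::{field,finite}) mpoly set"
  assumes V: "finite V" "V \<noteq> {}" and P: "\<And>i. i \<le> k \<Longrightarrow> prime_set V (P i)"
    "\<And>i. i < k \<Longrightarrow> P i \<subset> P (Suc i)"
    and f: "f \<in> P 0" "leads w f m0" "\<And>v. coef m0 v \<le> 1" and w: "\<And>v. v \<in> V \<Longrightarrow> w v \<ge> 1"
  shows "k \<le> card V - 1"
proof -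
  have "\<exists>t. i < k \<longrightarrow> t \<in> P (Suc i) \<and> t \<notin> P i" for i using P(2)[of i] by blast
  then obtain t where t: "\<And>i. i < k \<Longrightarrow> t i \<in> P (Suc i) \<and> t i \<notin> P i" by metis
  have tV: "t i \<in> polys V" if "i < k" for i
    using t[OF that] P(1)[of "Suc i"] that unfolding prime_set_def by auto
  define b where "b = Max (insert 0 (wt w ` (\<Union>i\<in>{..<k}. supp (t i))))"
  have b: "wt w m \<le> b" if "i < k" "m \<in> supp (t i)" for i m
    unfolding b_def using that by (intro Max_ge) auto
  have P0: "prime_set V (P 0)" using P(1) by simp
  have fV: "f \<in> polys V" using f(1) P0 unfolding prime_set_def by blast
  have m0V: "supp m0 \<subseteq> V" using f(2) fV by (auto simp: leads_def polys_def in_keys_iff)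
  \<comment> \<open>The constant left after taking the powers of \<open>D\<close> out of the final
    count of standard monomials.\<close>
  define C where "C = card V * (k * b + 1) ^ (card V - 1)"
  have "D ^ k \<le> C * D ^ (card V - 1)" if D: "D > 0" for D
  proof -
    let ?W = "Suc (k * (D * b))"
    let ?G = "{g :: (nat, 'a) mpoly. supp g \<subseteq> box D {..<k}}"
    \<comment> \<open>A monomial not divisible by the squarefree \<open>m0\<close> lacks one of the
      variables, hence the exponent \<open>card V - 1\<close>; the weight bounds the other
      exponents.\<close>
    define Std where "Std = (\<Union>v\<in>V. mons V (\<lambda>u. if u = v then {0} else {..<?W}))"
    let ?S = "{s :: ('v, 'a) mpoly. supp s \<subseteq> Std}"
    have finStd: "finite Std" unfolding Std_def by (intro finite_UN_I finite_mons V) simp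
    have ex: "\<exists>s'\<in>?S. psubst t g - s' \<in> P 0" if g: "g \<in> ?G" for g
    proof -
      have gp: "g \<in> polys {..<k}" using g box_iff[OF D, of _ "{..<k}"] unfolding polys_def by blast
      have "\<exists>s'\<in>polys V. psubst t g - s' \<in> P 0 \<and> (\<forall>m\<in>supp s'. wt w m < ?W \<and>
        (\<forall>m'\<in>{m0}. \<nexists>d. m = m' + d))"
      proof (rule standard_monomials)
        show "0 \<in> P 0" "\<And>s t. s \<in> P 0 \<Longrightarrow> t \<in> P 0 \<Longrightarrow> s + t \<in> P 0"
          "\<And>s t. s \<in> polys V \<Longrightarrow> t \<in> P 0 \<Longrightarrow> s * t \<in> P 0"
          using P0 unfolding prime_set_def by blast+
        show "\<exists>F\<in>P 0 \<inter> polys V. leads w F m'" if "m' \<in> {m0}" for m' using that f fV by auto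
        show "psubst t g \<in> polys V" using gp tV by (intro psubst_polys) auto
        show "wt w m < ?W" if "m \<in> supp (psubst t g)" for m
          using psubst_box_weight[where k = k and t = t and w = w and b = b and D = D and g = g
            and m = m] b g that
          by (simp add: less_Suc_eq_le)
      qed
      then obtain s' where s': "s' \<in> polys V" "psubst t g - s' \<in> P 0"
        "\<And>m. m \<in> supp s' \<Longrightarrow> wt w m < ?W \<and> (\<nexists>d. m = m0 + d)"
        by auto
      have "m \<in> Std" if m: "m \<in> supp s'" for m
      proof -
        have mV: "supp m \<subseteq> V" using s'(1) m by (simp add: polys_def)
        have mW: "coef m v < ?W" if "v \<in> V" for v using wt_ge[of w v m] w[OF that] s'(3)[OF m]
          by simp
        have "\<exists>v\<in>V. coef m v = 0"
        proof (rule ccontr)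
          assume "\<not> ?thesis"
          then have pos: "coef m v \<ge> 1" if "v \<in> V" for v using that by (simp add: Suc_le_eq)
          have "coef m0 v \<le> coef m v" for v
          proof (cases "v \<in> V")
            case True
            then show ?thesis using f(3)[of v] pos[OF True] by simp
          next
            case False
            then have "v \<notin> supp m0" using m0V by blast
            then show ?thesis by (simp add: in_keys_iff)
          qed
          then have "m = m0 + (m - m0)" by (intro poly_mapping_eqI)
            (simp add: lookup_add lookup_minus)
          then show False using s'(3)[OF m] by blast
        qed
        then show ?thesis using mV mW by (auto simp: Std_def mons_def)
      qed
      then show ?thesis using s'(2) by blast
    qed
    then obtain N where N: "\<And>g. g \<in> ?G \<Longrightarrow> N g \<in> ?S \<and> psubst t g - N g \<in> P 0" by metis
    \<comment> \<open>Equal remainders put the value of \<open>g - h\<close> into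
      \<open>P 0\<close>, so algebraic independence forces \<open>g = h\<close>.\<close>
    have "inj_on N ?G"
    proof (rule inj_onI)
      fix g h assume gh: "g \<in> ?G" "h \<in> ?G" "N g = N h"
      have "psubst t g - N g \<in> P 0" "psubst t h - N h \<in> P 0"
        using N[OF gh(1)] N[OF gh(2)] by blast+
      then have "psubst t g - N g - (psubst t h - N h) \<in> P 0"
        by (rule prime_set_diff[OF P0])
      then have "psubst t (g - h) \<in> P 0" by (simp add: gh(3) psubst_diff)
      moreover have "g - h \<in> polys {0..<k}"
        using gh D keys_diff[of g h] unfolding polys_def by (fastforce simp: box_iff)
      ultimately have "g - h = 0"
        using alg_indep_of_prime_chain[of k V P t 0 "g - h"] P t by auto
      then show "g = h" by simp
    qed
    moreover have "N ` ?G \<subseteq> ?S" using N by blast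
    ultimately have "card ?G \<le> card ?S" using card_supported(1)[OF finStd] card_inj_on_le by blast
    then have "CARD('a) ^ (D ^ k) \<le> CARD('a) ^ card Std"
      using finStd by (simp add: card_supported card_box)
    moreover have "card {0, 1 :: 'a} \<le> CARD('a)" by (rule card_mono) auto
    then have "CARD('a) > 1" by simp
    ultimately have "D ^ k \<le> card Std" by simp
    also have "\<dots> \<le> (\<Sum>v\<in>V. card (mons V (\<lambda>u. if u = v then {0} else {..<?W})))"
      unfolding Std_def using V by (intro card_UN_le)
    also have "\<dots> = (\<Sum>v\<in>V. ?W ^ (card V - 1))"
    proof (rule sum.cong)
      fix v assume v: "v \<in> V"
      have "card (mons V (\<lambda>u. if u = v then {0} else {..<?W}))
        = (\<Prod>u\<in>V. card (if u = v then {0} else {..<?W}))"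
        by (rule card_mons[OF V(1)])
      also have "\<dots> = (\<Prod>u\<in>V - {v}. ?W)"
        using v V by (subst prod.remove[of V v]) (auto intro!: prod.cong)
      also have "\<dots> = ?W ^ (card V - 1)" using v by (simp add: card_Diff_singleton)
      finally show "card (mons V (\<lambda>u. if u = v then {0} else {..<?W})) = ?W ^ (card V - 1)" .
    qed simp
    also have "\<dots> = card V * ?W ^ (card V - 1)" by simp
    also have "\<dots> \<le> card V * (D * (k * b + 1)) ^ (card V - 1)"
      using D by (intro mult_left_mono power_mono) (auto simp: algebra_simps)
    also have "\<dots> = C * D ^ (card V - 1)" unfolding C_def power_mult_distrib by (simp only: mult_ac)
    finally show ?thesis .
  qed
  then show ?thesis by (rule pow_le_imp_exponent_le)
qed

context local_hypersurface
begin

lemma prime_set_of_primeideal: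
  assumes "primeideal P L" shows "prime_set V {s \<in> polys V. \<phi> s \<in> P}"
proof -
  interpret P: primeideal P L by fact
  have "\<phi> 1 \<notin> P" using P.I_notcarr P.one_imp_carrier by (auto simp: phi_1)
  moreover have "\<phi> s \<in> P \<or> \<phi> t \<in> P" if "s \<in> polys V" "t \<in> polys V" "\<phi> s \<otimes> \<phi> t \<in> P" for s t
    using P.I_prime[OF _ _ that(3)] that by simp
  ultimately show ?thesis
    by (auto simp: prime_set_def phi_add phi_mult P.I_l_closed)
qed

lemma krull_dim_le:
  assumes f: "leads w f m0" "\<And>v. coef m0 v \<le> 1" and w: "\<And>v. v \<in> V \<Longrightarrow> w v \<ge> 1" and "V \<noteq> {}"
  shows "krull_dim L \<le> enat (card V - 1)"
  unfolding krull_dim_def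
proof (rule Sup_least)
  fix x assume "x \<in> {enat k | k. \<exists>P :: nat \<Rightarrow> 'l set. (\<forall>i\<le>k. primeideal (P i) L) \<and>
    (\<forall>i<k. P i \<subset> P (Suc i))}"
  then obtain k and P :: "nat \<Rightarrow> 'l set" where x: "x = enat k"
    and P: "\<And>i. i \<le> k \<Longrightarrow> primeideal (P i) L" "\<And>i. i < k \<Longrightarrow> P i \<subset> P (Suc i)"
    by blast
  define Q where "Q i = {s \<in> polys V. \<phi> s \<in> P i}" for i
  have "k \<le> card V - 1"
  proof (rule prime_chain_length[OF finV assms(4), where P = Q and f = f])
    show "prime_set V (Q i)" if "i \<le> k" for i unfolding Q_def
      by (rule prime_set_of_primeideal[OF P(1)[OF that]])
    \<comment> \<open>Denominators are units, so an element separating two primes of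
      \<open>L\<close> may be replaced by its numerator.\<close>
    show "Q i \<subset> Q (Suc i)" if i: "i < k" for i
    proof -
      interpret Pi: primeideal "P i" L using P(1) i by simp
      interpret Ps: primeideal "P (Suc i)" L using P(1) i by simp
      obtain y where y: "y \<in> P (Suc i)" "y \<notin> P i" using P(2)[OF i] by blast
      have yL: "y \<in> carrier L" using y Ps.a_Hcarr by blast
      obtain s u where r: "rep y s u" using ex_rep[OF yL] by blast
      then have su: "s \<in> polys V" "u \<in> units" "y \<otimes> \<phi> u = \<phi> s" by (auto simp: rep_def)
      have "\<phi> s \<in> P (Suc i)" using Ps.I_r_closed[OF y(1), of "\<phi> u"] su by simp
      moreover have "\<phi> s \<notin> P i"
      proof
        assume "\<phi> s \<in> P i"
        then have "\<phi> s \<otimes> inv (\<phi> u) \<in> P i" using su by (intro Pi.I_r_closed) auto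
        moreover have "\<phi> s \<otimes> inv (\<phi> u) = y" unfolding su(3)[symmetric] using su(2) yL
          by (simp add: m_assoc)
        ultimately show False using y by simp
      qed
      ultimately have "s \<in> Q (Suc i)" "s \<notin> Q i" using su by (auto simp: Q_def)
      moreover have "Q i \<subseteq> Q (Suc i)" using P(2)[OF i] by (auto simp: Q_def)
      ultimately show ?thesis by blast
    qed
    interpret P0: primeideal "P 0" L using P(1) by simp
    have "\<phi> f = \<zero>" using phi_f[of 1] by simp
    then show "f \<in> Q 0" using fV P0.zero_closed by (simp add: Q_def)
  qed (use f w in auto)
  then show "x \<le> enat (card V - 1)" by (simp add: x)
qed

text \<open>Primes that contain \<open>f\<close> and lie in the ideal of the origin survive the
  passage to \<open>L\<close>: membership of a fraction is tested on its numerator.\<close>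

lemma krull_dim_ge:
  assumes Q: "\<And>i. i \<le> k \<Longrightarrow> prime_set V (Q i)" "\<And>i. i < k \<Longrightarrow> Q i \<subset> Q (Suc i)"
    and f: "f \<in> Q 0" and c0: "\<And>s i. i \<le> k \<Longrightarrow> s \<in> Q i \<Longrightarrow> coef s 0 = 0"
  shows "krull_dim L \<ge> enat k"
proof -
  define P where "P i = {y \<in> carrier L. \<exists>s u. rep y s u \<and> s \<in> Q i}" for i
  have fQ: "f \<in> Q i" if "i \<le> k" for i
    using that
  proof (induction i)
    case (Suc i)
    then show ?case using Q(2)[of i] by auto
  qed (rule f)
  have QV: "s \<in> polys V" if "s \<in> Q i" "i \<le> k" for s i using that Q(1) unfolding prime_set_def
    by blast
  have unit_notin: "u \<notin> Q i" if "u \<in> units" "i \<le> k" for u i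
    using units_coef_0[OF that(1)] c0[OF that(2)] by blast
  \<comment> \<open>Two numerators of one element agree up to units and a multiple of
    \<open>f\<close>. Units are outside \<open>Q i\<close> and \<open>f\<close> is inside, so
    primality makes the test independent of the representation.\<close>
  have rep_Q: "s \<in> Q i" if i: "i \<le> k" and r: "rep y s u" and y: "y \<in> P i" for y s u i
  proof -
    obtain t w where t: "rep y t w" "t \<in> Q i" using y by (auto simp: P_def)
    have c: "s \<in> polys V" "u \<in> units" "t \<in> polys V" "w \<in> units" using r t by (auto simp: rep_def)
    have "\<phi> (s * w - t * u) = \<zero>" by (rule rep_unique[OF r t(1)])
    then obtain v x where v: "v \<in> units" "x \<in> polys V" "v * (s * w - t * u) = f * x"
      using phi_ker_units[of "s * w - t * u"] c by auto
    have Qi: "prime_set V (Q i)" using Q(1) i by simp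
    have "x * f \<in> Q i" "(v * u) * t \<in> Q i"
      using Qi fQ[OF i] v c t(2) unfolding prime_set_def by auto
    then have "x * f + (v * u) * t \<in> Q i" using Qi unfolding prime_set_def by blast
    moreover have "x * f + (v * u) * t = (v * w) * s" using v(3) by (simp add: algebra_simps)
    ultimately have "(v * w) * s \<in> Q i" by simp
    moreover have "v * w \<notin> Q i" using unit_notin[OF units_mult[OF v(1) c(4)] i] .
    moreover have "v * w \<in> polys V" using v c by simp
    ultimately show ?thesis using Qi c(1) unfolding prime_set_def by blast
  qed
  have prime: "primeideal (P i) L" if i: "i \<le> k" for i
  proof -
    have Qi: "0 \<in> Q i" "\<And>s t. s \<in> Q i \<Longrightarrow> t \<in> Q i \<Longrightarrow> s + t \<in> Q i"
      "\<And>s t. s \<in> polys V \<Longrightarrow> t \<in> Q i \<Longrightarrow> s * t \<in> Q i"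
      "\<And>s t. s \<in> polys V \<Longrightarrow> t \<in> polys V \<Longrightarrow> s * t \<in> Q i \<Longrightarrow> s \<in> Q i \<or> t \<in> Q i"
      using Q(1)[OF i] unfolding prime_set_def by blast+
    have mulP: "a \<otimes> x \<in> P i" if a: "a \<in> P i" "x \<in> carrier L" for a x
    proof -
      obtain s u where s: "rep a s u" "s \<in> Q i" using a by (auto simp: P_def)
      obtain t w where t: "rep x t w" using ex_rep a by blast
      have "a \<otimes> x \<otimes> (\<phi> u \<otimes> \<phi> w) = (a \<otimes> \<phi> u) \<otimes> (x \<otimes> \<phi> w)"
        using s(1)[unfolded rep_def, THEN conjunct2, THEN conjunct1] t[unfolded rep_def, THEN
          conjunct2, THEN conjunct1] a
        by (simp add: P_def m_ac)
      then have "rep (a \<otimes> x) (s * t) (u * w)" using s t a by (auto simp: rep_def phi_mult P_def)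
      moreover have "s * t \<in> Q i" using Qi(3)[of t s] s t by (auto simp: rep_def mult.commute)
      ultimately show ?thesis using a by (auto simp: P_def)
    qed
    have id: "ideal (P i) L"
    proof (rule idealI)
      show "ring L" by (rule ring_axioms)
      show "subgroup (P i) (add_monoid L)"
      proof (rule add.subgroupI)
        show "P i \<subseteq> carrier L" by (auto simp: P_def)
        have "rep \<zero> 0 1" using rep_phi[of 0] by simp
        then show "P i \<noteq> {}" using Qi(1) by (auto simp: P_def)
        fix a assume a: "a \<in> P i"
        then have aL: "a \<in> carrier L" by (simp add: P_def)
        have "\<ominus> a = a \<otimes> \<ominus> \<one>" using aL by (simp add: r_minus)
        then show "\<ominus> a \<in> P i" using mulP[OF a, of "\<ominus> \<one>"] by simp
        fix b assume b: "b \<in> P i"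
        then have bL: "b \<in> carrier L" by (simp add: P_def)
        obtain s t u where st: "rep a s u" "rep b t u" by (rule ex_common_rep[OF aL bL])
        have "s \<in> Q i" "t \<in> Q i" using rep_Q[OF i] st a b by auto
        moreover have "rep (a \<oplus> b) (s + t) u" using st by (simp add: rep_def phi_add l_distr)
        ultimately show "a \<oplus> b \<in> P i" using Qi(2) aL bL unfolding P_def by blast
      qed
      show "a \<otimes> x \<in> P i" if "a \<in> P i" "x \<in> carrier L" for a x by (rule mulP[OF that])
      show "x \<otimes> a \<in> P i" if "a \<in> P i" "x \<in> carrier L" for a x
        using mulP[OF that] m_comm[of x a] that by (simp add: P_def)
    qed
    show ?thesis
    proof (rule primeidealI[OF id is_cring])
      have "\<one> \<notin> P i"
      proof
        assume "\<one> \<in> P i"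
        then have "1 \<in> Q i" using rep_Q[OF i rep_phi[OF polys_1]] by (simp add: phi_1)
        then show False using unit_notin[OF units_1 i] by simp
      qed
      then show "carrier L \<noteq> P i" by auto
      fix a b assume ab: "a \<in> carrier L" "b \<in> carrier L" "a \<otimes> b \<in> P i"
      obtain s u where s: "rep a s u" using ex_rep ab by blast
      obtain t w where t: "rep b t w" using ex_rep ab by blast
      have "a \<otimes> b \<otimes> (\<phi> u \<otimes> \<phi> w) = (a \<otimes> \<phi> u) \<otimes> (b \<otimes> \<phi> w)"
        using s[unfolded rep_def, THEN conjunct2, THEN conjunct1] t[unfolded rep_def, THEN
          conjunct2, THEN conjunct1] ab
        by (simp add: m_ac)
      then have "rep (a \<otimes> b) (s * t) (u * w)" using s t ab by (auto simp: rep_def phi_mult)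
      then have "s * t \<in> Q i" using rep_Q[OF i] ab by blast
      then have "s \<in> Q i \<or> t \<in> Q i" using Qi(4) s t by (auto simp: rep_def)
      then show "a \<in> P i \<or> b \<in> P i" using s t ab unfolding P_def by blast
    qed
  qed
  have "P i \<subset> P (Suc i)" if i: "i < k" for i
  proof -
    have "P i \<subseteq> P (Suc i)" using Q(2)[OF i] unfolding P_def by blast
    moreover obtain s where s: "s \<in> Q (Suc i)" "s \<notin> Q i" using Q(2)[OF i] by blast
    have sV: "s \<in> polys V" using QV s(1) i by simp
    have "\<phi> s \<in> P (Suc i)" using rep_phi[OF sV] s(1) sV unfolding P_def by auto
    moreover have "\<phi> s \<notin> P i" using rep_Q[OF _ rep_phi[OF sV]] s(2) i by auto
    ultimately show ?thesis by blast
  qed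
  then show ?thesis unfolding krull_dim_def using prime by (intro Sup_upper) blast
qed

end

subsection \<open>Generic minors\<close>

text \<open>The top left minors of the generic matrix are \<open>minor k 0\<close>; shifting the columns by one
  gives a minor whose leading monomial is coprime to the diagonal.\<close>

definition minor :: "nat \<Rightarrow> nat \<Rightarrow> (nat \<times> nat, 'a::comm_ring_1) mpoly" where
  "minor k c = det (mat k k (\<lambda>(i, j). mpoly_var (i, j + c)))"

lemma det_generic_matrix: "det (generic_matrix n) = minor n 0"
  by (simp add: minor_def generic_matrix_def case_prod_unfold)

definition permmon :: "nat \<Rightarrow> nat \<Rightarrow> (nat \<Rightarrow> nat) \<Rightarrow> (nat \<times> nat) \<Rightarrow>\<^sub>0 nat" where
  "permmon k c \<pi> = (\<Sum>i<k. Poly_Mapping.single (i, \<pi> i + c) 1)"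

abbreviation perms :: "nat \<Rightarrow> (nat \<Rightarrow> nat) set" where
  "perms k \<equiv> {\<pi>. \<pi> permutes {0..<k}}"

lemma perms_less: "\<pi> \<in> perms k \<Longrightarrow> i < k \<Longrightarrow> \<pi> i < k"
  using permutes_in_image[of \<pi> "{0..<k}" i] by simp

lemma lookup_permmon: "coef (permmon k c \<pi>) (i, j) = (if i < k \<and> j = \<pi> i + c then 1 else 0)"
proof -
  have "coef (permmon k c \<pi>) (i, j) = (\<Sum>l<k. if l = i then (if j = \<pi> i + c then 1 else 0) else 0)"
    unfolding permmon_def lookup_sum by (intro sum.cong) (auto simp: lookup_single when_def)
  then show ?thesis by simp
qed

lemma permmon_inj: "\<pi> \<in> perms k \<Longrightarrow> \<sigma> \<in> perms k \<Longrightarrow> permmon k c \<pi> = permmon k c \<sigma> \<Longrightarrow> \<pi> = \<sigma>"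
proof
  fix i assume a: "\<pi> \<in> perms k" "\<sigma> \<in> perms k" "permmon k c \<pi> = permmon k c \<sigma>"
  show "\<pi> i = \<sigma> i"
  proof (cases "i < k")
    case True
    have "coef (permmon k c \<pi>) (i, \<pi> i + c) = coef (permmon k c \<sigma>) (i, \<pi> i + c)" using a by simp
    then show ?thesis using True by (simp add: lookup_permmon split: if_splits)
  next
    case False
    then show ?thesis using a by (simp add: permutes_def)
  qed
qed

lemma mterm_permmon: "mterm (permmon k c \<pi>) 1
  = (\<Prod>i<k. mpoly_var (i, \<pi> i + c) :: (nat \<times> nat, 'a::comm_ring_1) mpoly)"
proof -
  have "mterm (\<Sum>i\<in>A. Poly_Mapping.single (i, \<pi> i + c) 1) 1
    = (\<Prod>i\<in>A. mpoly_var (i, \<pi> i + c) :: (nat \<times> nat, 'a) mpoly)"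
    if "finite A" for A using that
  proof (induction A)
    case (insert a A)
    show ?case
      unfolding sum.insert[OF insert(1,2)] prod.insert[OF insert(1,2)] insert.IH[symmetric]
      by (simp add: mpoly_var_def mult_single)
  qed simp
  then show ?thesis by (simp add: permmon_def)
qed

lemma minor_expand: "minor k c = (\<Sum>\<pi>\<in>perms k. mterm (permmon k c \<pi>) (of_int (sign \<pi>)))"
proof -
  have "minor k c = (\<Sum>\<pi>\<in>perms k. of_int (sign \<pi>) * (\<Prod>i=0..<k. mat k k (\<lambda>(i, j). mpoly_var (i, j
    + c)) $$ (i, \<pi> i)))"
    unfolding minor_def by (subst det_def'[of _ k]) auto
  also have "\<dots> = (\<Sum>\<pi>\<in>perms k. mterm (permmon k c \<pi>) (of_int (sign \<pi>)))"
  proof (rule sum.cong)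
    fix \<pi> assume \<pi>: "\<pi> \<in> perms k"
    have "(\<Prod>i=0..<k. mat k k (\<lambda>(i, j). mpoly_var (i, j + c)) $$ (i, \<pi> i))
      = (\<Prod>i<k. mpoly_var (i, \<pi> i + c))"
      using \<pi> by (intro prod.cong) (auto simp: perms_less)
    also have "\<dots> = mterm (permmon k c \<pi>) 1" by (simp add: mterm_permmon)
    finally have e: "(\<Prod>i=0..<k. mat k k (\<lambda>(i, j). mpoly_var (i, j + c)) $$ (i, \<pi> i))
      = mterm (permmon k c \<pi>) 1" .
    show "of_int (sign \<pi>) * (\<Prod>i=0..<k. mat k k (\<lambda>(i, j). mpoly_var (i, j + c)) $$ (i, \<pi> i))
      = mterm (permmon k c \<pi>) (of_int (sign \<pi>))"
      unfolding e by (simp add: mult_single flip: single_of_int)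
  qed simp
  finally show ?thesis .
qed

lemma finite_perms [simp]: "finite (perms k)"
  by (simp add: finite_permutations)

lemma coef_minor: "\<pi> \<in> perms k \<Longrightarrow> coef (minor k c) (permmon k c \<pi>) = of_int (sign \<pi>)"
proof -
  assume \<pi>: "\<pi> \<in> perms k"
  have "coef (minor k c) (permmon k c \<pi>) = (\<Sum>\<sigma>\<in>perms k. if \<sigma> = \<pi> then of_int (sign \<pi>) else 0)"
    unfolding minor_expand lookup_sum using \<pi> permmon_inj
    by (intro sum.cong) (auto simp: lookup_single when_def)
  then show ?thesis using \<pi> by simp
qed

lemma supp_minor: "supp (minor k c :: (nat \<times> nat, 'a::comm_ring_1) mpoly) \<subseteq> permmon k c ` perms k"
proof
  fix m assume m: "m \<in> supp (minor k c :: (nat \<times> nat, 'a) mpoly)"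
  have "supp (minor k c :: (nat \<times> nat, 'a) mpoly)
      \<subseteq> (\<Union>\<pi>\<in>perms k. supp (mterm (permmon k c \<pi>) (of_int (sign \<pi>) :: 'a)))"
    unfolding minor_expand by (rule keys_sum)
  with m have "m \<in> (\<Union>\<pi>\<in>perms k. supp (mterm (permmon k c \<pi>) (of_int (sign \<pi>) :: 'a)))"
    by (rule rev_subsetD)
  then show "m \<in> permmon k c ` perms k" by (auto split: if_splits)
qed

lemma supp_permmon: "\<pi> \<in> perms k \<Longrightarrow> supp (permmon k c \<pi>) \<subseteq> {..<k} \<times> {c..<k + c}"
proof
  fix x assume "\<pi> \<in> perms k" "x \<in> supp (permmon k c \<pi>)"
  then show "x \<in> {..<k} \<times> {c..<k + c}"
    using perms_less[of \<pi> k] by (cases x) (auto simp: in_keys_iff lookup_permmon split: if_splits)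
qed

lemma minor_polys: "{..<k} \<times> {c..<k + c} \<subseteq> V \<Longrightarrow>
  (minor k c :: (nat \<times> nat, 'a::comm_ring_1) mpoly) \<in> polys V"
proof -
  assume V: "{..<k} \<times> {c..<k + c} \<subseteq> V"
  have "supp m \<subseteq> V" if m: "m \<in> supp (minor k c :: (nat \<times> nat, 'a) mpoly)" for m
  proof -
    obtain \<pi> where "\<pi> \<in> perms k" "m = permmon k c \<pi>" using subsetD[OF supp_minor m] by (rule imageE)
    then show ?thesis using supp_permmon[of \<pi> k c] V by simp
  qed
  then show ?thesis by (simp add: polys_def)
qed

lemma wt_permmon: "wt w (permmon k c \<pi>) = (\<Sum>i<k. w (i, \<pi> i + c))"
  by (simp add: permmon_def wt_sum wt_single)

lemma sum_perm: "\<pi> \<in> perms k \<Longrightarrow> (\<Sum>i<k. f (\<pi> i)) = (\<Sum>i<k. f i :: nat)"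
  using sum.permute[of \<pi> "{0..<k}" f] by (simp add: o_def atLeast0LessThan)

lemma rearrangement_strict:
  assumes "\<pi> \<in> perms k" "\<pi> \<noteq> id"
  shows "(\<Sum>i<k. i * \<pi> i) < (\<Sum>i<k. i * i)"
proof -
  obtain j where j: "\<pi> j \<noteq> j" using assms(2) by (auto simp: fun_eq_iff)
  then have jk: "j < k" using assms unfolding mem_Collect_eq permutes_def by fastforce
  \<comment> \<open>A permutation preserves the sum of squares, so expanding the squared
    displacements leaves twice the difference of the two sides.\<close>
  have "0 < (\<Sum>i<k. (int i - int (\<pi> i))\<^sup>2)"
    using j jk by (intro sum_pos2[of _ j]) auto
  also have "\<dots> = (\<Sum>i<k. int i * int i) + (\<Sum>i<k. int (\<pi> i) * int (\<pi> i))
    - 2 * (\<Sum>i<k. int i * int (\<pi> i))"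
    by (simp add: power2_eq_square algebra_simps sum.distrib sum_subtractf sum_distrib_left)
  also have "(\<Sum>i<k. int (\<pi> i) * int (\<pi> i)) = (\<Sum>i<k. int i * int i)"
    using sum_perm[OF assms(1), of "\<lambda>i. i * i"] by (simp flip: of_nat_mult of_nat_sum)
  finally have "int (\<Sum>i<k. i * \<pi> i) < int (\<Sum>i<k. i * i)" by simp
  then show ?thesis by linarith
qed

text \<open>The product \<open>i * j\<close> singles out the diagonal by the rearrangement
  inequality. The summand 1 makes all weights positive, so that bounded weight means bounded
  exponents.\<close>

definition diag_weight :: "nat \<times> nat \<Rightarrow> nat" where "diag_weight = (\<lambda>(i, j). i * j + 1)"

lemma diag_weight_ge: "diag_weight v \<ge> 1" by (simp add: diag_weight_def split: prod.split)

lemma id_perms [simp]: "id \<in> perms k" by (simp add: permutes_id)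

text \<open>The column shift and the summand 1 contribute the same amount for every permutation, so
  the rearrangement inequality decides.\<close>

lemma leads_minor: "leads diag_weight (minor k c :: (nat \<times> nat, 'a::comm_ring_1) mpoly)
  (permmon k c id)"
  unfolding leads_def
proof (intro conjI ballI impI)
  show "coef (minor k c :: (nat \<times> nat, 'a) mpoly) (permmon k c id) \<noteq> 0" by (simp add: coef_minor)
  fix m assume m: "m \<in> supp (minor k c :: (nat \<times> nat, 'a) mpoly)" "m \<noteq> permmon k c id"
  obtain \<pi> where \<pi>0: "m = permmon k c \<pi>" "\<pi> \<in> perms k" using subsetD[OF supp_minor m(1)]
    by (rule imageE)
  then have \<pi>: "\<pi> \<in> perms k" "m = permmon k c \<pi>" "\<pi> \<noteq> id" using m(2) by auto
  have "wt diag_weight (permmon k c \<sigma>) = (\<Sum>i<k. i * \<sigma> i) + (\<Sum>i<k. i * c + 1)" for \<sigma>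
    by (simp only: wt_permmon diag_weight_def prod.case distrib_left sum.distrib[symmetric]
      add.assoc)
  then show "wt diag_weight m < wt diag_weight (permmon k c id)"
    using rearrangement_strict[OF \<pi>(1,3)] \<pi>(2) by simp
qed

lemma minor_nonzero: "minor k c \<noteq> (0 :: (nat \<times> nat, 'a::comm_ring_1) mpoly)"
  using leads_minor[of k c, where 'a = 'a] by (auto simp: leads_def)

lemma minor_coef_0: "k > 0 \<Longrightarrow> coef (minor k c :: (nat \<times> nat, 'a::comm_ring_1) mpoly) 0 = 0"
proof (rule ccontr)
  assume k: "k > 0" and "coef (minor k c :: (nat \<times> nat, 'a) mpoly) 0 \<noteq> 0"
  then have "(0 :: (nat \<times> nat) \<Rightarrow>\<^sub>0 nat) \<in> supp (minor k c :: (nat \<times> nat, 'a) mpoly)"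
    by (simp add: in_keys_iff)
  from subsetD[OF supp_minor this] obtain \<pi> where "0 = permmon k c \<pi>" by (rule imageE)
  then have "permmon k c \<pi> = 0" by simp
  then have "coef (permmon k c \<pi>) (0, \<pi> 0 + c) = 0" by simp
  then show False using k by (simp add: lookup_permmon)
qed

lemma minor_homogeneous: "m \<in> supp (minor k c :: (nat \<times> nat, 'a::comm_ring_1) mpoly) \<Longrightarrow>
  wt (\<lambda>_. 1) m = k"
proof -
  assume "m \<in> supp (minor k c :: (nat \<times> nat, 'a) mpoly)"
  from subsetD[OF supp_minor this] obtain \<pi> where "m = permmon k c \<pi>" by (rule imageE)
  then show ?thesis by (simp add: wt_permmon)
qed

interpretation psubst_hom: comm_ring_hom "psubst y"
  by unfold_locales (simp_all add: psubst_add psubst_mult)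

lemma psubst_minor:
  "psubst y (minor k c) = det (mat k k (\<lambda>(i, j). y (i, j + c)))"
proof -
  have "map_mat (psubst y) (mat k k (\<lambda>(i, j). mpoly_var (i, j + c)))
    = mat k k (\<lambda>(i, j). y (i, j + c))"
    by (rule eq_matI) (auto simp: psubst_var)
  then show ?thesis unfolding minor_def by (simp flip: psubst_hom.hom_det)
qed

subsection \<open>Monotonicity in the size of the matrix\<close>

lemma top_form_power:
  fixes T R :: "('v, 'a::comm_ring_1) mpoly"
  assumes T: "\<And>m. m \<in> supp T \<Longrightarrow> wt w m = D" and R: "\<And>m. m \<in> supp R \<Longrightarrow> wt w m < D"
  shows "(\<forall>m\<in>supp (T ^ k). wt w m = k * D) \<and> (\<forall>m\<in>supp ((T + R) ^ k - T ^ k). wt w m < k * D)"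
proof (induction k)
  case 0
  then show ?case by simp
next
  case (Suc k)
  have 1: "wt w m = Suc k * D" if m: "m \<in> supp (T ^ Suc k)" for m
  proof -
    from m have "m \<in> supp (T * T ^ k)" by simp
    then obtain a b where "m = a + b" "a \<in> supp T" "b \<in> supp (T ^ k)" by (rule supp_mult_E)
    then show ?thesis using T Suc by (simp add: wt_add)
  qed
  let ?E = "(T + R) ^ k - T ^ k"
  have eq: "(T + R) ^ Suc k - T ^ Suc k = T * ?E + (R * T ^ k + R * ?E)"
    by (simp add: algebra_simps)
  have 2: "wt w m < Suc k * D" if m: "m \<in> supp ((T + R) ^ Suc k - T ^ Suc k)" for m
  proof -
    have "m \<in> supp (T * ?E) \<union> (supp (R * T ^ k) \<union> supp (R * ?E))"
      using m keys_add[of "T * ?E" "R * T ^ k + R * ?E"] keys_add[of "R * T ^ k" "R * ?E"]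
        unfolding eq by blast
    then consider "m \<in> supp (T * ?E)" | "m \<in> supp (R * T ^ k)" | "m \<in> supp (R * ?E)" by blast
    then show ?thesis
    proof cases
      case 1
      then obtain a b where ab: "m = a + b" "a \<in> supp T" "b \<in> supp ?E" by (rule supp_mult_E)
      then have "wt w b < k * D" using Suc by blast
      then show ?thesis using T[OF ab(2)] ab(1) by (simp add: wt_add)
    next
      case 2
      then obtain a b where ab: "m = a + b" "a \<in> supp R" "b \<in> supp (T ^ k)" by (rule supp_mult_E)
      then have "wt w b = k * D" using Suc by blast
      then show ?thesis using R[OF ab(2)] ab(1) by (simp add: wt_add)
    next
      case 3
      then obtain a b where ab: "m = a + b" "a \<in> supp R" "b \<in> supp ?E" by (rule supp_mult_E)
      then have "wt w b < k * D" using Suc by blast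
      then show ?thesis using R[OF ab(2)] ab(1) by (simp add: wt_add)
    qed
  qed
  show ?case using 1 2 by blast
qed

text \<open>Grouping the terms of a polynomial by their part in the new variables, multiplication by
  \<open>F\<close> acts on each of the \<open>q ^ card (V' - V)\<close> coefficients
  separately.\<close>

lemma mult_image_extend_vars:
  fixes F :: "('v, 'a::{comm_ring_1,finite}) mpoly"
  assumes V': "finite V'" "V \<subseteq> V'" and q: "q > 0" and F: "F \<in> polys V"
  shows "card (mult_image q V' F) \<le> card (mult_image q V F) ^ (q ^ card (V' - V))"
proof -
  have V: "finite V" using V' finite_subset by blast
  let ?B = "box q (V' - V)"
  have fB: "finite ?B" using V' by simp
  have B: "supp b \<subseteq> V' - V" "\<And>v. coef b v < q" if "b \<in> ?B"
    for b using that q by (auto simp: box_iff)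
  let ?\<Phi> = "\<lambda>h. \<Sum>b\<in>?B. mterm b 1 * h b"
  have "mult_image q V' F \<subseteq> ?\<Phi> ` (?B \<rightarrow>\<^sub>E mult_image q V F)"
  proof
    fix x assume "x \<in> mult_image q V' F"
    then obtain a where a: "supp a \<subseteq> box q V'" "x = red q (F * a)"
      using mult_image_box[OF q] by blast
    have aV: "supp m \<subseteq> V'" "\<And>v. coef m v < q" if "m \<in> supp a" for m
      using a(1) that box_iff[OF q, of m V'] by auto
    define r where "r m = monf V (coef m)" for m :: "'v \<Rightarrow>\<^sub>0 nat"
    define s where "s m = monf (V' - V) (coef m)" for m :: "'v \<Rightarrow>\<^sub>0 nat"
    have rs: "m = s m + r m" if "m \<in> supp a" for m
    proof (rule poly_mapping_eqI)
      fix v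
      have "v \<notin> V' \<Longrightarrow> coef m v = 0" using aV(1)[OF that] by (auto simp: in_keys_iff)
      then show "coef m v = coef (s m + r m) v"
        using V V' by (auto simp: lookup_add r_def s_def lookup_monf)
    qed
    have sB: "s m \<in> ?B" if "m \<in> supp a" for m
      using aV(2)[OF that] V' supp_monf[of "V' - V" "coef m"] q
        by (auto simp: box_iff s_def lookup_monf)
    have rV: "supp (r m) \<subseteq> V" for m unfolding r_def by (rule supp_monf[OF V])
    define c where "c b = (\<Sum>m\<in>{m \<in> supp a. s m = b}. mterm (r m) (coef a m))" for b
    have cV: "c b \<in> polys V" for b unfolding c_def by (intro polys_sum polys_mono rV)
    have "a = (\<Sum>m\<in>supp a. mterm m (coef a m))" by (rule poly_as_sum)
    also have "\<dots> = (\<Sum>b\<in>?B. \<Sum>m\<in>{m \<in> supp a. s m = b}. mterm m (coef a m))"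
      using sB fB by (intro sum.group[symmetric]) auto
    also have "\<dots> = (\<Sum>b\<in>?B. mterm b 1 * c b)"
      unfolding c_def sum_distrib_left
    proof (intro sum.cong refl)
      fix b m assume "m \<in> {m \<in> supp a. s m = b}"
      then show "mterm m (coef a m) = mterm b 1 * mterm (r m) (coef a m)"
        using rs[of m] by (simp add: mult_single)
    qed
    finally have ac: "a = (\<Sum>b\<in>?B. mterm b 1 * c b)" .
    have red_mt: "red q (mterm b 1 * g) = mterm b 1 * red q g" if b: "b \<in> ?B" and g: "g \<in> polys V"
      for b and g :: "('v, 'a) mpoly"
    proof (rule poly_mapping_eqI)
      fix m
      show "coef (red q (mterm b 1 * g)) m = coef (mterm b 1 * red q g) m"
      proof (cases "\<exists>l. m = b + l")
        case True
        then obtain l where l: "m = b + l" by blast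
        show ?thesis
        proof (cases "l \<in> supp g")
          case lg: True
          then have lV: "supp l \<subseteq> V" using g by (simp add: polys_def)
          have "(\<forall>v. coef m v < q) \<longleftrightarrow> (\<forall>v. coef l v < q)"
          proof -
            have "coef m v = coef l v \<or> (coef l v = 0 \<and> coef m v < q)" for v
            proof (cases "v \<in> V")
              case True
              then have "v \<notin> supp b" using B(1)[OF b] by blast
              then show ?thesis by (simp add: l lookup_add in_keys_iff)
            next
              case False
              then have "v \<notin> supp l" using lV by blast
              then show ?thesis using B(2)[OF b, of v] by (simp add: l lookup_add in_keys_iff)
            qed
            then show ?thesis using q by metis
          qed
          then show ?thesis
            using lookup_mono_mult[of b 1 g l] lookup_mono_mult[of b 1 "red q g" l]
              by (simp add: lookup_red l)
        next
          case False
          then show ?thesis by (simp add: lookup_red l lookup_mono_mult in_keys_iff)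
        qed
      next
        case False
        then show ?thesis by (simp add: lookup_red lookup_mono_mult_not)
      qed
    qed
    have red_sum: "red q (sum h B) = (\<Sum>b\<in>B. red q (h b))" for h :: "('v \<Rightarrow>\<^sub>0 nat) \<Rightarrow> ('v, 'a) mpoly"
      and B
      by (induction B rule: infinite_finite_induct) (simp_all add: red_add)
    have "F * a = (\<Sum>b\<in>?B. mterm b 1 * (F * c b))"
      by (subst ac) (simp add: sum_distrib_left mult.left_commute)
    then have "x = (\<Sum>b\<in>?B. mterm b 1 * red q (F * c b))"
      using a(2) red_mt F cV by (simp add: red_sum)
    also have "\<dots> = ?\<Phi> (\<lambda>b\<in>?B. red q (F * c b))" by (intro sum.cong) auto
    finally have x: "x = ?\<Phi> (\<lambda>b\<in>?B. red q (F * c b))" .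
    show "x \<in> ?\<Phi> ` (?B \<rightarrow>\<^sub>E mult_image q V F)"
      by (rule image_eqI[where x = "\<lambda>b\<in>?B. red q (F * c b)"]) (use x cV in \<open>auto simp:
        mult_image_def\<close>)
  qed
  moreover have fin: "finite (?B \<rightarrow>\<^sub>E mult_image q V F)"
    using fB finite_mult_image[OF V q F] by (intro finite_PiE) auto
  ultimately have "card (mult_image q V' F) \<le> card (?B \<rightarrow>\<^sub>E mult_image q V F)"
    by (meson card_image_le card_mono finite_imageI le_trans)
  then show ?thesis using fB V' by (simp add: card_funcsetE card_box)
qed

lemma frob_ideal_power_diff:
  fixes F G :: "('v, 'a::comm_ring_1) mpoly"
  assumes "F - G \<in> frob_ideal q" shows "F ^ k - G ^ k \<in> frob_ideal q"
proof (induction k)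
  case (Suc k)
  have "F ^ Suc k - G ^ Suc k = F * (F ^ k - G ^ k) + (F - G) * G ^ k" by (simp add: algebra_simps)
  then show ?case using frob_ideal_add[OF frob_ideal_mult(1)[OF Suc] frob_ideal_mult(2)[OF assms]]
    by simp
qed simp

lemma psubst_id: "psubst mpoly_var f = f"
  by (rule psubst_hom_unique[where V = UNIV and F = "\<lambda>x. x", symmetric]) (auto simp: polys_def)

text \<open>The \<open>q\<close>-th power of a variable goes to the \<open>q\<close>-th power of a
  polynomial without constant term, which is again in the Frobenius power.\<close>

lemma psubst_frob_ideal:
  fixes f :: "('v, 'p::prime_card mod_ring) mpoly" and y :: "'v \<Rightarrow> ('w, 'p mod_ring) mpoly"
  assumes f: "f \<in> frob_ideal q" and q: "q = CARD('p) ^ e" and y: "\<And>v. coef (y v) 0 = 0"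
  shows "psubst y f \<in> frob_ideal q"
  unfolding psubst_def
proof (intro frob_ideal_sum frob_ideal_mult(1))
  fix m assume "m \<in> supp f"
  then obtain v where v: "q \<le> coef m v" using f by (auto simp: frob_ideal_def)
  then have "m = mscale q (Poly_Mapping.single v 1) + (m - mscale q (Poly_Mapping.single v 1))"
    by (intro poly_mapping_eqI) (auto simp add: lookup_add lookup_minus lookup_single when_def)
  then have "mon_subst y m = mon_subst y (mscale q (Poly_Mapping.single v 1)) * mon_subst y (m
    - mscale q (Poly_Mapping.single v 1))"
    by (metis mon_subst_add)
  moreover have "mscale q (Poly_Mapping.single v 1) = Poly_Mapping.single v q"
    by (rule poly_mapping_eqI) (simp add: lookup_single when_def)
  then have "mon_subst y (mscale q (Poly_Mapping.single v 1)) = y v ^ q"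
    by (simp add: mon_subst_single)
  moreover have "y v ^ q \<in> frob_ideal q" unfolding q by (rule frob_power_in_frob_ideal[OF y])
  ultimately show "mon_subst y m \<in> frob_ideal q" using frob_ideal_mult(2) by simp
qed

lemma coef_0_var [simp]: "coef (mpoly_var v :: ('v, 'a::comm_ring_1) mpoly) 0 = 0"
proof -
  have "Poly_Mapping.single v (1::nat) \<noteq> 0"
  proof
    assume 0: "Poly_Mapping.single v (1::nat) = 0"
    show False using lookup_single_eq[of v "1::nat"] unfolding 0 by simp
  qed
  then show ?thesis by (simp add: mpoly_var_def lookup_single)
qed

text \<open>Setting \<open>x\<^sub>n\<^sub>n\<close> to \<open>1 + x\<^sub>n\<^sub>n\<close> makes it invertible modulo the Frobenius power, with inverse
  \<open>(1 + x\<^sub>n\<^sub>n)\<^sup>q\<^sup>-\<^sup>1\<close>; clearing the last row then gives a Schur complement.\<close>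

lemma det_schur:
  fixes n :: nat and q :: nat
  defines "X \<equiv> \<lambda>i j. mpoly_var (i, j) :: (nat \<times> nat, 'p::prime_card mod_ring) mpoly"
  defines "w \<equiv> (1 + X n n) ^ (q - 1)"
  defines "\<sigma> \<equiv> \<lambda>(i, j). if i < n \<and> j < n then X i j - w * X i n * X n j else X i j"
  assumes q: "q = CARD('p) ^ e"
  shows "minor (Suc n) 0 + minor n 0 - (1 + X n n) * psubst \<sigma> (minor n 0) \<in> frob_ideal q"
proof -
  let ?N = "Suc n"
  let ?c = "1 + X n n"
  define A where "A = mat ?N ?N (\<lambda>(i, j). X i j)"
  define Y where "Y = mat ?N ?N (\<lambda>(i, j). if i = n \<and> j = n then ?c else X i j)"
  \<comment> \<open>Right multiplication by \<open>E\<close> subtracts \<open>w * X n j\<close>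
    times the last column from column \<open>j\<close>. Since \<open>w\<close> inverts the corner up
    to \<open>X n n ^ q\<close>, this clears the last row modulo the Frobenius power.\<close>
  define E where "E = mat ?N ?N (\<lambda>(i, j). if i = j then 1 else if i = n then - w * X n j else 0)"
  have [simp]: "A \<in> carrier_mat ?N ?N" "Y \<in> carrier_mat ?N ?N" "E \<in> carrier_mat ?N ?N"
    by (simp_all add: A_def Y_def E_def)
  have cof: "cofactor Y n j = cofactor A n j" for j
  proof -
    have "mat_delete Y n j = mat_delete A n j"
      unfolding mat_delete_def by (rule eq_matI) (auto simp: A_def Y_def)
    then show ?thesis by (simp add: cofactor_def)
  qed
  have cofn: "cofactor A n n = minor n 0"
  proof -
    have "mat_delete A n n = mat n n (\<lambda>(i, j). X i j)"
      unfolding mat_delete_def by (rule eq_matI) (auto simp: A_def)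
    then show ?thesis by (simp add: cofactor_def minor_def X_def)
  qed
  have detA: "det A = minor ?N 0" by (simp add: A_def minor_def X_def)
  \<comment> \<open>\<open>Y\<close> exceeds \<open>A\<close> by 1 in the corner only, so the
    determinants differ by the cofactor there, which is the minor of size \<open>n\<close>.\<close>
  have "det Y = (\<Sum>j<?N. Y $$ (n, j) * cofactor Y n j)" by (rule laplace_expansion_row) auto
  also have "\<dots> = (\<Sum>j<?N. A $$ (n, j) * cofactor A n j + (if j = n then cofactor A n n else 0))"
  proof (rule sum.cong)
    fix j assume "j \<in> {..<?N}"
    then have "Y $$ (n, j) = (if j = n then ?c else X n j)" "A $$ (n, j) = X n j"
      by (simp_all add: Y_def A_def)
    then show "Y $$ (n, j) * cofactor Y n j = A $$ (n, j) * cofactor A n j + (if j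
      = n then cofactor A n n else 0)"
      by (simp add: cof distrib_right)
  qed simp
  also have "\<dots> = det A + cofactor A n n"
    by (subst laplace_expansion_row[of A ?N n]) (auto simp: sum.distrib)
  finally have detY: "det Y = minor ?N 0 + minor n 0" by (simp add: detA cofn)
  have "det E = prod_list (diag_mat E)"
    by (rule det_lower_triangular[of ?N]) (auto simp: E_def)
  also have "diag_mat E = replicate ?N 1"
    by (rule nth_equalityI) (auto simp: diag_mat_def E_def simp del: replicate_Suc upt_Suc)
  finally have detE: "det E = 1" by (simp add: prod_list_replicate)
  define Z where "Z = Y * E"
  have [simp]: "Z \<in> carrier_mat ?N ?N" unfolding Z_def
    by (rule mult_carrier_mat[of _ ?N ?N]) simp_all
  have Zn: "Z $$ (i, j) = (if j = n then Y $$ (i, n) else Y $$ (i, j) - w * Y $$ (i, n) * X n j)"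
    if ij: "i < ?N" "j < ?N" for i j
  proof -
    have "Z $$ (i, j) = (\<Sum>l<?N. Y $$ (i, l) * E $$ (l, j))"
      using ij unfolding Z_def by (simp add: scalar_prod_def Y_def E_def atLeast0LessThan del:
        sum.lessThan_Suc)
    also have "\<dots> = (\<Sum>l<?N. (if l = j then Y $$ (i, j) else 0) + (if l
      = n then (if j = n then 0 else - w * Y $$ (i, n) * X n j) else 0))"
      using ij by (intro sum.cong) (auto simp: E_def algebra_simps)
    also have "\<dots> = (if j = n then Y $$ (i, n) else Y $$ (i, j) - w * Y $$ (i, n) * X n j)"
      using ij by (simp add: sum.distrib del: sum.lessThan_Suc)
    finally show ?thesis .
  qed
  have cw: "?c * w = 1 + X n n ^ q"
  proof -
    have "?c * w = ?c ^ q" unfolding w_def using power_pred[of q ?c] q by simp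
    also have "\<dots> = 1 + X n n ^ q" unfolding q by (subst frob_add) simp
    finally show ?thesis .
  qed
  have Xq: "X n n ^ q \<in> frob_ideal q" unfolding q X_def by (rule frob_power_in_frob_ideal) simp
  have low: "Z $$ (n, j) \<in> frob_ideal q" if j: "j < n" for j
  proof -
    have "Z $$ (n, j) = X n j - (?c * w) * X n j"
      using j by (simp add: Zn Y_def algebra_simps)
    also have "\<dots> = (- X n j) * X n n ^ q" unfolding cw by (simp add: algebra_simps)
    finally show ?thesis by (simp only: frob_ideal_mult(1)[OF Xq])
  qed
  have Zcof: "cofactor Z n n = psubst \<sigma> (minor n 0)"
  proof -
    have "mat_delete Z n n = mat n n (\<lambda>(i, j). \<sigma> (i, j + 0))"
    proof (rule eq_matI)
      fix i j assume "i < dim_row (mat n n (\<lambda>(i, j). \<sigma> (i, j + 0)))"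
        "j < dim_col (mat n n (\<lambda>(i, j). \<sigma> (i, j + 0)))"
      then have ij: "i < n" "j < n" by auto
      have "mat_delete Z n n $$ (i, j) = Z $$ (i, j)"
        using ij by (simp add: mat_delete_def Z_def Y_def E_def)
      also have "\<dots> = X i j - w * X i n * X n j" using ij by (simp add: Zn Y_def)
      finally show "mat_delete Z n n $$ (i, j) = mat n n (\<lambda>(i, j). \<sigma> (i, j + 0)) $$ (i, j)"
        using ij by (simp add: \<sigma>_def)
    qed (auto simp: Z_def Y_def E_def)
    then show ?thesis by (simp add: cofactor_def psubst_minor)
  qed
  \<comment> \<open>Modulo the Frobenius power only the corner of the last row contributes, and its
    cofactor is the determinant of the substituted entries.\<close>
  have "det Z = (\<Sum>j<?N. Z $$ (n, j) * cofactor Z n j)" by (rule laplace_expansion_row) auto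
  also have "\<dots> = (\<Sum>j<n. Z $$ (n, j) * cofactor Z n j) + ?c * psubst \<sigma> (minor n 0)"
    by (simp add: Zn Y_def Zcof)
  finally have "det Z - ?c * psubst \<sigma> (minor n 0) = (\<Sum>j<n. Z $$ (n, j) * cofactor Z n j)" by simp
  moreover have "(\<Sum>j<n. Z $$ (n, j) * cofactor Z n j) \<in> frob_ideal q"
    by (intro frob_ideal_sum frob_ideal_mult(2) low) simp
  moreover have "det Z = det Y" unfolding Z_def by (subst det_mult[of _ ?N]) (simp_all add: detE)
  ultimately show ?thesis by (simp add: detY)
qed

lemma finite_matrix_vars [simp]: "finite (matrix_vars n)"
  and card_matrix_vars: "card (matrix_vars n) = n * n"
  by (simp_all add: matrix_vars_def)

lemma minor_matrix_vars: "k \<le> n \<Longrightarrow> minor k 0 \<in> polys (matrix_vars n)"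
  by (rule minor_polys) (auto simp: matrix_vars_def)

text \<open>In ordinary degree \<open>?F\<close> is the top form of \<open>?F + ?f\<close>, so its
  image is at most as large. By \<open>det_schur\<close> that sum is congruent to \<open>?c\<close>
  times a substituted \<open>?f\<close>, and the \<open>2 * n + 1\<close> variables not in
  \<open>?f\<close> account for the exponent on the right.\<close>

theorem card_mult_image_minor_Suc:
  assumes q: "q = CARD('p::prime_card) ^ e"
  shows "card (mult_image q (matrix_vars (Suc n)) ((minor (Suc n) 0 :: (nat \<times> nat, 'p mod_ring)
    mpoly) ^ (q - 1)))
    \<le> card (mult_image q (matrix_vars n) ((minor n 0 :: (nat \<times> nat, 'p mod_ring) mpoly) ^ (q - 1)))
      ^ (q ^ (2 * n + 1))"
proof -
  let ?V = "matrix_vars (Suc n)"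
  have q0: "q > 0" using q by simp
  define X where "X = (\<lambda>i j. mpoly_var (i, j) :: (nat \<times> nat, 'p mod_ring) mpoly)"
  define w where "w = (1 + X n n) ^ (q - 1)"
  define \<sigma> where "\<sigma> = (\<lambda>(i, j). if i < n \<and> j < n then X i j - w * X i n * X n j else X i j)"
  define \<tau> where "\<tau> = (\<lambda>(i, j). if i < n \<and> j < n then X i j + w * X i n * X n j else X i j)"
  let ?f = "minor n 0 :: (nat \<times> nat, 'p mod_ring) mpoly"
  let ?F = "minor (Suc n) 0 :: (nat \<times> nat, 'p mod_ring) mpoly"
  let ?c = "1 + X n n"
  let ?G = "?c * psubst \<sigma> ?f"
  have XV: "X i j \<in> polys ?V" if "i < Suc n" "j < Suc n" for i j
    using that unfolding X_def by (intro polys_var) (simp add: matrix_vars_def)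
  have wV: "w \<in> polys ?V" unfolding w_def using XV by simp
  have c0: "coef (\<sigma> v) 0 = 0" for v
    by (cases v) (simp add: \<sigma>_def X_def lookup_minus coef_0_mult)
  have \<tau>V: "\<tau> v \<in> polys ?V" if "v \<in> ?V" for v
    using that XV wV by (cases v) (auto simp: \<tau>_def matrix_vars_def)
  have \<sigma>w: "psubst \<sigma> w = w"
    by (simp add: w_def psubst_power psubst_add X_def psubst_var) (simp add: \<sigma>_def X_def)
  \<comment> \<open>\<open>\<sigma>\<close> fixes the last row and column and therefore
    \<open>w\<close>, so it subtracts exactly what \<open>\<tau>\<close> adds.\<close>
  have \<sigma>\<tau>: "psubst \<sigma> (psubst \<tau> s) = s" for s
  proof -
    have "psubst \<sigma> (\<tau> v) = mpoly_var v" for v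
    proof (cases v)
      case (Pair i j)
      have "psubst \<sigma> (X i j) = \<sigma> (i, j)" for i j by (simp add: X_def psubst_var)
      then have "psubst \<sigma> (\<tau> v) = (if i < n \<and>
        j < n then \<sigma> (i, j) + w * \<sigma> (i, n) * \<sigma> (n, j) else \<sigma> (i, j))"
        by (simp add: Pair \<tau>_def psubst_add psubst_mult \<sigma>w)
      then show ?thesis by (simp add: Pair) (auto simp: \<sigma>_def X_def)
    qed
    then have "psubst \<sigma> (psubst \<tau> s) = psubst mpoly_var s"
      by (intro psubst_hom_unique[where V = UNIV]) (auto simp: polys_def psubst_add psubst_mult
        psubst_var)
    then show ?thesis by (simp add: psubst_id)
  qed
  have "card (mult_image q ?V (?F ^ (q - 1)))
    \<le> card (mult_image q ?V (?F ^ (q - 1) + ((?F + ?f) ^ (q - 1) - ?F ^ (q - 1))))"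
  proof (rule card_mult_image_top_form[where w = "\<lambda>_. 1" and D = "(q - 1) * Suc n"])
    have "(\<forall>m\<in>supp (?F ^ (q - 1)). wt (\<lambda>_. 1) m = (q - 1) * Suc n) \<and>
        (\<forall>m\<in>supp ((?F + ?f) ^ (q - 1) - ?F ^ (q - 1)). wt (\<lambda>_. 1) m < (q - 1) * Suc n)"
    proof (rule top_form_power)
      show "wt (\<lambda>_. 1) m = Suc n" if "m \<in> supp ?F" for m by (rule minor_homogeneous[OF that])
      show "wt (\<lambda>_. 1) m < Suc n" if "m \<in> supp ?f" for m unfolding minor_homogeneous[OF that]
        by simp
    qed
    then show "\<And>m. m \<in> supp (?F ^ (q - 1)) \<Longrightarrow> wt (\<lambda>_. 1) m = (q - 1) * Suc n"
      "\<And>m. m \<in> supp ((?F + ?f) ^ (q - 1) - ?F ^ (q - 1)) \<Longrightarrow> wt (\<lambda>_. 1) m < (q - 1) * Suc n" by blast+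
  qed (use q0 in auto)
  also have "?F ^ (q - 1) + ((?F + ?f) ^ (q - 1) - ?F ^ (q - 1)) = (?F + ?f) ^ (q - 1)" by simp
  also have "mult_image q ?V ((?F + ?f) ^ (q - 1)) = mult_image q ?V (?G ^ (q - 1))"
  proof -
    have "?F + ?f - ?G \<in> frob_ideal q"
      using det_schur[OF q, of n] unfolding \<sigma>_def w_def X_def .
    then have "(?F + ?f) ^ (q - 1) - ?G ^ (q - 1) \<in> frob_ideal q" by (rule frob_ideal_power_diff)
    then have "red q ((?F + ?f) ^ (q - 1) * s) = red q (?G ^ (q - 1) * s)" for s
      unfolding red_eq_iff left_diff_distrib[symmetric] by (rule frob_ideal_mult(2))
    then show ?thesis by (simp add: mult_image_def)
  qed
  \<comment> \<open>The substitution and the factor \<open>?c ^ (q - 1)\<close> act on the image for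
    \<open>?f\<close> through a single map, which cannot increase its size.\<close>
  also have "card (mult_image q ?V (?G ^ (q - 1)))
      \<le> card ((\<lambda>z. red q (?c ^ (q - 1) * psubst \<sigma> z)) ` mult_image q ?V (?f ^ (q - 1)))"
  proof (rule card_mono)
    show "finite ((\<lambda>z. red q (?c ^ (q - 1) * psubst \<sigma> z)) ` mult_image q ?V (?f ^ (q - 1)))"
      using finite_mult_image[of ?V q "?f ^ (q - 1)"] q0 minor_matrix_vars[of n "Suc n",
        where 'a = "'p mod_ring"] by simp
    show "mult_image q ?V (?G ^ (q - 1)) \<subseteq> (\<lambda>z. red q (?c ^ (q - 1) * psubst \<sigma> z)) ` mult_image q ?V
      (?f ^ (q - 1))"
    proof
      fix x assume "x \<in> mult_image q ?V (?G ^ (q - 1))"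
      then obtain s where s: "s \<in> polys ?V" "x = red q (?G ^ (q - 1) * s)"
        by (auto simp: mult_image_def)
      define t where "t = psubst \<tau> s"
      have t: "t \<in> polys ?V" "psubst \<sigma> t = s"
        using s \<tau>V by (auto simp: t_def \<sigma>\<tau> intro: psubst_polys)
      define z where "z = red q (?f ^ (q - 1) * t)"
      have "?f ^ (q - 1) * t - z \<in> frob_ideal q"
        unfolding z_def red_eq_iff[symmetric] using red_red_mult[of q "?f ^ (q - 1) * t" 1] by simp
      then have "psubst \<sigma> (?f ^ (q - 1) * t - z) \<in> frob_ideal q"
        by (rule psubst_frob_ideal[OF _ q c0])
      then have "?c ^ (q - 1) * psubst \<sigma> (?f ^ (q - 1) * t - z) \<in> frob_ideal q"
        by (rule frob_ideal_mult(1))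
      moreover have "?c ^ (q - 1) * psubst \<sigma> (?f ^ (q - 1) * t - z)
        = ?G ^ (q - 1) * s - ?c ^ (q - 1) * psubst \<sigma> z"
        by (simp only: psubst_diff psubst_mult psubst_power t(2) power_mult_distrib
          right_diff_distrib mult.assoc)
      ultimately have "x = red q (?c ^ (q - 1) * psubst \<sigma> z)" unfolding s(2) red_eq_iff by simp
      moreover have "z \<in> mult_image q ?V (?f ^ (q - 1))" unfolding z_def mult_image_def using t
        by blast
      ultimately show "x \<in> (\<lambda>z. red q (?c ^ (q - 1) * psubst \<sigma> z)) ` mult_image q ?V (?f ^ (q - 1))"
        by blast
    qed
  qed
  also have "\<dots> \<le> card (mult_image q ?V (?f ^ (q - 1)))"
    using finite_mult_image[of ?V q "?f ^ (q - 1)"] q0 minor_matrix_vars[of n "Suc n",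
      where 'a = "'p mod_ring"]
    by (intro card_image_le) simp
  also have "\<dots> \<le> card (mult_image q (matrix_vars n) (?f ^ (q - 1))) ^ (q ^ card (?V
    - matrix_vars n))"
    by (rule mult_image_extend_vars) (use q0 minor_matrix_vars[of n n,
      where 'a = "'p mod_ring"] in \<open>auto simp: matrix_vars_def\<close>)
  also have "card (?V - matrix_vars n) = 2 * n + 1"
    by (subst card_Diff_subset) (auto simp: card_matrix_vars matrix_vars_def)
  finally show ?thesis .
qed

subsection \<open>Almost monotone growth\<close>

text \<open>Expansion along the last row is linear in the variable of its first column. That
  variable is chosen because its cofactor leads with the superdiagonal, which shares no variable
  with the diagonal.\<close>

lemma minor_last_row:
  assumes n: "n \<ge> 2" and V: "V = matrix_vars n - {(n - 1, 0)}"
  obtains g h :: "(nat \<times> nat, 'a::comm_ring_1) mpoly" where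
    "minor n 0 = mpoly_var (n - 1, 0) * g + h" "g \<in> polys V" "h \<in> polys V"
    "leads diag_weight g (permmon (n - 1) 1 id)"
proof -
  let ?A = "mat n n (\<lambda>(i, j). mpoly_var (i, j)) :: (nat \<times> nat, 'a) mpoly mat"
  let ?g = "cofactor ?A (n - 1) 0"
  let ?h = "\<Sum>j\<in>{1..<n}. ?A $$ (n - 1, j) * cofactor ?A (n - 1) j"
  have var: "mpoly_var (i, j) \<in> polys V" if "i < n" "j < n" "i \<noteq> n - 1 \<or> j \<noteq> 0" for i j
    using that by (intro polys_var) (auto simp: V matrix_vars_def)
  have "minor n 0 = det ?A" by (simp add: minor_def)
  also have "\<dots> = (\<Sum>j<n. ?A $$ (n - 1, j) * cofactor ?A (n - 1) j)"
    by (rule laplace_expansion_row) (use n in auto)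
  also have "{..<n} = insert 0 {1..<n}" using n by auto
  also have "(\<Sum>j\<in>insert 0 {1..<n}. ?A $$ (n - 1, j) * cofactor ?A (n - 1) j)
    = mpoly_var (n - 1, 0) * ?g + ?h"
    using n by simp
  finally have eq: "minor n 0 = mpoly_var (n - 1, 0) * ?g + ?h" .
  have detV: "det B \<in> polys V" if "B \<in> carrier_mat k k"
    "\<And>i j. i < k \<Longrightarrow> j < k \<Longrightarrow> B $$ (i, j) \<in> polys V"
    for B :: "(nat \<times> nat, 'a) mpoly mat" and k
    unfolding det_def'[OF that(1)]
  proof (intro polys_sum polys_mult polys_prod)
    fix \<pi> assume \<pi>: "\<pi> \<in> perms k"
    have "(of_int (sign \<pi>) :: (nat \<times> nat, 'a) mpoly) = mterm 0 (of_int (sign \<pi>))"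
      by (rule single_of_int[symmetric])
    then show "(of_int (sign \<pi>) :: (nat \<times> nat, 'a) mpoly) \<in> polys V" by (simp only: polys_const)
    show "B $$ (i, \<pi> i) \<in> polys V" if "i \<in> {0..<k}" for i
      using that perms_less[OF \<pi>, of i] by (intro \<open>\<And>i j. i < k \<Longrightarrow> j < k \<Longrightarrow> B $$ (i, j) \<in> polys V\<close>)
        auto
  qed
  have cofV: "cofactor ?A (n - 1) j \<in> polys V" for j
    unfolding cofactor_def
  proof (intro polys_mult polys_power polys_uminus polys_1 detV[of _ "n - 1"])
    show "mat_delete ?A (n - 1) j \<in> carrier_mat (n - 1) (n - 1)" by (rule mat_delete_carrier) auto
    fix i l assume il: "i < n - 1" "l < n - 1"
    then show "mat_delete ?A (n - 1) j $$ (i, l) \<in> polys V"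
      by (auto simp: mat_delete_def intro!: var)
  qed
  have hV: "?h \<in> polys V" 
  proof (intro polys_sum polys_mult cofV)
    fix j assume "j \<in> {1..<n}"
    then show "?A $$ (n - 1, j) \<in> polys V" using var[of "n - 1" j] n by simp
  qed
  \<comment> \<open>Deleting the first column shifts the column index, so up to sign
    \<open>?g\<close> is the minor with offset 1.\<close>
  have "mat_delete ?A (n - 1) 0 = mat (n - 1) (n - 1) (\<lambda>(i, j). mpoly_var (i, j + 1))"
    unfolding mat_delete_def by (rule eq_matI) auto
  then have "?g = (-1) ^ (n - 1) * minor (n - 1) 1" by (simp add: cofactor_def minor_def)
  then have "?g = minor (n - 1) 1 \<or> ?g = - minor (n - 1) 1" by (cases "even (n - 1)") simp_all
  then have "leads diag_weight ?g (permmon (n - 1) 1 id)"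
    using leads_minor[of "n - 1" 1, where 'a = 'a] by (auto simp: leads_def)
  then show ?thesis using that[OF eq cofV hV] by blast
qed

lemma power_mod_ideal:
  fixes f h :: "('v, 'a::comm_ring_1) mpoly"
  assumes "f \<in> polys V" "h \<in> polys V"
  shows "\<exists>a\<in>polys V. (f - h) ^ i = (- h) ^ i + f * a"
proof (induction i)
  case 0
  then show ?case by (intro bexI[of _ 0]) auto
next
  case (Suc i)
  then obtain a where a: "a \<in> polys V" "(f - h) ^ i = (- h) ^ i + f * a" by blast
  have "(f - h) ^ Suc i = (- h) ^ Suc i + f * ((- h) ^ i + (f - h) * a)"
    unfolding power_Suc a(2) by (simp add: algebra_simps)
  then show ?case using a(1) assms by (intro bexI[of _ "(- h) ^ i + (f - h) * a"]) auto
qed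

text \<open>For \<open>V0 = V - {x}\<close> the variable \<open>x\<close> enters only through
  \<open>p\<close>-th powers, so there are \<open>p ^ (card V - 1)\<close> generators instead of the
  \<open>p ^ card V\<close> for the whole ring. This factor \<open>p\<close> is what bounds the
  growth.\<close>

definition pth_span :: "'v set \<Rightarrow> 'v set \<Rightarrow> ('v, 'p::prime_card mod_ring) mpoly set" where
  "pth_span V0 V = {\<Sum>b\<in>box CARD('p) V0. mterm b 1 * z b ^ CARD('p) | z. \<forall>b. z b \<in> polys V}"

lemma pth_span_add:
  fixes s t :: "('v, 'p::prime_card mod_ring) mpoly"
  assumes "s \<in> pth_span V0 V" "t \<in> pth_span V0 V" shows "s + t \<in> pth_span V0 V"
proof -
  obtain y z where "s = (\<Sum>b\<in>box CARD('p) V0. mterm b 1 * y b ^ CARD('p))" "\<forall>b. y b \<in> polys V"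
    "t = (\<Sum>b\<in>box CARD('p) V0. mterm b 1 * z b ^ CARD('p))" "\<forall>b. z b \<in> polys V"
    using assms unfolding pth_span_def by blast
  moreover have "(y b + z b) ^ CARD('p) = y b ^ CARD('p) + z b ^ CARD('p)" for b
    using frob_add[of "y b" "z b" 1] by simp
  ultimately show ?thesis unfolding pth_span_def
    by (intro CollectI exI[of _ "\<lambda>b. y b + z b"]) (simp add: sum.distrib distrib_left)
qed

text \<open>For \<open>i \<le> p - 1\<close>, the product of \<open>g ^ (p - 1)\<close> and the
  \<open>i\<close>-th power of \<open>x\<close> is \<open>g ^ (p - 1 - i)\<close> times a power of
  \<open>x * g\<close>, hence congruent to \<open>g ^ (p - 1 - i) * (- h) ^ i\<close> modulo
  \<open>f\<close>, which is free of \<open>x\<close>.\<close>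

lemma mult_into_pth_span:
  fixes f g h b :: "('v, 'p::prime_card mod_ring) mpoly"
  assumes V: "finite V" "x \<in> V" "V0 = V - {x}" and f: "f = mpoly_var x * g + h"
    and gh: "g \<in> polys V0" "h \<in> polys V0"
    and b: "b \<in> polys V"
  shows "\<exists>y\<in>pth_span V0 V. \<exists>a\<in>polys V. g ^ (CARD('p) - 1) * b = y + f * a"
  using b
proof (induction rule: polys_induct)
  case zero
  have "(\<Sum>b\<in>box CARD('p) V0. mterm b 1 * 0 ^ CARD('p)) = (0 :: ('v, 'p mod_ring) mpoly)"
    by (intro sum.neutral ballI) (simp add: power_0_left)
  then have "(0 :: ('v, 'p mod_ring) mpoly) \<in> pth_span V0 V" unfolding pth_span_def
    by (intro CollectI exI[of _ "\<lambda>_. 0"]) simp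
  then show ?case by (intro bexI[of _ 0]) auto
next
  case (mterm m c)
  let ?p = "CARD('p)"
  have p0: "?p > 0" by simp
  have sub: "polys V0 \<subseteq> polys V" using V(3) by (intro polys_subset) auto
  have fV: "f \<in> polys V" unfolding f using gh sub V(2)
    by (intro polys_add polys_mult polys_var) auto
  have V0: "finite V0" using V by simp
  \<comment> \<open>The quotient goes into a \<open>p\<close>-th power; the remainder
    \<open>i\<close> is traded against factors of \<open>g\<close>.\<close>
  define k1 where "k1 = coef m x div ?p"
  define i where "i = coef m x mod ?p"
  define m0 where "m0 = monf V0 (coef m)"
  let ?X = "mpoly_var x :: ('v, 'p mod_ring) mpoly"
  have Xk: "?X ^ k = mterm (Poly_Mapping.single x k) 1" for k
  proof -
    have "mscale k (Poly_Mapping.single x 1) = Poly_Mapping.single x k"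
      by (rule poly_mapping_eqI) (simp add: lookup_single when_def)
    then show ?thesis by (simp add: mpoly_var_def mono_power)
  qed
  have mm: "m = Poly_Mapping.single x (coef m x) + m0"
  proof (rule poly_mapping_eqI)
    fix v
    have "v \<notin> V \<Longrightarrow> coef m v = 0" using mterm by (auto simp: in_keys_iff)
    then show "coef m v = coef (Poly_Mapping.single x (coef m x) + m0) v"
      using V0 V(3) by (auto simp: lookup_add lookup_single when_def m0_def lookup_monf)
  qed
  have b0: "mterm m0 c \<in> polys V0" unfolding m0_def by (rule polys_mono[OF supp_monf[OF V0]])
  have "mterm m c = ?X ^ coef m x * mterm m0 c" unfolding Xk by (subst mm) (simp add: mult_single)
  also have "?X ^ coef m x = (?X ^ k1) ^ ?p * ?X ^ i"
    by (simp add: k1_def i_def flip: power_mult power_add)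
  finally have mt: "mterm m c = (?X ^ k1) ^ ?p * ?X ^ i * mterm m0 c" .
  have ip: "i \<le> ?p - 1" unfolding i_def using mod_less_divisor[OF p0, of "coef m x"] by linarith
  obtain a where a: "a \<in> polys V" "(f - h) ^ i = (- h) ^ i + f * a"
    using power_mod_ideal[OF fV, of h i] gh sub by blast
  have gX: "g * ?X = f - h" by (simp add: f mult.commute)
  have "g ^ (?p - 1) * ?X ^ i = g ^ (?p - 1 - i) * (g * ?X) ^ i"
  proof -
    have "?p - 1 = (?p - 1 - i) + i" using ip by simp
    then have "g ^ (?p - 1) = g ^ (?p - 1 - i) * g ^ i" using power_add[of g "?p - 1 - i" i] by simp
    then show ?thesis by (simp only: power_mult_distrib mult.assoc)
  qed
  also have "\<dots> = g ^ (?p - 1 - i) * (- h) ^ i + f * (g ^ (?p - 1 - i) * a)"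
    unfolding gX a(2) by (simp add: algebra_simps)
  finally have gi: "g ^ (?p - 1) * ?X ^ i
    = g ^ (?p - 1 - i) * (- h) ^ i + f * (g ^ (?p - 1 - i) * a)" .
  define y0 where "y0 = g ^ (?p - 1 - i) * (- h) ^ i * mterm m0 c"
  have y0: "y0 \<in> polys V0" unfolding y0_def using gh b0 by simp
  have y0e: "y0 = (\<Sum>b\<in>box ?p V0. frob_trace ?p V0 (y0 * mterm (topm ?p V0 - b) 1) ^ ?p * mterm b 1)"
    by (rule frob_basis[OF V0 _ y0, of _ 1]) simp
  define z where "z b = (if b \<in> box ?p V0 then ?X ^ k1 * frob_trace ?p V0 (y0 * mterm (topm ?p V0
    - b) 1) else 0)" for b
  have zV: "z b \<in> polys V" for b
  proof -
    have "supp (topm ?p V0 - b) \<subseteq> V0" using supp_topm[OF V0, of ?p]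
      by (auto simp: in_keys_iff lookup_minus)
    then have "frob_trace ?p V0 (y0 * mterm (topm ?p V0 - b) 1) \<in> polys V0"
      using y0 by (intro frob_trace_polys) (auto simp: polys_mono)
    then show ?thesis using sub V(2) by (auto simp: z_def)
  qed
  have "(?X ^ k1) ^ ?p * y0 = (\<Sum>b\<in>box ?p V0. mterm b 1 * z b ^ ?p)"
    by (subst y0e) (simp add: sum_distrib_left z_def power_mult_distrib mult_ac)
  then have y: "(?X ^ k1) ^ ?p * y0 \<in> pth_span V0 V" unfolding pth_span_def using zV by blast
  have "g ^ (?p - 1) * mterm m c = (?X ^ k1) ^ ?p * ((g ^ (?p - 1) * ?X ^ i) * mterm m0 c)"
    by (simp add: mt mult_ac)
  also have "\<dots> = (?X ^ k1) ^ ?p * y0 + f * ((?X ^ k1) ^ ?p * g ^ (?p - 1 - i) * a * mterm m0 c)"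
    unfolding gi y0_def by (simp add: algebra_simps)
  finally have "g ^ (?p - 1) * mterm m c
    = (?X ^ k1) ^ ?p * y0 + f * ((?X ^ k1) ^ ?p * g ^ (?p - 1 - i) * a * mterm m0 c)" .
  moreover have "(?X ^ k1) ^ ?p * g ^ (?p - 1 - i) * a * mterm m0 c \<in> polys V"
    using a(1) gh b0 sub V(2) by (intro polys_mult polys_power polys_var) auto
  ultimately show ?case using y by blast
next
  case (add s t)
  obtain y1 a1 where 1: "y1 \<in> pth_span V0 V" "a1 \<in> polys V" "g ^ (CARD('p) - 1) * s = y1 + f * a1"
    using add by blast
  obtain y2 a2 where 2: "y2 \<in> pth_span V0 V" "a2 \<in> polys V" "g ^ (CARD('p) - 1) * t = y2 + f * a2"
    using add by blast
  have "g ^ (CARD('p) - 1) * (s + t) = (y1 + y2) + f * (a1 + a2)"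
    using 1(3) 2(3) by (simp add: distrib_left)
  then show ?case using pth_span_add[OF 1(1) 2(1)] 1(2) 2(2)
    by (intro bexI[of _ "y1 + y2"] bexI[of _ "a1 + a2"]) auto
qed

lemma red_sum: "red q (sum h B) = (\<Sum>b\<in>B. red q (h b))" for h :: "'i \<Rightarrow> ('v, 'a::comm_ring_1) mpoly"
  by (induction B rule: infinite_finite_induct) (simp_all add: red_add)

text \<open>Since \<open>x * g = f - h\<close>, modulo \<open>f\<close> all of \<open>g\<^sup>p\<^sup>-\<^sup>1 S\<close> is spanned over the \<open>p\<close>-th powers by the
  monomials in the variables other than \<open>x\<close> with exponents below \<open>p\<close>. On each of these \<open>p\<^bsup>|V|-1\<^esup>\<close>
  summands, multiplication by \<open>f\<^sup>p\<^sup>q\<^sup>-\<^sup>1 = f\<^sup>p\<^sup>-\<^sup>1 (f\<^sup>q\<^sup>-\<^sup>1)\<^sup>p\<close> factors through multiplication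
  by \<open>f\<^sup>q\<^sup>-\<^sup>1\<close>. The set \<open>\<Gamma>\<close> accounts for the remaining monomials.\<close>

theorem card_mult_image_Suc_exponent:
  fixes f g h :: "('v, 'p::prime_card mod_ring) mpoly"
  assumes V: "finite V" "x \<in> V" "V0 = V - {x}" and f: "f = mpoly_var x * g + h"
    and gh: "g \<in> polys V0" "h \<in> polys V0"
    and f0: "coef f 0 = 0" and q: "q = CARD('p) ^ e"
    and fin: "finite \<Gamma>"
    and \<Gamma>: "\<And>s. s \<in> polys V \<Longrightarrow> \<exists>s' a b r. supp s' \<subseteq> \<Gamma> \<and> s' \<in> polys V \<and> a \<in> polys V \<and> b \<in> polys V \<and>
      r \<in> frob_ideal (CARD('p) * q) \<and>
        s = s' + f * a + g ^ (CARD('p) - 1) * b + r"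
  shows "card (mult_image (CARD('p) * q) V (f ^ (CARD('p) * q - 1)))
    \<le> CARD('p) ^ card \<Gamma> * card (mult_image q V (f ^ (q - 1))) ^ (CARD('p) ^ (card V - 1))"
proof -
  let ?p = "CARD('p)" let ?Q = "CARD('p) * q"
  have Q: "?Q = CARD('p) ^ Suc e" by (simp add: q)
  have q0: "q > 0" "?Q > 0" using q by simp_all
  have sub: "polys V0 \<subseteq> polys V" using V(3) by (intro polys_subset) auto
  have fV: "f \<in> polys V" unfolding f using gh sub V(2)
    by (intro polys_add polys_mult polys_var) auto
  define \<mu> where "\<mu> s = red ?Q (f ^ (?Q - 1) * s)" for s
  have \<mu>_add: "\<mu> (s + t) = \<mu> s + \<mu> t" for s t by (simp add: \<mu>_def distrib_left red_add)
  have \<mu>_f: "\<mu> (f * a) = 0" for a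
  proof -
    have "f ^ (?Q - 1) * (f * a) = f ^ ?Q * a"
      using power_pred[OF q0(2), of f] by (simp add: mult_ac)
    moreover have "f ^ ?Q \<in> frob_ideal ?Q" unfolding Q by (rule frob_power_in_frob_ideal[OF f0])
    ultimately show ?thesis unfolding \<mu>_def red_eq_0_iff using frob_ideal_mult(2) by simp
  qed
  have \<mu>_r: "\<mu> r = 0" if "r \<in> frob_ideal ?Q" for r
    unfolding \<mu>_def red_eq_0_iff by (rule frob_ideal_mult(1)[OF that])
  define U where "U = \<mu> ` {s. supp s \<subseteq> \<Gamma>}"
  define T where "T b = (\<lambda>z. \<mu> (mterm b 1 * z ^ ?p)) ` polys V" for b
  have finU: "finite U" and cardU: "card U \<le> ?p ^ card \<Gamma>"
  proof -
    have c: "finite {s :: ('v, 'p mod_ring) mpoly. supp s \<subseteq> \<Gamma>}"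
      "card {s :: ('v, 'p mod_ring) mpoly. supp s \<subseteq> \<Gamma>} = ?p ^ card \<Gamma>"
      using card_supported[OF fin, where 'a = "'p mod_ring"] by (simp_all add: card_mod_ring)
    then show "finite U" by (simp add: U_def)
    show "card U \<le> ?p ^ card \<Gamma>" using card_image_le[OF c(1), of \<mu>] c(2) by (simp add: U_def)
  qed
  have fin_im: "finite (mult_image q V (f ^ (q - 1)))"
    using V q0 fV by (intro finite_mult_image) auto
  have fac: "\<mu> (mterm b 1 * z ^ ?p) = \<mu> (mterm b 1 * z' ^ ?p)"
    if e: "red q (f ^ (q - 1) * z) = red q (f ^ (q - 1) * z')" for b z z'
  proof -
    have "f ^ (q - 1) * (z - z') \<in> frob_ideal q"
      using e by (simp add: red_eq_iff right_diff_distrib)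
    then have "(f ^ (q - 1) * (z - z')) ^ ?p \<in> frob_ideal ?Q"
      using frob_ideal_frob[of _ q 1] by simp
    then have "mterm b 1 * f ^ (?p - 1) * (f ^ (q - 1) * (z - z')) ^ ?p \<in> frob_ideal ?Q"
      by (rule frob_ideal_mult(1))
    moreover have "mterm b 1 * f ^ (?p - 1) * (f ^ (q - 1) * (z - z')) ^ ?p
        = f ^ (?Q - 1) * (mterm b 1 * z ^ ?p) - f ^ (?Q - 1) * (mterm b 1 * z' ^ ?p)"
    proof -
      have "?p - 1 + (q - 1) * ?p = ?Q - 1"
        using q0 by (cases q) (simp_all add: algebra_simps)
      then have "f ^ (?p - 1) * (f ^ (q - 1)) ^ ?p = f ^ (?Q - 1)"
        by (simp flip: power_add power_mult)
      moreover have "(z - z') ^ ?p = z ^ ?p - z' ^ ?p" using frob_diff[of z z' 1] by simp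
      ultimately show ?thesis
        by (simp only: power_mult_distrib mult.assoc[symmetric])
          (simp only: mult.assoc mult.left_commute right_diff_distrib)
    qed
    ultimately show ?thesis unfolding \<mu>_def red_eq_iff by simp
  qed
  have finT: "finite (T b)" and cardT: "card (T b) \<le> card (mult_image q V (f ^ (q - 1)))" for b
  proof -
    show "card (T b) \<le> card (mult_image q V (f ^ (q - 1)))"
      unfolding T_def mult_image_def
    proof (rule card_image_le_if_factor)
      show "finite ((\<lambda>s. red q (f ^ (q - 1) * s)) ` polys V)"
        using fin_im by (simp add: mult_image_def)
    qed (rule fac)
    have "T b \<subseteq> (\<lambda>m. \<mu> (mterm b 1 * (SOME z. z \<in> polys V \<and> red q (f ^ (q - 1) * z)
      = m) ^ ?p)) ` mult_image q V (f ^ (q - 1))"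
    proof
      fix y assume "y \<in> T b"
      then obtain z where z: "z \<in> polys V" "y = \<mu> (mterm b 1 * z ^ ?p)" by (auto simp: T_def)
      let ?m = "red q (f ^ (q - 1) * z)"
      let ?z = "SOME z. z \<in> polys V \<and> red q (f ^ (q - 1) * z) = ?m"
      have "?z \<in> polys V \<and> red q (f ^ (q - 1) * ?z) = ?m"
        by (rule someI[of "\<lambda>z. z \<in> polys V \<and> red q (f ^ (q - 1) * z) = ?m" z]) (use z in simp)
      then have "y = \<mu> (mterm b 1 * ?z ^ ?p)" unfolding z(2) by (intro fac) simp
      then show "y \<in> (\<lambda>m. \<mu> (mterm b 1 * (SOME z. z \<in> polys V \<and> red q (f ^ (q - 1) * z)
        = m) ^ ?p)) ` mult_image q V (f ^ (q - 1))"
        using z by (intro image_eqI[of _ _ ?m]) (auto simp: mult_image_def)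
    qed
    then show "finite (T b)" using fin_im finite_subset by blast
  qed
  let ?B = "box ?p V0"
  have fB: "finite ?B" using V by simp
  let ?\<Phi> = "\<lambda>(u, t). u + (\<Sum>b\<in>?B. t b)"
  have "mult_image ?Q V (f ^ (?Q - 1)) \<subseteq> ?\<Phi> ` (U \<times> PiE ?B T)"
  proof
    fix y assume "y \<in> mult_image ?Q V (f ^ (?Q - 1))"
    then obtain s where s: "s \<in> polys V" "y = \<mu> s" by (auto simp: mult_image_def \<mu>_def)
    obtain s' a b r where d: "supp s' \<subseteq> \<Gamma>" "b \<in> polys V" "r \<in> frob_ideal ?Q"
      "s = s' + f * a + g ^ (?p - 1) * b + r"
      using \<Gamma>[OF s(1)] by blast
    obtain y' a' where y': "y' \<in> pth_span V0 V" "g ^ (?p - 1) * b = y' + f * a'"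
      using mult_into_pth_span[OF V f gh d(2)] by blast
    obtain z where z: "y' = (\<Sum>b\<in>?B. mterm b 1 * z b ^ ?p)" "\<And>b. z b \<in> polys V"
      using y'(1) unfolding pth_span_def by blast
    have "y = \<mu> s' + \<mu> y'" unfolding s(2) d(4) y'(2) \<mu>_add \<mu>_f \<mu>_r[OF d(3)] by simp
    also have "\<mu> y' = (\<Sum>b\<in>?B. \<mu> (mterm b 1 * z b ^ ?p))"
      unfolding z(1) \<mu>_def by (simp add: sum_distrib_left red_sum)
    also have "\<dots> = (\<Sum>b\<in>?B. (\<lambda>b\<in>?B. \<mu> (mterm b 1 * z b ^ ?p)) b)" by (intro sum.cong) auto
    finally have "y = ?\<Phi> (\<mu> s', \<lambda>b\<in>?B. \<mu> (mterm b 1 * z b ^ ?p))" by simp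
    moreover have "(\<mu> s', \<lambda>b\<in>?B. \<mu> (mterm b 1 * z b ^ ?p)) \<in> U \<times> PiE ?B T"
      using d(1) z(2) by (auto simp: U_def T_def)
    ultimately show "y \<in> ?\<Phi> ` (U \<times> PiE ?B T)" by blast
  qed
  moreover have finP: "finite (U \<times> PiE ?B T)"
    using finU finT fB by (intro finite_cartesian_product finite_PiE) auto
  ultimately have "card (mult_image ?Q V (f ^ (?Q - 1))) \<le> card (U \<times> PiE ?B T)"
    by (meson card_image_le card_mono finite_imageI le_trans)
  also have "\<dots> = card U * (\<Prod>b\<in>?B. card (T b))"
    using fB by (simp add: card_cartesian_product card_PiE)
  also have "\<dots> \<le> ?p ^ card \<Gamma> * (\<Prod>b\<in>?B. card (mult_image q V (f ^ (q - 1))))"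
    by (intro mult_le_mono cardU prod_mono) (use cardT in auto)
  also have "(\<Prod>b\<in>?B. card (mult_image q V (f ^ (q - 1))))
    = card (mult_image q V (f ^ (q - 1))) ^ (?p ^ (card V - 1))"
    using V by (simp add: card_box card_Diff_singleton)
  finally show ?thesis .
qed

subsection \<open>Binomials\<close>

lemma card_diff_union:
  assumes "finite A" "B \<subseteq> A" "C \<subseteq> A"
  shows "int (card (A - (B \<union> C))) = int (card A) - int (card B) - int (card C) + int (card (B \<inter> C))"
proof -
  have f: "finite B" "finite C" using assms finite_subset by blast+
  have "card (A - (B \<union> C)) = card A - card (B \<union> C)" using assms f by (intro card_Diff_subset) auto
  moreover have "card (B \<union> C) \<le> card A" using assms by (intro card_mono) auto
  moreover have "card (B \<union> C) + card (B \<inter> C) = card B + card C" using card_Un_Int[OF f] by simp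
  ultimately show ?thesis by linarith
qed

text \<open>A monomial basis modulo the kernel of multiplication by the \<open>q - 1\<close>-st
  power of a binomial. Exchanging the two products of variables leaves some \<open>VY\<close>
  exponent zero; the sum condition says that some term of the power keeps all exponents below
  \<open>q\<close>.\<close>

definition binomial_mons :: "nat \<Rightarrow> 'v set \<Rightarrow> 'v set \<Rightarrow> 'v set \<Rightarrow> ('v \<Rightarrow>\<^sub>0 nat) set" where
  "binomial_mons q V VX VY =
     {m \<in> box q V. (\<exists>v\<in>VY. coef m v = 0) \<and> (\<forall>u\<in>VX. \<forall>v\<in>VY. coef m u + coef m v < q)}"

text \<open>\<open>M\<close> is the largest exponent on the first \<open>n\<close> variables:
  \<open>(M + 1) ^ n - M ^ n\<close> vectors have maximum \<open>M\<close>, and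
  \<open>(q - M) ^ n - (q - 1 - M) ^ n\<close> vectors with entries below \<open>q - M\<close>
  contain a zero.\<close>

definition binomial_count :: "nat \<Rightarrow> nat \<Rightarrow> nat" where
  "binomial_count n q = (\<Sum>M<q. ((M + 1) ^ n - M ^ n) * ((q - M) ^ n - (q - 1 - M) ^ n))"

lemma prod_three_parts:
  fixes a b c :: nat
  assumes "finite V" "VX \<subseteq> V" "VY \<subseteq> V" "VX \<inter> VY = {}"
  shows "(\<Prod>v\<in>V. if v \<in> VX then a else if v \<in> VY then b else c)
    = a ^ card VX * b ^ card VY * c ^ (card V - card VX - card VY)"
proof -
  have f: "finite VX" "finite VY" using assms finite_subset by blast+
  let ?f = "\<lambda>v. if v \<in> VX then a else if v \<in> VY then b else c"
  have V: "V = (VX \<union> VY) \<union> (V - VX - VY)" using assms by auto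
  have "prod ?f V = prod ?f (VX \<union> VY) * prod ?f (V - VX - VY)"
    by (subst V, rule prod.union_disjoint) (use f assms in auto)
  also have "prod ?f (VX \<union> VY) = prod ?f VX * prod ?f VY"
    by (rule prod.union_disjoint) (use f assms in auto)
  also have "prod ?f VX = a ^ card VX" by simp
  also have "prod ?f VY = b ^ card VY"
  proof -
    have "prod ?f VY = (\<Prod>v\<in>VY. b)" using assms by (intro prod.cong) auto
    then show ?thesis by simp
  qed
  also have "prod ?f (V - VX - VY) = c ^ card (V - VX - VY)"
  proof -
    have "prod ?f (V - VX - VY) = (\<Prod>v\<in>V - VX - VY. c)" by (intro prod.cong) auto
    then show ?thesis by simp
  qed
  also have "card (V - VX - VY) = card V - card VX - card VY"
    using assms f by (subst card_Diff_subset) (auto simp: card_Diff_subset)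
  finally show ?thesis .
qed

lemma card_binomial_mons:
  assumes V: "finite V" "VX \<subseteq> V" "VY \<subseteq> V" "VX \<inter> VY = {}" and n: "card VX = n" "card VY = n" "n > 0"
  shows "card (binomial_mons q V VX VY) = binomial_count n q * q ^ (card V - 2 * n)"
proof -
  have f: "finite VX" "finite VY" using V finite_subset by blast+
  have ne: "VX \<noteq> {}" "VY \<noteq> {}" using n by auto
  define B where "B S T = mons V (\<lambda>v. if v \<in> VX then S else if v \<in> VY then T else {..<q})"
    for S T :: "nat set"
  have cardB: "card (B S T) = card S ^ n * card T ^ n * q ^ (card V - 2 * n)" for S T
  proof -
    have "card (B S T) = (\<Prod>v\<in>V. if v \<in> VX then card S else if v \<in> VY then card T else q)"
      unfolding B_def card_mons[OF V(1)] by (intro prod.cong) auto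
    also have "\<dots> = card S ^ card VX * card T ^ card VY * q ^ (card V - card VX - card VY)"
      by (rule prod_three_parts[OF V])
    finally show ?thesis using n by (simp add: mult_2)
  qed
  \<comment> \<open>Vectors with maximum exactly \<open>M\<close> on \<open>VX\<close> and a zero
    among the entries on \<open>VY\<close>, each condition obtained by removing a smaller box;
    inclusion and exclusion give the product of differences.\<close>
  define CM where "CM M = B {..M} {..<q - M} - (B {..<M} {..<q - M} \<union> B {..M} {1..<q - M})" for M
  have memB: "m \<in> B S T \<longleftrightarrow> supp m \<subseteq> V \<and> (\<forall>v\<in>VX. coef m v \<in> S) \<and> (\<forall>v\<in>VY. coef m v \<in> T) \<and>
    (\<forall>v\<in>V - VX - VY. coef m v < q)" for m S T
    unfolding B_def mons_def using V by (auto split: if_splits)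
  have finB: "finite (B S T)" if "finite S" "finite T" for S T
    unfolding B_def using V that by (intro finite_mons) auto
  have cardCM: "card (CM M) = ((M + 1) ^ n - M ^ n) * ((q - M) ^ n - (q - 1 - M) ^ n) * q ^ (card V
    - 2 * n)" if M: "M < q" for M
  proof -
    have I: "B {..<M} {..<q - M} \<inter> B {..M} {1..<q - M} = B {..<M} {1..<q - M}"
      using V by (auto simp: memB less_imp_le)
    have "int (card (CM M)) = int (card (B {..M} {..<q - M})) - int (card (B {..<M} {..<q - M}))
        - int (card (B {..M} {1..<q - M})) + int (card (B {..<M} {1..<q - M}))"
      unfolding CM_def I[symmetric] by (rule card_diff_union) (auto simp: finB memB less_imp_le)
    also have "\<dots> = (int ((M + 1) ^ n) - int (M ^ n)) * (int ((q - M) ^ n) - int ((q - 1 - M) ^ n)) *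
      int (q ^ (card V - 2 * n))"
      unfolding cardB by (simp add: algebra_simps)
    also have "int ((M + 1) ^ n) - int (M ^ n) = int ((M + 1) ^ n - M ^ n)"
      by (subst of_nat_diff) (simp_all add: power_mono)
    also have "int ((q - M) ^ n) - int ((q - 1 - M) ^ n) = int ((q - M) ^ n - (q - 1 - M) ^ n)"
      by (subst of_nat_diff) (simp_all add: power_mono)
    finally show ?thesis by (simp only: of_nat_mult[symmetric] of_nat_eq_iff)
  qed
  have eq: "binomial_mons q V VX VY = (\<Union>M\<in>{..<q}. CM M)"
  proof (rule Set.set_eqI, rule iffI)
    fix m assume m: "m \<in> binomial_mons q V VX VY"
    then have mb: "supp m \<subseteq> V" "\<And>v. v \<in> V \<Longrightarrow> coef m v < q" "\<exists>v\<in>VY. coef m v = 0"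
      "\<And>u v. u \<in> VX \<Longrightarrow> v \<in> VY \<Longrightarrow> coef m u + coef m v < q"
      by (auto simp: binomial_mons_def mons_def)
    define M where "M = Max (coef m ` VX)"
    have le: "coef m v \<le> M" if "v \<in> VX" for v unfolding M_def using that f by (intro Max_ge) auto
    have "M \<in> coef m ` VX" unfolding M_def using f ne by (intro Max_in) auto
    then obtain u where u: "u \<in> VX" "coef m u = M" by blast
    have "M < q" using mb(2)[of u] u V by auto
    moreover have "m \<in> B {..M} {..<q - M}"
      unfolding memB
    proof (intro conjI ballI)
      show "coef m v \<in> {..<q - M}" if "v \<in> VY" for v using mb(4)[OF u(1) that] u(2) by simp
    qed (use mb(1,2) le in simp_all)
    moreover have "m \<notin> B {..<M} {..<q - M}"
    proof
      assume "m \<in> B {..<M} {..<q - M}"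
      then have "coef m u \<in> {..<M}" using u(1) unfolding memB by blast
      then show False using u(2) by simp
    qed
    moreover have "m \<notin> B {..M} {1..<q - M}"
    proof
      assume B: "m \<in> B {..M} {1..<q - M}"
      obtain v where "v \<in> VY" "coef m v = 0" using mb(3) by blast
      moreover from this(1) have "coef m v \<in> {1..<q - M}" using B unfolding memB by blast
      ultimately show False by simp
    qed
    ultimately show "m \<in> (\<Union>M\<in>{..<q}. CM M)" unfolding CM_def by blast
  next
    fix m assume "m \<in> (\<Union>M\<in>{..<q}. CM M)"
    then obtain M where M: "M < q" "m \<in> B {..M} {..<q - M}" "m \<notin> B {..<M} {..<q - M}"
      "m \<notin> B {..M} {1..<q - M}"
      unfolding CM_def by blast
    have b: "supp m \<subseteq> V" "\<And>v. v \<in> VX \<Longrightarrow> coef m v \<le> M" "\<And>v. v \<in> VY \<Longrightarrow> coef m v < q - M"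
      "\<And>v. v \<in> V - VX - VY \<Longrightarrow> coef m v < q"
      using M(2) unfolding memB by simp_all
    have "\<exists>v\<in>VY. coef m v = 0"
    proof (rule ccontr)
      assume "\<not> ?thesis"
      then have "m \<in> B {..M} {1..<q - M}" using b unfolding memB by (simp add: Suc_le_eq)
      then show False using M(4) by simp
    qed
    moreover have "coef m u + coef m v < q" if "u \<in> VX" "v \<in> VY"
      for u v using b(2)[OF that(1)] b(3)[OF that(2)] by simp
    moreover have "coef m v < q" if "v \<in> V" for v
      using b(2)[of v] b(3)[of v] b(4)[of v] that M(1) by (cases "v \<in> VX"; cases "v \<in> VY") auto
    ultimately show "m \<in> binomial_mons q V VX VY"
      using b(1) by (auto simp: binomial_mons_def mons_def)
  qed
  have disj: "CM M \<inter> CM M' = {}" if "M < M'" for M M'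
  proof -
    have "m \<notin> CM M'" if "m \<in> CM M" for m
    proof
      assume "m \<in> CM M'"
      then have 1: "m \<in> B {..M'} {..<q - M'}" unfolding CM_def by blast
      have "m \<in> B {..M} {..<q - M}" using that unfolding CM_def by blast
      then have "coef m v < M'" if "v \<in> VX" for v using that \<open>M < M'\<close> unfolding memB
        by (meson atMost_iff le_less_trans)
      then have "m \<in> B {..<M'} {..<q - M'}" using 1 unfolding memB by simp
      then show False using \<open>m \<in> CM M'\<close> by (simp add: CM_def)
    qed
    then show ?thesis by blast
  qed
  have "card (binomial_mons q V VX VY) = (\<Sum>M<q. card (CM M))"
    unfolding eq
  proof (rule card_UN_disjoint)
    show "\<forall>M\<in>{..<q}. finite (CM M)" by (auto simp: CM_def finB)
    show "\<forall>M\<in>{..<q}. \<forall>M'\<in>{..<q}. M \<noteq> M' \<longrightarrow> CM M \<inter> CM M' = {}"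
      using disj by (metis Int_commute linorder_neqE_nat)
  qed simp
  also have "\<dots> = binomial_count n q * q ^ (card V - 2 * n)"
    by (simp add: cardCM binomial_count_def sum_distrib_right)
  finally show ?thesis .
qed

context
  fixes V VX VY :: "'v::linorder set" and c :: "'p::prime_card mod_ring" and q e n :: nat
    and T :: "('v, 'p mod_ring) mpoly"
  assumes V: "finite V" "VX \<subseteq> V" "VY \<subseteq> V" "VX \<inter> VY = {}" and n: "card VX = n" "card VY = n" "n > 0"
    and c: "c \<noteq> 0" and q: "q = CARD('p) ^ e"
    and T: "T = mterm (monf VX (\<lambda>_. 1)) 1 - mterm (monf VY (\<lambda>_. 1)) c"
begin

abbreviation (input) "mX \<equiv> monf VX (\<lambda>_. 1)"
abbreviation (input) "mY \<equiv> monf VY (\<lambda>_. 1)"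

lemma finXY: "finite VX" "finite VY" using V finite_subset by blast+

lemma lookup_mX: "coef (monf VX (\<lambda>_. k)) v = (if v \<in> VX then k else 0)"
    "coef (monf VY (\<lambda>_. k)) v = (if v \<in> VY then k else 0)"
  using finXY by (simp_all add: lookup_monf)

lemma neXY: "VX \<noteq> {}" "VY \<noteq> {}" using n by auto

lemma q0: "q > 0" using q by simp

lemma T_nonzero: "T \<noteq> 0"
proof -
  obtain u where u: "u \<in> VX" using neXY by blast
  have "coef mX u = 1" "coef mY u = 0" using u V by (auto simp: lookup_mX)
  then have "mX \<noteq> mY" by auto
  then have "coef T mX = 1" by (simp add: T lookup_minus lookup_single)
  then show ?thesis by auto
qed

text \<open>Since \<open>T ^ q\<close> is the difference of the \<open>q\<close>-th powers, dividing
  by \<open>T\<close> gives a geometric sum, with all binomial coefficients gone.\<close>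

lemma T_power: "T ^ (q - 1) = (\<Sum>i<q. mterm (mscale i mX + mscale (q - 1 - i) mY) (c ^ (q - 1 - i)))"
proof -
  have "T * T ^ (q - 1) = T ^ q" using power_pred[OF q0, of T] by simp
  also have "\<dots> = mterm mX 1 ^ q - mterm mY c ^ q" unfolding T q by (rule frob_diff)
  also have "\<dots> = (mterm mX 1 - mterm mY c) * (\<Sum>i<q. mterm mY c ^ (q - Suc i) * mterm mX 1 ^ i)"
    by (rule power_diff_sumr2)
  also have "(\<Sum>i<q. mterm mY c ^ (q - Suc i) * mterm mX 1 ^ i)
      = (\<Sum>i<q. mterm (mscale i mX + mscale (q - 1 - i) mY) (c ^ (q - 1 - i)))"
    by (intro sum.cong) (simp_all add: mono_power mult_single add.commute)
  finally have "T * T ^ (q - 1) = T * (\<Sum>i<q. mterm (mscale i mX + mscale (q - 1 - i) mY) (c ^ (q - 1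
    - i)))"
    unfolding T .
  then show ?thesis using T_nonzero by simp
qed

definition "bE i = mscale i (monf VX (\<lambda>_. 1)) + mscale (q - 1 - i) (monf VY (\<lambda>_. 1))"

abbreviation (input) "bC \<equiv> binomial_mons q V VX VY"

text \<open>As \<open>l\<close> and \<open>m\<close> have a zero exponent on \<open>VY\<close>, the
  least \<open>VY\<close> exponent of the sum is \<open>q - 1 - i\<close>, which recovers
  \<open>i\<close>.\<close>

lemma bE_unique:
  assumes "i < q" "j < q" "l \<in> bC" "m \<in> bC" "bE i + l = bE j + m"
  shows "i = j \<and> l = m"
proof -
  have le: "j \<le> i" if h: "i < q" "j < q" "m \<in> bC" "bE i + l = bE j + m" for i j l m
  proof -
    obtain v where v: "v \<in> VY" "coef m v = 0" using h(3) by (auto simp: binomial_mons_def)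
    have "v \<notin> VX" using v V by auto
    then have "q - 1 - i + coef l v = q - 1 - j"
      using arg_cong[OF h(4), of "\<lambda>x. coef x v"] v by (simp add: bE_def lookup_add lookup_mX)
    then show ?thesis using h by linarith
  qed
  have "i = j" using le[OF assms(1,2,4,5)] le[OF assms(2,1,3) assms(5)[symmetric]] by simp
  then show ?thesis using assms(5) by simp
qed

lemma coef_T_power_mult:
  assumes P: "supp P \<subseteq> bC" and m: "m \<in> bC" and j: "j < q"
  shows "coef (T ^ (q - 1) * P) (bE j + m) = c ^ (q - 1 - j) * coef P m"
proof -
  have "T ^ (q - 1) * P = (\<Sum>i<q. mterm (bE i) (c ^ (q - 1 - i)) * P)"
    unfolding T_power bE_def by (simp add: sum_distrib_right)
  then have "coef (T ^ (q - 1) * P) (bE j + m)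
    = (\<Sum>i<q. coef (mterm (bE i) (c ^ (q - 1 - i)) * P) (bE j + m))"
    by (simp add: lookup_sum)
  also have "\<dots> = (\<Sum>i<q. if i = j then c ^ (q - 1 - j) * coef P m else 0)"
  proof (rule sum.cong)
    fix i assume i: "i \<in> {..<q}"
    show "coef (mterm (bE i) (c ^ (q - 1 - i)) * P) (bE j + m)
      = (if i = j then c ^ (q - 1 - j) * coef P m else 0)"
    proof (cases "i = j")
      case True
      then show ?thesis by (simp add: lookup_mono_mult)
    next
      case False
      show ?thesis
      proof (cases "\<exists>l. bE j + m = bE i + l")
        case True
        then obtain l where l: "bE j + m = bE i + l" by blast
        have "l \<notin> bC" using bE_unique[of i j l m] i j m l False by auto
        then have "coef P l = 0" using P by (auto simp: in_keys_iff)
        then show ?thesis using False lookup_mono_mult[of "bE i" "c ^ (q - 1 - i)" P l]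
          by (simp add: l)
      next
        case no: False
        then show ?thesis using False by (simp add: lookup_mono_mult_not)
      qed
    qed
  qed simp
  also have "\<dots> = c ^ (q - 1 - j) * coef P m" using j by simp
  finally show ?thesis .
qed

lemma finite_bC: "finite bC"
  using V by (simp add: binomial_mons_def)

lemma card_mult_image_binomial_ge: "CARD('p) ^ card bC \<le> card (mult_image q V (T ^ (q - 1)))"
proof -
  let ?P = "{P :: ('v, 'p mod_ring) mpoly. supp P \<subseteq> bC}"
  have TV: "T \<in> polys V" unfolding T
    using V supp_monf[OF finXY(1)] supp_monf[OF finXY(2)] by (intro polys_diff polys_mono) blast+
  have "inj_on (\<lambda>P. red q (T ^ (q - 1) * P)) ?P"
  proof (rule inj_onI)
    fix P P' assume P: "P \<in> ?P" "P' \<in> ?P" "red q (T ^ (q - 1) * P) = red q (T ^ (q - 1) * P')"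
    show "P = P'"
    proof (rule poly_mapping_eqI)
      fix m
      show "coef P m = coef P' m"
      proof (cases "m \<in> bC")
        case True
        define M where "M = Max (coef m ` VX)"
        have le: "coef m v \<le> M" if "v \<in> VX" for v unfolding M_def using that finXY
          by (intro Max_ge) auto
        have "M \<in> coef m ` VX" unfolding M_def using finXY neXY by (intro Max_in) auto
        then obtain u where u: "u \<in> VX" "coef m u = M" by blast
        have mb: "\<And>v. coef m v < q" "\<And>u v. u \<in> VX \<Longrightarrow> v \<in> VY \<Longrightarrow> coef m u + coef m v < q"
          using True q0 by (auto simp: binomial_mons_def box_iff)
        have Mq: "M < q" using mb(1)[of u] u by simp
        \<comment> \<open>The term of \<open>T ^ (q - 1)\<close> with exponent
          \<open>q - 1 - M\<close> on \<open>VX\<close> keeps the product with \<open>m\<close> in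
          the box: its exponent on \<open>VY\<close> is \<open>M\<close>, and the sum condition on
          \<open>m\<close> applies.\<close>
        have j: "q - 1 - M < q" "q - 1 - (q - 1 - M) = M" using q0 Mq by auto
        have bx: "coef (bE (q - 1 - M) + m) v < q" for v
        proof -
          consider "v \<in> VX" "v \<notin> VY" | "v \<in> VY" "v \<notin> VX" | "v \<notin> VX" "v \<notin> VY" using V by blast
          then show ?thesis
          proof cases
            case 1
            then show ?thesis using le[of v] Mq by (simp add: bE_def lookup_add lookup_mX)
          next
            case 2
            then show ?thesis using mb(2)[OF u(1), of v] u(2) j(2)
              by (simp add: bE_def lookup_add lookup_mX)
          next
            case 3
            then show ?thesis using mb(1)[of v] by (simp add: bE_def lookup_add lookup_mX)
          qed
        qed
        have "coef (red q (T ^ (q - 1) * P)) (bE (q - 1 - M) + m)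
          = coef (red q (T ^ (q - 1) * P')) (bE (q - 1 - M) + m)"
          using P(3) by simp
        then have "c ^ M * coef P m = c ^ M * coef P' m"
        proof -
          have e: "coef (T ^ (q - 1) * P) (bE (q - 1 - M) + m)
            = coef (T ^ (q - 1) * P') (bE (q - 1 - M) + m)"
            using bx arg_cong[OF P(3), of "\<lambda>x. coef x (bE (q - 1 - M) + m)"]
              by (simp add: lookup_red)
          have "coef (T ^ (q - 1) * Q) (bE (q - 1 - M) + m) = c ^ M * coef Q m" if "Q \<in> ?P" for Q
            using coef_T_power_mult[OF _ True j(1), of Q] that unfolding j(2) by blast
          then show ?thesis using e P(1,2) by metis
        qed
        then show ?thesis using c by simp
      next
        case False
        then have "m \<notin> supp P" "m \<notin> supp P'" using P(1,2) by blast+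
        then show ?thesis by (simp add: in_keys_iff)
      qed
    qed
  qed
  moreover have "(\<lambda>P. red q (T ^ (q - 1) * P)) ` ?P \<subseteq> mult_image q V (T ^ (q - 1))"
  proof -
    have "P \<in> polys V" if "P \<in> ?P" for P
      using that q0 by (auto simp: polys_def binomial_mons_def mons_def)
    then show ?thesis by (auto simp: mult_image_def)
  qed
  moreover have "finite (mult_image q V (T ^ (q - 1)))"
    using V q0 TV by (intro finite_mult_image) auto
  ultimately have "card ?P \<le> card (mult_image q V (T ^ (q - 1)))" by (meson card_inj_on_le)
  then show ?thesis using card_supported(2)[OF finite_bC, where 'a = "'p mod_ring"]
    by (simp add: card_mod_ring)
qed

lemma card_mult_image_binomial_le: "card (mult_image q V (T ^ (q - 1))) \<le> CARD('p) ^ card bC"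
proof -
  let ?P = "{P :: ('v, 'p mod_ring) mpoly. supp P \<subseteq> bC}"
  let ?\<mu> = "\<lambda>s. red q (T ^ (q - 1) * s)"
  have \<mu>_add: "?\<mu> (s + t) = ?\<mu> s + ?\<mu> t" for s t by (simp add: distrib_left red_add)
  have T0: "coef T 0 = 0"
  proof -
    obtain u v where "u \<in> VX" "v \<in> VY" using neXY by blast
    then have "coef mX u = 1" "coef mY v = 1" by (simp_all add: lookup_mX)
    then have "mX \<noteq> 0" "mY \<noteq> 0" by auto
    then show ?thesis by (simp add: T lookup_minus lookup_single)
  qed
  have Tq: "T ^ q \<in> frob_ideal q" unfolding q by (rule frob_power_in_frob_ideal[OF T0])
  \<comment> \<open>\<open>T ^ q\<close> vanishes modulo the Frobenius power, so after
    multiplication by \<open>T ^ (q - 1)\<close> the product over \<open>VX\<close> equals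
    \<open>c\<close> times the product over \<open>VY\<close>.\<close>
  have swap: "?\<mu> (mterm (mY + m) a) = ?\<mu> (mterm (mX + m) (a / c))" for m a
  proof -
    have "mterm (mX + m) (a / c) - mterm (mY + m) a = T * mterm m (a / c)"
      using c by (simp add: T left_diff_distrib mult_single)
    then have "T ^ (q - 1) * (mterm (mX + m) (a / c) - mterm (mY + m) a) = T ^ q * mterm m (a / c)"
      by (simp add: power_pred[OF q0, of T] mult_ac)
    moreover have "T ^ q * mterm m (a / c) \<in> frob_ideal q" by (rule frob_ideal_mult(2)[OF Tq])
    ultimately have "T ^ (q - 1) * mterm (mX + m) (a / c) - T ^ (q - 1) * mterm (mY
      + m) a \<in> frob_ideal q"
      by (simp add: right_diff_distrib)
    then show ?thesis unfolding red_eq_iff[symmetric] by simp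
  qed
  \<comment> \<open>Each exchange lowers the total degree in \<open>VY\<close>, until some
    \<open>VY\<close> variable is absent. If the monomial is still outside \<open>bC\<close>, every
    term of its product with \<open>T ^ (q - 1)\<close> has an exponent at least
    \<open>q\<close>.\<close>
  have mon: "\<exists>P\<in>?P. ?\<mu> (mterm m a) = ?\<mu> P" if "supp m \<subseteq> V" for m a
    using that
  proof (induction "\<Sum>v\<in>VY. coef m v" arbitrary: m a rule: less_induct)
    case less
    show ?case
    proof (cases "\<exists>v\<in>VY. coef m v = 0")
      case True
      show ?thesis
      proof (cases "m \<in> bC")
        case True
        then show ?thesis by (intro bexI[of _ "mterm m a"]) auto
      next
        case False
        have "T ^ (q - 1) * mterm m a \<in> frob_ideal q"
          unfolding frob_ideal_def
        proof (intro CollectI ballI)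
          fix k assume "k \<in> supp (T ^ (q - 1) * mterm m a)"
          then obtain k1 k2 where k: "k = k1 + k2" "k1 \<in> supp (T ^ (q - 1))" "k2 \<in> supp (mterm m a)"
            by (rule supp_mult_E)
          have "supp (T ^ (q - 1)) \<subseteq> (\<Union>i\<in>{..<q}. supp (mterm (bE i) (c ^ (q - 1 - i))))"
            unfolding T_power bE_def by (rule keys_sum)
          then obtain i where i: "i < q" "k1 = bE i" using k(2) c by auto
          have k2: "k2 = m" using k(3) by (simp split: if_splits)
          show "\<exists>v. q \<le> coef k v"
          proof (rule ccontr)
            assume "\<not> ?thesis"
            then have lt: "coef (bE i) v + coef m v < q"
              for v by (simp add: k i k2 lookup_add not_le)
            have "m \<in> box q V" using less.prems lt q0
              by (auto simp: box_iff intro: le_less_trans[OF le_add2])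
            moreover have "coef m u + coef m v < q" if "u \<in> VX" "v \<in> VY" for u v
            proof -
              have "u \<notin> VY" "v \<notin> VX" using that V by auto
              then have "i + coef m u < q" "q - 1 - i + coef m v < q"
                using lt[of u] lt[of v] that by (simp_all add: bE_def lookup_add lookup_mX)
              then show ?thesis using i(1) by linarith
            qed
            ultimately have "m \<in> bC" using \<open>\<exists>v\<in>VY. coef m v = 0\<close> by (auto simp: binomial_mons_def)
            then show False using False by simp
          qed
        qed
        then have "?\<mu> (mterm m a) = 0" by (simp only: red_eq_0_iff)
        then show ?thesis by (intro bexI[of _ 0]) auto
      qed
    next
      case False
      define m' where "m' = m - mY"
      have mm: "m = mY + m'"
        by (rule poly_mapping_eqI) (use False in \<open>auto simp: m'_def lookup_add lookup_minus
          lookup_mX Suc_le_eq\<close>)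
      have "(\<Sum>v\<in>VY. coef (mX + m') v) < (\<Sum>v\<in>VY. coef m v)"
      proof (rule sum_strict_mono)
        show "finite VY" "VY \<noteq> {}" using finXY neXY by auto
        fix v assume v: "v \<in> VY"
        then have "v \<notin> VX" using V by auto
        then show "coef (mX + m') v < coef m v" using v by (simp add: mm lookup_add lookup_mX)
      qed
      moreover have "supp (mX + m') \<subseteq> V"
        using less.prems supp_monf[OF finXY(1), of "\<lambda>_. 1"] V(2) unfolding mm supp_add_mon by blast
      ultimately obtain P where "P \<in> ?P" "?\<mu> (mterm (mX + m') (a / c)) = ?\<mu> P"
        using less.hyps by blast
      then show ?thesis unfolding mm swap by blast
    qed
  qed
  have "\<exists>P\<in>?P. ?\<mu> s = ?\<mu> P" if "s \<in> polys V" for s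
    using that
  proof (induction rule: polys_induct)
    case zero
    then show ?case by (intro bexI[of _ 0]) auto
  next
    case (mterm m a)
    then show ?case by (rule mon)
  next
    case (add s t)
    obtain P Q where "P \<in> ?P" "?\<mu> s = ?\<mu> P" "Q \<in> ?P" "?\<mu> t = ?\<mu> Q" using add by blast
    moreover have "P + Q \<in> ?P" using calculation keys_add[of P Q] by blast
    ultimately show ?case using \<mu>_add[of s t] \<mu>_add[of P Q] by (intro bexI[of _ "P + Q"]) auto
  qed
  then have "mult_image q V (T ^ (q - 1)) \<subseteq> ?\<mu> ` ?P" unfolding mult_image_def by blast
  moreover have fin: "finite ?P" by (rule card_supported(1)[OF finite_bC])
  ultimately have "card (mult_image q V (T ^ (q - 1))) \<le> card ?P"
    by (meson card_image_le card_mono finite_imageI le_trans)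
  then show ?thesis using card_supported(2)[OF finite_bC, where 'a = "'p mod_ring"]
    by (simp add: card_mod_ring)
qed

lemma card_mult_image_binomial:
  "card (mult_image q V (T ^ (q - 1))) = CARD('p) ^ (binomial_count n q * q ^ (card V - 2 * n))"
  using card_mult_image_binomial_ge card_mult_image_binomial_le card_binomial_mons[OF V n, of q]
    by simp

end

subsection \<open>The cyclic degeneration\<close>

definition cyc :: "nat \<Rightarrow> nat \<Rightarrow> nat" where
  "cyc n i = (if i < n then Suc i mod n else i)"

lemma cyc_less: "i < n \<Longrightarrow> cyc n i < n" by (simp add: cyc_def)

lemma cyc_neq: "n \<ge> 2 \<Longrightarrow> i < n \<Longrightarrow> cyc n i \<noteq> i"
  by (cases "Suc i = n") (auto simp: cyc_def)

lemma cyc_perms: "cyc n \<in> perms n"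
proof -
  have "inj_on (cyc n) {0..<n}"
  proof (rule inj_onI)
    fix i j assume "i \<in> {0..<n}" "j \<in> {0..<n}" "cyc n i = cyc n j"
    then show "i = j" by (cases "Suc i = n"; cases "Suc j = n") (auto simp: cyc_def)
  qed
  moreover have "cyc n ` {0..<n} \<subseteq> {0..<n}" using cyc_less by auto
  ultimately have "bij_betw (cyc n) {0..<n} {0..<n}"
    unfolding bij_betw_def using endo_inj_surj[of "{0..<n}" "cyc n"] by simp
  then show ?thesis using bij_imp_permutes[of "cyc n" "{0..<n}"] by (simp add: cyc_def)
qed

text \<open>If one index moves, its successor is already taken as a value and must move as well; the
  movement runs around the whole cycle.\<close>

lemma perm_between_id_cyc:
  assumes n: "n \<ge> 2" and \<pi>: "\<pi> \<in> perms n" "\<And>i. i < n \<Longrightarrow> \<pi> i = i \<or> \<pi> i = cyc n i"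
  shows "\<pi> = id \<or> \<pi> = cyc n"
proof (cases "\<exists>i<n. \<pi> i \<noteq> i")
  case False
  then have "\<pi> i = i" for i using \<pi>(1) by (cases "i < n") (auto simp: permutes_def)
  then show ?thesis by auto
next
  case True
  then obtain i0 where i0: "i0 < n" "\<pi> i0 = cyc n i0" using \<pi>(2) by blast
  have inj: "inj \<pi>" using \<pi>(1) permutes_inj by blast
  have step: "\<pi> ((i0 + k) mod n) = cyc n ((i0 + k) mod n)" for k
  proof (induction k)
    case 0
    then show ?case using i0 by simp
  next
    case (Suc k)
    let ?i = "(i0 + k) mod n"
    have i: "?i < n" "cyc n ?i = (i0 + Suc k) mod n" using n by (simp_all add: cyc_def mod_Suc_eq)
    show ?case
    proof (rule ccontr)
      assume "\<not> ?thesis"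
      then have "\<pi> (cyc n ?i) = cyc n ?i" using \<pi>(2)[of "cyc n ?i"] cyc_less[OF i(1)] i(2) by auto
      then have "\<pi> (cyc n ?i) = \<pi> ?i" using Suc by simp
      then have "cyc n ?i = ?i" using inj by (simp add: inj_eq)
      then show False using cyc_neq[OF n i(1)] by simp
    qed
  qed
  have "\<pi> i = cyc n i" for i
  proof (cases "i < n")
    case True
    then have "(i0 + (n - i0 + i)) mod n = i" using i0(1) by simp
    then show ?thesis using step[of "n - i0 + i"] by simp
  next
    case False
    then show ?thesis using \<pi>(1) by (auto simp: permutes_def cyc_def)
  qed
  then show ?thesis by auto
qed

definition diag_vars :: "nat \<Rightarrow> (nat \<times> nat) set" where "diag_vars n = (\<lambda>i. (i, i)) ` {..<n}"
definition cyc_vars :: "nat \<Rightarrow> (nat \<times> nat) set" where "cyc_vars n = (\<lambda>i. (i, cyc n i)) ` {..<n}"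

lemma diag_cyc_vars:
  assumes "n \<ge> 2"
  shows "diag_vars n \<subseteq> matrix_vars n" "cyc_vars n \<subseteq> matrix_vars n" "diag_vars n \<inter> cyc_vars n = {}"
    "card (diag_vars n) = n" "card (cyc_vars n) = n"
    "permmon n 0 id = monf (diag_vars n) (\<lambda>_. 1)" "permmon n 0 (cyc n) = monf (cyc_vars n) (\<lambda>_. 1)"
proof -
  show "diag_vars n \<subseteq> matrix_vars n" "cyc_vars n \<subseteq> matrix_vars n"
    using cyc_less by (auto simp: diag_vars_def cyc_vars_def matrix_vars_def)
  show "diag_vars n \<inter> cyc_vars n = {}" using cyc_neq[OF assms, THEN not_sym]
    by (auto simp: diag_vars_def cyc_vars_def)
  show "card (diag_vars n) = n" "card (cyc_vars n) = n"
    unfolding diag_vars_def cyc_vars_def by (subst card_image; auto simp: inj_on_def)+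
  have f: "finite (diag_vars n)" "finite (cyc_vars n)" by (simp_all add: diag_vars_def cyc_vars_def)
  have "coef (permmon n 0 id) (i, j) = coef (monf (diag_vars n) (\<lambda>_. 1)) (i, j)" for i j
    using f by (auto simp: lookup_permmon lookup_monf diag_vars_def)
  then show "permmon n 0 id = monf (diag_vars n) (\<lambda>_. 1)"
    by (intro poly_mapping_eqI) (simp add: split_paired_all)
  have "coef (permmon n 0 (cyc n)) (i, j) = coef (monf (cyc_vars n) (\<lambda>_. 1)) (i, j)" for i j
    using f by (auto simp: lookup_permmon lookup_monf cyc_vars_def)
  then show "permmon n 0 (cyc n) = monf (cyc_vars n) (\<lambda>_. 1)"
    by (intro poly_mapping_eqI) (simp add: split_paired_all)
qed

lemma card_mult_image_minor_ge:
  assumes n: "n \<ge> 2" and q: "q = CARD('p::prime_card) ^ e"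
  shows "CARD('p) ^ (binomial_count n q * q ^ (n * n - 2 * n))
      \<le> card (mult_image q (matrix_vars n) ((minor n 0 :: (nat \<times> nat, 'p mod_ring) mpoly) ^
        (q - 1)))"
    and "n = 2 \<Longrightarrow> card (mult_image q (matrix_vars n) ((minor n 0 :: (nat \<times> nat, 'p mod_ring) mpoly) ^
      (q - 1)))
      = CARD('p) ^ binomial_count n q"
proof -
  let ?f = "minor n 0 :: (nat \<times> nat, 'p mod_ring) mpoly"
  let ?t = "\<lambda>\<pi>. mterm (permmon n 0 \<pi>) (of_int (sign \<pi>) :: 'p mod_ring)"
  have q0: "q > 0" using q by simp
  define s where "s = - (of_int (sign (cyc n)) :: 'p mod_ring)"
  define T where "T = mterm (monf (diag_vars n) (\<lambda>_. 1)) 1 - mterm (monf (cyc_vars n) (\<lambda>_. 1)) s"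
  define R where "R = (\<Sum>\<pi>\<in>perms n - {id, cyc n}. ?t \<pi>)"
  have s0: "s \<noteq> 0" unfolding s_def by (cases "evenperm (cyc n)") (simp_all add: sign_def)
  have ne: "id \<noteq> cyc n" using cyc_neq[OF n, of 0] n by (metis id_apply less_le_trans pos2)
  have Tt: "T = ?t id + ?t (cyc n)"
    unfolding T_def s_def diag_cyc_vars(6,7)[OF n, symmetric] by (simp add: single_uminus)
  have "?f = (\<Sum>\<pi>\<in>{id, cyc n}. ?t \<pi>) + R"
    unfolding minor_expand R_def using cyc_perms[of n] id_perms[of n]
    by (subst sum.subset_diff[of "{id, cyc n}"]) (auto simp: add.commute simp del: mem_Collect_eq)
  then have fTR: "?f = T + R" using ne by (simp add: Tt)
  \<comment> \<open>Every permutation monomial has weight at most \<open>n\<close>, with equality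
    only for permutations that use diagonal and cyclic entries alone: the identity and the
    cycle.\<close>
  define w :: "nat \<times> nat \<Rightarrow> nat" where "w = (\<lambda>(i, j). if j = i \<or> j = cyc n i then 1 else 0)"
  have wt_eq: "wt w (permmon n 0 \<pi>) = (\<Sum>i<n. if \<pi> i = i \<or> \<pi> i = cyc n i then 1 else 0)" for \<pi>
    by (simp add: wt_permmon w_def)
  have wT: "wt w m = n" if m: "m \<in> supp T" for m
  proof -
    have "m = permmon n 0 id \<or> m = permmon n 0 (cyc n)"
      using m keys_add[of "?t id" "?t (cyc n)"] unfolding Tt by (auto split: if_splits)
    then show ?thesis by (auto simp: wt_eq)
  qed
  have wR: "wt w m < n" if m: "m \<in> supp R" for m
  proof -
    have "supp R \<subseteq> (\<Union>\<pi>\<in>perms n - {id, cyc n}. supp (?t \<pi>))" unfolding R_def by (rule keys_sum)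
    then have "m \<in> (\<Union>\<pi>\<in>perms n - {id, cyc n}. supp (?t \<pi>))" using m by blast
    then obtain \<pi> where \<pi>0: "\<pi> \<in> perms n - {id, cyc n}" "m \<in> supp (?t \<pi>)" by blast
    then have \<pi>: "\<pi> \<in> perms n" "\<pi> \<noteq> id" "\<pi> \<noteq> cyc n" "m = permmon n 0 \<pi>"
      by (simp_all split: if_splits)
    obtain i where i: "i < n" "\<not> (\<pi> i = i \<or> \<pi> i = cyc n i)"
      using perm_between_id_cyc[OF n \<pi>(1)] \<pi>(2,3) by blast
    have "(\<Sum>i<n. if \<pi> i = i \<or> \<pi> i = cyc n i then 1 else 0) < (\<Sum>i<n. 1::nat)"
      by (rule sum_strict_mono_ex1) (use i in auto)
    then show ?thesis by (simp add: \<pi>(4) wt_eq)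
  qed
  have card_T: "card (mult_image q (matrix_vars n) (T ^ (q - 1)))
    = CARD('p) ^ (binomial_count n q * q ^ (n * n - 2 * n))"
    using card_mult_image_binomial[OF finite_matrix_vars diag_cyc_vars(1-5)[OF n] _ s0 q T_def] n
    by (simp add: card_matrix_vars)
  have tp: "(\<forall>m\<in>supp (T ^ (q - 1)). wt w m = (q - 1) * n) \<and>
    (\<forall>m\<in>supp ((T + R) ^ (q - 1) - T ^ (q - 1)). wt w m < (q - 1) * n)"
    by (rule top_form_power) (use wT wR in auto)
  have "card (mult_image q (matrix_vars n) (T ^ (q - 1)))
      \<le> card (mult_image q (matrix_vars n) (T ^ (q - 1) + ((T + R) ^ (q - 1) - T ^ (q - 1))))"
    by (rule card_mult_image_top_form[OF finite_matrix_vars q0, of _ w "(q - 1) * n"])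
      (use tp in auto)
  then show "CARD('p) ^ (binomial_count n q * q ^ (n * n - 2 * n))
    \<le> card (mult_image q (matrix_vars n) (?f ^ (q - 1)))"
    unfolding card_T fTR add_diff_eq[symmetric]
      by (simp only: add_diff_cancel_left' add_diff_cancel_left diff_add_cancel add_diff_eq)
  assume n2: "n = 2"
  \<comment> \<open>In size 2 there is no further permutation, so the degeneration loses
    nothing.\<close>
  have "\<pi> = id \<or> \<pi> = cyc n" if "\<pi> \<in> perms n" for \<pi>
  proof (rule perm_between_id_cyc[OF n that])
    fix i assume "i < n"
    then have "\<pi> i < 2" "i < 2" using perms_less[OF that] n2 by auto
    then show "\<pi> i = i \<or> \<pi> i = cyc n i" using n2 by (auto simp: cyc_def less_2_cases_iff)
  qed
  then have "R = 0" unfolding R_def by (intro sum.neutral) blast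
  then show "card (mult_image q (matrix_vars n) (?f ^ (q - 1))) = CARD('p) ^ binomial_count n q"
    using card_T unfolding fTR by (simp add: n2)
qed

section \<open>Estimates for the binomial count\<close>

text \<open>Both sides count the subsets of size \<open>a + b + 1\<close> of \<open>{0..m}\<close>,
  on the left by the element \<open>M\<close> that has \<open>a\<close> chosen elements below it.
  The induction uses Pascal's rule in the second factor.\<close>

lemma sum_choose_convolution: "(\<Sum>M\<le>m. (M choose a) * ((m - M) choose b)) = Suc m choose (a + b + 1)"
proof (induction m arbitrary: b)
  case 0
  then show ?case by (cases a; cases b) auto
next
  case (Suc m)
  show ?case
  proof (cases b)
    case 0
    then show ?thesis using sum_choose_upper[of a "Suc m"] by simp
  next
    case (Suc b')
    have "(\<Sum>M\<le>Suc m. (M choose a) * ((Suc m - M) choose b))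
      = (\<Sum>M\<le>m. (M choose a) * ((Suc m - M) choose Suc b'))"
      by (simp add: Suc)
    also have "\<dots> = (\<Sum>M\<le>m. (M choose a) * ((m - M) choose b')
      + (M choose a) * ((m - M) choose Suc b'))"
      by (rule sum.cong) (auto simp: Suc_diff_le distrib_left)
    also have "\<dots> = (Suc m choose (a + b' + 1)) + (Suc m choose (a + Suc b' + 1))"
      by (simp only: sum.distrib Suc.IH)
    finally show ?thesis by (simp add: Suc)
  qed
qed

lemma power_Suc_diff_ge: "n > 0 \<Longrightarrow> n * M ^ (n - 1) \<le> (M + 1) ^ n - M ^ n" for M n :: nat
proof -
  have "M ^ Suc k + Suc k * M ^ k \<le> (M + 1) ^ Suc k" for k
  proof (induction k)
    case (Suc k)
    have "M ^ Suc (Suc k) + Suc (Suc k) * M ^ Suc k \<le> (M + 1) * (M ^ Suc k + Suc k * M ^ k)"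
      by (simp add: algebra_simps)
    also have "\<dots> \<le> (M + 1) * (M + 1) ^ Suc k" using Suc by (rule mult_le_mono2)
    finally show ?case by simp
  qed simp
  then show "n > 0 \<Longrightarrow> n * M ^ (n - 1) \<le> (M + 1) ^ n - M ^ n"
    by (cases n) (simp_all add: le_diff_conv2 power_mono add.commute del: power_Suc)
qed

text \<open>A discrete Beta integral: each difference of powers is at least
  \<open>n * M ^ (n - 1)\<close> and hence at least \<open>fact n * (M choose (n - 1))\<close>, and
  these lower bounds convolve exactly.\<close>

lemma binomial_count_ge:
  assumes "n > 0" shows "(fact n)\<^sup>2 * (q choose (2 * n - 1)) \<le> binomial_count n q"
proof (cases q)
  case 0
  then show ?thesis using assms by (simp add: binomial_eq_0)
next
  case (Suc m)
  have ge: "fact n * (M choose (n - 1)) \<le> (M + 1) ^ n - M ^ n" for M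
  proof -
    have "fact n * (M choose (n - 1)) = n * ((M choose (n - 1)) * fact (n - 1))"
      using assms by (simp add: fact_reduce)
    also have "\<dots> \<le> n * M ^ (n - 1)" using binomial_fact_pow[of M "n - 1"] by (intro mult_le_mono2)
    also have "\<dots> \<le> (M + 1) ^ n - M ^ n" by (rule power_Suc_diff_ge[OF assms])
    finally show ?thesis .
  qed
  have "(fact n)\<^sup>2 * (q choose (2 * n - 1))
    = (fact n)\<^sup>2 * (\<Sum>M\<le>m. (M choose (n - 1)) * ((m - M) choose (n - 1)))"
  proof -
    have "n - 1 + (n - 1) + 1 = 2 * n - 1" using assms by simp
    then show ?thesis by (simp only: sum_choose_convolution Suc)
  qed
  also have "\<dots> = (\<Sum>M\<le>m. (fact n * (M choose (n - 1))) * (fact n * ((m - M) choose (n - 1))))"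
    by (simp add: sum_distrib_left power2_eq_square mult_ac)
  also have "\<dots> \<le> (\<Sum>M\<le>m. ((M + 1) ^ n - M ^ n) * ((m - M + 1) ^ n - (m - M) ^ n))"
    by (intro sum_mono mult_le_mono ge)
  also have "\<dots> = binomial_count n q"
    unfolding binomial_count_def Suc lessThan_Suc_atMost
      by (intro sum.cong) (auto simp: Suc_diff_le)
  finally show ?thesis .
qed

lemma binomial_count_2: "3 * binomial_count 2 q = 2 * q ^ 3 + q"
proof -
  \<comment> \<open>The free parameter \<open>a\<close> keeps the summand fixed while the range
    grows, as induction on \<open>k\<close> requires; afterwards \<open>a = 2 * q\<close> and
    \<open>k = q\<close>.\<close>
  have S: "3 * (\<Sum>M<k. (2 * int M + 1) * (a - 2 * int M - 1))
    = 3 * a * int k ^ 2 - int k * (4 * int k ^ 2 - 1)" for k a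
    by (induction k) (auto simp: algebra_simps power2_eq_square)
  have "int (((M + 1) ^ 2 - M ^ 2) * ((q - M) ^ 2 - (q - 1 - M) ^ 2))
    = (2 * int M + 1) * (2 * int q - 2 * int M - 1)"
    if M: "M < q" for M
  proof -
    obtain k where k: "q = Suc (M + k)" using less_imp_Suc_add[OF M] by blast
    have "(M + 1) ^ 2 - M ^ 2 = 2 * M + 1" "(q - M) ^ 2 - (q - 1 - M) ^ 2 = 2 * k + 1"
      by (simp_all add: k power2_eq_square)
    then show ?thesis by (simp add: k algebra_simps)
  qed
  then have "int (binomial_count 2 q) = (\<Sum>M<q. (2 * int M + 1) * (2 * int q - 2 * int M - 1))"
    unfolding binomial_count_def of_nat_sum by (intro sum.cong) auto
  then have "3 * int (binomial_count 2 q) = 3 * (2 * int q) * int q ^ 2 - int q * (4 * int q ^ 2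
    - 1)"
    using S[where k = q and a = "2 * int q"] by simp
  also have "\<dots> = int (2 * q ^ 3 + q)" by (simp add: algebra_simps power2_eq_square power3_eq_cube)
  finally have "int (3 * binomial_count 2 q) = int (2 * q ^ 3 + q)" by simp
  then show ?thesis by (simp only: of_nat_eq_iff)
qed

section \<open>Growth of the image for the determinant\<close>

lemma lookup_permmon_le: "coef (permmon k c \<pi>) v \<le> 1"
  by (cases v) (simp add: lookup_permmon)

lemma divides_iff: "(\<exists>d. m = m0 + d) \<longleftrightarrow> (\<forall>v. coef m0 v \<le> coef m v)" for m m0 :: "'v \<Rightarrow>\<^sub>0 nat"
proof
  assume "\<forall>v. coef m0 v \<le> coef m v"
  then have "m = m0 + (m - m0)" by (intro poly_mapping_eqI) (simp add: lookup_add lookup_minus)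
  then show "\<exists>d. m = m0 + d" by blast
qed (auto simp: lookup_add)

text \<open>The leading monomials of \<open>f = minor n 0\<close> and of \<open>g = minor (n - 1) 1\<close> are coprime, so the
  quotient of \<open>k[V]\<close> by \<open>f\<close>, \<open>g\<^sup>p\<^sup>-\<^sup>1\<close> and the \<open>pq\<close>-th powers of the \<open>n\<^sup>2\<close> variables has
  dimension of order \<open>q\<close> to the power \<open>n\<^sup>2 - 2\<close> only.\<close>

lemma card_mult_image_minor_Suc_exponent:
  assumes n: "n \<ge> 2" and q: "q = CARD('p::prime_card) ^ e"
  shows "card (mult_image (CARD('p) * q) (matrix_vars n) ((minor n 0 :: (nat \<times> nat, 'p mod_ring)
    mpoly) ^ (CARD('p) * q - 1)))
    \<le> CARD('p) ^ (n * n * CARD('p) * (CARD('p) * q) ^ (n * n - 2))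
      * card (mult_image q (matrix_vars n) ((minor n 0 :: (nat \<times> nat, 'p mod_ring) mpoly) ^
        (q - 1))) ^ (CARD('p) ^ (n * n - 1))"
proof -
  let ?p = "CARD('p)"
  let ?Q = "?p * q"
  let ?V = "matrix_vars n"
  let ?f = "minor n 0 :: (nat \<times> nat, 'p mod_ring) mpoly"
  define x where "x = (n - 1, 0 :: nat)"
  define V0 where "V0 = ?V - {x}"
  have p2: "?p \<ge> 2" using prime_card[where 'a = 'p] prime_ge_2_nat by blast
  have Q0: "?Q > 0" using q by simp
  have fV: "?f \<in> polys ?V" by (rule minor_matrix_vars) simp
  obtain g h :: "(nat \<times> nat, 'p mod_ring) mpoly"
    where gh: "?f = mpoly_var x * g + h" "g \<in> polys V0" "h \<in> polys V0"
    "leads diag_weight g (permmon (n - 1) 1 id)"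
    using minor_last_row[OF n, of V0, where 'a = "'p mod_ring"] unfolding V0_def x_def by blast
  have sub: "polys V0 \<subseteq> polys ?V" unfolding V0_def by (intro polys_subset) auto
  \<comment> \<open>A standard monomial misses a diagonal variable, because of the determinant, and
    has an exponent below \<open>?p - 1\<close> on the superdiagonal, because of
    \<open>g ^ (?p - 1)\<close>.\<close>
  let ?B = "\<lambda>i j v. if v = (i, i) then {0} else if v = (j, Suc j) then {..<?p - 1} else {..<?Q}"
  define \<Gamma> where "\<Gamma> = (\<Union>i\<in>{..<n}. \<Union>j\<in>{..<n - 1}. mons ?V (?B i j))"
  have finB: "finite (?B i j v)" for i j v by simp
  have fin\<Gamma>: "finite \<Gamma>" unfolding \<Gamma>_def by (intro finite_UN_I finite_mons finB) auto
  \<comment> \<open>The leading monomials of the determinant, of \<open>g ^ (?p - 1)\<close> and of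
    the \<open>?Q\<close>-th powers of the variables.\<close>
  define G where "G = insert (permmon n 0 id) (insert (mscale (?p - 1) (permmon (n - 1) 1 id))
    ((\<lambda>v. Poly_Mapping.single v ?Q) ` ?V))"
  define I where "I = {?f * a + g ^ (?p - 1) * b + r | a b r. a \<in> polys ?V \<and> b \<in> polys ?V \<and>
    r \<in> frob_ideal ?Q}"
  have I_memI: "?f * a + g ^ (?p - 1) * b + r \<in> I"
    if "a \<in> polys ?V" "b \<in> polys ?V" "r \<in> frob_ideal ?Q" for a b r
    unfolding I_def using that by blast
  have \<Gamma>: "\<exists>s' a b r. supp s' \<subseteq> \<Gamma> \<and> s' \<in> polys ?V \<and> a \<in> polys ?V \<and> b \<in> polys ?V \<and>
    r \<in> frob_ideal ?Q \<and>
      s = s' + ?f * a + g ^ (?p - 1) * b + r" if s: "s \<in> polys ?V" for s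
  proof -
    define W where "W = Suc (Max (insert 0 (wt diag_weight ` supp s)))"
    have "\<exists>s'\<in>polys ?V. s - s' \<in> I \<and> (\<forall>m\<in>supp s'. wt diag_weight m < W \<and> (\<forall>m0\<in>G. \<nexists>d. m = m0 + d))"
    proof (rule standard_monomials)
      show "0 \<in> I" using I_memI[of 0 0 0] by simp
      show "u + t \<in> I" if ut: "u \<in> I" "t \<in> I" for u t
      proof -
        obtain a b r a' b' r' where 1: "u = ?f * a + g ^ (?p - 1) * b + r" "a \<in> polys ?V"
          "b \<in> polys ?V" "r \<in> frob_ideal ?Q"
          "t = ?f * a' + g ^ (?p - 1) * b' + r'" "a' \<in> polys ?V" "b' \<in> polys ?V"
            "r' \<in> frob_ideal ?Q"
          using ut unfolding I_def by blast
        have "u + t = ?f * (a + a') + g ^ (?p - 1) * (b + b') + (r + r')"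
          unfolding 1(1,5) by (simp add: algebra_simps)
        then show ?thesis
          using I_memI[OF polys_add[OF 1(2,6)] polys_add[OF 1(3,7)] frob_ideal_add[OF 1(4,8)]]
            by (simp only:)
      qed
      show "u * t \<in> I" if u: "u \<in> polys ?V" and t: "t \<in> I" for u t
      proof -
        obtain a b r where 1: "t = ?f * a + g ^ (?p - 1) * b + r" "a \<in> polys ?V" "b \<in> polys ?V"
          "r \<in> frob_ideal ?Q"
          using t unfolding I_def by blast
        have "u * t = ?f * (u * a) + g ^ (?p - 1) * (u * b) + u * r"
          unfolding 1(1) by (simp add: algebra_simps)
        then show ?thesis 
          using I_memI[OF polys_mult[OF u 1(2)] polys_mult[OF u 1(3)] frob_ideal_mult(1)[OF 1(4)]]
            by (simp only:)
      qed
      show "\<exists>F\<in>I \<inter> polys ?V. leads diag_weight F m0" if "m0 \<in> G" for m0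
      proof -
        consider "m0 = permmon n 0 id" | "m0 = mscale (?p - 1) (permmon (n - 1) 1 id)" | v
          where "v \<in> ?V" "m0 = Poly_Mapping.single v ?Q"
          using \<open>m0 \<in> G\<close> unfolding G_def by blast
        then show ?thesis
        proof cases
          case 1
          have "?f \<in> I" using I_memI[of 1 0 0] by simp
          then show ?thesis using leads_minor fV 1 by blast
        next
          case 2
          have "g ^ (?p - 1) \<in> I" using I_memI[of 0 1 0] by simp
          moreover have "g ^ (?p - 1) \<in> polys ?V" using gh(2) sub by auto
          ultimately show ?thesis using leads_power[OF gh(4)] 2 by blast
        next
          case 3
          let ?F = "mterm (Poly_Mapping.single v ?Q) 1 :: (nat \<times> nat, 'p mod_ring) mpoly"
          have "?F \<in> frob_ideal ?Q" unfolding frob_ideal_def by (auto simp del: split_paired_Ex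
            intro!: exI[of _ v])
          then have "?F \<in> I" using I_memI[of 0 0 ?F] by simp
          moreover have "?F \<in> polys ?V" using 3(1) by (intro polys_mono) auto
          moreover have "leads diag_weight ?F m0" by (auto simp: leads_def 3(2))
          ultimately show ?thesis by blast
        qed
      qed
      show "s \<in> polys ?V" by (rule s)
      show "wt diag_weight m < W" if "m \<in> supp s" for m
        using that unfolding W_def by (intro le_imp_less_Suc Max_ge) auto
    qed
    then obtain s' where s': "s' \<in> polys ?V" "s - s' \<in> I"
      "\<And>m m0. m \<in> supp s' \<Longrightarrow> m0 \<in> G \<Longrightarrow> \<nexists>d. m = m0 + d"
      by blast
    obtain a b r where abr: "s - s' = ?f * a + g ^ (?p - 1) * b + r" "a \<in> polys ?V" "b \<in> polys ?V"
      "r \<in> frob_ideal ?Q"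
      using s'(2) unfolding I_def by blast
    have "m \<in> \<Gamma>" if m: "m \<in> supp s'" for m
    proof -
      have mV: "supp m \<subseteq> ?V" using s'(1) m by (simp add: polys_def)
      have lt: "coef m v < ?Q" if v: "v \<in> ?V" for v
      proof (rule ccontr)
        assume "\<not> ?thesis"
        then have "\<forall>u. coef (Poly_Mapping.single v ?Q) u \<le> coef m u"
          by (simp add: lookup_single when_def del: split_paired_All)
        then have "\<exists>d. m = Poly_Mapping.single v ?Q + d" unfolding divides_iff .
        moreover have "Poly_Mapping.single v ?Q \<in> G" using v by (simp add: G_def)
        ultimately show False using s'(3)[OF m] by blast
      qed
      have "\<not> (\<forall>v. coef (permmon n 0 id) v \<le> coef m v)"
        using s'(3)[OF m, of "permmon n 0 id"] unfolding divides_iff by (simp add: G_def)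
      then obtain v where v: "coef m v < coef (permmon n 0 id) v" by (auto simp: not_le)
      then obtain i where i: "i < n" "v = (i, i)" "coef m v = 0"
        by (cases v) (auto simp: lookup_permmon split: if_splits)
      have "\<not> (\<forall>v. coef (mscale (?p - 1) (permmon (n - 1) 1 id)) v \<le> coef m v)"
        using s'(3)[OF m, of "mscale (?p - 1) (permmon (n - 1) 1 id)"] unfolding divides_iff
          by (simp add: G_def)
      then obtain u where u: "coef m u < coef (mscale (?p - 1) (permmon (n - 1) 1 id)) u"
        by (auto simp: not_le)
      then obtain j where j: "j < n - 1" "u = (j, Suc j)" "coef m u < ?p - 1"
        by (cases u) (auto simp: lookup_permmon split: if_splits)
      have "m \<in> mons ?V (?B i j)" unfolding mons_def using mV lt i j by auto
      then show ?thesis unfolding \<Gamma>_def using i j by blast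
    qed
    moreover have "s = s' + ?f * a + g ^ (?p - 1) * b + r" using abr(1) by (simp add: algebra_simps)
    ultimately show ?thesis using s'(1) abr by blast
  qed
  \<comment> \<open>The two restricted variables are distinct, so two factors \<open>?Q\<close> are
    saved at the price of one factor \<open>?p\<close>.\<close>
  have card_B: "card (mons ?V (?B i j)) \<le> ?p * ?Q ^ (n * n - 2)" if ij: "i < n" "j < n - 1" for i j
  proof -
    have V: "(i, i) \<in> ?V" "(j, Suc j) \<in> ?V - {(i, i)}" using ij by (auto simp: matrix_vars_def)
    define c where "c v = card (?B i j v)" for v
    have "card (mons ?V (?B i j)) = (\<Prod>v\<in>?V. c v)" unfolding c_def by (rule card_mons) simp
    also have "\<dots> = c (i, i) * (c (j, Suc j) * (\<Prod>v\<in>?V - {(i, i)} - {(j, Suc j)}. c v))"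
      by (simp only: prod.remove[OF finite_matrix_vars V(1)]
        prod.remove[OF finite_Diff[OF finite_matrix_vars] V(2)])
    also have "c (i, i) = 1" by (simp add: c_def)
    also have "c (j, Suc j) = ?p - 1" by (simp add: c_def)
    also have "(\<Prod>v\<in>?V - {(i, i)} - {(j, Suc j)}. c v) = (\<Prod>v\<in>?V - {(i, i)} - {(j, Suc j)}. ?Q)"
      by (rule prod.cong) (auto simp: c_def)
    also have "\<dots> = ?Q ^ card (?V - {(i, i)} - {(j, Suc j)})" by simp
    also have "card (?V - {(i, i)} - {(j, Suc j)}) = n * n - 2"
      using V by (simp add: card_matrix_vars)
    finally show ?thesis by simp
  qed
  have "card \<Gamma> \<le> (\<Sum>i<n. card (\<Union>j\<in>{..<n - 1}. mons ?V (?B i j)))"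
    unfolding \<Gamma>_def by (rule card_UN_le) simp
  also have "\<dots> \<le> (\<Sum>i<n. \<Sum>j<n - 1. card (mons ?V (?B i j)))"
    by (intro sum_mono card_UN_le) simp
  also have "\<dots> \<le> (\<Sum>i<n. \<Sum>j<n - 1. ?p * ?Q ^ (n * n - 2))"
    by (intro sum_mono card_B) auto
  also have "\<dots> \<le> n * n * ?p * ?Q ^ (n * n - 2)" by (simp add: mult.assoc)
  finally have card\<Gamma>: "card \<Gamma> \<le> n * n * ?p * ?Q ^ (n * n - 2)" .
  have "card (mult_image ?Q ?V (?f ^ (?Q - 1)))
      \<le> ?p ^ card \<Gamma> * card (mult_image q ?V (?f ^ (q - 1))) ^ (?p ^ (card ?V - 1))"
  proof (rule card_mult_image_Suc_exponent[OF _ _ V0_def gh(1-3) _ q fin\<Gamma> \<Gamma>])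
    show "x \<in> ?V" using n by (simp add: x_def matrix_vars_def)
    show "coef ?f 0 = 0" using n by (intro minor_coef_0) simp
  qed auto
  also have "\<dots> \<le> ?p ^ (n * n * ?p * ?Q ^ (n * n - 2)) * card (mult_image q ?V (?f ^ (q - 1))) ^
    (?p ^ (card ?V - 1))"
    using card\<Gamma> p2 by (intro mult_le_mono1 power_increasing) auto
  finally show ?thesis by (simp add: card_matrix_vars)
qed

subsection \<open>A saturated chain of primes\<close>

text \<open>The zero set of the determinant is parametrized by the first \<open>n - 1\<close> rows and the coefficients
  of the last row as their linear combination. The parameter with index \<open>(n - 1, l)\<close> is the
  coefficient of row \<open>l\<close>; parameters outside \<open>K\<close> are set to zero.\<close>

definition det_param :: "nat \<Rightarrow> (nat \<times> nat) set \<Rightarrow> nat \<times> nat \<Rightarrow> (nat \<times> nat, 'a::comm_ring_1) mpoly"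
  where
  "det_param n K = (let z = (\<lambda>v. if v \<in> K then mpoly_var v else 0) in
     (\<lambda>(i, j). if i < n - 1 then z (i, j) else \<Sum>l<n - 1. z (n - 1, l) * z (l, j)))"

lemma det_param_upper: "i < n - 1 \<Longrightarrow> det_param n K (i, j)
  = (if (i, j) \<in> K then mpoly_var (i, j) else 0)"
  by (simp add: det_param_def Let_def)

lemma det_param_last: "det_param n K (n - 1, j)
    = (\<Sum>l<n - 1. (if (n - 1, l) \<in> K then mpoly_var (n - 1, l) else 0) * det_param n K (l, j))"
  by (simp add: det_param_def Let_def)

text \<open>The last row is a combination of the others, and its coefficients together with -1 form
  a nonzero vector in the kernel of the transpose.\<close>

lemma psubst_det_param_minor:
  assumes n: "n \<ge> 2"
  shows "psubst (det_param n K) (minor n 0) = (0 :: (nat \<times> nat, 'a::idom) mpoly)"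
proof -
  let ?t = "\<lambda>l. if (n - 1, l) \<in> K then mpoly_var (n - 1, l) else 0 :: (nat \<times> nat, 'a) mpoly"
  define A where "A = mat n n (\<lambda>(i, j). det_param n K (i, j) :: (nat \<times> nat, 'a) mpoly)"
  have A: "A \<in> carrier_mat n n" by (simp add: A_def)
  define v where "v = vec n (\<lambda>i. if i = n - 1 then - 1 else ?t i)"
  have "A\<^sup>T *\<^sub>v v = 0\<^sub>v n"
  proof (rule eq_vecI)
    fix j assume "j < dim_vec (0\<^sub>v n :: (nat \<times> nat, 'a) mpoly vec)"
    then have j: "j < n" by simp
    have "(A\<^sup>T *\<^sub>v v) $ j = (\<Sum>i<n. A $$ (i, j) * v $ i)"
      using j A by (simp add: scalar_prod_def v_def A_def atLeast0LessThan)
    also have "{..<n} = insert (n - 1) {..<n - 1}" using n by auto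
    also have "(\<Sum>i\<in>insert (n - 1) {..<n - 1}. A $$ (i, j) * v $ i)
        = A $$ (n - 1, j) * v $ (n - 1) + (\<Sum>i<n - 1. A $$ (i, j) * v $ i)" by simp
    also have "A $$ (n - 1, j) * v $ (n - 1) = - (\<Sum>l<n - 1. ?t l * det_param n K (l, j))"
      using j n det_param_last[of n K j, where 'a = 'a] by (simp add: A_def v_def)
    also have "(\<Sum>i<n - 1. A $$ (i, j) * v $ i) = (\<Sum>l<n - 1. ?t l * det_param n K (l, j))"
      using j by (intro sum.cong) (auto simp: A_def v_def mult.commute)
    finally show "(A\<^sup>T *\<^sub>v v) $ j = 0\<^sub>v n $ j" using j by simp
  qed (use A in auto)
  moreover have "v \<noteq> 0\<^sub>v n"
  proof
    assume "v = 0\<^sub>v n"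
    then have "v $ (n - 1) = 0" using n by simp
    then show False using n by (simp add: v_def)
  qed
  moreover have "v \<in> carrier_vec n" by (simp add: v_def)
  ultimately have "det A\<^sup>T = 0" using det_0_iff_vec_prod_zero[of "A\<^sup>T" n] A by auto
  then have "det A = 0" using det_transpose[OF A] by simp
  then show ?thesis by (simp add: psubst_minor A_def)
qed

lemma psubst_kill_det_param:
  "psubst (\<lambda>w. if w = u then 0 else mpoly_var w) (det_param n K v) = det_param n (K - {u}) v"
  by (cases v) (auto simp: det_param_def Let_def psubst_sum psubst_mult psubst_var intro!: sum.cong)

lemma coef_0_det_param: "coef (det_param n K v) 0 = 0"
  by (cases v) (auto simp: det_param_def Let_def lookup_sum coef_0_mult intro!: sum.neutral)

lemma mpoly_var_nonzero: "mpoly_var v \<noteq> (0 :: ('v, 'a::comm_ring_1) mpoly)"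
proof
  assume 0: "mpoly_var v = (0 :: ('v, 'a) mpoly)"
  have "coef (mpoly_var v :: ('v, 'a) mpoly) (Poly_Mapping.single v 1) = 1"
    by (simp add: mpoly_var_def)
  then show False unfolding 0 by simp
qed

text \<open>Kernels of the parametrization while its n^2 - 1 parameters are set to zero one by one.
  Each kernel is prime because the target is a domain; a matrix variable that dies at exactly that
  step shows that the inclusion is strict.\<close>

lemma det_prime_chain:
  assumes n: "n \<ge> 2"
  obtains Q :: "nat \<Rightarrow> (nat \<times> nat, 'a::idom) mpoly set" where
    "\<And>i. i \<le> n * n - 1 \<Longrightarrow> prime_set (matrix_vars n) (Q i)" "\<And>i. i < n * n - 1 \<Longrightarrow> Q i \<subset> Q (Suc i)"
    "minor n 0 \<in> Q 0" "\<And>s i. s \<in> Q i \<Longrightarrow> coef s 0 = 0"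
proof -
  let ?V = "matrix_vars n"
  \<comment> \<open>The order matters. Once the off-diagonal parameters are gone, the last row has
    entries \<open>(n - 1, l)\<close> times \<open>(l, l)\<close>; its coefficients are killed next,
    while the diagonal is still alive, and the diagonal comes last.\<close>
  define A1 where "A1 = {v \<in> ?V. fst v < n - 1 \<and> fst v \<noteq> snd v}"
  define A2 where "A2 = {v \<in> ?V. fst v = n - 1 \<and> snd v < n - 1}"
  define A3 where "A3 = {v \<in> ?V. fst v < n - 1 \<and> fst v = snd v}"
  have fin: "finite A1" "finite A2" "finite A3" by (simp_all add: A1_def A2_def A3_def)
  define x1 where "x1 = sorted_list_of_set A1"
  define x2 where "x2 = sorted_list_of_set A2"
  define x3 where "x3 = sorted_list_of_set A3"
  define xs where "xs = x1 @ x2 @ x3"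
  have sets: "set x1 = A1" "set x2 = A2" "set x3 = A3"
    using fin by (simp_all add: x1_def x2_def x3_def)
  have dist: "distinct xs" unfolding xs_def using sets fin
    by (auto simp: x1_def x2_def x3_def A1_def A2_def A3_def)
  have "A1 \<union> (A2 \<union> A3) = ?V - {(n - 1, n - 1)}"
    using n by (auto simp: A1_def A2_def A3_def matrix_vars_def)
  then have setx: "set xs = ?V - {(n - 1, n - 1)}" by (simp add: xs_def sets)
  then have len: "length xs = n * n - 1"
    using distinct_card[OF dist] n by (simp add: card_matrix_vars matrix_vars_def
      card_Diff_singleton)
  define K where "K i = set (drop i xs)" for i
  define Q :: "nat \<Rightarrow> (nat \<times> nat, 'a) mpoly set"
    where "Q i = {s \<in> polys ?V. psubst (det_param n (K i)) s = 0}" for i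
  have K_Suc: "xs ! i \<in> K i" "K (Suc i) = K i - {xs ! i}" if i: "i < length xs" for i
  proof -
    have d: "drop i xs = xs ! i # drop (Suc i) xs" using i by (simp add: Cons_nth_drop_Suc)
    have "distinct (drop i xs)" using dist by simp
    then show "xs ! i \<in> K i" "K (Suc i) = K i - {xs ! i}" unfolding K_def by (auto simp: d)
  qed
  have kill: "psubst (\<lambda>w. if w = u then 0 else mpoly_var w) (psubst (det_param n K') s)
    = psubst (det_param n (K' - {u})) (s :: (nat \<times> nat, 'a) mpoly)" for u K' s
    by (rule psubst_hom_unique[where V = UNIV]) (auto simp: polys_def psubst_add psubst_mult
      psubst_var psubst_kill_det_param)
  show ?thesis
  proof (rule that[of Q])
    show "prime_set ?V (Q i)" for i unfolding Q_def by (rule prime_set_kernel)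
    show "minor n 0 \<in> Q 0" unfolding Q_def
      using psubst_det_param_minor[OF n] minor_matrix_vars[of n n] by blast
    show "coef s 0 = 0" if "s \<in> Q i" for s i
      using that coef_0_psubst[of s ?V "det_param n (K i)"] by (simp add: Q_def coef_0_det_param)
    show "Q i \<subset> Q (Suc i)" if "i < n * n - 1" for i
    proof -
      have i: "i < length xs" using that len by simp
      define u where "u = xs ! i"
      have u: "u \<in> K i" "K (Suc i) = K i - {u}" using K_Suc[OF i] by (simp_all add: u_def)
      have "Q i \<subseteq> Q (Suc i)"
      proof
        fix s assume s: "s \<in> Q i"
        then have "psubst (det_param n (K (Suc i))) s = 0"
          unfolding u(2) kill[symmetric] by (simp add: Q_def)
        then show "s \<in> Q (Suc i)" using s by (simp add: Q_def)
      qed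
      moreover have uV: "u \<in> ?V" "u \<noteq> (n - 1, n - 1)"
        using setx i nth_mem[OF i] unfolding u_def by auto
      have "psubst (det_param n (K i)) (mpoly_var u) \<noteq> (0 :: (nat \<times> nat, 'a) mpoly) \<and>
        psubst (det_param n (K (Suc i))) (mpoly_var u) = (0 :: (nat \<times> nat, 'a) mpoly)"
      proof (cases "fst u < n - 1")
        case True
        then show ?thesis using u
          by (cases u) (simp add: psubst_var det_param_upper mpoly_var_nonzero)
      next
        case False
        then have uA: "u \<in> A2" using uV by (cases u) (auto simp: A2_def matrix_vars_def)
        obtain l where l: "u = (n - 1, l)" "l < n - 1" using uA by (cases u) (auto simp: A2_def)
        have i1: "length x1 \<le> i"
        proof (rule ccontr)
          assume "\<not> ?thesis"
          then have "u \<in> set x1" by (simp add: u_def xs_def nth_append)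
          then show False using uA by (auto simp: sets A1_def A2_def)
        qed
        have i2: "i < length x1 + length x2"
        proof (rule ccontr)
          assume "\<not> ?thesis"
          then have "u = x3 ! (i - length x1 - length x2)"
            using i1 by (auto simp: u_def xs_def nth_append)
          moreover have "i - length x1 - length x2 < length x3"
            using i \<open>\<not> i < _\<close> by (simp add: xs_def)
          ultimately have "u \<in> set x3" by simp
          then show False using uA by (auto simp: sets A3_def A2_def)
        qed
        have Kd: "K i = set (drop (i - length x1) x2) \<union> A3"
          using i1 i2 by (simp add: K_def xs_def sets)
        have K23: "K i \<subseteq> A2 \<union> A3" unfolding Kd using set_drop_subset[of "i - length x1" x2] sets
          by auto
        have A3K: "A3 \<subseteq> K i" unfolding Kd by blast
        have off: "det_param n K' (m, l) = (if m = l \<and>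
          (l, l) \<in> K' then mpoly_var (l, l) else (0 :: (nat \<times> nat, 'a) mpoly))"
          if "K' \<subseteq> K i" "m < n - 1" for m K'
          using that K23 by (auto simp: det_param_upper A2_def A3_def)
        \<comment> \<open>With the off-diagonal parameters dead, the sum for the last row keeps a
          single term.\<close>
        have e: "det_param n K' (n - 1, l) = (if (n - 1, l) \<in> K' \<and>
          (l, l) \<in> K' then mpoly_var (n - 1, l) * mpoly_var (l, l) else
          (0 :: (nat \<times> nat, 'a) mpoly))"
          if K': "K' \<subseteq> K i" for K'
        proof -
          have "det_param n K' (n - 1, l) = (\<Sum>m<n - 1. if m = l then (if (n - 1, l) \<in> K' \<and>
            (l, l) \<in> K' then mpoly_var (n - 1, l) * mpoly_var (l, l) else
            (0 :: (nat \<times> nat, 'a) mpoly)) else 0)"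
            unfolding det_param_last using off[OF K'] by (intro sum.cong) auto
          then show ?thesis using l(2) by simp
        qed
        have "(l, l) \<in> K i" using A3K l(2) by (auto simp: A3_def matrix_vars_def)
        then have "det_param n (K i) u \<noteq> (0 :: (nat \<times> nat, 'a) mpoly)"
          using e[of "K i"] u(1) l(1) by (simp add: mpoly_var_nonzero)
        moreover have "det_param n (K (Suc i)) u = (0 :: (nat \<times> nat, 'a) mpoly)"
          using e[of "K (Suc i)"] u(2) l(1) by auto
        ultimately show ?thesis by (simp add: psubst_var)
      qed
      then have "mpoly_var u \<in> Q (Suc i)" "mpoly_var u \<notin> Q i" using uV by (simp_all add: Q_def)
      ultimately show ?thesis by blast
    qed
  qed
qed

lemma krull_dim_det:
  assumes n: "n \<ge> 2"
    and hyp: "local_hypersurface L (matrix_vars n) (minor n 0 :: (nat \<times> nat, 'p::prime_card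
      mod_ring) mpoly) \<phi>"
  shows "krull_dim L = enat (n * n - 1)"
proof (rule antisym)
  have "(0, 0) \<in> matrix_vars n" using n by (simp add: matrix_vars_def)
  then have "matrix_vars n \<noteq> {}" by blast
  then show "krull_dim L \<le> enat (n * n - 1)"
    using local_hypersurface.krull_dim_le[OF hyp leads_minor lookup_permmon_le diag_weight_ge]
    by (simp add: card_matrix_vars)
  obtain Q :: "nat \<Rightarrow> (nat \<times> nat, 'p mod_ring) mpoly set" where
    "\<And>i. i \<le> n * n - 1 \<Longrightarrow> prime_set (matrix_vars n) (Q i)" "\<And>i. i < n * n - 1 \<Longrightarrow> Q i \<subset> Q (Suc i)"
    "minor n 0 \<in> Q 0" "\<And>s i. s \<in> Q i \<Longrightarrow> coef s 0 = 0"
    using det_prime_chain[OF n] by blast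
  then show "enat (n * n - 1) \<le> krull_dim L"
    by (intro local_hypersurface.krull_dim_ge[OF hyp])
qed

subsection \<open>The F-signature\<close>

definition det_rank :: "'p::prime_card itself \<Rightarrow> nat \<Rightarrow> nat \<Rightarrow> nat" where
  "det_rank _ n e = frobenius_free_rank CARD('p)
     (localization_at (det_ring n :: (nat \<times> nat, 'p mod_ring) mpoly set ring)
       (det_ring_maximal_ideal n)) e"

lemma det_ring_local_hypersurface:
  assumes "n \<ge> 2"
  shows "local_hypersurface (localization_at (det_ring n :: (nat \<times> nat, 'p::prime_card mod_ring)
    mpoly set ring) (det_ring_maximal_ideal n))
    (matrix_vars n) (minor n 0 :: (nat \<times> nat, 'p mod_ring) mpoly) (hyp_phi (matrix_vars n)
      (minor n 0))"
proof -
  let ?V = "matrix_vars n" and ?f = "minor n 0 :: (nat \<times> nat, 'p mod_ring) mpoly"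
  have f: "?f \<in> polys ?V" "?f \<noteq> 0" "coef ?f 0 = 0"
    using minor_matrix_vars[of n n] minor_nonzero[of n 0] minor_coef_0[of n 0] assms by simp_all
  note hyp = finite_matrix_vars[of n] f
  have I: "det_ideal n = hyp_ideal ?V ?f"
    by (simp add: det_ideal_def hyp_ideal_def[OF hyp] det_generic_matrix)
  have R: "det_ring n = hyp_ring ?V ?f" by (simp add: det_ring_def hyp_ring_def[OF hyp] I)
  have M: "det_ring_maximal_ideal n = hyp_max ?V ?f"
    by (simp add: det_ring_maximal_ideal_def hyp_max_def[OF hyp] cls_def[OF hyp] image_image I R)
  show ?thesis unfolding R M by (rule local_hypersurface_localization[OF hyp])
qed

lemma pow_det_rank:
  assumes "n \<ge> 2"
  shows "CARD('p::prime_card) ^ det_rank TYPE('p) n e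
    = card (mult_image (CARD('p) ^ e) (matrix_vars n) ((minor n 0 :: (nat \<times> nat, 'p mod_ring) mpoly)
      ^ (CARD('p) ^ e - 1)))"
  unfolding det_rank_def by (rule local_hypersurface.pow_frobenius_free_rank[OF
    det_ring_local_hypersurface[OF assms]])

definition det_ratio :: "'p::prime_card itself \<Rightarrow> nat \<Rightarrow> nat \<Rightarrow> real" where
  "det_ratio _ n e = real (det_rank TYPE('p) n e) / (real CARD('p) ^ e) ^ (n * n - 1)"

lemma det_F_signature_eq:
  assumes "n \<ge> 2"
  shows "det_F_signature TYPE('p::prime_card) n = lim (det_ratio TYPE('p) n)"
proof -
  have "det_ratio TYPE('p) n = (\<lambda>e. real (det_rank TYPE('p) n e) / real CARD('p) ^ (e * (n * n
    - 1)))"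
    by (simp add: det_ratio_def fun_eq_iff power_mult)
  then show ?thesis
    by (simp add: det_F_signature_def F_signature_def det_rank_def
        krull_dim_det[OF assms det_ring_local_hypersurface[OF assms]])
qed

lemma CARD_ge_2: "CARD('p::prime_card) \<ge> 2"
  using prime_card[where 'a = 'p] prime_ge_2_nat by blast

lemma det_rank_leI: "CARD('p::prime_card) ^ a \<le> CARD('p) ^ b \<Longrightarrow> a \<le> b"
  using CARD_ge_2[where 'p = 'p] by (simp add: power_increasing_iff)

lemma det_rank_Suc_le:
  assumes "n \<ge> 2"
  shows "det_rank TYPE('p::prime_card) (Suc n) e
    \<le> det_rank TYPE('p) n e * (CARD('p) ^ e) ^ (2 * n + 1)"
proof (rule det_rank_leI[where 'p = 'p])
  have n: "Suc n \<ge> 2" using assms by simp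
  show "CARD('p) ^ det_rank TYPE('p) (Suc n) e
    \<le> CARD('p) ^ (det_rank TYPE('p) n e * (CARD('p) ^ e) ^ (2 * n + 1))"
    using card_mult_image_minor_Suc[OF refl, where 'p = 'p, of e n]
    unfolding pow_det_rank[OF assms, symmetric] pow_det_rank[OF n, symmetric] power_mult[symmetric]
      .
qed

lemma det_rank_ge:
  assumes "n \<ge> 2"
  shows "binomial_count n (CARD('p::prime_card) ^ e) * (CARD('p) ^ e) ^ (n * n - 2 * n)
    \<le> det_rank TYPE('p) n e"
  using card_mult_image_minor_ge(1)[OF assms refl, where 'p = 'p, of e]
  unfolding pow_det_rank[OF assms, symmetric] by (rule det_rank_leI[where 'p = 'p])

lemma det_rank_2: "det_rank TYPE('p::prime_card) 2 e = binomial_count 2 (CARD('p) ^ e)"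
proof -
  have "CARD('p) ^ det_rank TYPE('p) 2 e = CARD('p) ^ binomial_count 2 (CARD('p) ^ e)"
    using card_mult_image_minor_ge(2)[OF le_refl refl refl, where 'p = 'p, of e]
    unfolding pow_det_rank[OF le_refl, symmetric] .
  then show ?thesis using CARD_ge_2[where 'p = 'p] power_inject_exp by simp
qed

lemma det_rank_Suc_exponent_le:
  assumes "n \<ge> 2"
  shows "det_rank TYPE('p::prime_card) n (Suc e)
    \<le> n * n * CARD('p) * (CARD('p) ^ Suc e) ^ (n * n - 2) + CARD('p) ^ (n * n - 1) * det_rank
      TYPE('p) n e"
proof (rule det_rank_leI[where 'p = 'p])
  let ?p = "CARD('p)"
  have "?p ^ det_rank TYPE('p) n (Suc e)
      \<le> ?p ^ (n * n * ?p * (?p * ?p ^ e) ^ (n * n - 2)) * (?p ^ det_rank TYPE('p) n e) ^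
        (?p ^ (n * n - 1))"
    using card_mult_image_minor_Suc_exponent[OF assms refl, where 'p = 'p, of e]
    unfolding power_Suc[symmetric] pow_det_rank[OF assms, symmetric] .
  also have "\<dots> = ?p ^ (n * n * ?p * (?p ^ Suc e) ^ (n * n - 2)
    + ?p ^ (n * n - 1) * det_rank TYPE('p) n e)"
    by (simp only: power_add power_mult[symmetric] power_Suc mult.commute[of "?p ^ (n * n - 1)"])
  finally show "?p ^ det_rank TYPE('p) n (Suc e) \<le> \<dots>" .
qed

lemma square_ge: "n \<ge> 2 \<Longrightarrow> 2 * n \<le> n * n" for n :: nat
  by (rule mult_le_mono1)

lemma det_ratio_Suc_le:
  assumes n: "n \<ge> 2"
  shows "det_ratio TYPE('p::prime_card) (Suc n) e \<le> det_ratio TYPE('p) n e"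
proof -
  define q where "q = real CARD('p) ^ e"
  have q: "q > 0" by (simp add: q_def)
  \<comment> \<open>The Krull dimensions differ by the number of additional variables, so the
    normalization cancels the extra factor.\<close>
  have "Suc n * Suc n - 1 = (n * n - 1) + (2 * n + 1)" using square_ge[OF n] n by simp
  then have pw: "q ^ (Suc n * Suc n - 1) = q ^ (n * n - 1) * q ^ (2 * n + 1)"
    by (simp only: power_add)
  have "real (det_rank TYPE('p) (Suc n) e)
    \<le> real (det_rank TYPE('p) n e * (CARD('p) ^ e) ^ (2 * n + 1))"
    using det_rank_Suc_le[OF n, where 'p = 'p, of e] by (simp only: of_nat_le_iff)
  then have "real (det_rank TYPE('p) (Suc n) e) \<le> real (det_rank TYPE('p) n e) * q ^ (2 * n + 1)"
    by (simp only: of_nat_mult of_nat_power q_def)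
  then show ?thesis unfolding det_ratio_def q_def[symmetric] pw using q by (simp add: field_simps)
qed

text \<open>The error has order \<open>q ^ (n * n - 2)\<close> and is divided by a power one higher,
  which leaves a multiple of \<open>1 / q\<close>.\<close>

lemma det_ratio_Suc_exponent_le:
  assumes n: "n \<ge> 2"
  shows "det_ratio TYPE('p::prime_card) n (Suc e)
    \<le> det_ratio TYPE('p) n e + real (n * n) / real CARD('p) ^ e"
proof -
  define p where "p = real CARD('p)"
  define q where "q = p ^ e"
  have p: "p > 0" by (simp add: p_def)
  have q: "q > 0" using p by (simp add: q_def)
  define r where "r = n * n - 2"
  have r: "n * n - 1 = Suc r" unfolding r_def using square_ge[OF n] n by linarith
  have "real (det_rank TYPE('p) n (Suc e))
      \<le> real (n * n * CARD('p) * (CARD('p) ^ Suc e) ^ (n * n - 2) + CARD('p) ^ (n * n - 1) *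
        det_rank TYPE('p) n e)"
    using det_rank_Suc_exponent_le[OF n, where 'p = 'p, of e] by (simp only: of_nat_le_iff)
  then have "real (det_rank TYPE('p) n (Suc e))
    \<le> real (n * n) * p * (p * q) ^ r + p ^ Suc r * real (det_rank TYPE('p) n e)"
    by (simp only: of_nat_mult of_nat_add of_nat_power p_def q_def power_Suc r r_def)
  then have "real (det_rank TYPE('p) n (Suc e)) / (p * q) ^ Suc r
      \<le> (real (n * n) * p * (p * q) ^ r + p ^ Suc r * real (det_rank TYPE('p) n e)) / (p * q) ^ Suc
        r"
    using p q by (intro divide_right_mono) auto
  also have "\<dots> = real (det_rank TYPE('p) n e) / q ^ Suc r + real (n * n) / q"
    using p q by (simp add: field_simps power_mult_distrib)
  finally show ?thesis unfolding det_ratio_def p_def[symmetric] power_Suc[of p e] q_def[symmetric] r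
    .
qed

section \<open>Convergence and limiting values\<close>

lemma det_ratio_convergent:
  assumes n: "n \<ge> 2"
  shows "det_ratio TYPE('p::prime_card) n \<longlonglongrightarrow> det_F_signature TYPE('p) n"
proof -
  define p where "p = real CARD('p)"
  have p: "p \<ge> 2" using CARD_ge_2[where 'p = 'p] by (simp add: p_def)
  \<comment> \<open>From \<open>e\<close> to \<open>Suc e\<close> the correction drops by at least
    \<open>real (n * n) / p ^ e\<close>, because \<open>p \<ge> 2\<close>. This absorbs the possible
    increase of the ratio, so \<open>t\<close> decreases; the correction itself tends to 0.\<close>
  define t where "t e = det_ratio TYPE('p) n e + 2 * real (n * n) / p ^ e" for e
  have "t (Suc e) \<le> t e" for e
  proof -
    have "2 * real (n * n) / p ^ Suc e = (2 / p) * (real (n * n) / p ^ e)"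
      using p by (simp add: field_simps)
    also have "\<dots> \<le> 1 * (real (n * n) / p ^ e)" using p by (intro mult_right_mono) auto
    finally show ?thesis
      using det_ratio_Suc_exponent_le[OF n, where 'p = 'p, of e] unfolding t_def p_def[symmetric]
        by simp
  qed
  then have "decseq t" by (rule decseq_SucI)
  moreover have "0 \<le> t e" for e using p by (simp add: t_def det_ratio_def)
  ultimately obtain l where l: "t \<longlonglongrightarrow> l" by (metis decseq_convergent)
  have "(\<lambda>e. 2 * real (n * n) / p ^ e) \<longlonglongrightarrow> 0" using p by (intro LIMSEQ_divide_realpow_zero) simp
  from tendsto_diff[OF l this] have "det_ratio TYPE('p) n \<longlonglongrightarrow> l" by (simp add: t_def)
  then show ?thesis unfolding det_F_signature_eq[OF n] by (simp only: limI)
qed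

lemma choose_over_power_tendsto: "(\<lambda>m. real (m choose k) / real m ^ k) \<longlonglongrightarrow> 1 / fact k"
proof -
  have "real (m choose k) / real m ^ k = (\<Prod>i<k. (real m - real i) / real m) / fact k" for m
    by (simp add: binomial_gbinomial gbinomial_prod_rev prod_dividef atLeast0LessThan)
  moreover have "(\<lambda>m. (real m - real i) / real m) \<longlonglongrightarrow> 1" for i
  proof (rule Lim_transform_eventually)
    show "(\<lambda>m. 1 - real i / real m) \<longlonglongrightarrow> 1" using tendsto_diff[OF tendsto_const lim_const_over_n]
      by fastforce
    show "\<forall>\<^sub>F m in sequentially. 1 - real i / real m = (real m - real i) / real m"
      by (rule eventually_sequentiallyI[of 1]) (simp add: diff_divide_distrib)
  qed
  then have "(\<lambda>m. (\<Prod>i<k. (real m - real i) / real m) / fact k) \<longlonglongrightarrow> (\<Prod>i<k. 1) / fact k"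
    by (intro tendsto_intros) auto
  ultimately show ?thesis by simp
qed

lemma det_ratio_ge:
  assumes n: "n \<ge> 2"
  shows "(fact n)\<^sup>2 * (real (CARD('p::prime_card) ^ e choose (2 * n - 1)) / real (CARD('p) ^ e) ^
    (2 * n - 1)) \<le> det_ratio TYPE('p) n e"
proof -
  define q where "q = CARD('p) ^ e"
  have q: "q > 0" by (simp add: q_def)
  have "n * n - 1 = (n * n - 2 * n) + (2 * n - 1)" using square_ge[OF n] n by simp
  then have pw: "real q ^ (n * n - 1) = real q ^ (n * n - 2 * n) * real q ^ (2 * n - 1)"
    by (simp only: power_add)
  have "(fact n)\<^sup>2 * (q choose (2 * n - 1)) * q ^ (n * n - 2 * n)
    \<le> binomial_count n q * q ^ (n * n - 2 * n)"
    using n by (intro mult_le_mono1 binomial_count_ge) simp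
  also have "\<dots> \<le> det_rank TYPE('p) n e" unfolding q_def by (rule det_rank_ge[OF n])
  finally have "real ((fact n)\<^sup>2 * (q choose (2 * n - 1)) * q ^ (n * n - 2 * n))
    \<le> real (det_rank TYPE('p) n e)"
    by (simp only: of_nat_le_iff)
  then have "(fact n)\<^sup>2 * real (q choose (2 * n - 1)) * real q ^ (n * n - 2 * n)
    \<le> real (det_rank TYPE('p) n e)"
    by simp
  then show ?thesis
    unfolding det_ratio_def of_nat_power[symmetric] q_def[symmetric] unfolding of_nat_power pw
      using q
    by (simp add: field_simps)
qed

text \<open>In size 2 the count is exact for every \<open>e\<close>, which gives the value and not
  just a bound for the limit.\<close>

lemma det_ratio_2: "det_ratio TYPE('p::prime_card) 2 e = 2 / 3 + 1 / (3 * (real CARD('p) ^ e) ^ 2)"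
proof -
  define q where "q = real CARD('p) ^ e"
  have q: "q > 0" by (simp add: q_def)
  have "real (3 * binomial_count 2 (CARD('p) ^ e)) = real (2 * (CARD('p) ^ e) ^ 3 + CARD('p) ^ e)"
    by (simp only: binomial_count_2)
  then have "3 * real (det_rank TYPE('p) 2 e) = 2 * q ^ 3 + q" by (simp add: det_rank_2 q_def)
  then have "real (det_rank TYPE('p) 2 e) = (2 * q ^ 3 + q) / 3" by simp
  then have "det_ratio TYPE('p) 2 e = (2 * q ^ 3 + q) / 3 / q ^ 3"
    unfolding det_ratio_def q_def[symmetric] by (simp only:) simp
  also have "\<dots> = 2 / 3 + 1 / (3 * q ^ 2)"
    using q by (simp add: add_divide_distrib power2_eq_square power3_eq_cube)
  finally show ?thesis by (simp only: q_def)
qed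

lemma det_F_signature_Suc_le:
  "n \<ge> 2 \<Longrightarrow> det_F_signature TYPE('p::prime_card) (Suc n) \<le> det_F_signature TYPE('p) n"
  by (rule LIMSEQ_le[OF det_ratio_convergent det_ratio_convergent]) (auto intro: det_ratio_Suc_le)

lemma det_F_signature_2: "det_F_signature TYPE('p::prime_card) 2 = 2 / 3"
proof (rule LIMSEQ_unique[OF det_ratio_convergent])
  have "real CARD('p) > 1" using CARD_ge_2[where 'p = 'p] by linarith
  then have "(real CARD('p))\<^sup>2 > 1" by simp
  then have "(\<lambda>e. 2 / 3 + (1 / 3) / ((real CARD('p))\<^sup>2) ^ e) \<longlonglongrightarrow> 2 / 3 + 0"
    by (intro tendsto_add tendsto_const LIMSEQ_divide_realpow_zero)
  moreover have "((real CARD('p))\<^sup>2) ^ e = (real CARD('p) ^ e)\<^sup>2" for e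
    by (simp only: power_mult[symmetric] mult.commute)
  ultimately have "(\<lambda>e. 2 / 3 + 1 / (3 * (real CARD('p) ^ e) ^ 2)) \<longlonglongrightarrow> 2 / 3" by simp
  then show "det_ratio TYPE('p) 2 \<longlonglongrightarrow> 2 / 3" by (simp only: det_ratio_2[abs_def])
qed simp

lemma det_F_signature_ge:
  assumes "n \<ge> 2"
  shows "(fact n)\<^sup>2 / fact (2 * n - 1) \<le> det_F_signature TYPE('p::prime_card) n"
proof (rule LIMSEQ_le[OF _ det_ratio_convergent[OF assms]])
  \<comment> \<open>The asymptotics of the binomial coefficient is used along the subsequence of
    powers of \<open>p\<close>.\<close>
  have "strict_mono (\<lambda>e. CARD('p) ^ e)"
    using CARD_ge_2[where 'p = 'p] by (intro strict_monoI power_strict_increasing) auto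
  from LIMSEQ_subseq_LIMSEQ[OF choose_over_power_tendsto[of "2 * n - 1"] this]
  have "(\<lambda>e. (fact n)\<^sup>2 * (real (CARD('p) ^ e choose (2 * n - 1)) / real (CARD('p) ^ e) ^ (2 * n
    - 1)))
      \<longlonglongrightarrow> (fact n)\<^sup>2 * (1 / fact (2 * n - 1))"
    unfolding comp_def by (rule tendsto_mult_left)
  then show "(\<lambda>e. (fact n)\<^sup>2 * (real (CARD('p) ^ e choose (2 * n - 1)) / real (CARD('p) ^ e) ^
    (2 * n - 1)))
      \<longlonglongrightarrow> (fact n)\<^sup>2 / fact (2 * n - 1)" by simp
  show "\<exists>N. \<forall>e\<ge>N. (fact n)\<^sup>2 * (real (CARD('p) ^ e choose (2 * n - 1)) / real (CARD('p) ^ e) ^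
    (2 * n - 1))
      \<le> det_ratio TYPE('p) n e"
    using det_ratio_ge[OF assms] by blast
qed

theorem theorem1:
  fixes n :: nat
  assumes "n \<ge> 2"
  shows "det_F_signature TYPE('p::prime_card) (n + 1) \<le> det_F_signature TYPE('p) n \<and>
    (fact n)\<^sup>2 / fact (2 * n - 1) \<le> det_F_signature TYPE('p) n \<and>
    det_F_signature TYPE('p) n \<le> 2 / 3"
proof (intro conjI)
  show "det_F_signature TYPE('p) (n + 1) \<le> det_F_signature TYPE('p) n"
    using det_F_signature_Suc_le[OF assms] by simp
  show "(fact n)\<^sup>2 / fact (2 * n - 1) \<le> det_F_signature TYPE('p) n"
    by (rule det_F_signature_ge[OF assms])
  \<comment> \<open>Monotonicity in the size reduces the bound to size 2, where it is
    attained.\<close>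
  show "det_F_signature TYPE('p) n \<le> 2 / 3" using assms
  proof (induction n rule: dec_induct)
    case base
    then show ?case by (simp add: det_F_signature_2)
  next
    case (step n)
    then show ?case using det_F_signature_Suc_le[of n, where 'p = 'p] by linarith
  qed
qed

end
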